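(* Let $\mathcal M$ be a complete (smooth) Riemannian manifold and let $H$ be a separable infinite-dimensional Hilbert space. Identify the standard hermitian module $C^1_0(\mathcal M)^\infty$ over the operator $*$-algebra $C^1_0(\mathcal M)$ with the hermitian operator module $C^1_0(\mathcal M,H)$. Then there is a canonical bijective correspondence between the endomorphism ring $\mathrm{End}(C^1_0(\mathcal M)^\infty)$ (completely bounded module endomorphisms having a completely bounded adjoint) and the set of $*$-strongly differentiable maps $\alpha:\mathcal M\to\mathcal L(H)$ with $$\sup_{x\in\mathcal M}\big(\|(d\alpha)(x)\|_\infty+\|\alpha(x)\|_\infty\big)<\infty ,$$ where $(d\alpha)(x):H\to H\otimes T^*_x\mathcal M$ is the strong de Rham derivative at $x$. The correspondence sends $\alpha$ to the endomorphism $s\mapsto\big(x\mapsto\alpha(x)(s(x))\big)$ of $C^1_0(\mathcal M,H)$.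
   Context: Manifolds are smooth, connected, second countable, Hausdorff, of finite dimension $N$. $T^*\mathcal M$ is the complexified cotangent bundle with the hermitian inner products induced by the Riemannian metric. Inner products are linear in the second variable. $\mathcal L(H)$ denotes the bounded operators on $H$ and $\|\cdot\|_\infty$ the operator norm. $C^1_0(\mathcal M)$: the $*$-algebra (under complex conjugation) of $C^1$-functions $f:\mathcal M\to\mathbb C$ such that for each $\varepsilon>0$ there is a compact $K\subset\mathcal M$ with $\sup_{x\notin K}(|f(x)|+\|(df)(x)\|)<\varepsilon$. $C^1_0(\mathcal M,H)$: the right $C^1_0(\mathcal M)$-module (pointwise scalar multiplication) of $C^1$-maps $s:\mathcal M\to H$ such that for each $\varepsilon>0$ there is a compact $K$ with $\sup_{x\notin K}(\|s(x)\|_H+\|(ds)(x)\|_{H\otimes T_x^*\mathcal M})<\varepsilon$; here in a chart $\phi$, $(ds)(x)=\sum_i\frac{\partial s}{\partial\phi_i}(x)\otimes(d\phi_i)(x)$. A map $\alpha:\mathcal M\to\mathcal L(H)$ is strongly differentiable if $x\mapsto\alpha(x)\xi$ is $C^1$ for every $\xi\in H$; it is $*$-strongly differentiable if also $x\mapsto\alpha(x)^*$ is strongly differentiable. The strong derivative is $(d\alpha)(x)(\xi):=d(\alpha(\cdot)\xi)(x)$, a bounded operator $H\to H\otimes T_x^*\mathcal M$. For a Hilbert space $E$ and a finite matrix $\xi$ over $E$, put $\|\xi\|_E:=\|\langle\xi,\xi\rangle\|^{1/2}$, with $\langle\xi,\eta\rangle_{ij}=\sum_k\langle\xi_{ki},\eta_{kj}\rangle$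 and the $C^*$-norm on complex matrices. Finite matrices $s$ over $C^1_0(\mathcal M,H)$ are normed by $\|s\|_1:=\sup_{x}\|(s(x),(ds)(x))\|_{H\oplus(H\otimes T_x^*\mathcal M)}$ (for $H$ replaced by $\mathbb C$ this is the matrix norm making $C^1_0(\mathcal M)$ an operator $*$-algebra). The hermitian form is $\langle s,t\rangle(x)=\langle s(x),t(x)\rangle_H\in C^1_0(\mathcal M)$. With an orthonormal basis $\{e_k\}$ of $H$, $C^1_0(\mathcal M)^\infty$ (the completion of the finite columns $f=(f(k))_k$ over $C^1_0(\mathcal M)$ in the column matrix norm, with form $\langle f,g\rangle=\sum_k\overline{f(k)}g(k)$) is identified with $C^1_0(\mathcal M,H)$ via $f\mapsto\sum_k e_kf(k)$. A linear map is completely bounded if its entrywise amplifications to $n\times n$ matrices are bounded uniformly in $n$. An endomorphism is a completely bounded $C^1_0(\mathcal M)$-module map $\beta$ for which there is a completely bounded module map $\beta^*$ with $\langle\beta(s),t\rangle=\langle s,\beta^*(t)\rangle$ for all $s,t$. *)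

theory Defs
  imports "HOL-Analysis.Analysis"
begin

section \<open>Complex Hilbert spaces\<close>

text \<open>The inner product is linear in the second variable.\<close>

class complex_hilbert = banach +
  fixes scaleC :: "complex \<Rightarrow> 'a \<Rightarrow> 'a" (infixr "*\<^sub>C" 75)
    and cinner :: "'a \<Rightarrow> 'a \<Rightarrow> complex"
  assumes scaleC_add_right: "c *\<^sub>C (x + y) = c *\<^sub>C x + c *\<^sub>C y"
    and scaleC_add_left: "(c + d) *\<^sub>C x = c *\<^sub>C x + d *\<^sub>C x"
    and scaleC_scaleC: "c *\<^sub>C d *\<^sub>C x = (c * d) *\<^sub>C x"
    and scaleR_scaleC: "r *\<^sub>R x = complex_of_real r *\<^sub>C x"
    and cinner_commute: "cinner x y = cnj (cinner y x)"
    and cinner_add_right: "cinner x (y + z) = cinner x y + cinner x z"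
    and cinner_scaleC_right: "cinner x (c *\<^sub>C y) = c * cinner x y"
    and norm_eq_sqrt_cinner: "norm x = sqrt (Re (cinner x x))"

instantiation complex :: complex_hilbert
begin

definition scaleC_complex :: "complex \<Rightarrow> complex \<Rightarrow> complex"
  where "scaleC_complex c z = c * z"

definition cinner_complex :: "complex \<Rightarrow> complex \<Rightarrow> complex"
  where "cinner_complex w z = cnj w * z"

instance
  by standard
    (auto simp: scaleC_complex_def cinner_complex_def algebra_simps scaleR_conv_of_real
      cmod_def power2_eq_square)

end

definition cspan :: "'h::complex_hilbert set \<Rightarrow> 'h set"
  where "cspan S = module.span scaleC S"

definition infinite_dimensional :: "'h::complex_hilbert itself \<Rightarrow> bool"
  where "infinite_dimensional _ \<longleftrightarrow> (\<forall>S::'h set. finite S \<longrightarrow> cspan S \<noteq> UNIV)"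

definition orthonormal_basis :: "(nat \<Rightarrow> 'h::complex_hilbert) \<Rightarrow> bool"
  where "orthonormal_basis e \<longleftrightarrow>
    (\<forall>i j. cinner (e i) (e j) = (if i = j then 1 else 0)) \<and> closure (cspan (range e)) = UNIV"

text \<open>\<open>\<L>(H)\<close> is the set of the complex linear elements of the type
  \<^typ>\<open>'h \<Rightarrow>\<^sub>L 'h\<close> of bounded real linear operators, whose norm is the operator norm.\<close>

definition bounded_operators :: "('h::complex_hilbert \<Rightarrow>\<^sub>L 'h) set"
  where "bounded_operators = {T. \<forall>c \<xi>. blinfun_apply T (c *\<^sub>C \<xi>) = c *\<^sub>C blinfun_apply T \<xi>}"

definition adjoint_op :: "('h::complex_hilbert \<Rightarrow>\<^sub>L 'h) \<Rightarrow> ('h \<Rightarrow>\<^sub>L 'h)"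
  where "adjoint_op T =
    (THE S. \<forall>\<xi> \<eta>. cinner (blinfun_apply S \<xi>) \<eta> = cinner \<xi> (blinfun_apply T \<eta>))"

text \<open>The \<open>C\<^sup>*\<close>-norm of an \<open>n \<times> n\<close> matrix, i.e. the operator norm on \<open>\<complex>\<^sup>n\<close> with
  its Euclidean norm.\<close>

definition cmatrix_norm :: "nat \<Rightarrow> (nat \<Rightarrow> nat \<Rightarrow> complex) \<Rightarrow> real"
  where "cmatrix_norm n A =
    (SUP v\<in>{v :: nat \<Rightarrow> complex. (\<Sum>j<n. (cmod (v j))\<^sup>2) \<le> 1}.
      sqrt (\<Sum>i<n. (cmod (\<Sum>j<n. A i j * v j))\<^sup>2))"


section \<open>Riemannian manifolds\<close>

text \<open>For open \<open>S\<close> in a finite-dimensional space this is being \<open>k\<close> times continuously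
  differentiable on \<open>S\<close>.\<close>

primrec Ck_on :: "nat \<Rightarrow> ('a::real_normed_vector \<Rightarrow> 'b::real_normed_vector) \<Rightarrow> 'a set \<Rightarrow> bool"
  where
    "Ck_on 0 f S \<longleftrightarrow> continuous_on S f"
  | "Ck_on (Suc k) f S \<longleftrightarrow>
      (\<forall>x\<in>S. f differentiable (at x)) \<and> (\<forall>v. Ck_on k (\<lambda>x. frechet_derivative f (at x) v) S)"

definition smooth_on :: "('a::real_normed_vector \<Rightarrow> 'b::real_normed_vector) \<Rightarrow> 'a set \<Rightarrow> bool"
  where "smooth_on f S \<longleftrightarrow> (\<forall>k. Ck_on k f S)"

text \<open>A chart is a pair \<open>(U, \<phi>)\<close> of its domain and its coordinate map.\<close>

type_synonym ('m, 'e) chart = "'m set \<times> ('m \<Rightarrow> 'e)"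

text \<open>The type \<open>'m\<close> is the underlying set of the manifold. The charts take values in \<open>'e\<close>,
  which together with the finite orthonormal basis \<open>axes\<close> plays the role of \<open>\<real>\<^sup>N\<close>,
  \<open>N = card axes\<close>. The class \<^class>\<open>euclidean_space\<close> is not used for \<open>'e\<close> since it
  excludes \<open>N = 0\<close>. In the chart \<open>c\<close>, \<open>riem_metric c x v w\<close> is the inner product of the
  tangent vectors at \<open>x\<close> with coordinate vectors \<open>v\<close> and \<open>w\<close>.\<close>

record ('m, 'e) manifold =
  axes :: "'e set"
  atlas :: "('m, 'e) chart set"
  riem_metric :: "('m, 'e) chart \<Rightarrow> 'm \<Rightarrow> 'e \<Rightarrow> 'e \<Rightarrow> real"

definition riemannian_manifold ::
    "('m::{second_countable_topology, t2_space}, 'e::real_inner) manifold \<Rightarrow> bool"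
  where "riemannian_manifold M \<longleftrightarrow>
    finite (axes M) \<and> pairwise orthogonal (axes M) \<and> (\<forall>b\<in>axes M. norm b = 1) \<and>
    span (axes M) = UNIV \<and>
    connected (UNIV :: 'm set) \<and>
    \<Union> (fst ` atlas M) = UNIV \<and>
    (\<forall>(U, \<phi>)\<in>atlas M. open U \<and> open (\<phi> ` U) \<and> inj_on \<phi> U \<and>
        homeomorphism U (\<phi> ` U) \<phi> (inv_into U \<phi>)) \<and>
    (\<forall>(U, \<phi>)\<in>atlas M. \<forall>(V, \<psi>)\<in>atlas M. smooth_on (\<psi> \<circ> inv_into U \<phi>) (\<phi> ` (U \<inter> V))) \<and>
    (\<forall>(U, \<phi>)\<in>atlas M. \<forall>x\<in>U. bilinear (riem_metric M (U, \<phi>) x) \<and>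
        (\<forall>v w. riem_metric M (U, \<phi>) x v w = riem_metric M (U, \<phi>) x w v) \<and>
        (\<forall>v. v \<noteq> 0 \<longrightarrow> riem_metric M (U, \<phi>) x v v > 0)) \<and>
    (\<forall>(U, \<phi>)\<in>atlas M. \<forall>v w.
        smooth_on (\<lambda>y. riem_metric M (U, \<phi>) (inv_into U \<phi> y) v w) (\<phi> ` U)) \<and>
    (\<forall>(U, \<phi>)\<in>atlas M. \<forall>(V, \<psi>)\<in>atlas M. \<forall>x\<in>U \<inter> V. \<forall>v w.
        riem_metric M (U, \<phi>) x v w =
          riem_metric M (V, \<psi>) x (frechet_derivative (\<psi> \<circ> inv_into U \<phi>) (at (\<phi> x)) v)
                           (frechet_derivative (\<psi> \<circ> inv_into U \<phi>) (at (\<phi> x)) w))"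

text \<open>An arbitrarily chosen chart at \<open>x\<close>; what is defined through it below does not depend on
  the choice.\<close>

definition chart_at :: "('m, 'e) manifold \<Rightarrow> 'm \<Rightarrow> ('m, 'e) chart"
  where "chart_at M x = (SOME c. c \<in> atlas M \<and> x \<in> fst c)"

text \<open>\<open>C\<^sup>1\<close>-curves \<open>[0,1] \<rightarrow> M\<close> and their lengths.\<close>

definition C1_curve :: "('m::topological_space, 'e::real_inner) manifold \<Rightarrow> (real \<Rightarrow> 'm) \<Rightarrow> bool"
  where "C1_curve M \<gamma> \<longleftrightarrow> continuous_on {0..1} \<gamma> \<and>
    (\<forall>(U, \<phi>)\<in>atlas M.
      (\<forall>t\<in>{t\<in>{0..1}. \<gamma> t \<in> U}. (\<phi> \<circ> \<gamma>) differentiable (at t within {0..1})) \<and>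
      continuous_on {t\<in>{0..1}. \<gamma> t \<in> U}
        (\<lambda>t. vector_derivative (\<phi> \<circ> \<gamma>) (at t within {0..1})))"

definition speed :: "('m, 'e::real_inner) manifold \<Rightarrow> (real \<Rightarrow> 'm) \<Rightarrow> real \<Rightarrow> real"
  where "speed M \<gamma> t =
    (let c = chart_at M (\<gamma> t); v = vector_derivative (snd c \<circ> \<gamma>) (at t within {0..1})
     in sqrt (riem_metric M c (\<gamma> t) v v))"

text \<open>\<open>pw_C1_path M x y l\<close>: a concatenation of finitely many \<open>C\<^sup>1\<close>-curves leads from
  \<open>x\<close> to \<open>y\<close> and has length \<open>l\<close>.\<close>

inductive pw_C1_path ::
    "('m::topological_space, 'e::real_inner) manifold \<Rightarrow> 'm \<Rightarrow> 'm \<Rightarrow> real \<Rightarrow> bool"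
  for M where
    "pw_C1_path M x x 0"
  | "pw_C1_path M x (\<gamma> 0) l \<Longrightarrow> C1_curve M \<gamma> \<Longrightarrow>
      pw_C1_path M x (\<gamma> 1) (l + integral {0..1} (speed M \<gamma>))"

definition riemannian_dist ::
    "('m::topological_space, 'e::real_inner) manifold \<Rightarrow> 'm \<Rightarrow> 'm \<Rightarrow> real"
  where "riemannian_dist M x y = Inf {l. pw_C1_path M x y l}"

definition complete_manifold :: "('m::topological_space, 'e::real_inner) manifold \<Rightarrow> bool"
  where "complete_manifold M \<longleftrightarrow> Metric_space.mcomplete UNIV (riemannian_dist M)"


section \<open>Exterior derivatives of vector valued maps\<close>

definition C1_map ::
    "('m, 'e::real_inner) manifold \<Rightarrow> ('m \<Rightarrow> 'h::real_normed_vector) \<Rightarrow> bool"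
  where "C1_map M s \<longleftrightarrow> (\<forall>(U, \<phi>)\<in>atlas M. Ck_on 1 (s \<circ> inv_into U \<phi>) (\<phi> ` U))"

text \<open>In a chart \<open>\<phi>\<close> at \<open>x\<close> the element \<open>\<Sum>\<^sub>b \<omega> b \<otimes> d\<phi>\<^sub>b\<close> of \<open>H \<otimes> T\<^sub>x\<^sup>*M\<close>
  is represented by its family of coefficients \<open>\<omega> b \<in> H\<close>, \<open>b \<in> axes M\<close>. The coefficients
  of \<open>ds\<close> are the partial derivatives of \<open>s\<close>.\<close>

definition dcoeff ::
    "('m, 'e::real_inner) chart \<Rightarrow> ('m \<Rightarrow> 'h::real_normed_vector) \<Rightarrow> 'm \<Rightarrow> 'e \<Rightarrow> 'h"
  where "dcoeff c s x b = frechet_derivative (s \<circ> inv_into (fst c) (snd c)) (at (snd c x)) b"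

definition matrix_inverse_on :: "'e set \<Rightarrow> ('e \<Rightarrow> 'e \<Rightarrow> real) \<Rightarrow> 'e \<Rightarrow> 'e \<Rightarrow> real"
  where "matrix_inverse_on B G = (THE h.
    (\<forall>b\<in>B. \<forall>d\<in>B. (\<Sum>k\<in>B. h b k * G k d) = (if b = d then 1 else 0)) \<and>
    (\<forall>b d. b \<notin> B \<or> d \<notin> B \<longrightarrow> h b d = 0))"

text \<open>The induced hermitian inner product on \<open>T\<^sub>x\<^sup>*M\<close> satisfies
  \<open>\<langle>d\<phi>\<^sub>b, d\<phi>\<^sub>d\<rangle> = g\<^sup>b\<^sup>d\<close>, the inverse matrix of the metric \<open>g\<^sub>b\<^sub>d\<close>; the following
  is the resulting inner product on \<open>H \<otimes> T\<^sub>x\<^sup>*M\<close>.\<close>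

definition cotangent_inner ::
    "('m, 'e::real_inner) manifold \<Rightarrow> 'm \<Rightarrow> ('e \<Rightarrow> 'h::complex_hilbert) \<Rightarrow> ('e \<Rightarrow> 'h) \<Rightarrow> complex"
  where "cotangent_inner M x \<omega> \<eta> =
    (\<Sum>b\<in>axes M. \<Sum>d\<in>axes M.
      complex_of_real (matrix_inverse_on (axes M) (riem_metric M (chart_at M x) x) b d) *
      cinner (\<omega> b) (\<eta> d))"

definition cotangent_norm ::
    "('m, 'e::real_inner) manifold \<Rightarrow> 'm \<Rightarrow> ('e \<Rightarrow> 'h::complex_hilbert) \<Rightarrow> real"
  where "cotangent_norm M x \<omega> = sqrt (Re (cotangent_inner M x \<omega> \<omega>))"

definition deriv_at ::
    "('m, 'e::real_inner) manifold \<Rightarrow> ('m \<Rightarrow> 'h::real_normed_vector) \<Rightarrow> 'm \<Rightarrow> 'e \<Rightarrow> 'h"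
  where "deriv_at M s x = dcoeff (chart_at M x) s x"


section \<open>Strongly differentiable maps\<close>

definition strongly_differentiable ::
    "('m, 'e::real_inner) manifold \<Rightarrow> ('m \<Rightarrow> 'h::complex_hilbert \<Rightarrow>\<^sub>L 'h) \<Rightarrow> bool"
  where "strongly_differentiable M \<alpha> \<longleftrightarrow> (\<forall>\<xi>. C1_map M (\<lambda>x. blinfun_apply (\<alpha> x) \<xi>))"

definition star_strongly_differentiable ::
    "('m, 'e::real_inner) manifold \<Rightarrow> ('m \<Rightarrow> 'h::complex_hilbert \<Rightarrow>\<^sub>L 'h) \<Rightarrow> bool"
  where "star_strongly_differentiable M \<alpha> \<longleftrightarrow>
    strongly_differentiable M \<alpha> \<and> strongly_differentiable M (\<lambda>x. adjoint_op (\<alpha> x))"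

text \<open>The operator norm of the strong derivative
  \<open>(d\<alpha>)(x) : H \<rightarrow> H \<otimes> T\<^sub>x\<^sup>*M\<close>, \<open>\<xi> \<mapsto> d(\<alpha>(\<cdot>)\<xi>)(x)\<close>.\<close>

definition strong_deriv_norm ::
    "('m, 'e::real_inner) manifold \<Rightarrow> ('m \<Rightarrow> 'h::complex_hilbert \<Rightarrow>\<^sub>L 'h) \<Rightarrow> 'm \<Rightarrow> real"
  where "strong_deriv_norm M \<alpha> x =
    (SUP \<xi>\<in>{\<xi>. norm \<xi> \<le> 1}. cotangent_norm M x (deriv_at M (\<lambda>y. blinfun_apply (\<alpha> y) \<xi>) x))"

definition bounded_star_strong ::
    "('m, 'e::real_inner) manifold \<Rightarrow> ('m \<Rightarrow> 'h::complex_hilbert \<Rightarrow>\<^sub>L 'h) set"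
  where "bounded_star_strong M =
    {\<alpha>. (\<forall>x. \<alpha> x \<in> bounded_operators) \<and> star_strongly_differentiable M \<alpha> \<and>
        bdd_above (range (\<lambda>x. strong_deriv_norm M \<alpha> x + norm (\<alpha> x)))}"


section \<open>Hermitian operator modules of functions on a manifold\<close>

text \<open>\<open>C10_maps M\<close> is \<open>C\<^sup>1\<^sub>0(M, H)\<close>, and for \<open>H = \<complex>\<close> it is the algebra
  \<open>C\<^sup>1\<^sub>0(M)\<close>.\<close>

definition C10_maps ::
    "('m::topological_space, 'e::real_inner) manifold \<Rightarrow> ('m \<Rightarrow> 'h::complex_hilbert) set"
  where "C10_maps M = {s. C1_map M s \<and>
    (\<forall>\<epsilon>>0. \<exists>K. compact K \<and> (\<forall>x\<in>- K. norm (s x) + cotangent_norm M x (deriv_at M s x) < \<epsilon>))}"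

definition jet_inner ::
    "('m, 'e::real_inner) manifold \<Rightarrow> ('m \<Rightarrow> 'h::complex_hilbert) \<Rightarrow> ('m \<Rightarrow> 'h) \<Rightarrow> 'm \<Rightarrow> complex"
  where "jet_inner M s t x =
    cinner (s x) (t x) + cotangent_inner M x (deriv_at M s x) (deriv_at M t x)"

text \<open>The norm \<open>\<parallel>s\<parallel>\<^sub>1\<close> of a matrix \<open>s\<close> over \<open>C\<^sup>1\<^sub>0(M, H)\<close> whose rows are indexed by
  the finite set \<open>R\<close> and which has \<open>n\<close> columns.\<close>

definition norm1 ::
    "('m, 'e::real_inner) manifold \<Rightarrow> 'r set \<Rightarrow> nat \<Rightarrow> ('r \<Rightarrow> nat \<Rightarrow> 'm \<Rightarrow> 'h::complex_hilbert) \<Rightarrow> real"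
  where "norm1 M R n s =
    (SUP x. sqrt (cmatrix_norm n (\<lambda>i j. \<Sum>k\<in>R. jet_inner M (s k i) (s k j) x)))"

text \<open>\<open>mnorm n\<close> is the norm on \<open>n \<times> n\<close> matrices, \<open>act\<close> the right action of the algebra
  \<open>scalars\<close> of functions.\<close>

record ('m, 'x) op_module =
  elems :: "'x set"
  scalars :: "('m \<Rightarrow> complex) set"
  add :: "'x \<Rightarrow> 'x \<Rightarrow> 'x"
  cscale :: "complex \<Rightarrow> 'x \<Rightarrow> 'x"
  act :: "'x \<Rightarrow> ('m \<Rightarrow> complex) \<Rightarrow> 'x"
  form :: "'x \<Rightarrow> 'x \<Rightarrow> 'm \<Rightarrow> complex"
  mnorm :: "nat \<Rightarrow> (nat \<Rightarrow> nat \<Rightarrow> 'x) \<Rightarrow> real"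

definition maps_module ::
    "('m::topological_space, 'e::real_inner) manifold \<Rightarrow> ('m, 'm \<Rightarrow> 'h::complex_hilbert) op_module"
  where "maps_module M =
    \<lparr> elems = C10_maps M,
      scalars = C10_maps M,
      add = (\<lambda>s t x. s x + t x),
      cscale = (\<lambda>c s x. c *\<^sub>C s x),
      act = (\<lambda>s f x. f x *\<^sub>C s x),
      form = (\<lambda>s t x. cinner (s x) (t x)),
      mnorm = (\<lambda>n s. norm1 M {..<n} n s) \<rparr>"

text \<open>The completion \<open>C\<^sup>1\<^sub>0(M)\<^sup>\<infinity>\<close> of the finite columns in the column norm. Coordinates
  are contractive and truncations \<open>P\<^sub>K\<close> are contractions converging strongly to the
  identity, so an element of the completion is a sequence \<open>f\<close> in the (complete) algebra
  \<open>C\<^sup>1\<^sub>0(M)\<close> whose truncations form a Cauchy sequence. Note that \<open>P\<^sub>L f - P\<^sub>K f\<close> is the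
  column with entries \<open>f k\<close>, \<open>K \<le> k < L\<close>.\<close>

definition std_columns ::
    "('m::topological_space, 'e::real_inner) manifold \<Rightarrow> (nat \<Rightarrow> 'm \<Rightarrow> complex) set"
  where "std_columns M = {f. (\<forall>k. f k \<in> C10_maps M) \<and>
    (\<forall>\<epsilon>>0. \<exists>K0. \<forall>K L. K0 \<le> K \<and> K \<le> L \<longrightarrow> norm1 M {K..<L} 1 (\<lambda>k _. f k) < \<epsilon>)}"

text \<open>An \<open>n \<times> n\<close> matrix \<open>F\<close> of columns of height \<open>K\<close> is normed as an \<open>nK \<times> n\<close> matrix
  over \<open>C\<^sup>1\<^sub>0(M)\<close>; the norm and the form extend to the completion by continuity.\<close>

definition std_module ::
    "('m::topological_space, 'e::real_inner) manifold \<Rightarrow> ('m, nat \<Rightarrow> 'm \<Rightarrow> complex) op_module"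
  where "std_module M =
    \<lparr> elems = std_columns M,
      scalars = C10_maps M,
      add = (\<lambda>f g k x. f k x + g k x),
      cscale = (\<lambda>c f k x. c * f k x),
      act = (\<lambda>f a k x. f k x * a x),
      form = (\<lambda>f g x. \<Sum>k. cnj (f k x) * g k x),
      mnorm = (\<lambda>n F. lim (\<lambda>K. norm1 M ({..<n} \<times> {..<K}) n (\<lambda>(i, k) j. F i j k))) \<rparr>"

definition completely_bounded :: "('m, 'x) op_module \<Rightarrow> ('x \<Rightarrow> 'x) \<Rightarrow> bool"
  where "completely_bounded X \<beta> \<longleftrightarrow>
    (\<exists>C. \<forall>n s. (\<forall>i<n. \<forall>j<n. s i j \<in> elems X) \<longrightarrow>
      mnorm X n (\<lambda>i j. \<beta> (s i j)) \<le> C * mnorm X n s)"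

definition module_map :: "('m, 'x) op_module \<Rightarrow> ('m, 'y) op_module \<Rightarrow> ('x \<Rightarrow> 'y) \<Rightarrow> bool"
  where "module_map X Y \<beta> \<longleftrightarrow>
    (\<forall>s\<in>elems X. \<beta> s \<in> elems Y) \<and>
    (\<forall>s\<in>elems X. \<forall>t\<in>elems X. \<beta> (add X s t) = add Y (\<beta> s) (\<beta> t)) \<and>
    (\<forall>c. \<forall>s\<in>elems X. \<beta> (cscale X c s) = cscale Y c (\<beta> s)) \<and>
    (\<forall>s\<in>elems X. \<forall>f\<in>scalars X. \<beta> (act X s f) = act Y (\<beta> s) f)"

definition endomorphisms :: "('m, 'x) op_module \<Rightarrow> ('x \<Rightarrow> 'x) set"
  where "endomorphisms X = {\<beta> \<in> extensional (elems X).
    module_map X X \<beta> \<and> completely_bounded X \<beta> \<and>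
    (\<exists>\<beta>'. module_map X X \<beta>' \<and> completely_bounded X \<beta>' \<and>
      (\<forall>s\<in>elems X. \<forall>t\<in>elems X. form X (\<beta> s) t = form X s (\<beta>' t)))}"

text \<open>Unitary complete isometries between modules over the same algebra.\<close>

definition module_iso :: "('m, 'x) op_module \<Rightarrow> ('m, 'y) op_module \<Rightarrow> ('x \<Rightarrow> 'y) \<Rightarrow> bool"
  where "module_iso X Y u \<longleftrightarrow>
    scalars X = scalars Y \<and> module_map X Y u \<and> bij_betw u (elems X) (elems Y) \<and>
    (\<forall>s\<in>elems X. \<forall>t\<in>elems X. form Y (u s) (u t) = form X s t) \<and>
    (\<forall>n s. (\<forall>i<n. \<forall>j<n. s i j \<in> elems X) \<longrightarrow> mnorm Y n (\<lambda>i j. u (s i j)) = mnorm X n s)"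

definition transport ::
    "('m, 'x) op_module \<Rightarrow> ('m, 'y) op_module \<Rightarrow> ('x \<Rightarrow> 'y) \<Rightarrow> ('x \<Rightarrow> 'x) \<Rightarrow> 'y \<Rightarrow> 'y"
  where "transport X Y u \<beta> = (\<lambda>s\<in>elems Y. u (\<beta> (inv_into (elems X) u s)))"

definition column_sum ::
    "(nat \<Rightarrow> 'h::complex_hilbert) \<Rightarrow> (nat \<Rightarrow> 'm \<Rightarrow> complex) \<Rightarrow> 'm \<Rightarrow> 'h"
  where "column_sum e f x = (\<Sum>k. f k x *\<^sub>C e k)"

definition mult_op ::
    "('m::topological_space, 'e::real_inner) manifold \<Rightarrow> ('m \<Rightarrow> 'h::complex_hilbert \<Rightarrow>\<^sub>L 'h) \<Rightarrow>
      ('m \<Rightarrow> 'h) \<Rightarrow> 'm \<Rightarrow> 'h"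
  where "mult_op M \<alpha> = (\<lambda>s\<in>C10_maps M. \<lambda>x. blinfun_apply (\<alpha> x) (s x))"

end

theory Submission
  imports Defs
begin

text \<open>Along an orthonormal frame the matrix norms become \<open>sup\<^sub>x sup\<^sub>v (\<Sum>\<^sub>k \<bar>j\<^sub>x (\<Sum>\<^sub>l v\<^sub>l s\<^sub>k\<^sub>l)\<bar>\<^sup>2)\<close> to the power
  one half, where \<open>j\<^sub>x\<close> is the 1-jet at \<open>x\<close>. Hence a pointwise multiplier that is bounded on jets is
  automatically completely bounded, and the identification of the two modules is Parseval's identity
  together with uniform smallness of the tails on compact sets.

  Conversely, an endomorphism \<open>\<beta>\<close> with an adjoint acts pointwise, \<open>\<beta> s x = \<alpha> x (s x)\<close>, and the bounds
  on \<open>\<alpha>\<close> and \<open>d\<alpha>\<close> follow by testing \<open>\<beta>\<close> on \<open>f \<xi>\<close> with \<open>f x = 1\<close>, provided that \<open>f\<close> and \<open>df\<close> are bounded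
  independently of \<open>x\<close>. This is where completeness enters: closed unit balls are compact
  (Hopf-Rinow), and \<open>f\<close> is a soft maximum \<open>ln (1 + \<Sum>\<^sub>p \<chi>\<^sub>p exp (\<mu> u\<^sub>p)) / \<mu>\<close> over a finite net \<open>p\<close> of the
  unit ball around \<open>x\<close>, where \<open>u\<^sub>p = 1 - d x p - 8 n\<^sub>p\<^sup>2 / s\<close> with a local Euclidean distance \<open>n\<^sub>p\<close> to \<open>p\<close>.
  The differential of a soft maximum is a weighted mean of those of the \<open>u\<^sub>p\<close>, and for large \<open>\<mu>\<close>
  the weights are negligible where the cut-offs \<open>\<chi>\<^sub>p\<close> vary.\<close>

section \<open>Complex Hilbert spaces\<close>

text \<open>Surjectivity is the delicate half. Where \<open>f x = 1\<close>, the product rule turns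
  a bound on \<open>d(\<beta> (f \<xi>))\<close> into one on \<open>d\<alpha>\<close>, at the price
  of \<open>df\<close>, so one constant must serve all points although the geometry is not
  controlled at infinity. Charts alone give cut-offs with differentials of size 1 / r, where the
  radius r depends on the point, and the distance function, which has the right Lipschitz constant,
  need not be differentiable. The scaling \<open>8 * n\<^sup>2 / s\<close> resolves this: on
  \<open>n \<le> s\<close> its differential is at most 32 whatever \<open>s\<close> is, while from
  \<open>n = s / 2\<close> on it exceeds the distance to \<open>p\<close> by at least
  \<open>s\<close>. Radius and number of net points may depend on the centre, because
  \<open>\<mu>\<close> is chosen after them. In the other half the obstacle is that
  \<open>\<alpha>\<close> is differentiable only strongly: the product rule for
  \<open>\<alpha> y (s y)\<close> has to split \<open>s\<close> into pieces on which strong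
  derivatives suffice, and pointwise convergence of difference quotients has to be upgraded to an
  operator bound.\<close>

lemma cinner_add_left: "cinner (x + y) z = cinner x z + cinner y (z::'h::complex_hilbert)"
  by (metis cinner_commute cinner_add_right complex_cnj_add)

lemma cinner_scaleC_left: "cinner (c *\<^sub>C x) (y::'h::complex_hilbert) = cnj c * cinner x y"
  by (metis cinner_commute cinner_scaleC_right complex_cnj_mult)

lemma scaleC_zero_right [simp]: "c *\<^sub>C (0::'h::complex_hilbert) = 0"
  using scaleC_add_right[of c 0 0] by simp

lemma scaleC_zero_left [simp]: "0 *\<^sub>C (x::'h::complex_hilbert) = 0"
  using scaleC_add_left[of 0 0 x] by simp

lemma scaleC_one [simp]: "1 *\<^sub>C (x::'h::complex_hilbert) = x"
  using scaleR_scaleC[of 1 x] by simp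

lemma scaleC_minus_left [simp]: "(- c) *\<^sub>C (x::'h::complex_hilbert) = - (c *\<^sub>C x)"
  using scaleC_add_left[of c "-c" x] by (simp add: eq_neg_iff_add_eq_0 add.commute)

lemma scaleC_diff_left: "(c - d) *\<^sub>C (x::'h::complex_hilbert) = c *\<^sub>C x - d *\<^sub>C x"
  using scaleC_add_left[of c "-d" x] by simp

lemma cinner_zero_left [simp]: "cinner 0 (x::'h::complex_hilbert) = 0"
  using cinner_add_left[of 0 0 x] by simp

lemma cinner_zero_right [simp]: "cinner (x::'h::complex_hilbert) 0 = 0"
  using cinner_add_right[of x 0 0] by simp

lemma cinner_minus_left [simp]: "cinner (- x) (y::'h::complex_hilbert) = - cinner x y"
  using cinner_add_left[of x "-x" y] by (simp add: eq_neg_iff_add_eq_0 add.commute)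

lemma cinner_minus_right [simp]: "cinner x (- y::'h::complex_hilbert) = - cinner x y"
  using cinner_add_right[of x y "-y"] by (simp add: eq_neg_iff_add_eq_0 add.commute)

lemma cinner_diff_left: "cinner (x - y) z = cinner x z - cinner y (z::'h::complex_hilbert)"
  using cinner_add_left[of x "-y" z] by simp

lemma cinner_diff_right: "cinner z (x - y) = cinner z x - cinner z (y::'h::complex_hilbert)"
  using cinner_add_right[of z x "-y"] by simp

lemma cinner_scaleR_left: "cinner (r *\<^sub>R x) (y::'h::complex_hilbert) = r *\<^sub>R cinner x y"
  by (simp add: scaleR_scaleC cinner_scaleC_left scaleR_conv_of_real scaleC_complex_def)

lemma cinner_scaleR_right: "cinner x (r *\<^sub>R y::'h::complex_hilbert) = r *\<^sub>R cinner x y"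
  by (simp add: scaleR_scaleC cinner_scaleC_right scaleR_conv_of_real scaleC_complex_def)

lemma cinner_sum_left: "cinner (sum f A) (x::'h::complex_hilbert) = (\<Sum>a\<in>A. cinner (f a) x)"
  by (induction A rule: infinite_finite_induct) (simp_all add: cinner_add_left)

lemma cinner_sum_right: "cinner (x::'h::complex_hilbert) (sum f A) = (\<Sum>a\<in>A. cinner x (f a))"
  by (induction A rule: infinite_finite_induct) (simp_all add: cinner_add_right)

lemma cinner_self: "cinner x x = complex_of_real ((norm (x::'h::complex_hilbert))\<^sup>2)"
proof -
  \<comment> \<open>Positivity is not an axiom of the class. It follows because \<open>sqrt\<close>
    is an odd function on the reals, so a nonnegative norm rules out a negative
    \<open>Re (cinner x x)\<close>.\<close>
  have "sqrt (Re (cinner x x)) \<ge> 0"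
    using norm_ge_zero[of x] by (simp only: norm_eq_sqrt_cinner)
  then have "Re (cinner x x) = (norm x)\<^sup>2"
    by (simp add: norm_eq_sqrt_cinner[of x])
  moreover have "Im (cinner x x) = 0"
    using cinner_commute[of x x] by (metis complex_cnj_cancel_iff Reals_cnj_iff complex_is_Real_iff)
  ultimately show ?thesis by (simp add: complex_eq_iff)
qed

lemma norm_scaleC: "norm (c *\<^sub>C (x::'h::complex_hilbert)) = cmod c * norm x"
proof -
  have "complex_of_real ((norm (c *\<^sub>C x))\<^sup>2) = complex_of_real ((cmod c * norm x)\<^sup>2)"
    unfolding cinner_self[symmetric] cinner_scaleC_left cinner_scaleC_right
    by (simp only: cinner_self power_mult_distrib of_real_mult complex_norm_square mult_ac)
  then have "(norm (c *\<^sub>C x))\<^sup>2 = (cmod c * norm x)\<^sup>2" by (simp only: of_real_eq_iff)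
  then show ?thesis by (simp add: power2_eq_iff_nonneg)
qed

lemma norm_diff_sq:
  "(norm (x - y))\<^sup>2 = (norm x)\<^sup>2 - 2 * Re (cinner x y) + (norm (y::'h::complex_hilbert))\<^sup>2"
proof -
  have "complex_of_real ((norm (x - y))\<^sup>2)
      = of_real ((norm x)\<^sup>2) - cinner x y - cinner y x + of_real ((norm y)\<^sup>2)"
    unfolding cinner_self[symmetric] by (simp add: cinner_diff_left cinner_diff_right)
  then have "(norm (x - y))\<^sup>2 = Re (of_real ((norm x)\<^sup>2) - cinner x y - cinner y x + of_real ((norm y)\<^sup>2))"
    by (metis Re_complex_of_real)
  also have "\<dots> = (norm x)\<^sup>2 - 2 * Re (cinner x y) + (norm y)\<^sup>2"
    using cinner_commute[of y x] by simp
  finally show ?thesis .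
qed

lemma cinner_cauchy_schwarz: "cmod (cinner x y) \<le> norm x * norm (y::'h::complex_hilbert)"
proof (cases "x = 0")
  case False
  define c where "c = cinner x y / of_real ((norm x)\<^sup>2)"
  have nz: "norm x > 0" using False by simp
  have "0 \<le> (norm (y - c *\<^sub>C x))\<^sup>2" by simp
  also have "\<dots> = (norm y)\<^sup>2 - 2 * Re (c * cinner y x) + (cmod c)\<^sup>2 * (norm x)\<^sup>2"
    by (simp add: norm_diff_sq cinner_scaleC_right norm_scaleC power_mult_distrib)
  also have "c * cinner y x = of_real ((cmod (cinner x y))\<^sup>2 / (norm x)\<^sup>2)"
    unfolding c_def by (subst cinner_commute[of y x]) (simp only: complex_norm_square of_real_divide times_divide_eq_left)
  also have "(cmod c)\<^sup>2 * (norm x)\<^sup>2 = (cmod (cinner x y))\<^sup>2 / (norm x)\<^sup>2"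
  proof -
    have "cmod c = cmod (cinner x y) / (norm x)\<^sup>2" by (simp only: c_def norm_divide norm_of_real) simp
    then show ?thesis using nz by (simp add: power_divide power2_eq_square)
  qed
  finally have "(cmod (cinner x y))\<^sup>2 / (norm x)\<^sup>2 \<le> (norm y)\<^sup>2" by simp
  then have "(cmod (cinner x y))\<^sup>2 \<le> (norm x * norm y)\<^sup>2"
    using nz by (simp add: divide_simps power_mult_distrib mult.commute)
  then show ?thesis by (simp add: power2_le_iff_abs_le)
qed simp

lemma bounded_bilinear_cinner:
  "bounded_bilinear (cinner :: 'h::complex_hilbert \<Rightarrow> 'h \<Rightarrow> complex)"
  by (rule bounded_bilinear.intro)
    (auto simp: cinner_add_left cinner_add_right cinner_scaleR_left cinner_scaleR_right
      intro!: exI[of _ 1] cinner_cauchy_schwarz)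

lemma bounded_bilinear_scaleC:
  "bounded_bilinear (scaleC :: complex \<Rightarrow> 'h::complex_hilbert \<Rightarrow> 'h)"
  by (rule bounded_bilinear.intro)
    (auto simp: scaleC_add_left scaleC_add_right scaleR_scaleC scaleC_scaleC scaleC_complex_def
      mult.commute norm_scaleC intro!: exI[of _ 1])

lemmas bounded_linear_cinner_right = bounded_bilinear.bounded_linear_right[OF bounded_bilinear_cinner]
lemmas bounded_linear_cinner_left = bounded_bilinear.bounded_linear_left[OF bounded_bilinear_cinner]
lemmas bounded_linear_scaleC_right = bounded_bilinear.bounded_linear_right[OF bounded_bilinear_scaleC]
lemmas bounded_linear_scaleC_left = bounded_bilinear.bounded_linear_left[OF bounded_bilinear_scaleC]

lemma cinner_ext: "(\<And>z. cinner z x = cinner z y) \<Longrightarrow> x = (y::'h::complex_hilbert)"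
proof -
  assume "\<And>z. cinner z x = cinner z y"
  then have "cinner (x - y) (x - y) = 0" by (simp add: cinner_diff_right)
  then show "x = y" by (simp add: cinner_self)
qed

lemma module_scaleC: "module (scaleC :: complex \<Rightarrow> 'h::complex_hilbert \<Rightarrow> 'h)"
  by standard (simp_all add: scaleC_add_left scaleC_add_right scaleC_scaleC)

subsection \<open>Orthonormal bases\<close>

definition proj :: "(nat \<Rightarrow> 'h::complex_hilbert) \<Rightarrow> nat \<Rightarrow> 'h \<Rightarrow> 'h" where
  "proj e K x = (\<Sum>k<K. cinner (e k) x *\<^sub>C e k)"

lemma proj_diff: "proj e K (x - y) = proj e K x - proj e K y"
  by (simp add: proj_def cinner_diff_right scaleC_diff_left sum_subtractf)

context
  fixes e :: "nat \<Rightarrow> 'h::complex_hilbert"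
  assumes onb: "orthonormal_basis e"
begin

lemma onb_inner: "cinner (e i) (e j) = (if i = j then 1 else 0)"
  using onb by (simp add: orthonormal_basis_def)

lemma cinner_onb_sum:
  assumes "finite A"
  shows "cinner (e k) (\<Sum>j\<in>A. c j *\<^sub>C e j) = (if k \<in> A then c k else 0)"
proof -
  have "cinner (e k) (\<Sum>j\<in>A. c j *\<^sub>C e j) = (\<Sum>j\<in>A. if k = j then c j else 0)"
    by (auto simp: cinner_sum_right cinner_scaleC_right onb_inner intro: sum.cong)
  then show ?thesis using assms by simp
qed

lemma norm_sum_onb:
  assumes "finite A"
  shows "(norm (\<Sum>k\<in>A. c k *\<^sub>C e k))\<^sup>2 = (\<Sum>k\<in>A. (cmod (c k))\<^sup>2)"
proof -
  have "complex_of_real ((norm (\<Sum>k\<in>A. c k *\<^sub>C e k))\<^sup>2)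
      = (\<Sum>k\<in>A. cnj (c k) * cinner (e k) (\<Sum>j\<in>A. c j *\<^sub>C e j))"
    unfolding cinner_self[symmetric] by (subst cinner_sum_left) (simp add: cinner_scaleC_left)
  also have "\<dots> = (\<Sum>k\<in>A. cnj (c k) * c k)"
    using assms by (intro sum.cong refl) (simp add: cinner_onb_sum)
  also have "\<dots> = of_real (\<Sum>k\<in>A. (cmod (c k))\<^sup>2)"
    by (simp only: complex_norm_square of_real_sum mult.commute)
  finally show ?thesis by (simp only: of_real_eq_iff)
qed

lemma norm_proj: "(norm (proj e K x))\<^sup>2 = (\<Sum>k<K. (cmod (cinner (e k) x))\<^sup>2)"
  unfolding proj_def by (rule norm_sum_onb) simp

lemma norm_diff_proj: "(norm (x - proj e K x))\<^sup>2 = (norm x)\<^sup>2 - (\<Sum>k<K. (cmod (cinner (e k) x))\<^sup>2)"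
proof -
  have "cinner x (proj e K x) = (\<Sum>k<K. cinner (e k) x * cnj (cinner (e k) x))"
    unfolding proj_def cinner_sum_right cinner_scaleC_right
    by (intro sum.cong refl) (metis cinner_commute)
  also have "\<dots> = of_real (\<Sum>k<K. (cmod (cinner (e k) x))\<^sup>2)"
    by (simp only: complex_norm_square[symmetric] of_real_sum)
  finally show ?thesis by (simp add: norm_diff_sq norm_proj)
qed

lemma norm_proj_le: "norm (proj e K x) \<le> norm x"
  and norm_diff_proj_le: "norm (x - proj e K x) \<le> norm x"
proof -
  have "(\<Sum>k<K. (cmod (cinner (e k) x))\<^sup>2) \<ge> 0" by (simp add: sum_nonneg)
  then have "(norm (x - proj e K x))\<^sup>2 \<le> (norm x)\<^sup>2" by (simp add: norm_diff_proj)
  then show "norm (x - proj e K x) \<le> norm x" by (simp add: power2_le_iff_abs_le)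
  have "0 \<le> (norm (x - proj e K x))\<^sup>2" by simp
  then have "(norm (proj e K x))\<^sup>2 \<le> (norm x)\<^sup>2" unfolding norm_diff_proj norm_proj by linarith
  then show "norm (proj e K x) \<le> norm x" by (simp add: power2_le_iff_abs_le)
qed

lemma proj_eventually_id:
  assumes "x \<in> cspan (range e)"
  shows "\<exists>K. \<forall>L\<ge>K. proj e L x = x"
proof -
  interpret module "scaleC :: complex \<Rightarrow> 'h \<Rightarrow> 'h" by (rule module_scaleC)
  from assms show ?thesis unfolding cspan_def
  proof (induction rule: span_induct_alt)
    case base
    then show ?case by (simp add: proj_def)
  next
    case (step c y x)
    then obtain k K where k: "y = e k" and K: "\<forall>L\<ge>K. proj e L x = x" by auto
    have "proj e L (c *\<^sub>C y + x) = c *\<^sub>C y + x" if "L \<ge> max (Suc k) K" for L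
    proof -
      have "proj e L (c *\<^sub>C y + x) = (\<Sum>j<L. (c * (if j = k then 1 else 0)) *\<^sub>C e j) + proj e L x"
        by (simp add: proj_def cinner_add_right cinner_scaleC_right k onb_inner scaleC_add_left sum.distrib)
      also have "(\<Sum>j<L. (c * (if j = k then 1 else 0)) *\<^sub>C e j) = c *\<^sub>C e k"
        using that by (subst sum.remove[of _ k]) (auto intro!: sum.neutral)
      finally show ?thesis using K that k by simp
    qed
    then show ?case by blast
  qed
qed

text \<open>On the dense span the projections are eventually the identity. The limit passes to the
  closure because every map \<open>x - proj e L x\<close> is a contraction.\<close>

lemma proj_tendsto: "(\<lambda>K. proj e K x) \<longlonglongrightarrow> x"
proof (rule LIMSEQ_I)
  fix r :: real assume r: "0 < r"
  have "x \<in> closure (cspan (range e))" using onb by (simp add: orthonormal_basis_def)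
  then obtain y where y: "y \<in> cspan (range e)" "dist y x < r"
    using r closure_approachable by blast
  then obtain K where K: "\<And>L. L \<ge> K \<Longrightarrow> proj e L y = y" using proj_eventually_id by blast
  have "norm (proj e L x - x) < r" if "L \<ge> K" for L
  proof -
    have "x - proj e L x = (x - y) - proj e L (x - y)" using K[OF that] by (simp add: proj_diff)
    then have "norm (x - proj e L x) \<le> norm (x - y)" using norm_diff_proj_le by metis
    then show ?thesis using y by (simp add: dist_norm norm_minus_commute)
  qed
  then show "\<exists>no. \<forall>n\<ge>no. norm (proj e n x - x) < r" by blast
qed

lemma onb_sums: "(\<lambda>k. cinner (e k) x *\<^sub>C e k) sums x"
  using proj_tendsto by (simp add: sums_def proj_def)

lemma tail_tendsto: "(\<lambda>K. norm (x - proj e K x)) \<longlonglongrightarrow> 0"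
  using tendsto_norm[OF tendsto_diff[OF tendsto_const proj_tendsto], of x x] by simp

lemma parseval_sums: "(\<lambda>k. (cmod (cinner (e k) x))\<^sup>2) sums (norm x)\<^sup>2"
  using tendsto_power[OF tendsto_norm[OF proj_tendsto], of x 2] by (simp add: norm_proj sums_def)

lemma cinner_sums: "(\<lambda>k. cnj (cinner (e k) x) * cinner (e k) y) sums cinner x y"
proof -
  have "(\<lambda>k. cinner (cinner (e k) x *\<^sub>C e k) y) sums cinner x y"
    by (rule bounded_linear.sums[OF bounded_linear_cinner_left onb_sums])
  then show ?thesis by (simp add: cinner_scaleC_left)
qed

text \<open>Riesz-Fischer: by Pythagoras a block of the vector series has as squared norm the same
  block of the scalar series, so the Cauchy criterion carries over.\<close>

lemma summable_onb:
  assumes "summable (\<lambda>k. (cmod (c k))\<^sup>2)"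
  shows "summable (\<lambda>k. c k *\<^sub>C e k)"
  unfolding summable_Cauchy
proof (intro allI impI)
  fix r :: real assume r: "0 < r"
  then obtain N where N: "\<forall>m\<ge>N. \<forall>n. norm (\<Sum>k\<in>{m..<n}. (cmod (c k))\<^sup>2) < r\<^sup>2"
    using assms[unfolded summable_Cauchy, rule_format, of "r\<^sup>2"] by auto
  have "norm (\<Sum>k\<in>{m..<n}. c k *\<^sub>C e k) < r" if "m \<ge> N" for m n
  proof -
    have "(norm (\<Sum>k\<in>{m..<n}. c k *\<^sub>C e k))\<^sup>2 < r\<^sup>2"
      using N[rule_format, OF that, of n] by (simp add: norm_sum_onb sum_nonneg)
    then show ?thesis using r by (simp add: power2_less_imp_less)
  qed
  then show "\<exists>N. \<forall>m\<ge>N. \<forall>n. norm (\<Sum>k\<in>{m..<n}. c k *\<^sub>C e k) < r" by blast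
qed

lemma cinner_onb_sums:
  assumes "(\<lambda>k. c k *\<^sub>C e k) sums y"
  shows "cinner (e k) y = c k"
proof -
  have "(\<lambda>j. cinner (e k) (c j *\<^sub>C e j)) sums cinner (e k) y"
    by (rule bounded_linear.sums[OF bounded_linear_cinner_right assms])
  moreover have "(\<lambda>j. cinner (e k) (c j *\<^sub>C e j)) = (\<lambda>j. if j = k then c j else 0)"
    by (auto simp: cinner_scaleC_right onb_inner)
  ultimately show ?thesis using sums_single[of k c] sums_unique2 by metis
qed

text \<open>The adjoint is assembled from its Fourier coefficients: the \<open>k\<close>-th
  coefficient of \<open>S \<xi>\<close> has to be \<open>cinner (T (e k)) \<xi>\<close>, and it
  remains to see that these are square summable with a bound linear in
  \<open>norm \<xi>\<close>.\<close>

lemma adjoint_exists: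
  fixes T :: "'h \<Rightarrow>\<^sub>L 'h"
  assumes T: "T \<in> bounded_operators"
  shows "\<exists>S. \<forall>\<xi> \<eta>. cinner (blinfun_apply S \<xi>) \<eta> = cinner \<xi> (blinfun_apply T \<eta>)"
proof -
  let ?c = "\<lambda>\<xi> k. cinner (T (e k)) \<xi>"
  \<comment> \<open>\<open>T\<close> is tested on the vector \<open>?v\<close> whose coefficients
    are the numbers to be bounded. Then \<open>cinner (T ?v) \<xi>\<close> equals
    \<open>(norm ?v)\<^sup>2\<close>, and one factor \<open>norm ?v\<close> cancels.\<close>
  have fin: "(\<Sum>k<K. (cmod (?c \<xi> k))\<^sup>2) \<le> (norm T * norm \<xi>)\<^sup>2" for \<xi> K
  proof -
    let ?v = "\<Sum>k<K. ?c \<xi> k *\<^sub>C e k" and ?s = "\<Sum>k<K. (cmod (?c \<xi> k))\<^sup>2"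
    have nv: "(norm ?v)\<^sup>2 = ?s" by (rule norm_sum_onb) simp
    have "cinner (T ?v) \<xi> = (\<Sum>k<K. cnj (?c \<xi> k) * ?c \<xi> k)"
      using T unfolding blinfun.sum_right cinner_sum_left
      by (intro sum.cong refl) (simp add: bounded_operators_def cinner_scaleC_left)
    also have "\<dots> = of_real ?s" by (simp only: complex_norm_square of_real_sum mult.commute)
    finally have "cmod (cinner (T ?v) \<xi>) = \<bar>?s\<bar>" by (simp only: norm_of_real)
    then have "?s = cmod (cinner (T ?v) \<xi>)" by (simp add: sum_nonneg)
    also have "\<dots> \<le> norm (T ?v) * norm \<xi>" by (rule cinner_cauchy_schwarz)
    also have "\<dots> \<le> (norm T * norm ?v) * norm \<xi>"
      by (intro mult_right_mono norm_blinfun) simp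
    finally have "norm ?v * norm ?v \<le> (norm T * norm \<xi>) * norm ?v"
      using nv by (simp add: power2_eq_square mult_ac)
    then have "norm ?v \<le> norm T * norm \<xi>"
      by (cases "norm ?v = 0") (auto simp: mult_le_cancel_right)
    then have "(norm ?v)\<^sup>2 \<le> (norm T * norm \<xi>)\<^sup>2" by (intro power_mono) auto
    then show ?thesis using nv by simp
  qed
  have sm2: "summable (\<lambda>k. (cmod (?c \<xi> k))\<^sup>2)" for \<xi>
    by (rule summableI_nonneg_bounded[OF _ fin]) simp
  have sm: "summable (\<lambda>k. ?c \<xi> k *\<^sub>C e k)" for \<xi>
    by (rule summable_onb[OF sm2])
  define S where "S \<xi> = (\<Sum>k. ?c \<xi> k *\<^sub>C e k)" for \<xi>
  have S_inner: "cinner (e k) (S \<xi>) = ?c \<xi> k" for \<xi> k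
    unfolding S_def using cinner_onb_sums[OF summable_sums[OF sm]] by simp
  have "bounded_linear S"
  proof (rule bounded_linear_intro)
    fix x y r
    show "S (x + y) = S x + S y"
      unfolding S_def by (simp only: suminf_add[OF sm sm] cinner_add_right scaleC_add_left)
    show "S (r *\<^sub>R x) = r *\<^sub>R S x"
    proof -
      have "?c (r *\<^sub>R x) k *\<^sub>C e k = r *\<^sub>R (?c x k *\<^sub>C e k)" for k
        unfolding scaleR_scaleC[of r] cinner_scaleC_right scaleC_scaleC ..
      then show ?thesis unfolding S_def by (simp only: suminf_scaleR_right[OF sm])
    qed
    have "(norm (S x))\<^sup>2 \<le> (norm T * norm x)\<^sup>2"
    proof -
      have "(\<lambda>k. (cmod (?c x k))\<^sup>2) sums (norm (S x))\<^sup>2"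
        using parseval_sums[of "S x"] by (simp add: S_inner)
      then show ?thesis unfolding sums_def by (rule LIMSEQ_le_const2) (use fin in blast)
    qed
    then have "norm (S x) \<le> norm T * norm x" by (simp add: power2_le_iff_abs_le)
    then show "norm (S x) \<le> norm x * norm T" by (simp add: mult.commute)
  qed
  then have bS: "blinfun_apply (Blinfun S) = S" by (rule bounded_linear_Blinfun_apply)
  have "cinner (S \<xi>) \<eta> = cinner \<xi> (T \<eta>)" for \<xi> \<eta>
  proof -
    have "(\<lambda>k. cinner \<xi> (T (cinner (e k) \<eta> *\<^sub>C e k))) sums cinner \<xi> (T \<eta>)"
      by (intro bounded_linear.sums[OF bounded_linear_cinner_right]
          bounded_linear.sums[OF blinfun.bounded_linear_right] onb_sums)
    moreover have "cinner \<xi> (T (cinner (e k) \<eta> *\<^sub>C e k)) = cnj (cinner (e k) (S \<xi>)) * cinner (e k) \<eta>" for k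
      using T by (simp add: S_inner bounded_operators_def cinner_scaleC_right cinner_commute[of \<xi>])
    ultimately show ?thesis using cinner_sums[of "S \<xi>" \<eta>] sums_unique2 by force
  qed
  then show ?thesis using bS by metis
qed

end

lemma adjoint_op_eqI:
  fixes T S :: "'h::complex_hilbert \<Rightarrow>\<^sub>L 'h"
  assumes "\<And>\<xi> \<eta>. cinner (S \<xi>) \<eta> = cinner \<xi> (T \<eta>)"
  shows "adjoint_op T = S"
  unfolding adjoint_op_def
proof (rule the_equality)
  fix S' :: "'h \<Rightarrow>\<^sub>L 'h"
  assume S': "\<forall>\<xi> \<eta>. cinner (S' \<xi>) \<eta> = cinner \<xi> (T \<eta>)"
  show "S' = S"
  proof (rule blinfun_eqI)
    fix \<xi>
    show "S' \<xi> = S \<xi>"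
      by (rule cinner_ext, subst (1 2) cinner_commute) (simp add: S' assms)
  qed
qed (use assms in simp)

lemma adjoint_in_bounded_operators:
  fixes T S :: "'h::complex_hilbert \<Rightarrow>\<^sub>L 'h"
  assumes "\<And>\<xi> \<eta>. cinner (S \<xi>) \<eta> = cinner \<xi> (T \<eta>)"
  shows "S \<in> bounded_operators"
proof -
  have "S (c *\<^sub>C \<xi>) = c *\<^sub>C S \<xi>" for c \<xi>
    by (rule cinner_ext, subst (1 2) cinner_commute)
      (simp add: assms cinner_scaleC_left)
  then show ?thesis by (simp add: bounded_operators_def)
qed

text \<open>Stated for plain functions, so that it applies to the values of \<open>\<alpha>\<close>
  as well as to the directional components of its strong derivative.\<close>

lemma norm_adjoint_le:
  fixes T S :: "'h::complex_hilbert \<Rightarrow> 'h"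
  assumes adj: "\<And>\<xi> \<eta>. cinner (S \<xi>) \<eta> = cinner \<xi> (T \<eta>)"
    and T: "\<And>\<eta>. norm (T \<eta>) \<le> C * norm \<eta>"
  shows "norm (S \<xi>) \<le> C * norm \<xi>"
proof (cases "S \<xi> = 0")
  case True
  have "0 \<le> norm (T \<xi>)" by simp
  also have "\<dots> \<le> C * norm \<xi>" by (rule T)
  finally show ?thesis using True by simp
next
  case False
  have "(norm (S \<xi>))\<^sup>2 = cmod (cinner (S \<xi>) (S \<xi>))" by (simp add: cinner_self norm_power)
  also have "\<dots> = cmod (cinner \<xi> (T (S \<xi>)))" by (simp add: adj)
  also have "\<dots> \<le> norm \<xi> * norm (T (S \<xi>))" by (rule cinner_cauchy_schwarz)
  also have "\<dots> \<le> norm \<xi> * (C * norm (S \<xi>))" by (intro mult_left_mono T) simp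
  finally have "norm (S \<xi>) * norm (S \<xi>) \<le> (C * norm \<xi>) * norm (S \<xi>)"
    by (simp only: power2_eq_square mult_ac)
  then show ?thesis using False by (simp only: mult_le_cancel_right) auto
qed

section \<open>Operator norms and the uniform boundedness principle\<close>

lemma norm_blinfun_le_iff:
  fixes T :: "'a::real_normed_vector \<Rightarrow>\<^sub>L 'b::real_normed_vector"
  assumes "0 \<le> C"
  shows "norm T \<le> C \<longleftrightarrow> (\<forall>x. norm (T x) \<le> C * norm x)"
proof
  assume "norm T \<le> C"
  then show "\<forall>x. norm (T x) \<le> C * norm x"
    using norm_blinfun[of T] by (meson mult_right_mono norm_ge_zero order_trans)
next
  assume "\<forall>x. norm (T x) \<le> C * norm x"
  then show "norm T \<le> C" using assms by (intro norm_blinfun_bound) auto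
qed

text \<open>Banach-Steinhaus by Baire category: convergent sequences are bounded, so the closed sets
  \<open>F m\<close> cover the space and one of them contains a ball. Differences of points of that
  ball carry the bound to a ball around 0.\<close>

lemma limit_of_blinfuns_bounded:
  fixes T :: "nat \<Rightarrow> 'a::banach \<Rightarrow>\<^sub>L 'b::real_normed_vector"
  assumes lim: "\<And>x. (\<lambda>n. T n x) \<longlonglongrightarrow> S x"
  shows "\<exists>C. \<forall>x. norm (S x) \<le> C * norm x"
proof -
  have bdd: "\<exists>c. \<forall>n. norm (T n x) \<le> c" for x
    using convergent_imp_Bseq[OF convergentI[OF lim[of x]]] unfolding Bseq_def by blast
  define F where "F m = {x. \<forall>n. norm (T n x) \<le> real m}" for m :: nat
  have cl: "closed (F m)" for m
  proof -
    have "F m = (\<Inter>n. {x. norm (T n x) \<le> real m})" by (auto simp: F_def)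
    then show ?thesis
      by (auto intro!: closed_INT closed_Collect_le continuous_on_norm continuous_on_const
          blinfun.continuous_on)
  qed
  have "\<exists>m. interior (F m) \<noteq> {}"
  proof (rule ccontr)
    assume *: "\<nexists>m. interior (F m) \<noteq> {}"
    have "Met_TC.mtopology interior_of \<Union> (range F) = {}"
    proof (rule Met_TC.metric_Baire_category_alt)
      show "Met_TC.mcomplete TYPE('a)" using complete_UNIV by simp
      show "countable (range F)" by simp
      show "closedin Met_TC.mtopology G \<and> Met_TC.mtopology interior_of G = {}" if "G \<in> range F" for G
        using that * cl by auto
    qed
    moreover have "\<Union> (range F) = UNIV"
    proof -
      have "\<exists>m. x \<in> F m" for x
      proof -
        obtain c where c: "\<forall>n. norm (T n x) \<le> c" using bdd by blast
        obtain m :: nat where "c \<le> real m" using real_arch_simple by blast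
        with c have "x \<in> F m" by (auto simp: F_def intro: order_trans)
        then show ?thesis ..
      qed
      then show ?thesis by auto
    qed
    ultimately show False by simp
  qed
  then obtain m a r where r: "r > 0" "ball a r \<subseteq> F m"
    by (metis all_not_in_conv mem_interior)
  have "norm (T n x) \<le> (4 * real m / r) * norm x" for n x
  proof (cases "x = 0")
    case False
    \<comment> \<open>Rescaling to norm \<open>r / 2\<close> keeps \<open>a + y\<close> inside the
      ball. Both values at \<open>a + y\<close> and \<open>a\<close> are at most \<open>m\<close>,
      whence the constant \<open>2 * m / (r / 2)\<close>.\<close>
    define y where "y = (r / (2 * norm x)) *\<^sub>R x"
    have ny: "norm y = r / 2" using False r by (simp add: y_def)
    then have "a + y \<in> F m" "a \<in> F m" using r by (auto simp: dist_norm subset_iff)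
    then have "norm (T n (a + y)) \<le> m" "norm (T n a) \<le> m" by (auto simp: F_def)
    moreover have "T n y = T n (a + y) - T n a" by (simp add: blinfun.add_right)
    ultimately have "norm (T n y) \<le> 2 * m" using norm_triangle_ineq4[of "T n (a + y)" "T n a"] by simp
    moreover have "norm (T n y) = r / (2 * norm x) * norm (T n x)"
      using r by (simp add: y_def blinfun.scaleR_right)
    ultimately show ?thesis using r False by (simp add: field_simps)
  qed simp
  then have "norm (S x) \<le> (4 * real m / r) * norm x" for x
    using LIMSEQ_le_const2[OF tendsto_norm[OF lim]] by blast
  then show ?thesis by blast
qed

section \<open>Differentiable maps on manifolds\<close>

lemma Ck_on_1_iff:
  "Ck_on 1 f S \<longleftrightarrow> (\<forall>x\<in>S. f differentiable (at x)) \<and>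
    (\<forall>v. continuous_on S (\<lambda>x. frechet_derivative f (at x) v))"
  by simp

lemma dcoeff_eqI:
  "((s \<circ> inv_into (fst c) (snd c)) has_derivative D) (at (snd c x)) \<Longrightarrow> dcoeff c s x = D"
  unfolding dcoeff_def using frechet_derivative_at by fastforce

definition diff_at_chart ::
    "('m, 'e::real_inner) chart \<Rightarrow> ('m \<Rightarrow> 'h::real_normed_vector) \<Rightarrow> 'm \<Rightarrow> bool" where
  "diff_at_chart c s x \<longleftrightarrow> (s \<circ> inv_into (fst c) (snd c)) differentiable (at (snd c x))"

lemma diff_at_chart_iff:
  "diff_at_chart c s x \<longleftrightarrow> ((s \<circ> inv_into (fst c) (snd c)) has_derivative dcoeff c s x) (at (snd c x))"
  unfolding diff_at_chart_def dcoeff_def by (metis differentiableI frechet_derivative_works)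

lemmas diff_at_chartD = diff_at_chart_iff[THEN iffD1]

lemma diff_at_chartI:
  "((s \<circ> inv_into (fst c) (snd c)) has_derivative D) (at (snd c x)) \<Longrightarrow> diff_at_chart c s x"
  unfolding diff_at_chart_def by (rule differentiableI)

lemma linear_dcoeff: "diff_at_chart c s x \<Longrightarrow> linear (dcoeff c s x)"
  by (rule has_derivative_linear[OF diff_at_chartD])

locale riemannian =
  fixes M :: "('m::{second_countable_topology, t2_space}, 'e::real_inner) manifold"
  assumes riemannian: "riemannian_manifold M"
begin

abbreviation dom :: "('m, 'e) chart \<Rightarrow> 'm set" where "dom c \<equiv> fst c"
abbreviation crd :: "('m, 'e) chart \<Rightarrow> 'm \<Rightarrow> 'e" where "crd c \<equiv> snd c"
abbreviation par :: "('m, 'e) chart \<Rightarrow> 'e \<Rightarrow> 'm" where "par c \<equiv> inv_into (fst c) (snd c)"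

lemmas riemannian_conjs = riemannian[unfolded riemannian_manifold_def]

section \<open>The model space and its orthonormal axes\<close>

lemma finite_axes [simp, intro]: "finite (axes M)"
  by (rule riemannian_conjs[THEN conjunct1])

lemma norm_axes: "b \<in> axes M \<Longrightarrow> norm b = 1"
  by (rule riemannian_conjs[THEN conjunct2, THEN conjunct2, THEN conjunct1, THEN bspec])

lemma orthogonal_axes: "pairwise orthogonal (axes M)"
  by (rule riemannian_conjs[THEN conjunct2, THEN conjunct1])

lemma span_axes: "span (axes M) = UNIV"
  by (rule riemannian_conjs[THEN conjunct2, THEN conjunct2, THEN conjunct2, THEN conjunct1])

lemmas riemannian_conjs' =
  riemannian_conjs[THEN conjunct2, THEN conjunct2, THEN conjunct2, THEN conjunct2]

lemma connected_M: "connected (UNIV :: 'm set)"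
  by (rule riemannian_conjs'[THEN conjunct1])

lemma inner_axes: "b \<in> axes M \<Longrightarrow> d \<in> axes M \<Longrightarrow> b \<bullet> d = (if b = d then 1 else 0)"
  using orthogonal_axes norm_axes unfolding pairwise_def orthogonal_def
  by (auto simp: norm_eq_1)

lemma axes_expansion: "v = (\<Sum>b\<in>axes M. (v \<bullet> b) *\<^sub>R b)"
proof -
  have "v \<in> span (axes M)" by (simp add: span_axes)
  then show ?thesis
  proof (induction rule: span_induct_alt)
    case base
    then show ?case by simp
  next
    case (step c d y)
    have "(\<Sum>b\<in>axes M. (d \<bullet> b) *\<^sub>R b) = (\<Sum>b\<in>axes M. if b = d then d else 0)"
      using step(1) by (intro sum.cong) (auto simp: inner_axes)
    also have "\<dots> = d" using step(1) by simp
    finally have "c *\<^sub>R d = c *\<^sub>R (\<Sum>b\<in>axes M. (d \<bullet> b) *\<^sub>R b)" by simp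
    also have "\<dots> = (\<Sum>b\<in>axes M. (c *\<^sub>R d \<bullet> b) *\<^sub>R b)" by (simp add: scaleR_sum_right)
    finally show ?case
      using step(2) by (simp only: inner_add_left scaleR_add_left sum.distrib)
  qed
qed

lemma linear_expansion:
  assumes "linear f"
  shows "f v = (\<Sum>b\<in>axes M. (v \<bullet> b) *\<^sub>R f b)"
  by (subst axes_expansion) (simp add: linear_sum[OF assms] linear_cmul[OF assms])

lemma inner_axes_le: "b \<in> axes M \<Longrightarrow> \<bar>v \<bullet> b\<bar> \<le> norm v"
  using Cauchy_Schwarz_ineq2[of v b] by (simp add: norm_axes)

lemma linear_bound:
  fixes f :: "'e \<Rightarrow> 'b::real_normed_vector"
  assumes "linear f"
  shows "norm (f v) \<le> (\<Sum>b\<in>axes M. norm (f b)) * norm v"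
proof -
  have "norm (f v) \<le> (\<Sum>b\<in>axes M. norm ((v \<bullet> b) *\<^sub>R f b))"
    by (subst linear_expansion[OF assms]) (rule norm_sum)
  also have "\<dots> \<le> (\<Sum>b\<in>axes M. norm v * norm (f b))"
    by (intro sum_mono) (auto intro!: mult_right_mono inner_axes_le)
  finally show ?thesis by (simp add: sum_distrib_left mult.commute)
qed

text \<open>The type \<open>'e\<close> is just a \<open>real_inner\<close> space and is
  finite-dimensional only through \<open>axes M\<close>. A closed ball around 0 is a closed subset
  of the Minkowski sum of finitely many compact segments along the axes.\<close>

lemma compact_cball_model: "compact (cball (a::'e) r)"
proof -
  have cp: "finite B \<Longrightarrow> (\<And>b. b \<in> B \<Longrightarrow> compact (K b)) \<Longrightarrow>
      compact {\<Sum>b\<in>B. f b | f :: 'e \<Rightarrow> 'e. \<forall>b\<in>B. f b \<in> K b}" for B :: "'e set" and K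
  proof (induction B rule: finite_induct)
    case empty
    then show ?case by simp
  next
    case (insert b B)
    have "{\<Sum>b\<in>insert b B. f b | f :: 'e \<Rightarrow> 'e. \<forall>b\<in>insert b B. f b \<in> K b} =
        {x + y | x y. x \<in> K b \<and> y \<in> {\<Sum>b\<in>B. f b | f :: 'e \<Rightarrow> 'e. \<forall>b\<in>B. f b \<in> K b}}" (is "?L = ?R")
    proof (intro set_eqI iffI)
      fix z assume "z \<in> ?L"
      then show "z \<in> ?R" using insert.hyps by auto
    next
      fix z assume "z \<in> ?R"
      then obtain x f where f: "z = x + (\<Sum>b\<in>B. f b)" "x \<in> K b" "\<forall>b\<in>B. f b \<in> K b" by auto
      have "(\<Sum>a\<in>insert b B. (f(b := x)) a) = x + (\<Sum>a\<in>B. (f(b := x)) a)"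
        using insert.hyps by simp
      also have "(\<Sum>a\<in>B. (f(b := x)) a) = (\<Sum>a\<in>B. f a)"
        using insert.hyps by (intro sum.cong) auto
      finally have "z = (\<Sum>a\<in>insert b B. (f(b := x)) a)" using f by simp
      moreover have "\<forall>a\<in>insert b B. (f(b := x)) a \<in> K a" using f insert.hyps by auto
      ultimately show "z \<in> ?L" by blast
    qed
    moreover have "compact ?R" using insert by (intro compact_sums) auto
    ultimately show ?case by simp
  qed
  let ?K = "\<lambda>b. (\<lambda>t. t *\<^sub>R b) ` {- r..r} :: 'e set"
  let ?S = "{\<Sum>b\<in>axes M. f b | f. \<forall>b\<in>axes M. f b \<in> ?K b}"
  have "compact ?S"
    by (rule cp) (auto intro!: compact_continuous_image continuous_intros)
  moreover have "cball 0 r \<subseteq> ?S"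
  proof
    fix v :: 'e assume "v \<in> cball 0 r"
    then have "(v \<bullet> b) *\<^sub>R b \<in> ?K b" if "b \<in> axes M" for b
      using inner_axes_le[OF that, of v] by (intro imageI) auto
    then show "v \<in> ?S" using axes_expansion[of v] by blast
  qed
  ultimately have "compact (?S \<inter> cball 0 r)" by (intro compact_Int_closed closed_cball)
  with \<open>cball 0 r \<subseteq> ?S\<close> have "compact (cball (0::'e) r)" by (simp add: Int_absorb1)
  then have "compact ((+) a ` cball (0::'e) r)" by (rule compact_translation)
  then show ?thesis by (simp add: cball_translation[symmetric] image_add_cball)
qed

lemma compact_closed_bounded:
  assumes "closed S" "S \<subseteq> cball (a::'e) r"
  shows "compact S"
  using compact_Int_closed[OF compact_cball_model assms(1), of a r] assms(2) by (simp add: Int_absorb1)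

subsection \<open>Charts\<close>

lemma charts_cover: "\<Union> (fst ` atlas M) = UNIV"
  by (rule riemannian_conjs'[THEN conjunct2, THEN conjunct1])

lemma chart_conjs:
  assumes "c \<in> atlas M"
  shows "open (dom c) \<and> open (crd c ` dom c) \<and> inj_on (crd c) (dom c) \<and>
    homeomorphism (dom c) (crd c ` dom c) (crd c) (par c)"
  using riemannian_conjs'[THEN conjunct2, THEN conjunct2, THEN conjunct1, THEN bspec, OF assms]
  by (simp only: case_prod_beta)

lemma chart_open: "c \<in> atlas M \<Longrightarrow> open (dom c)"
  and chart_open_img: "c \<in> atlas M \<Longrightarrow> open (crd c ` dom c)"
  and chart_inj: "c \<in> atlas M \<Longrightarrow> inj_on (crd c) (dom c)"
  and chart_homeo: "c \<in> atlas M \<Longrightarrow> homeomorphism (dom c) (crd c ` dom c) (crd c) (par c)"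
  by (drule chart_conjs, elim conjE, assumption)+

lemma transition_smooth:
  assumes "c \<in> atlas M" "c' \<in> atlas M"
  shows "smooth_on (crd c' \<circ> par c) (crd c ` (dom c \<inter> dom c'))"
  using riemannian_conjs'[THEN conjunct2, THEN conjunct2, THEN conjunct2, THEN conjunct1, THEN bspec, OF assms(1)]
    assms(2)
  by (simp only: case_prod_beta) (drule bspec, assumption, simp only: case_prod_beta)

lemma open_dom_Int: "c \<in> atlas M \<Longrightarrow> open W \<Longrightarrow> open (dom c \<inter> W)"
  by (simp only: chart_open open_Int)

lemma par_crd [simp]: "c \<in> atlas M \<Longrightarrow> x \<in> dom c \<Longrightarrow> par c (crd c x) = x"
  by (simp add: chart_inj)

lemma chart_cont: "c \<in> atlas M \<Longrightarrow> continuous_on (dom c) (crd c)"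
  and par_cont: "c \<in> atlas M \<Longrightarrow> continuous_on (crd c ` dom c) (par c)"
  using chart_homeo unfolding homeomorphism_def by blast+

lemma chart_open_image: "c \<in> atlas M \<Longrightarrow> open W \<Longrightarrow> W \<subseteq> dom c \<Longrightarrow> open (crd c ` W)"
proof -
  assume c: "c \<in> atlas M" and W: "open W" "W \<subseteq> dom c"
  have "openin (top_of_set (crd c ` dom c)) (crd c ` W)"
    using homeomorphism_imp_open_map[OF chart_homeo[OF c]] W open_subset by blast
  then show ?thesis using chart_open_img[OF c] openin_open_trans by blast
qed

lemma par_open_image: "c \<in> atlas M \<Longrightarrow> open W \<Longrightarrow> W \<subseteq> crd c ` dom c \<Longrightarrow> open (par c ` W)"
proof -
  assume c: "c \<in> atlas M" and W: "open W" "W \<subseteq> crd c ` dom c"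
  have "openin (top_of_set (dom c)) (par c ` W)"
    using homeomorphism_imp_open_map[OF homeomorphism_symD[OF chart_homeo[OF c]]] W open_subset by blast
  then show ?thesis using chart_open[OF c] openin_open_trans by blast
qed

lemma chart_isCont: "c \<in> atlas M \<Longrightarrow> x \<in> dom c \<Longrightarrow> isCont (crd c) x"
  using chart_cont chart_open continuous_on_eq_continuous_at by blast

lemma ex_chart: "\<exists>c\<in>atlas M. x \<in> dom c"
  using charts_cover by blast

lemma chart_at: "chart_at M x \<in> atlas M" "x \<in> dom (chart_at M x)"
proof -
  have "\<exists>c. c \<in> atlas M \<and> x \<in> dom c" using ex_chart[of x] by (simp add: Bex_def)
  then have "chart_at M x \<in> atlas M \<and> x \<in> dom (chart_at M x)"
    unfolding chart_at_def by (rule someI_ex)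
  then show "chart_at M x \<in> atlas M" "x \<in> dom (chart_at M x)" by (simp_all only:)
qed

definition transit :: "('m, 'e) chart \<Rightarrow> ('m, 'e) chart \<Rightarrow> 'm \<Rightarrow> 'e \<Rightarrow> 'e" where
  "transit c c' x = dcoeff c (crd c') x"

lemma transit_deriv:
  assumes "c \<in> atlas M" "c' \<in> atlas M" "x \<in> dom c" "x \<in> dom c'"
  shows "((crd c' \<circ> par c) has_derivative transit c c' x) (at (crd c x))"
proof -
  have "Ck_on 1 (crd c' \<circ> par c) (crd c ` (dom c \<inter> dom c'))"
    using transition_smooth[OF assms(1,2)] unfolding smooth_on_def by blast
  then have "(crd c' \<circ> par c) differentiable (at (crd c x))"
    using assms unfolding Ck_on_1_iff by blast
  then show ?thesis
    unfolding transit_def dcoeff_def by (simp add: frechet_derivative_works)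
qed

lemma transit_cont:
  assumes "c \<in> atlas M" "c' \<in> atlas M"
  shows "continuous_on (dom c \<inter> dom c') (\<lambda>x. transit c c' x v)"
proof -
  have "Ck_on 1 (crd c' \<circ> par c) (crd c ` (dom c \<inter> dom c'))"
    using transition_smooth[OF assms(1,2)] unfolding smooth_on_def by blast
  then have "continuous_on (crd c ` (dom c \<inter> dom c')) (\<lambda>y. frechet_derivative (crd c' \<circ> par c) (at y) v)"
    unfolding Ck_on_1_iff by blast
  moreover have "continuous_on (dom c \<inter> dom c') (crd c)"
    using chart_cont[OF assms(1)] continuous_on_subset by blast
  ultimately have "continuous_on (dom c \<inter> dom c') ((\<lambda>y. frechet_derivative (crd c' \<circ> par c) (at y) v) \<circ> crd c)"
    by (intro continuous_on_compose)
  then show ?thesis by (simp add: transit_def dcoeff_def comp_def)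
qed

lemma dcoeff_change_chart:
  assumes c: "c \<in> atlas M" "c' \<in> atlas M" "x \<in> dom c" "x \<in> dom c'"
    and d: "diff_at_chart c s x"
  shows "diff_at_chart c' s x"
    and "dcoeff c' s x v = dcoeff c s x (transit c' c x v)"
proof -
  let ?W = "crd c' ` (dom c \<inter> dom c')"
  have op: "open ?W" by (subst Int_commute) (intro chart_open_image open_dom_Int chart_open c Int_lower1)
  have "((s \<circ> par c) has_derivative dcoeff c s x) (at ((crd c \<circ> par c') (crd c' x)))"
    using diff_at_chartD[OF d] c by simp
  from diff_chain_at[OF transit_deriv[OF c(2,1,4,3)] this]
  have "(((s \<circ> par c) \<circ> (crd c \<circ> par c')) has_derivative (dcoeff c s x \<circ> transit c' c x)) (at (crd c' x))" .
  moreover have "crd c' x \<in> ?W" using c by blast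
  moreover have "((s \<circ> par c) \<circ> (crd c \<circ> par c')) y = (s \<circ> par c') y" if "y \<in> ?W" for y
    using that c by auto
  ultimately have *: "((s \<circ> par c') has_derivative (dcoeff c s x \<circ> transit c' c x)) (at (crd c' x))"
    using has_derivative_transform_within_open[OF _ op] by blast
  then show "diff_at_chart c' s x" by (rule diff_at_chartI)
  show "dcoeff c' s x v = dcoeff c s x (transit c' c x v)"
    using dcoeff_eqI[OF *] by simp
qed

text \<open>Expansion along the axes reduces a varying argument to finitely many fixed ones. For
  operators on \<open>'h\<close> the same role is played by
  \<open>continuous_on_strong_apply\<close>, which asks for a norm bound instead.\<close>

lemma continuous_on_linear_apply:
  fixes L :: "'a::topological_space \<Rightarrow> 'e \<Rightarrow> 'b::real_normed_vector"
  assumes "\<And>x. x \<in> S \<Longrightarrow> linear (L x)" "\<And>v. continuous_on S (\<lambda>x. L x v)" "continuous_on S w"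
  shows "continuous_on S (\<lambda>x. L x (w x))"
proof -
  have "continuous_on S (\<lambda>x. \<Sum>b\<in>axes M. (w x \<bullet> b) *\<^sub>R L x b)"
    by (intro continuous_intros assms)
  then show ?thesis
    using linear_expansion[OF assms(1)] by (simp cong: continuous_on_cong)
qed

subsection \<open>Maps of class \<open>C\<^sup>1\<close>\<close>

text \<open>Derivatives are regarded as functions of the point of the manifold rather than of its
  coordinates, and \<open>W\<close> need not lie in one chart. Restriction and gluing then involve
  no images under charts.\<close>

definition C1_in :: "'m set \<Rightarrow> ('m \<Rightarrow> 'h::real_normed_vector) \<Rightarrow> bool" where
  "C1_in W s \<longleftrightarrow> (\<forall>c\<in>atlas M. (\<forall>x\<in>dom c \<inter> W. diff_at_chart c s x) \<and>
    (\<forall>v. continuous_on (dom c \<inter> W) (\<lambda>x. dcoeff c s x v)))"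

lemma C1_inD:
  assumes "C1_in W s" "c \<in> atlas M"
  shows "x \<in> dom c \<Longrightarrow> x \<in> W \<Longrightarrow> diff_at_chart c s x"
    and "continuous_on (dom c \<inter> W) (\<lambda>x. dcoeff c s x v)"
  using assms unfolding C1_in_def by auto

lemma C1_map_iff: "C1_map M s \<longleftrightarrow> C1_in UNIV s"
proof -
  have "Ck_on 1 (s \<circ> par c) (crd c ` dom c) \<longleftrightarrow>
      (\<forall>x\<in>dom c. diff_at_chart c s x) \<and> (\<forall>v. continuous_on (dom c) (\<lambda>x. dcoeff c s x v))"
    if c: "c \<in> atlas M" for c
  proof -
    have "continuous_on (crd c ` dom c) (\<lambda>y. frechet_derivative (s \<circ> par c) (at y) v) \<longleftrightarrow>
        continuous_on (dom c) (\<lambda>x. dcoeff c s x v)" (is "?A \<longleftrightarrow> ?B") for v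
    proof
      assume ?A
      from continuous_on_compose[OF chart_cont[OF c] this] show ?B
        by (simp add: dcoeff_def comp_def)
    next
      assume ?B
      moreover have "par c ` crd c ` dom c \<subseteq> dom c" using c by auto
      ultimately have "continuous_on (crd c ` dom c) (\<lambda>y. dcoeff c s (par c y) v)"
        using continuous_on_compose2[OF _ par_cont[OF c]] by blast
      then show ?A
        using c by (auto simp: dcoeff_def f_inv_into_f cong: continuous_on_cong)
    qed
    then show ?thesis unfolding Ck_on_1_iff by (simp add: diff_at_chart_def)
  qed
  then show ?thesis by (simp add: C1_map_def C1_in_def case_prod_beta)
qed

lemma C1_in_subset: "C1_in W s \<Longrightarrow> V \<subseteq> W \<Longrightarrow> C1_in V s"
  unfolding C1_in_def by (meson Int_iff Int_mono continuous_on_subset order_refl subsetD)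

lemma C1_in_local:
  assumes "\<And>x. x \<in> W \<Longrightarrow> \<exists>V. open V \<and> x \<in> V \<and> C1_in V s"
  shows "C1_in W s"
  unfolding C1_in_def
proof (intro ballI conjI allI)
  fix c x assume c: "c \<in> atlas M" and "x \<in> dom c \<inter> W"
  then show "diff_at_chart c s x" using assms C1_inD(1) by (metis IntD1 IntD2)
next
  fix c v assume c: "c \<in> atlas M"
  show "continuous_on (dom c \<inter> W) (\<lambda>x. dcoeff c s x v)"
    unfolding continuous_on_eq_continuous_within
  proof
    fix x assume x: "x \<in> dom c \<inter> W"
    then obtain V where V: "open V" "x \<in> V" "C1_in V s" using assms by blast
    have "continuous_on (dom c \<inter> V) (\<lambda>x. dcoeff c s x v)" using C1_inD(2)[OF V(3) c] .
    moreover have "open (dom c \<inter> V)" using V chart_open[OF c] by auto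
    ultimately have "isCont (\<lambda>x. dcoeff c s x v) x"
      using x V continuous_on_eq_continuous_at by blast
    then show "continuous (at x within dom c \<inter> W) (\<lambda>x. dcoeff c s x v)"
      using continuous_at_imp_continuous_at_within by blast
  qed
qed

lemma diff_at_chart_cong:
  assumes c: "c \<in> atlas M" and W: "open W" "x \<in> W" "x \<in> dom c"
    and eq: "\<And>y. y \<in> W \<Longrightarrow> s y = t y" and d: "diff_at_chart c s x"
  shows "diff_at_chart c t x" "dcoeff c t x = dcoeff c s x"
proof -
  have op: "open (crd c ` (dom c \<inter> W))"
    by (intro chart_open_image open_dom_Int c W Int_lower1)
  have "((t \<circ> par c) has_derivative dcoeff c s x) (at (crd c x))"
    by (rule has_derivative_transform_within_open[OF diff_at_chartD[OF d] op]) (use W c eq in auto)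
  then show "diff_at_chart c t x" "dcoeff c t x = dcoeff c s x"
    by (auto intro: diff_at_chartI dcoeff_eqI)
qed

lemma C1_in_cong:
  assumes W: "open W" and eq: "\<And>y. y \<in> W \<Longrightarrow> s y = t y" and s: "C1_in W s"
  shows "C1_in W t"
  unfolding C1_in_def
proof (intro ballI conjI allI)
  fix c x assume c: "c \<in> atlas M" "x \<in> dom c \<inter> W"
  then show "diff_at_chart c t x"
    using diff_at_chart_cong(1)[OF c(1) W, of x s t] eq C1_inD(1)[OF s c(1)] by auto
next
  fix c v assume c: "c \<in> atlas M"
  have "dcoeff c t x = dcoeff c s x" if "x \<in> dom c \<inter> W" for x
    using that diff_at_chart_cong(2)[OF c W, of x s t] eq C1_inD(1)[OF s c] by auto
  then show "continuous_on (dom c \<inter> W) (\<lambda>x. dcoeff c t x v)"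
    by (intro continuous_on_eq[OF C1_inD(2)[OF s c, of v]]) simp
qed

text \<open>In any other chart the coefficients are those of \<open>c\<close> applied to the
  differential of the transition map, and that differential is continuous. So one chart
  suffices.\<close>

lemma C1_in_chart:
  assumes c: "c \<in> atlas M" and W: "open W" "W \<subseteq> dom c"
    and d: "\<And>x. x \<in> W \<Longrightarrow> ((s \<circ> par c) has_derivative D x) (at (crd c x))"
    and cont: "\<And>v. continuous_on W (\<lambda>x. D x v)"
  shows "C1_in W s"
  unfolding C1_in_def
proof (intro ballI conjI allI)
  fix c' x assume c': "c' \<in> atlas M" "x \<in> dom c' \<inter> W"
  then show "diff_at_chart c' s x"
    using dcoeff_change_chart(1)[OF c, of c' x s] diff_at_chartI[OF d] W by blast
next
  fix c' v assume c': "c' \<in> atlas M"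
  have "dcoeff c' s x v = D x (transit c' c x v)" if "x \<in> dom c' \<inter> W" for x
    using that dcoeff_change_chart(2)[OF c, of c' x s] diff_at_chartI[OF d] dcoeff_eqI[OF d] c' W
    by (metis IntD1 IntD2 subsetD)
  moreover have "continuous_on (dom c' \<inter> W) (\<lambda>x. D x (transit c' c x v))"
  proof (rule continuous_on_linear_apply)
    show "linear (D x)" if "x \<in> dom c' \<inter> W" for x
      using that d has_derivative_linear by blast
    show "continuous_on (dom c' \<inter> W) (\<lambda>x. D x v)" for v
      using cont continuous_on_subset by blast
    show "continuous_on (dom c' \<inter> W) (\<lambda>x. transit c' c x v)"
      using transit_cont[OF c' c] W by (meson Int_mono continuous_on_subset order_refl)
  qed
  ultimately show "continuous_on (dom c' \<inter> W) (\<lambda>x. dcoeff c' s x v)"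
    by (auto intro: continuous_on_eq)
qed

lemma C1_in_isCont:
  assumes "C1_in W s" "open W" "x \<in> W"
  shows "isCont s x"
proof -
  obtain c where c: "c \<in> atlas M" "x \<in> dom c" using ex_chart by blast
  have "isCont (s \<circ> par c) (crd c x)"
    using diff_at_chartD[OF C1_inD(1)[OF assms(1) c]] assms(3) has_derivative_continuous by blast
  then have "isCont (\<lambda>y. (s \<circ> par c) (crd c y)) x"
    using chart_isCont[OF c] by (rule isCont_o2[rotated])
  moreover have "eventually (\<lambda>y. (s \<circ> par c) (crd c y) = s y) (nhds x)"
    using c chart_open by (intro eventually_nhds[THEN iffD2] exI[of _ "dom c"]) auto
  ultimately show ?thesis by (simp only: isCont_cong[of "\<lambda>y. (s \<circ> par c) (crd c y)" s])
qed

lemma C1_in_continuous_on: "C1_in W s \<Longrightarrow> open W \<Longrightarrow> continuous_on W s"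
  using C1_in_isCont continuous_at_imp_continuous_on by blast

section \<open>Rules of differentiation\<close>

lemma has_derivative_dcoeff_bilinear:
  assumes bl: "bounded_bilinear pr" and c: "c \<in> atlas M" "x \<in> dom c"
    and s: "diff_at_chart c s x" and t: "diff_at_chart c t x"
  shows "diff_at_chart c (\<lambda>x. pr (s x) (t x)) x"
    and "dcoeff c (\<lambda>x. pr (s x) (t x)) x v = pr (s x) (dcoeff c t x v) + pr (dcoeff c s x v) (t x)"
proof -
  have *: "(((\<lambda>x. pr (s x) (t x)) \<circ> par c) has_derivative
      (\<lambda>v. pr (s x) (dcoeff c t x v) + pr (dcoeff c s x v) (t x))) (at (crd c x))"
    using bounded_bilinear.FDERIV[OF bl diff_at_chartD[OF s] diff_at_chartD[OF t]] c
    by (simp add: comp_def)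
  show "diff_at_chart c (\<lambda>x. pr (s x) (t x)) x" using * by (rule diff_at_chartI)
  show "dcoeff c (\<lambda>x. pr (s x) (t x)) x v = pr (s x) (dcoeff c t x v) + pr (dcoeff c s x v) (t x)"
    using dcoeff_eqI[OF *] by simp
qed

lemma C1_in_bilinear:
  assumes bl: "bounded_bilinear pr" and s: "C1_in W s" and t: "C1_in W t" and W: "open W"
  shows "C1_in W (\<lambda>x. pr (s x) (t x))"
  unfolding C1_in_def
proof (intro ballI conjI allI)
  fix c x assume c: "c \<in> atlas M" "x \<in> dom c \<inter> W"
  then show "diff_at_chart c (\<lambda>x. pr (s x) (t x)) x"
    using has_derivative_dcoeff_bilinear(1)[OF bl] C1_inD(1)[OF s] C1_inD(1)[OF t] by blast
next
  fix c v assume c: "c \<in> atlas M"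
  have "dcoeff c (\<lambda>x. pr (s x) (t x)) x v = pr (s x) (dcoeff c t x v) + pr (dcoeff c s x v) (t x)"
    if "x \<in> dom c \<inter> W" for x
    using that has_derivative_dcoeff_bilinear(2)[OF bl c] C1_inD(1)[OF s c] C1_inD(1)[OF t c] by blast
  moreover have "continuous_on (dom c \<inter> W) s" "continuous_on (dom c \<inter> W) t"
    using C1_in_continuous_on[OF s W] C1_in_continuous_on[OF t W] continuous_on_subset by blast+
  then have "continuous_on (dom c \<inter> W) (\<lambda>x. pr (s x) (dcoeff c t x v) + pr (dcoeff c s x v) (t x))"
    by (intro continuous_on_add bounded_bilinear.continuous_on[OF bl] C1_inD(2)[OF s c] C1_inD(2)[OF t c])
  ultimately show "continuous_on (dom c \<inter> W) (\<lambda>x. dcoeff c (\<lambda>x. pr (s x) (t x)) x v)"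
    by (auto intro: continuous_on_eq)
qed

lemma has_derivative_dcoeff_linear:
  fixes c :: "('m, 'e) chart"
  assumes bl: "bounded_linear f" and s: "diff_at_chart c s x"
  shows "diff_at_chart c (\<lambda>x. f (s x)) x"
    and "dcoeff c (\<lambda>x. f (s x)) x v = f (dcoeff c s x v)"
proof -
  have *: "(((\<lambda>x. f (s x)) \<circ> par c) has_derivative (\<lambda>v. f (dcoeff c s x v))) (at (crd c x))"
    using bounded_linear.has_derivative[OF bl diff_at_chartD[OF s]] by (simp add: comp_def)
  show "diff_at_chart c (\<lambda>x. f (s x)) x" using * by (rule diff_at_chartI)
  show "dcoeff c (\<lambda>x. f (s x)) x v = f (dcoeff c s x v)" using dcoeff_eqI[OF *] by simp
qed

lemma C1_in_linear:
  assumes bl: "bounded_linear f" and s: "C1_in W s"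
  shows "C1_in W (\<lambda>x. f (s x))"
  unfolding C1_in_def
proof (intro ballI conjI allI)
  fix c x assume c: "c \<in> atlas M" "x \<in> dom c \<inter> W"
  then show "diff_at_chart c (\<lambda>x. f (s x)) x"
    using has_derivative_dcoeff_linear(1)[OF bl] C1_inD(1)[OF s] by blast
next
  fix c v assume c: "c \<in> atlas M"
  have "dcoeff c (\<lambda>x. f (s x)) x v = f (dcoeff c s x v)" if "x \<in> dom c \<inter> W" for x
    using that has_derivative_dcoeff_linear(2)[OF bl] C1_inD(1)[OF s c] by blast
  moreover have "continuous_on (dom c \<inter> W) (\<lambda>x. f (dcoeff c s x v))"
    by (intro bounded_linear.continuous_on[OF bl] C1_inD(2)[OF s c])
  ultimately show "continuous_on (dom c \<inter> W) (\<lambda>x. dcoeff c (\<lambda>x. f (s x)) x v)"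
    by (auto intro: continuous_on_eq)
qed

lemma has_derivative_dcoeff_add:
  fixes c :: "('m, 'e) chart"
  assumes s: "diff_at_chart c s x" and t: "diff_at_chart c t x"
  shows "diff_at_chart c (\<lambda>x. s x + t x) x"
    and "dcoeff c (\<lambda>x. s x + t x) x v = dcoeff c s x v + dcoeff c t x v"
proof -
  have *: "(((\<lambda>x. s x + t x) \<circ> par c) has_derivative (\<lambda>v. dcoeff c s x v + dcoeff c t x v)) (at (crd c x))"
    using has_derivative_add[OF diff_at_chartD[OF s] diff_at_chartD[OF t]] by (simp add: comp_def)
  show "diff_at_chart c (\<lambda>x. s x + t x) x" using * by (rule diff_at_chartI)
  show "dcoeff c (\<lambda>x. s x + t x) x v = dcoeff c s x v + dcoeff c t x v" using dcoeff_eqI[OF *] by simp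
qed

lemma C1_in_add:
  assumes s: "C1_in W s" and t: "C1_in W t"
  shows "C1_in W (\<lambda>x. s x + t x)"
  unfolding C1_in_def
proof (intro ballI conjI allI)
  fix c x assume c: "c \<in> atlas M" "x \<in> dom c \<inter> W"
  then show "diff_at_chart c (\<lambda>x. s x + t x) x"
    using has_derivative_dcoeff_add(1) C1_inD(1)[OF s] C1_inD(1)[OF t] by blast
next
  fix c v assume c: "c \<in> atlas M"
  have "dcoeff c (\<lambda>x. s x + t x) x v = dcoeff c s x v + dcoeff c t x v" if "x \<in> dom c \<inter> W" for x
    using that has_derivative_dcoeff_add(2) C1_inD(1)[OF s c] C1_inD(1)[OF t c] by blast
  moreover have "continuous_on (dom c \<inter> W) (\<lambda>x. dcoeff c s x v + dcoeff c t x v)"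
    by (intro continuous_on_add C1_inD(2)[OF s c] C1_inD(2)[OF t c])
  ultimately show "continuous_on (dom c \<inter> W) (\<lambda>x. dcoeff c (\<lambda>x. s x + t x) x v)"
    by (auto intro: continuous_on_eq)
qed

lemma has_derivative_dcoeff_const:
  fixes c :: "('m, 'e) chart"
  shows "diff_at_chart c (\<lambda>x. k) x" and "dcoeff c (\<lambda>x. k) x v = 0"
proof -
  have *: "(((\<lambda>x. k) \<circ> par c) has_derivative (\<lambda>v. 0)) (at (crd c x))" by (simp add: comp_def)
  show "diff_at_chart c (\<lambda>x. k) x" using * by (rule diff_at_chartI)
  show "dcoeff c (\<lambda>x. k) x v = 0" using dcoeff_eqI[OF *] by simp
qed

lemma C1_in_const: "C1_in W (\<lambda>x. k)"
  by (simp add: C1_in_def has_derivative_dcoeff_const)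

lemma has_derivative_dcoeff_sum:
  fixes c :: "('m, 'e) chart"
  assumes "\<And>i. i \<in> I \<Longrightarrow> diff_at_chart c (s i) x"
  shows "diff_at_chart c (\<lambda>x. \<Sum>i\<in>I. s i x) x"
    and "dcoeff c (\<lambda>x. \<Sum>i\<in>I. s i x) x v = (\<Sum>i\<in>I. dcoeff c (s i) x v)"
proof -
  have "diff_at_chart c (\<lambda>x. \<Sum>i\<in>I. s i x) x \<and>
      (\<forall>v. dcoeff c (\<lambda>x. \<Sum>i\<in>I. s i x) x v = (\<Sum>i\<in>I. dcoeff c (s i) x v))"
    using assms
  proof (induction I rule: infinite_finite_induct)
    case (insert i I)
    then show ?case
      using has_derivative_dcoeff_add[of c "s i" x "\<lambda>x. \<Sum>i\<in>I. s i x"] by simp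
  qed (simp_all add: has_derivative_dcoeff_const)
  then show "diff_at_chart c (\<lambda>x. \<Sum>i\<in>I. s i x) x"
    "dcoeff c (\<lambda>x. \<Sum>i\<in>I. s i x) x v = (\<Sum>i\<in>I. dcoeff c (s i) x v)" by auto
qed

lemma C1_in_sum: "(\<And>i. i \<in> I \<Longrightarrow> C1_in W (s i)) \<Longrightarrow> C1_in W (\<lambda>x. \<Sum>i\<in>I. s i x)"
  by (induction I rule: infinite_finite_induct) (simp_all add: C1_in_const C1_in_add)

lemma has_derivative_dcoeff_compose:
  fixes f :: "'m \<Rightarrow> real" and h :: "real \<Rightarrow> real"
  assumes c: "c \<in> atlas M" "x \<in> dom c" and f: "diff_at_chart c f x"
    and h: "(h has_real_derivative h') (at (f x))"
  shows "diff_at_chart c (\<lambda>x. h (f x)) x" and "dcoeff c (\<lambda>x. h (f x)) x v = h' * dcoeff c f x v"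
proof -
  have "(h has_derivative (*) h') (at ((f \<circ> par c) (crd c x)))"
    using h c by (simp add: has_field_derivative_def)
  from diff_chain_at[OF diff_at_chartD[OF f] this]
  have *: "(((\<lambda>x. h (f x)) \<circ> par c) has_derivative (\<lambda>v. h' * dcoeff c f x v)) (at (crd c x))"
    by (simp add: comp_def)
  show "diff_at_chart c (\<lambda>x. h (f x)) x" using * by (rule diff_at_chartI)
  show "dcoeff c (\<lambda>x. h (f x)) x v = h' * dcoeff c f x v" using dcoeff_eqI[OF *] by simp
qed

lemma C1_in_compose:
  fixes f :: "'m \<Rightarrow> real" and h h' :: "real \<Rightarrow> real"
  assumes f: "C1_in W f" and W: "open W" and h: "\<And>x. x \<in> W \<Longrightarrow> (h has_real_derivative h' (f x)) (at (f x))"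
    and h': "continuous_on (f ` W) h'"
  shows "C1_in W (\<lambda>x. h (f x))"
  unfolding C1_in_def
proof (intro ballI conjI allI)
  fix c x assume c: "c \<in> atlas M" "x \<in> dom c \<inter> W"
  then show "diff_at_chart c (\<lambda>x. h (f x)) x"
    using has_derivative_dcoeff_compose(1)[OF c(1) _ C1_inD(1)[OF f] h] by blast
next
  fix c v assume c: "c \<in> atlas M"
  have "dcoeff c (\<lambda>x. h (f x)) x v = h' (f x) * dcoeff c f x v" if "x \<in> dom c \<inter> W" for x
    using that has_derivative_dcoeff_compose(2)[OF c _ C1_inD(1)[OF f c] h] by blast
  moreover have "continuous_on (dom c \<inter> W) (\<lambda>x. h' (f x))"
    using continuous_on_compose2[OF h' C1_in_continuous_on[OF f W]] continuous_on_subset by blast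
  then have "continuous_on (dom c \<inter> W) (\<lambda>x. h' (f x) * dcoeff c f x v)"
    by (intro continuous_on_mult C1_inD(2)[OF f c])
  ultimately show "continuous_on (dom c \<inter> W) (\<lambda>x. dcoeff c (\<lambda>x. h (f x)) x v)"
    by (auto intro: continuous_on_eq)
qed

section \<open>Extension by zero and bump functions\<close>

lemma C1_in_extend:
  assumes c: "c \<in> atlas M" and f: "C1_in (dom c) f"
    and K: "compact K" "K \<subseteq> dom c" "\<And>x. x \<in> dom c \<Longrightarrow> x \<notin> K \<Longrightarrow> f x = 0"
  shows "C1_in UNIV (\<lambda>x. if x \<in> dom c then f x else 0)"
proof (rule C1_in_local)
  fix x
  \<comment> \<open>The topology is Hausdorff, so \<open>K\<close> is closed, and
    \<open>dom c\<close> together with \<open>- K\<close> is an open cover on whose members the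
    extension is \<open>f\<close> and 0.\<close>
  have "closed K" using K by (simp add: compact_imp_closed)
  show "\<exists>V. open V \<and> x \<in> V \<and> C1_in V (\<lambda>x. if x \<in> dom c then f x else 0)"
  proof (cases "x \<in> dom c")
    case True
    have "C1_in (dom c) (\<lambda>x. if x \<in> dom c then f x else 0)"
      by (rule C1_in_cong[OF chart_open[OF c] _ f]) simp
    then show ?thesis using True chart_open[OF c] by blast
  next
    case False
    have "C1_in (- K) (\<lambda>x. if x \<in> dom c then f x else 0)"
      by (rule C1_in_cong[OF _ _ C1_in_const[of _ 0]]) (use \<open>closed K\<close> K in auto)
    then show ?thesis using False K \<open>closed K\<close> by (intro exI[of _ "- K"]) auto
  qed
qed

text \<open>A cut-off of class C^1 made of squared positive parts: it is 0 for t \<ge> 1 and 1 for t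
  \<le> 1 - 1 / sqrt 2, in particular for t \<le> 1/4. It is always fed with a squared distance in
  units of a radius, so 1/4 marks half that radius.\<close>

definition plateau :: "real \<Rightarrow> real" where
  "plateau t = 1 - (max 0 (1 - 2 * (max 0 (1 - t))\<^sup>2))\<^sup>2"

definition plateau' :: "real \<Rightarrow> real" where
  "plateau' t = - 8 * max 0 (1 - 2 * (max 0 (1 - t))\<^sup>2) * max 0 (1 - t)"

lemma sq_pos_part_deriv:
  "((\<lambda>t. (max 0 t)\<^sup>2) has_real_derivative 2 * max 0 t) (at (t::real))"
proof -
  consider "t < 0" | "t > 0" | "t = 0" by linarith
  then show ?thesis
  proof cases
    case 1
    have "((\<lambda>t. 0) has_real_derivative 2 * max 0 t) (at t)" using 1 by simp
    then show ?thesis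
      by (rule has_field_derivative_transform_within_open[of _ _ _ "{..<0}"]) (use 1 in auto)
  next
    case 2
    have "((\<lambda>t. t\<^sup>2) has_real_derivative 2 * max 0 t) (at t)"
      using 2 by (auto intro!: derivative_eq_intros)
    then show ?thesis
      by (rule has_field_derivative_transform_within_open[of _ _ _ "{0<..}"]) (use 2 in auto)
  next
    case 3
    have "((\<lambda>h. (max 0 h)\<^sup>2 / h) \<longlongrightarrow> 0) (at (0::real))"
    proof (rule Lim_null_comparison)
      show "\<forall>\<^sub>F h in at (0::real). norm ((max 0 h)\<^sup>2 / h) \<le> \<bar>h\<bar>"
        by (auto simp: max_def power2_eq_square)
      show "((\<lambda>h::real. \<bar>h\<bar>) \<longlongrightarrow> 0) (at 0)" by (rule tendsto_rabs_zero) simp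
    qed
    then show ?thesis using 3 by (simp add: DERIV_def)
  qed
qed

lemma plateau_deriv: "(plateau has_real_derivative plateau' t) (at t)"
  unfolding plateau_def[abs_def] plateau'_def
  by (rule derivative_eq_intros DERIV_chain2[OF sq_pos_part_deriv] refl)+ simp

lemma plateau'_cont: "continuous_on S plateau'"
  unfolding plateau'_def[abs_def] by (intro continuous_intros)

lemma plateau_nonneg: "0 \<le> plateau t"
  and plateau_le_1: "plateau t \<le> 1"
proof -
  have "0 \<le> max 0 (1 - 2 * (max 0 (1 - t))\<^sup>2)" "max 0 (1 - 2 * (max 0 (1 - t))\<^sup>2) \<le> 1" by auto
  then show "0 \<le> plateau t" "plateau t \<le> 1"
    unfolding plateau_def using power_mono[of _ 1 2] by (auto simp: power_le_one)
qed

lemma plateau_eq_1: "t \<le> 1/4 \<Longrightarrow> plateau t = 1"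
proof -
  assume "t \<le> 1/4"
  then have "(3/4)\<^sup>2 \<le> (max 0 (1 - t))\<^sup>2" by (intro power_mono) auto
  then have "1 - 2 * (max 0 (1 - t))\<^sup>2 \<le> 0" by (simp add: power2_eq_square)
  then show ?thesis by (simp add: plateau_def max_absorb1)
qed

lemma plateau_eq_0: "1 \<le> t \<Longrightarrow> plateau t = 0"
  by (simp add: plateau_def)

lemma plateau'_eq_0: "t \<le> 1/4 \<Longrightarrow> plateau' t = 0" "1 \<le> t \<Longrightarrow> plateau' t = 0"
proof -
  assume "t \<le> 1/4"
  then have "(3/4)\<^sup>2 \<le> (max 0 (1 - t))\<^sup>2" by (intro power_mono) auto
  then have "1 - 2 * (max 0 (1 - t))\<^sup>2 \<le> 0" by (simp add: power2_eq_square)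
  then show "plateau' t = 0" by (simp add: plateau'_def max_absorb1)
qed (simp add: plateau'_def)

lemma chart_nbhd:
  assumes c: "c \<in> atlas M" and x: "x \<in> dom c" and W: "open W" "x \<in> W"
  obtains r where "r > 0" "cball (crd c x) r \<subseteq> crd c ` dom c" "par c ` cball (crd c x) r \<subseteq> W"
proof -
  have "open (crd c ` (dom c \<inter> W))" by (intro chart_open_image open_dom_Int c W Int_lower1)
  moreover have "crd c x \<in> crd c ` (dom c \<inter> W)" using x W by auto
  ultimately obtain r where r: "r > 0" "cball (crd c x) r \<subseteq> crd c ` (dom c \<inter> W)"
    unfolding open_contains_cball by blast
  have "par c ` crd c ` (dom c \<inter> W) \<subseteq> W" using c by auto
  with r show ?thesis by (intro that[of r]) blast+
qed

lemma crd_C1: "c \<in> atlas M \<Longrightarrow> C1_in (dom c) (crd c)"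
  and crd_dcoeff: "c \<in> atlas M \<Longrightarrow> x \<in> dom c \<Longrightarrow> dcoeff c (crd c) x v = v"
proof -
  assume c: "c \<in> atlas M"
  have *: "((crd c \<circ> par c) has_derivative (\<lambda>v. v)) (at (crd c x))" if "x \<in> dom c" for x
    by (rule has_derivative_transform_within_open[OF has_derivative_ident chart_open_img[OF c]])
      (use that in \<open>auto simp: f_inv_into_f\<close>)
  show "C1_in (dom c) (crd c)"
    by (rule C1_in_chart[OF c chart_open[OF c] order_refl *]) auto
  show "dcoeff c (crd c) x v = v" if "x \<in> dom c" using dcoeff_eqI[OF *[OF that]] by simp
qed

lemma bump:
  assumes W: "open W" "x \<in> W"
  obtains f :: "'m \<Rightarrow> real" and V K where "C1_in UNIV f" "\<And>y. 0 \<le> f y" "\<And>y. f y \<le> 1"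
    "open V" "x \<in> V" "\<And>y. y \<in> V \<Longrightarrow> f y = 1" "compact K" "K \<subseteq> W" "\<And>y. y \<notin> K \<Longrightarrow> f y = 0"
proof -
  obtain c where c: "c \<in> atlas M" "x \<in> dom c" using ex_chart by blast
  obtain r where r: "r > 0" "cball (crd c x) r \<subseteq> crd c ` dom c" "par c ` cball (crd c x) r \<subseteq> W"
    using chart_nbhd[OF c W] by blast
  \<comment> \<open>The squared coordinate distance in units of \<open>r\<close>: squaring keeps it
    differentiable at the centre.\<close>
  define h where "h y = ((crd c y - crd c x) \<bullet> (crd c y - crd c x)) * (1 / r\<^sup>2)" for y
  define f where "f y = (if y \<in> dom c then plateau (h y) else 0)" for y
  define K where "K = par c ` cball (crd c x) r"
  define V where "V = par c ` ball (crd c x) (r/2)"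
  have hd: "h y = (norm (crd c y - crd c x) / r)\<^sup>2" for y
    by (simp add: h_def power2_norm_eq_inner power_divide)
  have K: "compact K"
    unfolding K_def using r continuous_on_subset[OF par_cont[OF c(1)]] compact_cball_model
    by (intro compact_continuous_image) auto
  have Kd: "K \<subseteq> dom c" unfolding K_def using r c by (auto simp: inv_into_into subset_iff)
  have notK: "1 \<le> h y" if "y \<in> dom c" "y \<notin> K" for y
  proof -
    have "crd c y \<notin> cball (crd c x) r"
    proof
      assume "crd c y \<in> cball (crd c x) r"
      then have "par c (crd c y) \<in> K" unfolding K_def by blast
      then show False using that c by simp
    qed
    then have "norm (crd c y - crd c x) \<ge> r" by (simp add: dist_norm norm_minus_commute)
    then have "1 \<le> norm (crd c y - crd c x) / r" using r by simp
    then show ?thesis unfolding hd by (simp add: one_le_power)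
  qed
  have hC1: "C1_in (dom c) h"
  proof -
    have d: "C1_in (dom c) (\<lambda>y. crd c y + (- crd c x))"
      by (intro C1_in_add crd_C1 C1_in_const c)
    show ?thesis
      unfolding h_def
      by (intro C1_in_linear[OF bounded_linear_mult_left] C1_in_bilinear[OF bounded_bilinear_inner] chart_open c)
        (use d in simp_all)
  qed
  have "C1_in (dom c) (\<lambda>y. plateau (h y))"
    by (rule C1_in_compose[OF hC1 chart_open[OF c(1)] plateau_deriv plateau'_cont])
  then have "C1_in UNIV f"
    unfolding f_def by (rule C1_in_extend[OF c(1) _ K Kd]) (use notK plateau_eq_0 in blast)
  moreover have "f y = 1" if "y \<in> V" for y
  proof -
    obtain z where z: "z \<in> ball (crd c x) (r/2)" "y = par c z" using \<open>y \<in> V\<close> V_def by blast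
    then have zi: "z \<in> crd c ` dom c" using r by auto
    then have "y \<in> dom c" "crd c y = z" using z by (auto simp: f_inv_into_f inv_into_into)
    moreover have "norm (z - crd c x) / r \<le> 1/2"
      using z r by (simp add: dist_norm norm_minus_commute field_simps)
    then have "(norm (z - crd c x) / r)\<^sup>2 \<le> (1/2)\<^sup>2" using r by (intro power_mono) auto
    ultimately show ?thesis by (simp add: f_def hd plateau_eq_1 power2_eq_square)
  qed
  moreover have "open V"
    unfolding V_def using r by (intro par_open_image c) (auto simp: subset_iff)
  moreover have "x \<in> V"
    unfolding V_def using c r by (intro image_eqI[of _ _ "crd c x"]) auto
  moreover have "f y = 0" if "y \<notin> K" for y
    using notK[OF _ that] by (simp add: f_def plateau_eq_0)
  moreover have "K \<subseteq> W" using r K_def by simp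
  moreover have "0 \<le> f y" "f y \<le> 1" for y by (simp_all add: f_def plateau_nonneg plateau_le_1)
  ultimately show ?thesis using K that by blast
qed

end

section \<open>Orthonormal frames and jets\<close>

context riemannian
begin

abbreviation met :: "('m, 'e) chart \<Rightarrow> 'm \<Rightarrow> 'e \<Rightarrow> 'e \<Rightarrow> real" where
  "met c x v w \<equiv> riem_metric M c x v w"

lemmas riemannian_conjs'' =
  riemannian_conjs'[THEN conjunct2, THEN conjunct2, THEN conjunct2, THEN conjunct2]

lemma met_conjs:
  assumes "c \<in> atlas M" "x \<in> dom c"
  shows "bilinear (met c x) \<and> (\<forall>v w. met c x v w = met c x w v) \<and> (\<forall>v. v \<noteq> 0 \<longrightarrow> 0 < met c x v v)"
proof -
  obtain U \<phi> where c: "c = (U, \<phi>)" by (cases c)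
  have "(U, \<phi>) \<in> atlas M" "x \<in> U" using assms unfolding c fst_conv .
  from riemannian_conjs''[THEN conjunct1, THEN bspec, THEN case_prodD, THEN bspec, OF this]
  show ?thesis unfolding c .
qed

lemma met_bilinear: "c \<in> atlas M \<Longrightarrow> x \<in> dom c \<Longrightarrow> bilinear (met c x)"
  and met_pos: "c \<in> atlas M \<Longrightarrow> x \<in> dom c \<Longrightarrow> v \<noteq> 0 \<Longrightarrow> 0 < met c x v v"
  using met_conjs by blast+

lemma met_sym: "c \<in> atlas M \<Longrightarrow> x \<in> dom c \<Longrightarrow> met c x v w = met c x w v"
  using met_conjs by blast

lemma met_cont:
  assumes c: "c \<in> atlas M"
  shows "continuous_on (dom c) (\<lambda>x. met c x v w)"
proof -
  have "smooth_on (\<lambda>y. met c (par c y) v w) (crd c ` dom c)"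
  proof -
    obtain U \<phi> where c': "c = (U, \<phi>)" by (cases c)
    have "(U, \<phi>) \<in> atlas M" using c unfolding c' .
    from riemannian_conjs''[THEN conjunct2, THEN conjunct1, THEN bspec, THEN case_prodD, OF this]
    show ?thesis unfolding c' fst_conv snd_conv by (elim allE)
  qed
  then have "Ck_on 0 (\<lambda>y. met c (par c y) v w) (crd c ` dom c)" unfolding smooth_on_def by blast
  then have "continuous_on (dom c) (\<lambda>x. met c (par c (crd c x)) v w)"
    using continuous_on_compose[OF chart_cont[OF c]] by (simp add: comp_def)
  then show ?thesis by (rule continuous_on_eq) (simp add: c)
qed

lemma met_transit:
  assumes "c \<in> atlas M" "c' \<in> atlas M" "x \<in> dom c" "x \<in> dom c'"
  shows "met c x v w = met c' x (transit c c' x v) (transit c c' x w)"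
proof -
  obtain U \<phi> V \<psi> where c: "c = (U, \<phi>)" "c' = (V, \<psi>)" by (cases c, cases c')
  have a: "(U, \<phi>) \<in> atlas M" "(V, \<psi>) \<in> atlas M" using assms(1,2) unfolding c .
  have x: "x \<in> U \<inter> V" using assms(3,4) unfolding c by simp
  from riemannian_conjs''[THEN conjunct2, THEN conjunct2, THEN bspec, THEN case_prodD, THEN bspec,
      THEN case_prodD, THEN bspec, OF a x, THEN spec, THEN spec, of v w]
  show ?thesis unfolding c transit_def dcoeff_def fst_conv snd_conv .
qed

lemma met_nonneg: "c \<in> atlas M \<Longrightarrow> x \<in> dom c \<Longrightarrow> 0 \<le> met c x v v"
  using met_pos[of c x v] bilinear_lzero[OF met_bilinear, of c x v] by (cases "v = 0") auto

definition gnorm :: "('m, 'e) chart \<Rightarrow> 'm \<Rightarrow> 'e \<Rightarrow> real" where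
  "gnorm c x v = sqrt (met c x v v)"

lemma gnorm_nonneg: "c \<in> atlas M \<Longrightarrow> x \<in> dom c \<Longrightarrow> 0 \<le> gnorm c x v"
  by (simp add: gnorm_def met_nonneg)

lemma gnorm_sq: "c \<in> atlas M \<Longrightarrow> x \<in> dom c \<Longrightarrow> (gnorm c x v)\<^sup>2 = met c x v v"
  by (simp add: gnorm_def met_nonneg)

lemma gnorm_transit:
  "c \<in> atlas M \<Longrightarrow> c' \<in> atlas M \<Longrightarrow> x \<in> dom c \<Longrightarrow> x \<in> dom c' \<Longrightarrow>
    gnorm c' x (transit c c' x v) = gnorm c x v"
  unfolding gnorm_def by (simp only: met_transit[of c c' x])

text \<open>The expansion of every vector is part of the notion, so that no dimension count is
  required to know that the frame spans.\<close>

definition orthonormal_frame :: "('e \<Rightarrow> 'e \<Rightarrow> real) \<Rightarrow> ('e \<Rightarrow> 'e) \<Rightarrow> bool" where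
  "orthonormal_frame g F \<longleftrightarrow>
    (\<forall>b\<in>axes M. \<forall>d\<in>axes M. g (F b) (F d) = (if b = d then 1 else 0)) \<and>
    (\<forall>v. v = (\<Sum>b\<in>axes M. g v (F b) *\<^sub>R F b))"

section \<open>Gram-Schmidt frames and the inverse of the metric matrix\<close>

lemma inner_span_axes:
  assumes "B \<subseteq> axes M" "b \<in> axes M" "b \<notin> B" "w \<in> span B"
  shows "w \<bullet> b = 0"
  using assms(4)
proof (induction rule: span_induct_alt)
  case (step c d y)
  then have "d \<bullet> b = 0" using assms by (subst inner_axes) auto
  then show ?case using step by (simp add: inner_add_left)
qed simp

text \<open>The induction runs over subsets of the axes and carries the expansion of all of
  \<open>span B\<close>. For \<open>B = axes M\<close> this is precisely an orthonormal
  frame.\<close>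

lemma gram_schmidt:
  assumes bl: "bilinear g" and sym: "\<And>v w. g v w = g w v" and pos: "\<And>v. v \<noteq> 0 \<Longrightarrow> 0 < g v v"
    and B: "B \<subseteq> axes M"
  shows "\<exists>F. (\<forall>b\<in>B. F b \<in> span B) \<and> (\<forall>b\<in>B. \<forall>d\<in>B. g (F b) (F d) = (if b = d then 1 else 0)) \<and>
    (\<forall>v\<in>span B. v = (\<Sum>b\<in>B. g v (F b) *\<^sub>R F b))"
  using finite_subset[OF B finite_axes] B
proof (induction B rule: finite_induct)
  case empty
  then show ?case by simp
next
  case (insert b B)
  have lin: "linear (\<lambda>v. g v w)" for w using bl by (simp add: bilinear_def)
  from insert obtain F where F: "\<And>b. b \<in> B \<Longrightarrow> F b \<in> span B"
    "\<And>b d. b \<in> B \<Longrightarrow> d \<in> B \<Longrightarrow> g (F b) (F d) = (if b = d then 1 else 0)"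
    "\<And>v. v \<in> span B \<Longrightarrow> v = (\<Sum>b\<in>B. g v (F b) *\<^sub>R F b)" by blast
  define w where "w = (\<Sum>d\<in>B. g b (F d) *\<^sub>R F d)"
  define u where "u = b - w"
  have w: "w \<in> span B" unfolding w_def by (intro span_sum span_scale F)
  \<comment> \<open>Independence of the axes comes from their Euclidean orthonormality, not from
    \<open>g\<close>.\<close>
  have u0: "u \<noteq> 0"
  proof
    assume "u = 0"
    then have "b \<in> span B" using w by (simp add: u_def)
    then have "b \<bullet> b = 0" using inner_span_axes[of B b b] insert by simp
    then show False using insert norm_axes[of b] by auto
  qed
  define n where "n = sqrt (g u u)"
  have n: "n > 0" "n * n = g u u" using pos[OF u0] by (auto simp: n_def)
  have guF: "g u (F d) = 0" if "d \<in> B" for d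
  proof -
    have "g w (F d) = (\<Sum>d'\<in>B. g b (F d') * g (F d') (F d))"
      unfolding w_def by (simp add: linear_sum[OF lin] linear_cmul[OF lin])
    also have "\<dots> = (\<Sum>d'\<in>B. if d' = d then g b (F d') else 0)"
      using that by (intro sum.cong) (auto simp: F(2))
    also have "\<dots> = g b (F d)" using that insert.hyps by simp
    finally show ?thesis by (simp add: u_def linear_diff[OF lin])
  qed
  have gvu: "g v u = 0" if "v \<in> span B" for v
  proof -
    have "g v u = (\<Sum>d\<in>B. g v (F d) * g (F d) u)"
      by (subst F(3)[OF that]) (simp add: linear_sum[OF lin] linear_cmul[OF lin])
    also have "\<dots> = 0" using guF sym[of _ u] by (intro sum.neutral) auto
    finally show ?thesis .
  qed
  define F' where "F' = F(b := u /\<^sub>R n)"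
  have F'b: "F' b = u /\<^sub>R n" and F'd: "d \<in> B \<Longrightarrow> F' d = F d" for d
    using insert.hyps by (auto simp: F'_def)
  have sp: "span B \<subseteq> span (insert b B)" by (intro span_mono) auto
  have bs: "b \<in> span (insert b B)" by (simp add: span_base)
  have us: "u \<in> span (insert b B)" unfolding u_def using w sp bs by (intro span_diff) auto
  have 1: "\<forall>d\<in>insert b B. F' d \<in> span (insert b B)"
  proof
    fix d assume "d \<in> insert b B"
    then consider "d = b" | "d \<in> B" by blast
    then show "F' d \<in> span (insert b B)"
    proof cases
      case 1 then show ?thesis using us by (simp add: F'b span_scale)
    next
      case 2 then show ?thesis using F(1) sp by (auto simp: F'd)
    qed
  qed
  have uu: "g (u /\<^sub>R n) v = g u v / n" for v
    by (simp add: linear_cmul[OF lin] divide_inverse mult.commute)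
  have vu: "g v (u /\<^sub>R n) = g v u / n" for v
    using uu[of v] by (simp add: sym[of v])
  have 2: "\<forall>d\<in>insert b B. \<forall>d'\<in>insert b B. g (F' d) (F' d') = (if d = d' then 1 else 0)"
  proof (intro ballI)
    fix d d' assume "d \<in> insert b B" "d' \<in> insert b B"
    then consider "d = b" "d' = b" | "d = b" "d' \<in> B" | "d \<in> B" "d' = b" | "d \<in> B" "d' \<in> B" by blast
    then show "g (F' d) (F' d') = (if d = d' then 1 else 0)"
    proof cases
      case 1
      then show ?thesis using n by (simp add: F'b uu vu) (metis less_irrefl nonzero_divide_eq_eq divide_divide_eq_left divide_self mult_eq_0_iff)
    next
      case 2
      then show ?thesis using insert.hyps by (auto simp: F'b F'd uu guF)
    next
      case 3
      then show ?thesis using insert.hyps guF sym[of _ u] by (auto simp: F'b F'd vu)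
    next
      case 4
      then show ?thesis by (simp add: F'd F(2))
    qed
  qed
  have ins: "(\<Sum>d\<in>insert b B. g v (F' d) *\<^sub>R F' d) = (g v u / g u u) *\<^sub>R u + (\<Sum>d\<in>B. g v (F d) *\<^sub>R F d)" for v
  proof -
    have "(\<Sum>d\<in>B. g v (F' d) *\<^sub>R F' d) = (\<Sum>d\<in>B. g v (F d) *\<^sub>R F d)"
      by (intro sum.cong) (simp_all add: F'd)
    then show ?thesis
      using insert.hyps n by (simp add: F'b vu) (simp add: divide_inverse n(2)[symmetric])
  qed
  have 3: "v = (\<Sum>d\<in>insert b B. g v (F' d) *\<^sub>R F' d)" if "v \<in> span (insert b B)" for v
    unfolding ins
  proof -
    \<comment> \<open>Since \<open>b = u + w\<close>, replacing \<open>b\<close> by \<open>u\<close>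
      changes the remainder only by a multiple of \<open>w\<close>, which stays in
      \<open>span B\<close>. The new decomposition is orthogonal for \<open>g\<close>.\<close>
    from that obtain k where k: "v - k *\<^sub>R b \<in> span B" unfolding span_breakdown_eq ..
    define y where "y = v - k *\<^sub>R b + k *\<^sub>R w"
    have y: "y \<in> span B" unfolding y_def using k w by (intro span_add span_scale)
    have v: "v = k *\<^sub>R u + y" by (simp add: y_def u_def scaleR_diff_right)
    have "g v u = k * g u u"
      by (simp add: v linear_add[OF lin] linear_cmul[OF lin] gvu[OF y])
    moreover have "(\<Sum>d\<in>B. g v (F d) *\<^sub>R F d) = (\<Sum>d\<in>B. g y (F d) *\<^sub>R F d)"
      by (intro sum.cong) (simp_all add: v linear_add[OF lin] linear_cmul[OF lin] guF)
    ultimately show "v = (g v u / g u u) *\<^sub>R u + (\<Sum>d\<in>B. g v (F d) *\<^sub>R F d)"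
      using F(3)[OF y] pos[OF u0] v by simp
  qed
  show ?case using 1 2 3 by blast
qed

lemma ex_orthonormal_frame:
  assumes "c \<in> atlas M" "x \<in> dom c"
  shows "\<exists>F. orthonormal_frame (met c x) F"
  using gram_schmidt[OF met_bilinear[OF assms] met_sym[OF assms] met_pos[OF assms], of "axes M"]
  unfolding orthonormal_frame_def span_axes by blast

lemma frame_parseval:
  assumes F: "orthonormal_frame g F" and bl: "bilinear g"
  shows "g v v = (\<Sum>b\<in>axes M. (g v (F b))\<^sup>2)"
proof -
  have lin: "linear (\<lambda>w. g v w)" using bl by (simp add: bilinear_def)
  have "g v v = g v (\<Sum>b\<in>axes M. g v (F b) *\<^sub>R F b)" using F by (simp add: orthonormal_frame_def)
  also have "\<dots> = (\<Sum>b\<in>axes M. (g v (F b))\<^sup>2)"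
    by (simp add: linear_sum[OF lin] linear_cmul[OF lin] power2_eq_square)
  finally show ?thesis .
qed

text \<open>If F is the matrix whose columns are the frame vectors and G that of \<open>g\<close>,
  orthonormality reads F^T G F = 1, so the inverse of G is F F^T. The definite description asks for
  a left inverse; by symmetry F F^T is also a right inverse, and this yields uniqueness.\<close>

lemma matrix_inverse_frame:
  assumes F: "orthonormal_frame g F" and bl: "bilinear g" and sym: "\<And>v w. g v w = g w v"
    and b: "b \<in> axes M" "d \<in> axes M"
  shows "matrix_inverse_on (axes M) g b d = (\<Sum>k\<in>axes M. (F k \<bullet> b) * (F k \<bullet> d))"
proof -
  define h where "h b d = (if b \<in> axes M \<and> d \<in> axes M then \<Sum>k\<in>axes M. (F k \<bullet> b) * (F k \<bullet> d) else 0)" for b d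
  have linl: "linear (\<lambda>v. g v w)" for w using bl by (simp add: bilinear_def)
  have hl: "(\<Sum>k\<in>axes M. h b k * g k d) = (if b = d then 1 else 0)" if "b \<in> axes M" "d \<in> axes M" for b d
  proof -
    have "(\<Sum>k\<in>axes M. h b k * g k d) = (\<Sum>k\<in>axes M. \<Sum>j\<in>axes M. (F j \<bullet> b) * ((F j \<bullet> k) * g k d))"
      using that by (intro sum.cong refl) (simp add: h_def sum_distrib_right mult.assoc)
    also have "\<dots> = (\<Sum>j\<in>axes M. (F j \<bullet> b) * (\<Sum>k\<in>axes M. (F j \<bullet> k) * g k d))"
      by (subst sum.swap) (simp add: sum_distrib_left)
    also have "\<dots> = (\<Sum>j\<in>axes M. (F j \<bullet> b) * g (F j) d)"
    proof -
      have "g (F j) d = (\<Sum>k\<in>axes M. (F j \<bullet> k) * g k d)" for j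
        using linear_expansion[of "\<lambda>v. g v d" "F j"] linl by simp
      then show ?thesis by (simp only:)
    qed
    also have "\<dots> = (\<Sum>j\<in>axes M. g d (F j) *\<^sub>R F j) \<bullet> b"
      by (simp add: inner_sum_left sym[of d] mult.commute)
    also have "(\<Sum>j\<in>axes M. g d (F j) *\<^sub>R F j) = d" using F by (simp add: orthonormal_frame_def)
    finally show ?thesis using that by (simp add: inner_axes)
  qed
  have hsym: "h b d = h d b" for b d by (simp add: h_def mult.commute)
  have hr: "(\<Sum>k\<in>axes M. g b k * h k d) = (if b = d then 1 else 0)" if "b \<in> axes M" "d \<in> axes M" for b d
  proof -
    have "(\<Sum>k\<in>axes M. g b k * h k d) = (\<Sum>k\<in>axes M. h d k * g k b)"
      by (intro sum.cong refl) (metis hsym sym mult.commute)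
    then show ?thesis using hl[OF that(2,1)] by auto
  qed
  have "matrix_inverse_on (axes M) g = h"
    unfolding matrix_inverse_on_def
  proof (rule the_equality)
    show "(\<forall>b\<in>axes M. \<forall>d\<in>axes M. (\<Sum>k\<in>axes M. h b k * g k d) = (if b = d then 1 else 0)) \<and>
      (\<forall>b d. b \<notin> axes M \<or> d \<notin> axes M \<longrightarrow> h b d = 0)"
      using hl by (auto simp: h_def)
    fix h' assume h': "(\<forall>b\<in>axes M. \<forall>d\<in>axes M. (\<Sum>k\<in>axes M. h' b k * g k d) = (if b = d then 1 else 0)) \<and>
      (\<forall>b d. b \<notin> axes M \<or> d \<notin> axes M \<longrightarrow> h' b d = 0)"
    show "h' = h"
    proof (intro ext)
      fix b d
      show "h' b d = h b d"
      proof (cases "b \<in> axes M \<and> d \<in> axes M")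
        case True
        \<comment> \<open>The chain is h' = h' (G h) = (h' G) h = h.\<close>
        have "h' b d = (\<Sum>k\<in>axes M. if k = d then h' b k else 0)" using True by simp
        also have "\<dots> = (\<Sum>k\<in>axes M. h' b k * (if k = d then 1 else 0))" by (intro sum.cong) auto
        also have "\<dots> = (\<Sum>k\<in>axes M. h' b k * (\<Sum>m\<in>axes M. g k m * h m d))"
          using True hr by (intro sum.cong) auto
        also have "\<dots> = (\<Sum>m\<in>axes M. (\<Sum>k\<in>axes M. h' b k * g k m) * h m d)"
          by (subst sum_distrib_left, subst sum.swap) (simp add: sum_distrib_right mult.assoc)
        also have "\<dots> = (\<Sum>m\<in>axes M. (if b = m then 1 else 0) * h m d)"
          using True h' by (intro sum.cong) auto
        also have "\<dots> = (\<Sum>m\<in>axes M. if b = m then h m d else 0)" by (intro sum.cong) auto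
        also have "\<dots> = h b d" using True by simp
        finally show ?thesis .
      next
        case False
        then show ?thesis using h' by (auto simp: h_def)
      qed
    qed
  qed
  then show ?thesis using b by (simp add: h_def)
qed

section \<open>Jets along a chosen orthonormal frame\<close>

definition frame :: "'m \<Rightarrow> 'e \<Rightarrow> 'e" where
  "frame x = (SOME F. orthonormal_frame (met (chart_at M x) x) F)"

lemma frame: "orthonormal_frame (met (chart_at M x) x) (frame x)"
  unfolding frame_def by (rule someI_ex[OF ex_orthonormal_frame[OF chart_at]])

text \<open>Inserting F F^T for the inverse metric diagonalises the double sum. Linearity is what
  allows the coefficient families on the axes to be evaluated at frame vectors.\<close>

lemma cotangent_inner_frame:
  fixes \<omega> \<eta> :: "'e \<Rightarrow> 'h::complex_hilbert"
  assumes "linear \<omega>" "linear \<eta>"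
  shows "cotangent_inner M x \<omega> \<eta> = (\<Sum>k\<in>axes M. cinner (\<omega> (frame x k)) (\<eta> (frame x k)))"
proof -
  have inv: "matrix_inverse_on (axes M) (met (chart_at M x) x) b d = (\<Sum>k\<in>axes M. (frame x k \<bullet> b) * (frame x k \<bullet> d))"
    if "b \<in> axes M" "d \<in> axes M" for b d
    by (rule matrix_inverse_frame[OF frame met_bilinear[OF chart_at] met_sym[OF chart_at] that])
  have "cotangent_inner M x \<omega> \<eta> = (\<Sum>b\<in>axes M. \<Sum>d\<in>axes M. \<Sum>k\<in>axes M.
      (frame x k \<bullet> b) *\<^sub>R (frame x k \<bullet> d) *\<^sub>R cinner (\<omega> b) (\<eta> d))"
    unfolding cotangent_inner_def
    by (intro sum.cong refl) (simp add: inv sum_distrib_right scaleR_conv_of_real mult.assoc)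
  also have "\<dots> = (\<Sum>b\<in>axes M. \<Sum>k\<in>axes M. \<Sum>d\<in>axes M.
      (frame x k \<bullet> b) *\<^sub>R (frame x k \<bullet> d) *\<^sub>R cinner (\<omega> b) (\<eta> d))"
    by (intro sum.cong refl sum.swap)
  also have "\<dots> = (\<Sum>k\<in>axes M. \<Sum>b\<in>axes M. \<Sum>d\<in>axes M.
      (frame x k \<bullet> b) *\<^sub>R (frame x k \<bullet> d) *\<^sub>R cinner (\<omega> b) (\<eta> d))"
    by (rule sum.swap)
  also have "\<dots> = (\<Sum>k\<in>axes M. cinner (\<omega> (frame x k)) (\<eta> (frame x k)))"
  proof (intro sum.cong refl)
    fix k
    show "(\<Sum>b\<in>axes M. \<Sum>d\<in>axes M. (frame x k \<bullet> b) *\<^sub>R (frame x k \<bullet> d) *\<^sub>R cinner (\<omega> b) (\<eta> d))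
        = cinner (\<omega> (frame x k)) (\<eta> (frame x k))"
      unfolding linear_expansion[OF assms(1), of "frame x k"] linear_expansion[OF assms(2), of "frame x k"]
      unfolding cinner_sum_left unfolding cinner_sum_right cinner_scaleR_left cinner_scaleR_right
      by (simp only: scaleR_sum_right scaleR_left_commute)
  qed
  finally show ?thesis .
qed

text \<open>The value of the section and its derivatives along an orthonormal frame, so that
  \<^const>\<open>jet_inner\<close> becomes an ordinary direct sum inner product.\<close>

definition jet :: "('m \<Rightarrow> 'h::real_normed_vector) \<Rightarrow> 'm \<Rightarrow> 'e option \<Rightarrow> 'h" where
  "jet s x i = (case i of None \<Rightarrow> s x | Some b \<Rightarrow> deriv_at M s x (frame x b))"

definition jets :: "'e option set" where "jets = insert None (Some ` axes M)"

definition diffble :: "('m \<Rightarrow> 'h::real_normed_vector) \<Rightarrow> 'm \<Rightarrow> bool" where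
  "diffble s x \<longleftrightarrow> diff_at_chart (chart_at M x) s x"

text \<open>This is \<open>cotangent_norm\<close> of the differential when the values lie in a
  Hilbert space. Being defined for all normed spaces, it also measures the real-valued functions
  used for cut-offs and for the distance.\<close>

definition dnorm :: "('m \<Rightarrow> 'h::real_normed_vector) \<Rightarrow> 'm \<Rightarrow> real" where
  "dnorm s x = L2_set (\<lambda>b. norm (jet s x (Some b))) (axes M)"

definition jnorm :: "('m \<Rightarrow> 'h::real_normed_vector) \<Rightarrow> 'm \<Rightarrow> real" where
  "jnorm s x = L2_set (\<lambda>i. norm (jet s x i)) jets"

lemma finite_jets [simp, intro]: "finite jets" by (simp add: jets_def)

lemma sum_jets: "(\<Sum>i\<in>jets. f i) = f None + (\<Sum>b\<in>axes M. f (Some b))"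
  unfolding jets_def by (simp add: sum.reindex)

lemma diffble_chart: "c \<in> atlas M \<Longrightarrow> x \<in> dom c \<Longrightarrow> diff_at_chart c s x \<longleftrightarrow> diffble s x"
  unfolding diffble_def using dcoeff_change_chart(1) chart_at by blast

lemma linear_dcoeff_diffble: "c \<in> atlas M \<Longrightarrow> x \<in> dom c \<Longrightarrow> diffble s x \<Longrightarrow> linear (dcoeff c s x)"
  by (simp add: linear_dcoeff diffble_chart)

lemma C1_in_diffble: "C1_in W s \<Longrightarrow> x \<in> W \<Longrightarrow> diffble s x"
  unfolding diffble_def using C1_inD(1) chart_at by blast

lemma linear_deriv_at: "diffble s x \<Longrightarrow> linear (deriv_at M s x)"
  unfolding diffble_def deriv_at_def by (rule linear_dcoeff)

lemma dnorm_nonneg: "0 \<le> dnorm s x" and jnorm_nonneg: "0 \<le> jnorm s x"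
  by (simp_all add: dnorm_def jnorm_def)

lemma cotangent_norm_eq:
  "diffble s x \<Longrightarrow> cotangent_norm M x (deriv_at M s x) = dnorm (s :: 'm \<Rightarrow> 'h::complex_hilbert) x"
  unfolding cotangent_norm_def dnorm_def L2_set_def jet_def
  by (simp add: cotangent_inner_frame linear_deriv_at cinner_self)

lemma jet_inner_eq:
  "diffble s x \<Longrightarrow> diffble t x \<Longrightarrow>
    jet_inner M s t x = (\<Sum>i\<in>jets. cinner (jet s x i) (jet (t :: 'm \<Rightarrow> 'h::complex_hilbert) x i))"
  unfolding jet_inner_def sum_jets by (simp add: cotangent_inner_frame linear_deriv_at jet_def)

lemma jnorm_sq: "(jnorm s x)\<^sup>2 = (norm (s x))\<^sup>2 + (dnorm s x)\<^sup>2"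
  by (simp add: jnorm_def dnorm_def L2_set_def sum_nonneg sum_jets jet_def)

lemma jnorm_sq_sum: "(jnorm s x)\<^sup>2 = (\<Sum>i\<in>jets. (norm (jet s x i))\<^sup>2)"
  by (simp add: jnorm_def L2_set_def sum_nonneg)

lemma norm_le_jnorm: "norm (s x) \<le> jnorm s x" and dnorm_le_jnorm: "dnorm s x \<le> jnorm s x"
  and jnorm_le: "jnorm s x \<le> norm (s x) + dnorm s x"
proof -
  show "norm (s x) \<le> jnorm s x" "dnorm s x \<le> jnorm s x"
    by (rule power2_le_imp_le, simp add: jnorm_sq, rule jnorm_nonneg)+
  have "(jnorm s x)\<^sup>2 \<le> (norm (s x) + dnorm s x)\<^sup>2"
    using dnorm_nonneg[of s x] by (simp add: jnorm_sq power2_sum)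
  then show "jnorm s x \<le> norm (s x) + dnorm s x"
    by (rule power2_le_imp_le) (simp add: dnorm_nonneg)
qed

text \<open>The frame chosen in \<open>chart_at M x\<close>, carried to the chart \<open>c\<close>:
  jets can be computed in any chart and still refer to the same frame.\<close>

definition cframe :: "('m, 'e) chart \<Rightarrow> 'm \<Rightarrow> 'e \<Rightarrow> 'e" where
  "cframe c x b = transit (chart_at M x) c x (frame x b)"

lemma transit_inverse:
  assumes "c \<in> atlas M" "c' \<in> atlas M" "x \<in> dom c" "x \<in> dom c'"
  shows "transit c' c x (transit c c' x v) = v"
proof -
  have "diff_at_chart c' (crd c) x"
    using transit_deriv[OF assms(2,1,4,3)] by (rule diff_at_chartI)
  from dcoeff_change_chart(2)[OF assms(2,1,4,3) this] show ?thesis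
    using crd_dcoeff[OF assms(1,3)] by (simp add: transit_def)
qed

lemma cframe_orthonormal:
  assumes c: "c \<in> atlas M" "x \<in> dom c"
  shows "orthonormal_frame (met c x) (cframe c x)"
  unfolding orthonormal_frame_def
proof (intro conjI ballI allI)
  note tr = chart_at(1)[of x] c(1) chart_at(2)[of x] c(2)
  fix b d assume "b \<in> axes M" "d \<in> axes M"
  then show "met c x (cframe c x b) (cframe c x d) = (if b = d then 1 else 0)"
    using frame[of x] unfolding cframe_def met_transit[OF tr, symmetric] orthonormal_frame_def by blast
next
  let ?a = "chart_at M x"
  note tr = chart_at(1)[of x] c(1) chart_at(2)[of x] c(2)
  note tr' = c(1) chart_at(1)[of x] c(2) chart_at(2)[of x]
  fix v
  let ?T = "transit ?a c x" and ?T' = "transit c ?a x"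
  have lin: "linear ?T" using transit_deriv[OF tr] has_derivative_linear by blast
  have TT': "?T (?T' v) = v" by (rule transit_inverse[OF tr'])
  have "?T' v = (\<Sum>b\<in>axes M. met ?a x (?T' v) (frame x b) *\<^sub>R frame x b)"
    using frame[of x] unfolding orthonormal_frame_def by blast
  then have "?T (?T' v) = (\<Sum>b\<in>axes M. met ?a x (?T' v) (frame x b) *\<^sub>R ?T (frame x b))"
    by (metis (no_types, lifting) linear_sum[OF lin] linear_cmul[OF lin] sum.cong)
  then show "v = (\<Sum>b\<in>axes M. met c x v (cframe c x b) *\<^sub>R cframe c x b)"
    unfolding met_transit[OF tr] TT' cframe_def .
qed

lemma jet_chart:
  assumes c: "c \<in> atlas M" "x \<in> dom c" and s: "diffble s x"
  shows "jet s x (Some b) = dcoeff c s x (cframe c x b)"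
proof -
  have "diff_at_chart c s x" using s diffble_chart[OF c] by blast
  from dcoeff_change_chart(2)[OF c(1) chart_at(1) c(2) chart_at(2) this]
  show ?thesis by (simp add: jet_def deriv_at_def cframe_def)
qed

text \<open>Cauchy-Schwarz for the coordinates of \<open>v\<close> along the frame, whose sum of
  squares is \<open>(gnorm c x v)\<^sup>2\<close> by Parseval.\<close>

lemma dcoeff_le_dnorm:
  assumes c: "c \<in> atlas M" "x \<in> dom c" and s: "diffble s x"
  shows "norm (dcoeff c s x v) \<le> gnorm c x v * dnorm s x"
proof -
  let ?F = "cframe c x"
  have lin: "linear (dcoeff c s x)" by (rule linear_dcoeff_diffble[OF c s])
  have F: "orthonormal_frame (met c x) ?F" by (rule cframe_orthonormal[OF c])
  then have "dcoeff c s x v = dcoeff c s x (\<Sum>b\<in>axes M. met c x v (?F b) *\<^sub>R ?F b)"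
    by (simp add: orthonormal_frame_def)
  also have "\<dots> = (\<Sum>b\<in>axes M. met c x v (?F b) *\<^sub>R dcoeff c s x (?F b))"
    by (simp add: linear_sum[OF lin] linear_cmul[OF lin])
  also have "norm \<dots> \<le> (\<Sum>b\<in>axes M. \<bar>met c x v (?F b)\<bar> * norm (dcoeff c s x (?F b)))"
    by (rule order_trans[OF norm_sum]) simp
  also have "\<dots> = (\<Sum>b\<in>axes M. \<bar>met c x v (?F b)\<bar> * \<bar>norm (jet s x (Some b))\<bar>)"
    by (simp add: jet_chart[OF c s])
  also have "\<dots> \<le> L2_set (\<lambda>b. met c x v (?F b)) (axes M) * dnorm s x"
    unfolding dnorm_def by (rule L2_set_mult_ineq)
  also have "L2_set (\<lambda>b. met c x v (?F b)) (axes M) = gnorm c x v"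
    by (simp add: L2_set_def gnorm_def frame_parseval[OF F met_bilinear[OF c], of v])
  finally show ?thesis .
qed

lemma gnorm_cframe: "c \<in> atlas M \<Longrightarrow> x \<in> dom c \<Longrightarrow> b \<in> axes M \<Longrightarrow> gnorm c x (cframe c x b) = 1"
  using cframe_orthonormal[of c x] unfolding gnorm_def orthonormal_frame_def by simp

text \<open>The hypothesis is tested at \<open>w\<close>, the gradient of \<open>f\<close> at
  \<open>x\<close>: there the differential takes the value \<open>(dnorm f x)\<^sup>2\<close>, and
  \<open>gnorm c x w = dnorm f x\<close>.\<close>

lemma dnorm_le_of_dcoeff:
  fixes f :: "'m \<Rightarrow> real"
  assumes c: "c \<in> atlas M" "x \<in> dom c" and f: "diffble f x"
    and bd: "\<And>v. \<bar>dcoeff c f x v\<bar> \<le> A * gnorm c x v" and "0 \<le> A"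
  shows "dnorm f x \<le> A"
proof -
  let ?F = "cframe c x"
  let ?l = "dcoeff c f x"
  define w where "w = (\<Sum>b\<in>axes M. ?l (?F b) *\<^sub>R ?F b)"
  have lin: "linear ?l" by (rule linear_dcoeff_diffble[OF c f])
  have F: "orthonormal_frame (met c x) ?F" by (rule cframe_orthonormal[OF c])
  have bl: "bilinear (met c x)" by (rule met_bilinear[OF c])
  then have linl: "linear (\<lambda>v. met c x v u)" for u by (simp add: bilinear_def)
  have dn: "(dnorm f x)\<^sup>2 = (\<Sum>b\<in>axes M. (?l (?F b))\<^sup>2)"
    by (simp add: dnorm_def L2_set_def sum_nonneg jet_chart[OF c f])
  have "?l w = (dnorm f x)\<^sup>2"
    unfolding w_def dn by (simp add: linear_sum[OF lin] linear_cmul[OF lin] power2_eq_square)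
  moreover have "met c x w (?F b) = ?l (?F b)" if "b \<in> axes M" for b
  proof -
    have "met c x w (?F b) = (\<Sum>d\<in>axes M. ?l (?F d) * met c x (?F d) (?F b))"
      unfolding w_def by (simp add: linear_sum[OF linl] linear_cmul[OF linl])
    also have "\<dots> = (\<Sum>d\<in>axes M. if d = b then ?l (?F d) else 0)"
      using F that by (intro sum.cong) (auto simp: orthonormal_frame_def)
    finally show ?thesis using that by simp
  qed
  then have "met c x w w = (dnorm f x)\<^sup>2"
    unfolding dn by (subst frame_parseval[OF F bl]) (intro sum.cong refl, simp)
  then have "gnorm c x w = dnorm f x" by (simp add: gnorm_def dnorm_nonneg)
  ultimately have "dnorm f x * dnorm f x \<le> A * dnorm f x"
    using bd[of w] by (simp add: power2_eq_square)
  then show ?thesis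
    using dnorm_nonneg[of f x] \<open>0 \<le> A\<close> by (cases "dnorm f x = 0") (auto simp: mult_le_cancel_right)
qed

lemma dnorm_of_real:
  fixes f :: "'m \<Rightarrow> real"
  assumes f: "diffble f x"
  shows "diffble (\<lambda>x. complex_of_real (f x)) x" "dnorm (\<lambda>x. complex_of_real (f x)) x = dnorm f x"
proof -
  note d = f[unfolded diffble_def]
  show "diffble (\<lambda>x. complex_of_real (f x)) x"
    unfolding diffble_def by (rule has_derivative_dcoeff_linear(1)[OF bounded_linear_of_real d])
  show "dnorm (\<lambda>x. complex_of_real (f x)) x = dnorm f x"
    by (simp add: dnorm_def jet_def deriv_at_def has_derivative_dcoeff_linear(2)[OF bounded_linear_of_real d])
qed

subsection \<open>Local comparison of the metric\<close>

lemma gnorm_euclid: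
  assumes c: "c \<in> atlas M" "x \<in> dom c"
  obtains A where "A > 0" "\<And>v. norm v \<le> A * gnorm c x v" "\<And>v. gnorm c x v \<le> A * norm v"
proof -
  let ?F = "cframe c x"
  have F: "orthonormal_frame (met c x) ?F" by (rule cframe_orthonormal[OF c])
  have bl: "bilinear (met c x)" by (rule met_bilinear[OF c])
  define A where "A = 1 + (\<Sum>b\<in>axes M. norm (?F b))"
  have 1: "norm v \<le> A * gnorm c x v" for v
  proof -
    have le: "\<bar>met c x v (?F b)\<bar> \<le> gnorm c x v" if "b \<in> axes M" for b
    proof -
      have "(met c x v (?F b))\<^sup>2 \<le> (\<Sum>b\<in>axes M. (met c x v (?F b))\<^sup>2)"
        using that by (intro member_le_sum) auto
      then show ?thesis unfolding gnorm_def frame_parseval[OF F bl, of v]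
        by (intro real_le_rsqrt) simp
    qed
    have "norm v \<le> (\<Sum>b\<in>axes M. norm (met c x v (?F b) *\<^sub>R ?F b))"
      using F norm_sum unfolding orthonormal_frame_def by metis
    also have "\<dots> \<le> (\<Sum>b\<in>axes M. gnorm c x v * norm (?F b))"
      by (intro sum_mono) (auto intro!: mult_right_mono le)
    also have "\<dots> \<le> A * gnorm c x v"
      unfolding A_def using gnorm_nonneg[OF c, of v] by (simp add: sum_distrib_left[symmetric] algebra_simps)
    finally show ?thesis .
  qed
  define B where "B = (\<Sum>b\<in>axes M. \<bar>\<Sum>d\<in>axes M. \<bar>met c x b d\<bar>\<bar>)"
  have lin: "linear (\<lambda>v. met c x v w)" "linear (\<lambda>v. met c x w v)" for w
    using bl by (simp_all add: bilinear_def)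
  have 2: "gnorm c x v \<le> sqrt B * norm v" for v
  proof -
    have "\<bar>met c x v v\<bar> \<le> (\<Sum>b\<in>axes M. \<bar>met c x b v\<bar>) * norm v"
      using linear_bound[OF lin(1), of v v] by simp
    also have "\<dots> \<le> (\<Sum>b\<in>axes M. (\<Sum>d\<in>axes M. \<bar>met c x b d\<bar>) * norm v) * norm v"
      using linear_bound[OF lin(2), of _ v] by (intro mult_right_mono sum_mono) auto
    also have "\<dots> = B * (norm v)\<^sup>2"
      by (simp add: B_def sum_distrib_right power2_eq_square sum_nonneg mult.assoc)
    finally have "met c x v v \<le> B * (norm v)\<^sup>2" by simp
    then have "gnorm c x v \<le> sqrt (B * (norm v)\<^sup>2)" unfolding gnorm_def by (rule real_sqrt_le_mono)
    then show ?thesis by (simp add: real_sqrt_mult)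
  qed
  have "A \<ge> 1" unfolding A_def by (simp add: sum_nonneg)
  show ?thesis
  proof (rule that[of "A + sqrt B"])
    have B: "0 \<le> sqrt B" by (simp add: B_def sum_nonneg)
    show "A + sqrt B > 0" using \<open>A \<ge> 1\<close> B by linarith
    show "norm v \<le> (A + sqrt B) * gnorm c x v" for v
      using 1[of v] mult_nonneg_nonneg[OF B gnorm_nonneg[OF c, of v]] by (simp add: algebra_simps)
    show "gnorm c x v \<le> (A + sqrt B) * norm v" for v
    proof -
      have "0 \<le> A * norm v" using \<open>A \<ge> 1\<close> by simp
      then show ?thesis using 2[of v] by (simp only: distrib_right)
    qed
  qed
qed

lemma gnorm_nearby:
  assumes c: "c \<in> atlas M" "p \<in> dom c"
  obtains W where "open W" "p \<in> W" "W \<subseteq> dom c"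
    "\<And>x v. x \<in> W \<Longrightarrow> gnorm c x v \<le> 2 * gnorm c p v" "\<And>x v. x \<in> W \<Longrightarrow> gnorm c p v \<le> 2 * gnorm c x v"
proof -
  obtain A where A: "A > 0" "\<And>v. norm v \<le> A * gnorm c p v" by (rule gnorm_euclid[OF c]) blast
  define D where "D x = (\<Sum>b\<in>axes M. \<Sum>d\<in>axes M. \<bar>met c x b d - met c p b d\<bar>)" for x
  have "continuous_on (dom c) D"
    unfolding D_def by (intro continuous_intros met_cont c)
  \<comment> \<open>With this threshold the metric at \<open>x\<close> differs from that at
    \<open>p\<close> by at most 3/4 of the latter, in the sense of quadratic forms. The lower factor
    1/4 gives the constant 2 for norms, and 7/4 is below 4 for the other inequality.\<close>
  define W where "W = dom c \<inter> D -` {..<3 / (4 * A\<^sup>2)}"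
  have "open W"
    unfolding W_def
    by (rule continuous_open_preimage[OF \<open>continuous_on (dom c) D\<close> chart_open[OF c(1)] open_lessThan])
  moreover have "p \<in> W" using c A by (simp add: W_def D_def)
  moreover have "W \<subseteq> dom c" by (simp add: W_def)
  moreover have key: "\<bar>met c x v v - met c p v v\<bar> \<le> 3/4 * met c p v v" if "x \<in> W" for x v
  proof -
    have xd: "x \<in> dom c" and Dx: "D x < 3 / (4 * A\<^sup>2)" using that by (auto simp: W_def)
    have lin1: "linear (\<lambda>v. met c x v w - met c p v w)" for w
      using met_bilinear[OF c(1) xd] met_bilinear[OF c] by (intro linear_compose_sub) (simp_all add: bilinear_def)
    have lin2: "linear (\<lambda>v. met c x w v - met c p w v)" for w
      using met_bilinear[OF c(1) xd] met_bilinear[OF c] by (intro linear_compose_sub) (simp_all add: bilinear_def)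
    have "\<bar>met c x v v - met c p v v\<bar> \<le> (\<Sum>b\<in>axes M. \<bar>met c x b v - met c p b v\<bar>) * norm v"
      using linear_bound[OF lin1, of v v] by simp
    also have "\<dots> \<le> (\<Sum>b\<in>axes M. (\<Sum>d\<in>axes M. \<bar>met c x b d - met c p b d\<bar>) * norm v) * norm v"
      using linear_bound[OF lin2, of _ v] by (intro mult_right_mono sum_mono) auto
    also have "\<dots> = D x * (norm v)\<^sup>2"
      by (simp add: D_def sum_distrib_right power2_eq_square mult.assoc)
    also have "\<dots> \<le> 3 / (4 * A\<^sup>2) * (A * gnorm c p v)\<^sup>2"
      using Dx A by (intro mult_mono power_mono) (auto simp: D_def sum_nonneg)
    also have "\<dots> = 3/4 * met c p v v"
      using A gnorm_sq[OF c, of v] by (simp add: power_mult_distrib)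
    finally show ?thesis .
  qed
  moreover have "gnorm c x v \<le> 2 * gnorm c p v" if "x \<in> W" for x v
  proof -
    have "met c x v v \<le> 4 * met c p v v" using key[OF that, of v] met_nonneg[OF c, of v] by linarith
    then have "sqrt (met c x v v) \<le> sqrt (4 * met c p v v)" by (rule real_sqrt_le_mono)
    then show ?thesis by (simp add: gnorm_def real_sqrt_mult)
  qed
  moreover have "gnorm c p v \<le> 2 * gnorm c x v" if "x \<in> W" for x v
  proof -
    have "met c p v v \<le> 4 * met c x v v" using key[OF that, of v] met_nonneg[OF c, of v] by linarith
    then have "sqrt (met c p v v) \<le> sqrt (4 * met c x v v)" by (rule real_sqrt_le_mono)
    then show ?thesis by (simp add: gnorm_def real_sqrt_mult)
  qed
  ultimately show ?thesis using that by blast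
qed

lemma gnorm_euclid_nearby:
  assumes c: "c \<in> atlas M" "p \<in> dom c"
  obtains W A where "open W" "p \<in> W" "W \<subseteq> dom c" "A > 0"
    "\<And>x v. x \<in> W \<Longrightarrow> norm v \<le> A * gnorm c x v" "\<And>x v. x \<in> W \<Longrightarrow> gnorm c x v \<le> A * norm v"
proof -
  obtain A where A: "A > 0" "\<And>v. norm v \<le> A * gnorm c p v" "\<And>v. gnorm c p v \<le> A * norm v"
    using gnorm_euclid[OF c] by blast
  obtain W where W: "open W" "p \<in> W" "W \<subseteq> dom c"
    "\<And>x v. x \<in> W \<Longrightarrow> gnorm c x v \<le> 2 * gnorm c p v" "\<And>x v. x \<in> W \<Longrightarrow> gnorm c p v \<le> 2 * gnorm c x v"
    using gnorm_nearby[OF c] by blast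
  show ?thesis
  proof (rule that[of W "2 * A"])
    show "norm v \<le> 2 * A * gnorm c x v" if "x \<in> W" for x v
      using A(2)[of v] W(5)[OF that, of v] A(1) mult_left_mono[of "gnorm c p v" "2 * gnorm c x v" A] by linarith
    show "gnorm c x v \<le> 2 * A * norm v" if "x \<in> W" for x v
      using A(3)[of v] W(4)[OF that, of v] by simp
  qed (use A W in auto)
qed

text \<open>One constant serves all maps \<open>s\<close> at once. This is what allows uniform
  statements in \<open>jnorm\<close> to be translated into uniform statements on partial derivatives
  near \<open>p\<close>, and back.\<close>

lemma jnorm_local_bound:
  assumes c: "c \<in> atlas M" "p \<in> dom c"
  obtains W A where "open W" "p \<in> W" "W \<subseteq> dom c" "A \<ge> 1"
    "\<And>s x. x \<in> W \<Longrightarrow> diffble s x \<Longrightarrow> jnorm (s :: 'm \<Rightarrow> 'h::real_normed_vector) x \<le> A * (norm (s x) + (\<Sum>b\<in>axes M. norm (dcoeff c s x b)))"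
    "\<And>s x v. x \<in> W \<Longrightarrow> diffble s x \<Longrightarrow> norm (dcoeff c (s :: 'm \<Rightarrow> 'h) x v) \<le> A * norm v * dnorm s x"
proof -
  obtain W A where W: "open W" "p \<in> W" "W \<subseteq> dom c" and A: "A > 0"
    "\<And>x v. x \<in> W \<Longrightarrow> norm v \<le> A * gnorm c x v" "\<And>x v. x \<in> W \<Longrightarrow> gnorm c x v \<le> A * norm v"
    using gnorm_euclid_nearby[OF c] by blast
  define N where "N = real (card (axes M))"
  have jb: "jnorm s x \<le> (1 + A + A * N) * (norm (s x) + (\<Sum>b\<in>axes M. norm (dcoeff c s x b)))"
    if x: "x \<in> W" and s: "diffble s x" for s :: "'m \<Rightarrow> 'h" and x
  proof -
    have xc: "x \<in> dom c" using x W by blast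
    have lin: "linear (dcoeff c s x)" by (rule linear_dcoeff_diffble[OF c(1) xc s])
    let ?S = "\<Sum>b\<in>axes M. norm (dcoeff c s x b)"
    have "dnorm s x \<le> (\<Sum>b\<in>axes M. norm (jet s x (Some b)))"
      unfolding dnorm_def by (rule L2_set_le_sum) simp
    also have "\<dots> \<le> (\<Sum>b\<in>axes M. ?S * A)"
    proof (rule sum_mono)
      fix b assume b: "b \<in> axes M"
      have "norm (jet s x (Some b)) \<le> ?S * norm (cframe c x b)"
        unfolding jet_chart[OF c(1) xc s] by (rule linear_bound[OF lin])
      also have "\<dots> \<le> ?S * A"
        using A(2)[OF x, of "cframe c x b"] gnorm_cframe[OF c(1) xc b]
        by (intro mult_left_mono) (auto simp: sum_nonneg)
      finally show "norm (jet s x (Some b)) \<le> ?S * A" .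
    qed
    also have "\<dots> = A * N * ?S" by (simp add: N_def)
    finally have "jnorm s x \<le> norm (s x) + A * N * ?S" using jnorm_le[of s x] by linarith
    moreover have "0 \<le> ?S" "0 \<le> N" by (auto simp: sum_nonneg N_def)
    moreover have "0 \<le> A * norm (s x)" "0 \<le> A * N * norm (s x)" "0 \<le> A * ?S"
      using A \<open>0 \<le> ?S\<close> \<open>0 \<le> N\<close> by auto
    ultimately show ?thesis by (simp add: algebra_simps)
  qed
  have db: "norm (dcoeff c s x v) \<le> (1 + A + A * N) * norm v * dnorm s x"
    if x: "x \<in> W" and s: "diffble s x" for s :: "'m \<Rightarrow> 'h" and x v
  proof -
    have xc: "x \<in> dom c" using x W by blast
    have "norm (dcoeff c s x v) \<le> gnorm c x v * dnorm s x" by (rule dcoeff_le_dnorm[OF c(1) xc s])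
    also have "\<dots> \<le> (A * norm v) * dnorm s x" by (intro mult_right_mono A x dnorm_nonneg)
    also have "\<dots> \<le> ((1 + A + A * N) * norm v) * dnorm s x"
      using A by (intro mult_right_mono dnorm_nonneg) (auto simp: N_def)
    finally show ?thesis .
  qed
  show ?thesis
    by (rule that[OF W, of "1 + A + A * N"]) (use A jb db in \<open>auto simp: N_def\<close>)
qed

end

section \<open>Matrix norms\<close>

lemma gram_form:
  fixes a :: "'q \<Rightarrow> nat \<Rightarrow> 'h::complex_hilbert"
  shows "(\<Sum>i<n. cnj (w i) * (\<Sum>j<n. (\<Sum>q\<in>Q. cinner (a q i) (a q j)) * v j)) =
    (\<Sum>q\<in>Q. cinner (\<Sum>i<n. w i *\<^sub>C a q i) (\<Sum>j<n. v j *\<^sub>C a q j))"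
proof -
  have "(\<Sum>i<n. cnj (w i) * (\<Sum>j<n. (\<Sum>q\<in>Q. cinner (a q i) (a q j)) * v j)) =
      (\<Sum>i<n. \<Sum>j<n. \<Sum>q\<in>Q. cnj (w i) * (cinner (a q i) (a q j) * v j))"
    by (simp add: sum_distrib_left sum_distrib_right)
  also have "\<dots> = (\<Sum>i<n. \<Sum>q\<in>Q. \<Sum>j<n. cnj (w i) * (cinner (a q i) (a q j) * v j))"
    by (intro sum.cong refl sum.swap)
  also have "\<dots> = (\<Sum>q\<in>Q. \<Sum>i<n. \<Sum>j<n. cnj (w i) * (cinner (a q i) (a q j) * v j))"
    by (rule sum.swap)
  also have "\<dots> = (\<Sum>q\<in>Q. cinner (\<Sum>i<n. w i *\<^sub>C a q i) (\<Sum>j<n. v j *\<^sub>C a q j))"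
    unfolding cinner_sum_left unfolding cinner_sum_right cinner_scaleC_left cinner_scaleC_right
    by (simp only: mult_ac)
  finally show ?thesis .
qed

lemma cmatrix_norm_bdd:
  "bdd_above ((\<lambda>v :: nat \<Rightarrow> complex. sqrt (\<Sum>i<n. (cmod (\<Sum>j<n. A i j * v j))\<^sup>2)) ` {v. (\<Sum>j<n. (cmod (v j))\<^sup>2) \<le> 1})"
proof (rule bdd_aboveI2)
  fix v :: "nat \<Rightarrow> complex" assume v: "v \<in> {v. (\<Sum>j<n. (cmod (v j))\<^sup>2) \<le> 1}"
  have v1: "cmod (v j) \<le> 1" if "j < n" for j
  proof -
    have "(cmod (v j))\<^sup>2 \<le> (\<Sum>j<n. (cmod (v j))\<^sup>2)" using that by (intro member_le_sum) auto
    also have "\<dots> \<le> 1\<^sup>2" using v by simp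
    finally show ?thesis by (rule power2_le_imp_le) simp
  qed
  have "sqrt (\<Sum>i<n. (cmod (\<Sum>j<n. A i j * v j))\<^sup>2) \<le> (\<Sum>i<n. cmod (\<Sum>j<n. A i j * v j))"
    using L2_set_le_sum[of "{..<n}" "\<lambda>i. cmod (\<Sum>j<n. A i j * v j)"] by (simp add: L2_set_def)
  also have "\<dots> \<le> (\<Sum>i<n. \<Sum>j<n. cmod (A i j))"
  proof (rule sum_mono)
    fix i
    have "cmod (\<Sum>j<n. A i j * v j) \<le> (\<Sum>j<n. cmod (A i j * v j))" by (rule norm_sum)
    also have "\<dots> \<le> (\<Sum>j<n. cmod (A i j))"
      by (intro sum_mono) (auto simp: norm_mult intro!: mult_left_le v1)
    finally show "cmod (\<Sum>j<n. A i j * v j) \<le> (\<Sum>j<n. cmod (A i j))" .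
  qed
  finally show "sqrt (\<Sum>i<n. (cmod (\<Sum>j<n. A i j * v j))\<^sup>2) \<le> (\<Sum>i<n. \<Sum>j<n. cmod (A i j))" .
qed

lemma cmatrix_norm_nonneg: "0 \<le> cmatrix_norm n A"
  unfolding cmatrix_norm_def
  by (rule cSUP_upper2[OF cmatrix_norm_bdd, of "\<lambda>_. 0"]) auto

lemma cmatrix_norm_upper:
  assumes "(\<Sum>j<n. (cmod (v j))\<^sup>2) \<le> 1"
  shows "sqrt (\<Sum>i<n. (cmod (\<Sum>j<n. A i j * v j))\<^sup>2) \<le> cmatrix_norm n A"
  unfolding cmatrix_norm_def by (rule cSUP_upper[OF _ cmatrix_norm_bdd]) (use assms in simp)

lemma complex_cauchy_schwarz:
  "cmod (\<Sum>i\<in>I. cnj (w i) * z i) \<le> sqrt (\<Sum>i\<in>I. (cmod (w i))\<^sup>2) * sqrt (\<Sum>i\<in>I. (cmod (z i))\<^sup>2)"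
proof -
  have "cmod (\<Sum>i\<in>I. cnj (w i) * z i) \<le> (\<Sum>i\<in>I. \<bar>cmod (w i)\<bar> * \<bar>cmod (z i)\<bar>)"
    by (rule order_trans[OF norm_sum]) (simp add: norm_mult)
  also have "\<dots> \<le> L2_set (\<lambda>i. cmod (w i)) I * L2_set (\<lambda>i. cmod (z i)) I"
    by (rule L2_set_mult_ineq)
  finally show ?thesis by (simp add: L2_set_def)
qed

lemma le_of_square_le: "x * x \<le> C * x \<Longrightarrow> 0 \<le> x \<Longrightarrow> 0 \<le> C \<Longrightarrow> x \<le> (C::real)"
  by (cases "x = 0") (auto simp: mult_le_cancel_right)

lemma of_real_eq_imp_eq_norm: "complex_of_real r = z \<Longrightarrow> 0 \<le> r \<Longrightarrow> r = cmod z"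
  by auto

text \<open>A Gram matrix is positive, so its norm is the supremum of its quadratic form on unit
  vectors. The comparison with an arbitrary \<open>C\<close> dispenses with the supremum
  altogether.\<close>

lemma cmatrix_norm_gram_le_iff:
  fixes a :: "'q \<Rightarrow> nat \<Rightarrow> 'h::complex_hilbert"
  assumes C: "0 \<le> C"
  shows "cmatrix_norm n (\<lambda>i j. \<Sum>q\<in>Q. cinner (a q i) (a q j)) \<le> C \<longleftrightarrow>
    (\<forall>v. (\<Sum>q\<in>Q. (norm (\<Sum>j<n. v j *\<^sub>C a q j))\<^sup>2) \<le> C * (\<Sum>j<n. (cmod (v j))\<^sup>2))"
    (is "cmatrix_norm n ?G \<le> C \<longleftrightarrow> (\<forall>v. ?S v \<le> C * ?n v)")
proof
  let ?Gv = "\<lambda>v i. \<Sum>j<n. ?G i j * v j"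
  have Snn: "0 \<le> ?S v" and nnn: "0 \<le> ?n v" for v by (simp_all add: sum_nonneg)
  {
    assume le: "cmatrix_norm n ?G \<le> C"
    show "\<forall>v. ?S v \<le> C * ?n v"
    proof
      fix v
      have "complex_of_real (?S v) = (\<Sum>i<n. cnj (v i) * ?Gv v i)"
        unfolding gram_form by (simp add: cinner_self)
      then have "?S v = cmod (\<Sum>i<n. cnj (v i) * ?Gv v i)"
        using Snn[of v] by (rule of_real_eq_imp_eq_norm)
      also have "\<dots> \<le> sqrt (?n v) * sqrt (\<Sum>i<n. (cmod (?Gv v i))\<^sup>2)"
        by (rule complex_cauchy_schwarz)
      finally have 1: "?S v \<le> sqrt (?n v) * sqrt (\<Sum>i<n. (cmod (?Gv v i))\<^sup>2)" .
      show "?S v \<le> C * ?n v"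
      proof (cases "?n v = 0")
        case True
        then show ?thesis using 1 by simp
      next
        case False
        \<comment> \<open>\<open>cmatrix_norm\<close> sees only the unit ball, so \<open>v\<close>
          is divided by its Euclidean norm.\<close>
        define t where "t = sqrt (?n v)"
        have t: "t > 0" "t * t = ?n v" using False nnn[of v] by (auto simp: t_def)
        let ?w = "\<lambda>j. v j / of_real t"
        have "?n ?w = ?n v / (t * t)"
          using t by (simp add: norm_divide power_divide power2_eq_square flip: sum_divide_distrib)
        then have "?n ?w \<le> 1" using t False by simp
        then have "sqrt (\<Sum>i<n. (cmod (?Gv ?w i))\<^sup>2) \<le> C"
          using cmatrix_norm_upper[where n=n and v="?w" and A="?G"] le by simp
        moreover have "?Gv ?w i = ?Gv v i / of_real t" for i
          by (simp add: sum_divide_distrib)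
        then have "sqrt (\<Sum>i<n. (cmod (?Gv ?w i))\<^sup>2) = sqrt (\<Sum>i<n. (cmod (?Gv v i))\<^sup>2) / t"
          using t by (simp only: norm_divide power_divide sum_divide_distrib[symmetric] norm_of_real
              power2_abs real_sqrt_divide real_sqrt_abs abs_of_pos)
        ultimately have "sqrt (\<Sum>i<n. (cmod (?Gv v i))\<^sup>2) / t \<le> C" by (simp only:)
        then have "sqrt (\<Sum>i<n. (cmod (?Gv v i))\<^sup>2) \<le> C * t" using t by (simp only: pos_divide_le_eq)
        then have "t * sqrt (\<Sum>i<n. (cmod (?Gv v i))\<^sup>2) \<le> t * (C * t)" using t by (intro mult_left_mono) auto
        then show ?thesis using 1 t by (simp add: t_def[symmetric] mult_ac)
      qed
    qed
  }
  {
    assume S: "\<forall>v. ?S v \<le> C * ?n v"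
    show "cmatrix_norm n ?G \<le> C"
      unfolding cmatrix_norm_def
    proof (rule cSUP_least)
      show "{v :: nat \<Rightarrow> complex. (\<Sum>j<n. (cmod (v j))\<^sup>2) \<le> 1} \<noteq> {}" by (auto intro: exI[of _ "\<lambda>_. 0"])
      fix v :: "nat \<Rightarrow> complex" assume "v \<in> {v. (\<Sum>j<n. (cmod (v j))\<^sup>2) \<le> 1}"
      then have v: "?n v \<le> 1" by simp
      \<comment> \<open>Pairing \<open>w\<close> with the image of \<open>v\<close> gives the
        squared norm of \<open>w\<close>. Cauchy-Schwarz for the Gram form bounds it by the
        quadratic forms at \<open>w\<close> and at \<open>v\<close>, and one factor
        \<open>sqrt (?n w)\<close> cancels.\<close>
      define w where "w = ?Gv v"
      define A where "A u q = (\<Sum>j<n. u j *\<^sub>C a q j)" for u q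
      have nw: "complex_of_real (?n w) = (\<Sum>i<n. cnj (w i) * ?Gv v i)"
        by (simp only: w_def of_real_sum complex_norm_square mult.commute)
      then have "?n w = cmod (\<Sum>q\<in>Q. cinner (A w q) (A v q))"
        unfolding gram_form A_def using nnn[of w] by (rule of_real_eq_imp_eq_norm)
      also have "\<dots> \<le> (\<Sum>q\<in>Q. \<bar>norm (A w q)\<bar> * \<bar>norm (A v q)\<bar>)"
        by (rule order_trans[OF norm_sum]) (auto intro!: sum_mono cinner_cauchy_schwarz)
      also have "\<dots> \<le> L2_set (\<lambda>q. norm (A w q)) Q * L2_set (\<lambda>q. norm (A v q)) Q"
        by (rule L2_set_mult_ineq)
      also have "\<dots> = sqrt (?S w) * sqrt (?S v)" by (simp add: L2_set_def A_def)
      also have "\<dots> \<le> sqrt (C * ?n w) * sqrt (C * 1)"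
      proof -
        have "?S w \<le> C * ?n w" using S by blast
        moreover have "?S v \<le> C * 1"
          by (rule order_trans[OF S[rule_format, of v]]) (rule mult_left_mono[OF v C])
        ultimately show ?thesis
          using C nnn[of w] by (intro mult_mono real_sqrt_le_mono real_sqrt_ge_zero Snn) simp_all
      qed
      also have "\<dots> = C * sqrt (?n w)" using C by (simp add: real_sqrt_mult)
      finally have "sqrt (?n w) * sqrt (?n w) \<le> C * sqrt (?n w)" using nnn[of w] by simp
      moreover have "0 \<le> sqrt (?n w)" using nnn[of w] by simp
      ultimately have "sqrt (?n w) \<le> C"
        using C by (rule le_of_square_le)
      then show "sqrt (\<Sum>i<n. (cmod (?Gv v i))\<^sup>2) \<le> C" by (simp add: w_def)
    qed
  }
qed

section \<open>The modules of \<open>C\<^sup>1\<close>-maps vanishing at infinity\<close>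

context riemannian
begin

section \<open>Algebra of jets and jet norms\<close>

lemma jet_add: "diffble s x \<Longrightarrow> diffble t x \<Longrightarrow> jet (\<lambda>x. s x + t x) x i = jet s x i + jet t x i"
  by (simp add: jet_def deriv_at_def diffble_def has_derivative_dcoeff_add split: option.split)

lemma jet_linear: "bounded_linear f \<Longrightarrow> diffble s x \<Longrightarrow> jet (\<lambda>x. f (s x)) x i = f (jet s x i)"
  by (simp add: jet_def deriv_at_def diffble_def has_derivative_dcoeff_linear split: option.split)

lemma jet_diff: "diffble s x \<Longrightarrow> diffble t x \<Longrightarrow> jet (\<lambda>x. s x - t x) x i = jet s x i - jet t x i"
  using jet_add[of s x "\<lambda>x. - t x" i] jet_linear[OF bounded_linear_minus[OF bounded_linear_ident], of t x i]
    has_derivative_dcoeff_linear(1)[OF bounded_linear_minus[OF bounded_linear_ident], of _ t x]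
  by (simp add: diffble_def)

lemma jet_sum:
  assumes "\<And>i. i \<in> I \<Longrightarrow> diffble (s i) x"
  shows "diffble (\<lambda>x. \<Sum>i\<in>I. s i x) x" and "jet (\<lambda>x. \<Sum>i\<in>I. s i x) x k = (\<Sum>i\<in>I. jet (s i) x k)"
  using assms has_derivative_dcoeff_sum[of I "chart_at M x" s x]
  by (simp_all add: jet_def deriv_at_def diffble_def split: option.split)

lemma diffble_linear: "bounded_linear f \<Longrightarrow> diffble s x \<Longrightarrow> diffble (\<lambda>x. f (s x)) x"
  by (simp add: diffble_def has_derivative_dcoeff_linear)

lemma diffble_add: "diffble s x \<Longrightarrow> diffble t x \<Longrightarrow> diffble (\<lambda>x. s x + t x) x"
  by (simp add: diffble_def has_derivative_dcoeff_add)

lemma diffble_diff: "diffble s x \<Longrightarrow> diffble t x \<Longrightarrow> diffble (\<lambda>x. s x - t x) x"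
  using diffble_add[of s x "\<lambda>x. - t x"] diffble_linear[OF bounded_linear_minus[OF bounded_linear_ident], of t x]
  by simp

lemma C1_in_diff: "C1_in W s \<Longrightarrow> C1_in W t \<Longrightarrow> C1_in W (\<lambda>x. s x - t x)"
  using C1_in_add[of W s "\<lambda>x. - t x"] C1_in_linear[OF bounded_linear_minus[OF bounded_linear_ident], of W t]
  by simp

lemma jnorm_cong: "(\<And>i. i \<in> jets \<Longrightarrow> norm (jet s x i) = norm (jet t x i)) \<Longrightarrow> jnorm s x = jnorm t x"
  unfolding jnorm_def by (intro L2_set_cong refl) simp

lemma jnorm_mono: "(\<And>i. i \<in> jets \<Longrightarrow> norm (jet s x i) \<le> norm (jet t x i)) \<Longrightarrow> jnorm s x \<le> jnorm t x"
  unfolding jnorm_def by (intro L2_set_mono) auto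

lemma jnorm_add: "diffble s x \<Longrightarrow> diffble t x \<Longrightarrow> jnorm (\<lambda>x. s x + t x) x \<le> jnorm s x + jnorm t x"
  unfolding jnorm_def
  by (rule order_trans[OF _ L2_set_triangle_ineq]) (auto simp: jet_add intro!: L2_set_mono norm_triangle_ineq)

lemma jnorm_linear:
  assumes "bounded_linear f" "\<And>v. norm (f v) \<le> B * norm v" "0 \<le> B" "diffble s x"
  shows "jnorm (\<lambda>x. f (s x)) x \<le> B * jnorm s x"
  unfolding jnorm_def L2_set_right_distrib[OF assms(3)]
  using assms by (intro L2_set_mono) (auto simp: jet_linear)

lemma jnorm_scaleC: "diffble s x \<Longrightarrow> jnorm (\<lambda>x. k *\<^sub>C s x) x = cmod k * jnorm s x"
  unfolding jnorm_def L2_set_right_distrib[OF norm_ge_zero]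
  by (intro L2_set_cong refl) (simp add: jet_linear[OF bounded_linear_scaleC_right] norm_scaleC)

lemma jnorm_minus_commute:
  "diffble s x \<Longrightarrow> diffble t x \<Longrightarrow> jnorm (\<lambda>x. s x - t x) x = jnorm (\<lambda>x. t x - s x) x"
  by (intro jnorm_cong) (simp add: jet_diff norm_minus_commute)

lemma jnorm_const_zero: "jnorm (\<lambda>x. 0 :: 'h::real_normed_vector) x = 0"
proof -
  have "jet (\<lambda>x. 0 :: 'h) x i = 0" for i
    by (simp add: jet_def deriv_at_def has_derivative_dcoeff_const split: option.split)
  then show ?thesis by (simp add: jnorm_def L2_set_def)
qed

lemma jnorm_sum:
  "(\<And>i. i \<in> I \<Longrightarrow> diffble (s i) x) \<Longrightarrow> jnorm (\<lambda>x. \<Sum>i\<in>I. s i x) x \<le> (\<Sum>i\<in>I. jnorm (s i) x)"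
proof (induction I rule: infinite_finite_induct)
  case (insert i I)
  then have "diffble (\<lambda>x. \<Sum>i\<in>I. s i x) x" by (intro jet_sum) auto
  then have "jnorm (\<lambda>x. s i x + (\<Sum>i\<in>I. s i x)) x \<le> jnorm (s i) x + jnorm (\<lambda>x. \<Sum>i\<in>I. s i x) x"
    using insert by (intro jnorm_add) auto
  then show ?case using insert by force
qed (simp_all add: jnorm_const_zero)

section \<open>Maps whose jets vanish at infinity\<close>

lemma C10_iff:
  fixes s :: "'m \<Rightarrow> 'h::complex_hilbert"
  shows "s \<in> C10_maps M \<longleftrightarrow> C1_in UNIV s \<and> (\<forall>\<epsilon>>0. \<exists>K. compact K \<and> (\<forall>x. x \<notin> K \<longrightarrow> jnorm s x < \<epsilon>))"
proof -
  have "(\<forall>\<epsilon>>0. \<exists>K. compact K \<and> (\<forall>x\<in>- K. norm (s x) + dnorm s x < \<epsilon>)) \<longleftrightarrow>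
      (\<forall>\<epsilon>>0. \<exists>K. compact K \<and> (\<forall>x. x \<notin> K \<longrightarrow> jnorm s x < \<epsilon>))" (is "?A \<longleftrightarrow> ?B")
  proof
    assume ?A
    then show ?B by (meson ComplI jnorm_le le_less_trans)
  next
    assume B: ?B
    show ?A
    proof (intro allI impI)
      fix \<epsilon> :: real assume "\<epsilon> > 0"
      then obtain K where K: "compact K" "\<And>x. x \<notin> K \<Longrightarrow> jnorm s x < \<epsilon> / 2"
        using B[rule_format, of "\<epsilon> / 2"] by auto
      have "norm (s x) + dnorm s x < \<epsilon>" if "x \<notin> K" for x
        using K(2)[OF that] norm_le_jnorm[of s x] dnorm_le_jnorm[of s x] by linarith
      then show "\<exists>K. compact K \<and> (\<forall>x\<in>- K. norm (s x) + dnorm s x < \<epsilon>)" using K by blast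
    qed
  qed
  moreover have "C1_in UNIV s \<Longrightarrow> cotangent_norm M x (deriv_at M s x) = dnorm s x" for x
    by (rule cotangent_norm_eq[OF C1_in_diffble]) auto
  ultimately show ?thesis unfolding C10_maps_def C1_map_iff mem_Collect_eq
    by (intro conj_cong refl) simp
qed

lemma C10_C1: "s \<in> C10_maps M \<Longrightarrow> C1_in UNIV (s :: 'm \<Rightarrow> 'h::complex_hilbert)"
  and C10_diffble: "s \<in> C10_maps M \<Longrightarrow> diffble (s :: 'm \<Rightarrow> 'h::complex_hilbert) x"
  using C10_iff C1_in_diffble by blast+

lemma C10_vanish:
  "s \<in> C10_maps M \<Longrightarrow> \<epsilon> > 0 \<Longrightarrow> \<exists>K. compact K \<and> (\<forall>x. x \<notin> K \<longrightarrow> jnorm (s :: 'm \<Rightarrow> 'h::complex_hilbert) x < \<epsilon>)"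
  using C10_iff by blast

text \<open>No continuity is asked of \<open>f\<close>: besides jet norms it has to cover the number
  of terms of an expansion that are required at a point.\<close>

lemma compact_locally_bounded:
  fixes f :: "'m \<Rightarrow> real"
  assumes K: "compact K" and loc: "\<And>p. p \<in> K \<Longrightarrow> \<exists>W B. open W \<and> p \<in> W \<and> (\<forall>x\<in>W. f x \<le> B)"
  shows "\<exists>B. \<forall>x\<in>K. f x \<le> B"
proof -
  let ?C = "{W. open W \<and> (\<exists>B. \<forall>x\<in>W. f x \<le> B)}"
  have "K \<subseteq> \<Union>?C" using loc by blast
  then obtain D where D: "D \<subseteq> ?C" "finite D" "K \<subseteq> \<Union>D"
    using compactE[OF K, of ?C] by blast
  have "\<forall>W\<in>D. \<exists>B. \<forall>x\<in>W. f x \<le> B" using D by blast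
  then obtain b where b: "\<And>W x. W \<in> D \<Longrightarrow> x \<in> W \<Longrightarrow> f x \<le> b W" by metis
  have "f x \<le> (\<Sum>W\<in>D. \<bar>b W\<bar>)" if x: "x \<in> K" for x
  proof -
    obtain W where W: "W \<in> D" "x \<in> W" using x D by blast
    have "f x \<le> \<bar>b W\<bar>" using b[OF W] by linarith
    also have "\<dots> \<le> (\<Sum>W\<in>D. \<bar>b W\<bar>)" using W D by (intro member_le_sum) auto
    finally show ?thesis .
  qed
  then show ?thesis by blast
qed

lemma jnorm_locally_bounded:
  fixes s :: "'m \<Rightarrow> 'h::real_normed_vector"
  assumes s: "C1_in UNIV s"
  shows "\<exists>W B. open W \<and> p \<in> W \<and> (\<forall>x\<in>W. jnorm s x \<le> B)"
proof -
  obtain c where c: "c \<in> atlas M" "p \<in> dom c" using ex_chart by blast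
  obtain W A where W: "open W" "p \<in> W" "W \<subseteq> dom c" "A \<ge> 1" and
    A: "\<And>s x. x \<in> W \<Longrightarrow> diffble s x \<Longrightarrow> jnorm (s :: 'm \<Rightarrow> 'h) x \<le> A * (norm (s x) + (\<Sum>b\<in>axes M. norm (dcoeff c s x b)))"
    by (rule jnorm_local_bound[OF c, where ?'h = 'h]) blast
  let ?f = "\<lambda>x. norm (s x) + (\<Sum>b\<in>axes M. norm (dcoeff c s x b))"
  have "continuous_on (dom c) ?f"
    using C1_in_continuous_on[OF s] C1_inD(2)[OF s c(1)]
    by (intro continuous_intros) (auto intro: continuous_on_subset)
  then have op: "open (dom c \<inter> ?f -` {..<?f p + 1})"
    using continuous_open_preimage[OF _ chart_open[OF c(1)] open_lessThan] by blast
  have "jnorm s x \<le> A * (?f p + 1)" if "x \<in> W \<inter> (dom c \<inter> ?f -` {..<?f p + 1})" for x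
  proof -
    have "jnorm s x \<le> A * ?f x" using that s by (intro A C1_in_diffble[of UNIV]) auto
    also have "\<dots> \<le> A * (?f p + 1)" using that W(4) by (intro mult_left_mono) auto
    finally show ?thesis .
  qed
  moreover have "p \<in> W \<inter> (dom c \<inter> ?f -` {..<?f p + 1})" using c W by auto
  ultimately show ?thesis using W(1) op by (meson open_Int)
qed

lemma C10_bounded:
  assumes s: "s \<in> C10_maps M"
  shows "\<exists>B>0. \<forall>x. jnorm (s :: 'm \<Rightarrow> 'h::complex_hilbert) x \<le> B"
proof -
  obtain K where K: "compact K" "\<And>x. x \<notin> K \<Longrightarrow> jnorm s x < 1" using C10_vanish[OF s, of 1] by auto
  obtain B where B: "\<And>x. x \<in> K \<Longrightarrow> jnorm s x \<le> B"
    using compact_locally_bounded[OF K(1) jnorm_locally_bounded[OF C10_C1[OF s]]] by blast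
  have "jnorm s x \<le> max 1 B" for x using K(2)[of x] B[of x] by (cases "x \<in> K") auto
  then show ?thesis by (intro exI[of _ "max 1 B"]) auto
qed

text \<open>Outside the finite union of the compact sets belonging to the \<open>s i\<close>, the
  right-hand side is small. Sums, products and images under operators all enter
  \<open>C10_maps\<close> through this domination.\<close>

lemma C10_dominated:
  fixes s :: "'i \<Rightarrow> 'm \<Rightarrow> 'g::complex_hilbert" and t :: "'m \<Rightarrow> 'h::complex_hilbert"
  assumes t: "C1_in UNIV t" and I: "finite I" and s: "\<And>i. i \<in> I \<Longrightarrow> s i \<in> C10_maps M"
    and le: "\<And>x. jnorm t x \<le> A * (\<Sum>i\<in>I. jnorm (s i) x)"
  shows "t \<in> C10_maps M"
  unfolding C10_iff
proof (intro conjI t allI impI)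
  fix \<epsilon> :: real assume e: "\<epsilon> > 0"
  \<comment> \<open>Both factors are enlarged by 1, so that \<open>N\<close> is positive and
    strictly larger than \<open>\<bar>A\<bar> * card I\<close>, even for \<open>A = 0\<close> or
    empty \<open>I\<close>.\<close>
  define N where "N = (1 + \<bar>A\<bar>) * (1 + real (card I))"
  have N: "N > 0" unfolding N_def by (intro mult_pos_pos) auto
  have "\<forall>i\<in>I. \<exists>K. compact K \<and> (\<forall>x. x \<notin> K \<longrightarrow> jnorm (s i) x < \<epsilon> / N)"
    using s C10_vanish e N by (meson divide_pos_pos)
  then obtain K where K: "\<And>i. i \<in> I \<Longrightarrow> compact (K i)" "\<And>i x. i \<in> I \<Longrightarrow> x \<notin> K i \<Longrightarrow> jnorm (s i) x < \<epsilon> / N"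
    by metis
  have "jnorm t x < \<epsilon>" if "x \<notin> \<Union> (K ` I)" for x
  proof -
    have "(\<Sum>i\<in>I. jnorm (s i) x) \<le> (\<Sum>i\<in>I. \<epsilon> / N)"
      using that K(2) by (intro sum_mono less_imp_le) auto
    also have "\<dots> = real (card I) * (\<epsilon> / N)" by simp
    finally have S: "(\<Sum>i\<in>I. jnorm (s i) x) \<le> real (card I) * (\<epsilon> / N)" .
    have "jnorm t x \<le> \<bar>A\<bar> * (\<Sum>i\<in>I. jnorm (s i) x)"
      by (rule order_trans[OF le]) (auto intro!: mult_right_mono sum_nonneg jnorm_nonneg)
    also have "\<dots> \<le> \<bar>A\<bar> * (real (card I) * (\<epsilon> / N))" using S by (intro mult_left_mono) auto
    also have "\<dots> < N * (\<epsilon> / N)"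
    proof -
      have "\<bar>A\<bar> * real (card I) < N" unfolding N_def
        by (intro mult_strict_mono') auto
      then show ?thesis using e N by (simp only: mult.assoc[symmetric]) (intro mult_strict_right_mono, auto)
    qed
    also have "\<dots> = \<epsilon>" using N by simp
    finally show ?thesis .
  qed
  moreover have "compact (\<Union> (K ` I))" using K I by (intro compact_UN) auto
  ultimately show "\<exists>K. compact K \<and> (\<forall>x. x \<notin> K \<longrightarrow> jnorm t x < \<epsilon>)" by blast
qed

lemma C10_dominated1:
  fixes s :: "'m \<Rightarrow> 'g::complex_hilbert" and t :: "'m \<Rightarrow> 'h::complex_hilbert"
  assumes "C1_in UNIV t" "s \<in> C10_maps M" "\<And>x. jnorm t x \<le> A * jnorm s x"
  shows "t \<in> C10_maps M"
  by (rule C10_dominated[where I = "{()}" and s = "\<lambda>_. s"]) (use assms in auto)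

lemma C10_sum:
  assumes "finite I" "\<And>i. i \<in> I \<Longrightarrow> s i \<in> C10_maps M"
  shows "(\<lambda>x. \<Sum>i\<in>I. s i x :: 'h::complex_hilbert) \<in> C10_maps M"
proof (rule C10_dominated[OF _ assms])
  show "C1_in UNIV (\<lambda>x. \<Sum>i\<in>I. s i x)" by (intro C1_in_sum C10_C1 assms)
  show "jnorm (\<lambda>x. \<Sum>i\<in>I. s i x) x \<le> 1 * (\<Sum>i\<in>I. jnorm (s i) x)" for x
    unfolding mult_1 by (intro jnorm_sum C10_diffble assms)
qed

lemma C10_add:
  assumes "s \<in> C10_maps M" "t \<in> C10_maps M"
  shows "(\<lambda>x. s x + t x :: 'h::complex_hilbert) \<in> C10_maps M"
  using C10_sum[of UNIV "\<lambda>b. if b then s else t"] assms by (simp add: UNIV_bool add.commute)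

lemma C10_linear:
  assumes f: "bounded_linear f" and s: "s \<in> C10_maps M"
  shows "(\<lambda>x. f (s x :: 'g::complex_hilbert) :: 'h::complex_hilbert) \<in> C10_maps M"
proof -
  obtain B where B: "B \<ge> 0" "\<And>v. norm (f v) \<le> B * norm v"
    using bounded_linear.nonneg_bounded[OF f] by (metis mult.commute)
  show ?thesis
    by (rule C10_dominated1[OF C1_in_linear[OF f C10_C1[OF s]] s jnorm_linear[OF f B(2,1) C10_diffble[OF s]]])
qed

lemma C10_scaleC: "s \<in> C10_maps M \<Longrightarrow> (\<lambda>x. k *\<^sub>C s x :: 'h::complex_hilbert) \<in> C10_maps M"
  by (rule C10_linear[OF bounded_linear_scaleC_right])

section \<open>Products\<close>

lemma dnorm_bilinear:
  assumes bl: "bounded_bilinear p" and le: "\<And>v w. norm (p v w) \<le> norm v * norm w"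
    and s: "diffble s x" "diffble t x"
  shows "diffble (\<lambda>x. p (s x) (t x)) x"
    and "dnorm (\<lambda>x. p (s x) (t x)) x \<le> norm (s x) * dnorm t x + norm (t x) * dnorm s x"
proof -
  note d = has_derivative_dcoeff_bilinear[OF bl chart_at s[unfolded diffble_def]]
  show "diffble (\<lambda>x. p (s x) (t x)) x" unfolding diffble_def by (rule d)
  have "norm (jet (\<lambda>x. p (s x) (t x)) x (Some b)) \<le> norm (s x) * norm (jet t x (Some b)) + norm (t x) * norm (jet s x (Some b))" for b
    unfolding jet_def deriv_at_def option.case d
    using le[of "s x" "dcoeff (chart_at M x) t x (frame x b)"] le[of "dcoeff (chart_at M x) s x (frame x b)" "t x"]
    by (intro order_trans[OF norm_triangle_ineq]) (simp add: mult.commute)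
  then have "dnorm (\<lambda>x. p (s x) (t x)) x \<le> L2_set (\<lambda>b. norm (s x) * norm (jet t x (Some b)) + norm (t x) * norm (jet s x (Some b))) (axes M)"
    unfolding dnorm_def by (intro L2_set_mono) auto
  also have "\<dots> \<le> norm (s x) * dnorm t x + norm (t x) * dnorm s x"
    unfolding dnorm_def L2_set_right_distrib[OF norm_ge_zero] by (rule L2_set_triangle_ineq)
  finally show "dnorm (\<lambda>x. p (s x) (t x)) x \<le> norm (s x) * dnorm t x + norm (t x) * dnorm s x" .
qed

lemma jnorm_bilinear:
  assumes bl: "bounded_bilinear p" and le: "\<And>v w. norm (p v w) \<le> norm v * norm w"
    and s: "diffble s x" "diffble t x"
  shows "jnorm (\<lambda>x. p (s x) (t x)) x \<le> 3 * jnorm s x * jnorm t x"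
proof -
  have "jnorm (\<lambda>x. p (s x) (t x)) x \<le> norm (p (s x) (t x)) + dnorm (\<lambda>x. p (s x) (t x)) x" by (rule jnorm_le)
  also have "\<dots> \<le> norm (s x) * norm (t x) + (norm (s x) * dnorm t x + norm (t x) * dnorm s x)"
    by (intro add_mono le dnorm_bilinear[OF bl le s])
  also have "\<dots> \<le> jnorm s x * jnorm t x + (jnorm s x * jnorm t x + jnorm t x * jnorm s x)"
    by (intro add_mono mult_mono norm_le_jnorm dnorm_le_jnorm jnorm_nonneg dnorm_nonneg norm_ge_zero)
  finally show ?thesis by simp
qed

lemma C10_act:
  assumes f: "f \<in> C10_maps M" and s: "s \<in> C10_maps M"
  shows "(\<lambda>x. f x *\<^sub>C s x :: 'h::complex_hilbert) \<in> C10_maps M"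
proof -
  obtain B where B: "\<And>x. jnorm f x \<le> B" using C10_bounded[OF f] by blast
  show ?thesis
  proof (rule C10_dominated1[OF _ s])
    show "C1_in UNIV (\<lambda>x. f x *\<^sub>C s x)"
      by (rule C1_in_bilinear[OF bounded_bilinear_scaleC C10_C1[OF f] C10_C1[OF s] open_UNIV])
    fix x
    have "jnorm (\<lambda>x. f x *\<^sub>C s x) x \<le> 3 * jnorm f x * jnorm s x"
      by (rule jnorm_bilinear[OF bounded_bilinear_scaleC _ C10_diffble[OF f] C10_diffble[OF s]])
        (simp add: norm_scaleC)
    also have "\<dots> \<le> (3 * B) * jnorm s x" using B[of x] by (intro mult_right_mono jnorm_nonneg) auto
    finally show "jnorm (\<lambda>x. f x *\<^sub>C s x) x \<le> (3 * B) * jnorm s x" .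
  qed
qed

subsection \<open>The operator norm of matrices over the modules\<close>

text \<open>The quadratic form, at the vector \<open>v\<close>, of the Gram matrix of jets whose
  norm occurs in \<open>norm1\<close>.\<close>

definition comb_sq :: "'r set \<Rightarrow> nat \<Rightarrow> ('r \<Rightarrow> nat \<Rightarrow> 'm \<Rightarrow> 'h::complex_hilbert) \<Rightarrow> (nat \<Rightarrow> complex) \<Rightarrow> 'm \<Rightarrow> real" where
  "comb_sq R n s v x = (\<Sum>k\<in>R. (jnorm (\<lambda>y. \<Sum>j<n. v j *\<^sub>C s k j y) x)\<^sup>2)"

lemma jet_comb:
  assumes "\<And>j. j < n \<Longrightarrow> diffble (s j) x"
  shows "diffble (\<lambda>y. \<Sum>j<n. v j *\<^sub>C s j y :: 'h::complex_hilbert) x"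
    and "jet (\<lambda>y. \<Sum>j<n. v j *\<^sub>C s j y :: 'h::complex_hilbert) x i = (\<Sum>j<n. v j *\<^sub>C jet (s j) x i)"
  using jet_sum[of "{..<n}" "\<lambda>j y. v j *\<^sub>C s j y" x] assms
  by (simp_all add: diffble_linear[OF bounded_linear_scaleC_right] jet_linear[OF bounded_linear_scaleC_right])

lemma cmatrix_norm_jets_le_iff:
  assumes R: "finite R" and s: "\<And>k j. k \<in> R \<Longrightarrow> j < n \<Longrightarrow> diffble (s k j) x" and C: "0 \<le> C"
  shows "cmatrix_norm n (\<lambda>i j. \<Sum>k\<in>R. jet_inner M (s k i) (s k j) x) \<le> C \<longleftrightarrow>
    (\<forall>v. comb_sq R n s v x \<le> C * (\<Sum>j<n. (cmod (v j))\<^sup>2))"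
proof -
  let ?a = "\<lambda>q j. jet (s (fst q) j) x (snd q)"
  have "cmatrix_norm n (\<lambda>i j. \<Sum>k\<in>R. jet_inner M (s k i) (s k j) x)
      = cmatrix_norm n (\<lambda>i j. \<Sum>q\<in>R \<times> jets. cinner (?a q i) (?a q j))"
  proof -
    have *: "(\<Sum>k\<in>R. jet_inner M (s k i) (s k j) x) = (\<Sum>q\<in>R \<times> jets. cinner (?a q i) (?a q j))"
      if "i < n" "j < n" for i j
      using that s by (subst sum.cartesian_product') (simp add: jet_inner_eq)
    show ?thesis unfolding cmatrix_norm_def
      by (intro SUP_cong refl arg_cong[of _ _ sqrt] sum.cong arg_cong[of _ _ "\<lambda>z. (cmod z)\<^sup>2"] arg_cong2[of _ _ _ _ "(*)"] *)
        auto
  qed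
  moreover have "(\<Sum>q\<in>R \<times> jets. (norm (\<Sum>j<n. v j *\<^sub>C ?a q j))\<^sup>2) = comb_sq R n s v x" for v
    using s unfolding comb_sq_def jnorm_sq_sum
    by (subst sum.cartesian_product') (simp add: jet_comb)
  ultimately show ?thesis using cmatrix_norm_gram_le_iff[OF C, of n ?a "R \<times> jets"] by simp
qed

lemma comb_sq_bound:
  assumes R: "finite R" and s: "\<And>k j. k \<in> R \<Longrightarrow> j < n \<Longrightarrow> s k j \<in> C10_maps M"
  shows "\<exists>B\<ge>0. \<forall>x v. comb_sq R n s v x \<le> B * (\<Sum>j<n. (cmod (v j))\<^sup>2)"
proof -
  have "\<exists>B>0. \<forall>x. jnorm (s k j) x \<le> B" if "k \<in> R" "j < n" for k j using C10_bounded[OF s[OF that]] .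
  then obtain b where b: "\<And>k j. k \<in> R \<Longrightarrow> j < n \<Longrightarrow> b k j > 0" "\<And>k j x. k \<in> R \<Longrightarrow> j < n \<Longrightarrow> jnorm (s k j) x \<le> b k j"
    by metis
  have "comb_sq R n s v x \<le> (\<Sum>k\<in>R. (\<Sum>j<n. b k j)\<^sup>2) * (\<Sum>j<n. (cmod (v j))\<^sup>2)" for x v
    unfolding comb_sq_def sum_distrib_right
  proof (rule sum_mono)
    fix k assume k: "k \<in> R"
    let ?V = "sqrt (\<Sum>j<n. (cmod (v j))\<^sup>2)"
    have vj: "cmod (v j) \<le> ?V" if "j < n" for j
    proof -
      have "(cmod (v j))\<^sup>2 \<le> (\<Sum>j<n. (cmod (v j))\<^sup>2)" using that by (intro member_le_sum) auto
      then show ?thesis by (rule real_le_rsqrt)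
    qed
    have "jnorm (\<lambda>y. \<Sum>j<n. v j *\<^sub>C s k j y) x \<le> (\<Sum>j<n. jnorm (\<lambda>y. v j *\<^sub>C s k j y) x)"
      using k s by (intro jnorm_sum diffble_linear[OF bounded_linear_scaleC_right] C10_diffble) auto
    also have "\<dots> = (\<Sum>j<n. cmod (v j) * jnorm (s k j) x)"
      using k s by (intro sum.cong refl jnorm_scaleC C10_diffble) auto
    also have "\<dots> \<le> (\<Sum>j<n. ?V * b k j)"
      using k by (intro sum_mono mult_mono vj b) (auto simp: jnorm_nonneg sum_nonneg)
    also have "\<dots> = (\<Sum>j<n. b k j) * ?V" by (simp only: sum_distrib_right mult.commute)
    finally have "(jnorm (\<lambda>y. \<Sum>j<n. v j *\<^sub>C s k j y) x)\<^sup>2 \<le> ((\<Sum>j<n. b k j) * ?V)\<^sup>2"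
      by (intro power_mono jnorm_nonneg)
    then show "(jnorm (\<lambda>y. \<Sum>j<n. v j *\<^sub>C s k j y) x)\<^sup>2 \<le> (\<Sum>j<n. b k j)\<^sup>2 * (\<Sum>j<n. (cmod (v j))\<^sup>2)"
      by (simp add: power_mult_distrib sum_nonneg)
  qed
  then show ?thesis by (intro exI[of _ "\<Sum>k\<in>R. (\<Sum>j<n. b k j)\<^sup>2"]) (auto simp: sum_nonneg)
qed

lemma norm1_bdd:
  assumes R: "finite R" and s: "\<And>k j. k \<in> R \<Longrightarrow> j < n \<Longrightarrow> s k j \<in> C10_maps M"
  shows "bdd_above (range (\<lambda>x. sqrt (cmatrix_norm n (\<lambda>i j. \<Sum>k\<in>R. jet_inner M (s k i) (s k j) x))))"
proof -
  obtain B where B: "B \<ge> 0" "\<forall>x v. comb_sq R n s v x \<le> B * (\<Sum>j<n. (cmod (v j))\<^sup>2)"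
  proof -
    have "\<exists>B\<ge>0. \<forall>x v. comb_sq R n s v x \<le> B * (\<Sum>j<n. (cmod (v j))\<^sup>2)"
      by (rule comb_sq_bound[OF R]) (rule s)
    then show ?thesis using that by (elim exE conjE)
  qed
  have "cmatrix_norm n (\<lambda>i j. \<Sum>k\<in>R. jet_inner M (s k i) (s k j) x) \<le> B" for x
    using B by (subst cmatrix_norm_jets_le_iff[OF R]) (simp_all add: s C10_diffble)
  then show ?thesis by (intro bdd_aboveI2[of _ _ "sqrt B"] real_sqrt_le_mono)
qed

lemma norm1_nonneg:
  assumes "finite R" "\<And>k j. k \<in> R \<Longrightarrow> j < n \<Longrightarrow> s k j \<in> C10_maps M"
  shows "0 \<le> norm1 M R n s"
  unfolding norm1_def
  by (rule cSUP_upper2[OF norm1_bdd[OF assms], where x = undefined]) (simp_all add: cmatrix_norm_nonneg)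

lemma norm1_le_iff:
  assumes R: "finite R" and s: "\<And>k j. k \<in> R \<Longrightarrow> j < n \<Longrightarrow> s k j \<in> C10_maps M" and C: "0 \<le> C"
  shows "norm1 M R n s \<le> C \<longleftrightarrow> (\<forall>x v. comb_sq R n s v x \<le> C\<^sup>2 * (\<Sum>j<n. (cmod (v j))\<^sup>2))"
proof -
  have "norm1 M R n s \<le> C \<longleftrightarrow> (\<forall>x. sqrt (cmatrix_norm n (\<lambda>i j. \<Sum>k\<in>R. jet_inner M (s k i) (s k j) x)) \<le> C)"
    unfolding norm1_def using cSUP_le_iff[OF _ norm1_bdd[OF R s]] by auto
  also have "\<dots> \<longleftrightarrow> (\<forall>x. cmatrix_norm n (\<lambda>i j. \<Sum>k\<in>R. jet_inner M (s k i) (s k j) x) \<le> C\<^sup>2)"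
    using C by (simp add: real_sqrt_le_iff' cmatrix_norm_nonneg)
  also have "\<dots> \<longleftrightarrow> (\<forall>x v. comb_sq R n s v x \<le> C\<^sup>2 * (\<Sum>j<n. (cmod (v j))\<^sup>2))"
    by (subst cmatrix_norm_jets_le_iff[OF R]) (simp_all add: s C10_diffble)
  finally show ?thesis .
qed

lemma comb_sq_1:
  assumes "\<And>k. k \<in> R \<Longrightarrow> diffble (f k) x"
  shows "comb_sq R 1 (\<lambda>k _. f k) v x = (\<Sum>k\<in>R. (jnorm (f k) x)\<^sup>2) * (cmod (v 0))\<^sup>2"
  using assms by (simp add: comb_sq_def jnorm_scaleC power_mult_distrib sum_distrib_left mult.commute)

lemma norm1_column_le_iff:
  assumes R: "finite R" and f: "\<And>k. k \<in> R \<Longrightarrow> f k \<in> C10_maps M" and C: "0 \<le> C"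
  shows "norm1 M R 1 (\<lambda>k _. f k) \<le> C \<longleftrightarrow> (\<forall>x. (\<Sum>k\<in>R. (jnorm (f k) x)\<^sup>2) \<le> C\<^sup>2)"
proof -
  have "norm1 M R 1 (\<lambda>k _. f k) \<le> C \<longleftrightarrow>
      (\<forall>x v. (\<Sum>k\<in>R. (jnorm (f k) x)\<^sup>2) * (cmod (v (0::nat)))\<^sup>2 \<le> C\<^sup>2 * (cmod (v 0))\<^sup>2)"
    using f by (subst norm1_le_iff[OF R _ C]) (simp_all add: comb_sq_1[unfolded One_nat_def] C10_diffble)
  also have "\<dots> \<longleftrightarrow> (\<forall>x. (\<Sum>k\<in>R. (jnorm (f k) x)\<^sup>2) \<le> C\<^sup>2)"
  proof (intro iffI allI)
    fix x assume *: "\<forall>x v. (\<Sum>k\<in>R. (jnorm (f k) x)\<^sup>2) * (cmod (v (0::nat)))\<^sup>2 \<le> C\<^sup>2 * (cmod (v 0))\<^sup>2"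
    show "(\<Sum>k\<in>R. (jnorm (f k) x)\<^sup>2) \<le> C\<^sup>2" using *[rule_format, of x "\<lambda>_. 1"] by simp
  qed (auto intro: mult_right_mono)
  finally show ?thesis .
qed

end

section \<open>The standard module\<close>

lemma less_twice_one_plus: "0 \<le> (r::real) \<Longrightarrow> r < 2 * (1 + r)"
  by simp

context riemannian
begin

section \<open>Completeness of \<open>C10_maps M\<close>\<close>

lemma jnorm_tendsto:
  assumes "\<And>i. i \<in> jets \<Longrightarrow> ((\<lambda>n. jet (s n) x i) \<longlongrightarrow> jet t x i) F"
  shows "((\<lambda>n. jnorm (s n) x) \<longlongrightarrow> jnorm t x) F"
  unfolding jnorm_def L2_set_def
  by (intro tendsto_real_sqrt tendsto_sum tendsto_power tendsto_norm assms)

text \<open>On a ball in a chart, which is convex, uniformly convergent derivatives may be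
  interchanged with the limit. The Cauchy condition in \<open>jnorm\<close> becomes uniform
  convergence of partial derivatives there by \<open>jnorm_local_bound\<close>.\<close>

lemma C10_local_limit:
  fixes s :: "nat \<Rightarrow> 'm \<Rightarrow> 'h::complex_hilbert"
  assumes s: "\<And>n. s n \<in> C10_maps M"
    and cauchy: "\<And>\<epsilon>. \<epsilon> > 0 \<Longrightarrow> \<exists>N. \<forall>m\<ge>N. \<forall>n\<ge>N. \<forall>x. jnorm (\<lambda>y. s m y - s n y) x \<le> \<epsilon>"
  shows "\<exists>V. open V \<and> p \<in> V \<and> C1_in V (\<lambda>x. lim (\<lambda>n. s n x)) \<and>
    (\<forall>x\<in>V. \<forall>i\<in>jets. (\<lambda>n. jet (s n) x i) \<longlonglongrightarrow> jet (\<lambda>x. lim (\<lambda>n. s n x)) x i)"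
proof -
  obtain c where c: "c \<in> atlas M" "p \<in> dom c" using ex_chart by blast
  obtain W A where W: "open W" "p \<in> W" "W \<subseteq> dom c" "A \<ge> 1" and
    A: "\<And>s x v. x \<in> W \<Longrightarrow> diffble s x \<Longrightarrow> norm (dcoeff c (s :: 'm \<Rightarrow> 'h) x v) \<le> A * norm v * dnorm s x"
    by (rule jnorm_local_bound[OF c, where ?'h = 'h]) blast
  obtain r where r: "r > 0" "cball (crd c p) r \<subseteq> crd c ` dom c" "par c ` cball (crd c p) r \<subseteq> W"
    using chart_nbhd[OF c W(1,2)] by blast
  define S where "S = ball (crd c p) r"
  have Sc: "S \<subseteq> cball (crd c p) r" unfolding S_def by auto
  have SW: "par c y \<in> W" if "y \<in> S" for y using that Sc r by auto
  have cp: "crd c (par c y) = y" if "y \<in> S" for y using that Sc r by (intro f_inv_into_f) auto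
  define f' where "f' n y h = dcoeff c (s n) (par c y) h" for n y h
  have df: "diffble (s n) x" for n x by (rule C10_diffble[OF s])
  have dc: "diff_at_chart c (s n) x" if "x \<in> dom c" for n x
    using diffble_chart[OF c(1) that] df by blast
  have der: "((s n \<circ> par c) has_derivative f' n y) (at y)" if "y \<in> S" for n y
    using diff_at_chartD[OF dc, of "par c y" n] that SW W(3) by (auto simp: cp f'_def[abs_def])
  have f'diff: "f' m y h - f' n y h = dcoeff c (\<lambda>x. s m x - s n x) (par c y) h" if "y \<in> S" for m n y h
  proof -
    have "((\<lambda>x. s m x - s n x) \<circ> par c has_derivative (\<lambda>h. f' m y h - f' n y h)) (at (crd c (par c y)))"
      using has_derivative_diff[OF der[OF that, of m] der[OF that, of n]] by (simp add: comp_def cp[OF that])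
    from dcoeff_eqI[OF this] show ?thesis by simp
  qed
  have bound: "norm (f' m y h - f' n y h) \<le> A * norm h * jnorm (\<lambda>x. s m x - s n x) (par c y)"
    if "y \<in> S" for m n y h
    unfolding f'diff[OF that]
  proof (rule order_trans[OF A[OF SW[OF that] diffble_diff[OF df df]]])
    show "A * norm h * dnorm (\<lambda>x. s m x - s n x) (par c y) \<le> A * norm h * jnorm (\<lambda>x. s m x - s n x) (par c y)"
      using W(4) by (intro mult_left_mono dnorm_le_jnorm) auto
  qed
  have unif: "\<exists>N. \<forall>m\<ge>N. \<forall>n\<ge>N. \<forall>y\<in>S. \<forall>h. norm (f' m y h - f' n y h) \<le> \<epsilon> * norm h" if e: "\<epsilon> > 0" for \<epsilon>
  proof -
    have "\<epsilon> / A > 0" using e W(4) by simp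
    from cauchy[OF this] obtain N where N: "\<And>m n x. m \<ge> N \<Longrightarrow> n \<ge> N \<Longrightarrow> jnorm (\<lambda>y. s m y - s n y) x \<le> \<epsilon> / A"
      by blast
    have "norm (f' m y h - f' n y h) \<le> \<epsilon> * norm h" if "m \<ge> N" "n \<ge> N" "y \<in> S" for m n y h
    proof -
      have "norm (f' m y h - f' n y h) \<le> A * norm h * (\<epsilon> / A)"
      proof (rule order_trans[OF bound[OF that(3)]])
        show "A * norm h * jnorm (\<lambda>x. s m x - s n x) (par c y) \<le> A * norm h * (\<epsilon> / A)"
          using W(4) by (intro mult_left_mono N that) simp
      qed
      then show ?thesis using W(4) by (simp add: mult.commute)
    qed
    then show ?thesis by blast
  qed
  have conv': "convergent (\<lambda>n. f' n y h)" if y: "y \<in> S" for y h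
  proof -
    have "Cauchy (\<lambda>n. f' n y h)"
    proof (rule metric_CauchyI)
      fix e :: real assume e: "0 < e"
      \<comment> \<open>The denominator stays positive for \<open>h = 0\<close>, and the factor 2
        leaves room for a strict inequality.\<close>
      then have "e / (2 * (1 + norm h)) > 0" by (intro divide_pos_pos) (auto simp: add_pos_nonneg)
      from unif[OF this] obtain N where
        N: "\<And>m n. m \<ge> N \<Longrightarrow> n \<ge> N \<Longrightarrow> norm (f' m y h - f' n y h) \<le> e / (2 * (1 + norm h)) * norm h"
        using y by blast
      have "e / (2 * (1 + norm h)) * norm h < e"
      proof -
        have "norm h < 2 * (1 + norm h)" by (rule less_twice_one_plus) simp
        then show ?thesis using e by (simp add: divide_less_eq add_pos_nonneg)
      qed
      then have "dist (f' m y h) (f' n y h) < e" if "m \<ge> N" "n \<ge> N" for m n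
        unfolding dist_norm by (rule le_less_trans[OF N[OF that]])
      then show "\<exists>N. \<forall>m\<ge>N. \<forall>n\<ge>N. dist (f' m y h) (f' n y h) < e" by blast
    qed
    then show ?thesis by (rule Cauchy_convergent)
  qed
  define g' where "g' y h = lim (\<lambda>n. f' n y h)" for y h
  have lim': "(\<lambda>n. f' n y h) \<longlonglongrightarrow> g' y h" if "y \<in> S" for y h
    unfolding g'_def using conv'[OF that] by (simp add: convergent_LIMSEQ_iff)
  have unif': "\<exists>N. \<forall>n\<ge>N. \<forall>y\<in>S. \<forall>h. norm (f' n y h - g' y h) \<le> \<epsilon> * norm h" if e: "\<epsilon> > 0" for \<epsilon>
  proof -
    from unif[OF e] obtain N where
      N: "\<And>m n y h. m \<ge> N \<Longrightarrow> n \<ge> N \<Longrightarrow> y \<in> S \<Longrightarrow> norm (f' m y h - f' n y h) \<le> \<epsilon> * norm h" by blast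
    have "norm (f' n y h - g' y h) \<le> \<epsilon> * norm h" if "n \<ge> N" "y \<in> S" for n y h
    proof (rule LIMSEQ_le_const2)
      show "(\<lambda>m. norm (f' n y h - f' m y h)) \<longlonglongrightarrow> norm (f' n y h - g' y h)"
        by (intro tendsto_norm tendsto_diff tendsto_const lim' that)
      show "\<exists>N. \<forall>m\<ge>N. norm (f' n y h - f' m y h) \<le> \<epsilon> * norm h" using N that by blast
    qed
    then show ?thesis by blast
  qed
  have conv: "convergent (\<lambda>n. s n x)" for x
  proof -
    have "Cauchy (\<lambda>n. s n x)"
    proof (rule metric_CauchyI)
      fix e :: real assume e: "0 < e"
      then obtain N where N: "\<And>m n. m \<ge> N \<Longrightarrow> n \<ge> N \<Longrightarrow> jnorm (\<lambda>y. s m y - s n y) x \<le> e / 2"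
        using cauchy[of "e/2"] by (meson half_gt_zero)
      have "dist (s m x) (s n x) < e" if "m \<ge> N" "n \<ge> N" for m n
        using N[OF that] norm_le_jnorm[of "\<lambda>y. s m y - s n y" x] e by (simp add: dist_norm)
      then show "\<exists>N. \<forall>m\<ge>N. \<forall>n\<ge>N. dist (s m x) (s n x) < e" by blast
    qed
    then show ?thesis by (rule Cauchy_convergent)
  qed
  define t where "t x = lim (\<lambda>n. s n x)" for x
  have lim: "(\<lambda>n. s n x) \<longlonglongrightarrow> t x" for x
    unfolding t_def using conv[of x] by (simp add: convergent_LIMSEQ_iff)
  have "\<exists>g. \<forall>y\<in>S. (\<lambda>n. (s n \<circ> par c) y) \<longlonglongrightarrow> g y \<and> (g has_derivative g' y) (at y within S)"
  proof (rule has_derivative_sequence)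
    show "convex S" by (simp add: S_def)
    show "((s n \<circ> par c) has_derivative f' n y) (at y within S)" if "y \<in> S" for n y
      by (rule has_derivative_at_withinI[OF der[OF that]])
    show "\<forall>\<^sub>F n in sequentially. \<forall>y\<in>S. \<forall>h. norm (f' n y h - g' y h) \<le> e * norm h" if "0 < e" for e
      using unif'[OF that] by (simp add: eventually_sequentially)
    show "crd c p \<in> S" using r by (simp add: S_def)
    show "(\<lambda>n. (s n \<circ> par c) (crd c p)) \<longlonglongrightarrow> t (par c (crd c p))" using lim by simp
  qed
  then obtain g where g: "\<And>y. y \<in> S \<Longrightarrow> (\<lambda>n. (s n \<circ> par c) y) \<longlonglongrightarrow> g y"
    "\<And>y. y \<in> S \<Longrightarrow> (g has_derivative g' y) (at y within S)" by blast
  have gt: "g y = (t \<circ> par c) y" if "y \<in> S" for y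
    using LIMSEQ_unique[OF g(1)[OF that]] lim by simp
  have opS: "open S" by (simp add: S_def)
  have dt: "((t \<circ> par c) has_derivative g' y) (at y)" if "y \<in> S" for y
  proof (rule has_derivative_transform_within_open[OF _ opS that gt])
    show "(g has_derivative g' y) (at y)" using g(2)[OF that] at_within_open[OF that opS] by simp
  qed
  define V where "V = par c ` S"
  have Vd: "V \<subseteq> dom c" using SW W(3) by (auto simp: V_def)
  have opV: "open V" unfolding V_def using Sc r by (intro par_open_image c opS) auto
  have crdV: "crd c x \<in> S" if "x \<in> V" for x using that cp by (auto simp: V_def)
  have pV: "p \<in> V" unfolding V_def S_def using c r by (intro image_eqI[of _ _ "crd c p"]) auto
  have contV: "continuous_on V (\<lambda>x. g' (crd c x) v)" for v
  proof (rule uniform_limit_theorem)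
    show "uniform_limit V (\<lambda>n x. dcoeff c (s n) x v) (\<lambda>x. g' (crd c x) v) sequentially"
      unfolding uniform_limit_iff
    proof (intro allI impI)
      fix e :: real assume e: "0 < e"
      then have "e / (2 * (1 + norm v)) > 0" by (intro divide_pos_pos) (auto simp: add_pos_nonneg)
      from unif'[OF this] obtain N where
        N: "\<And>n y. n \<ge> N \<Longrightarrow> y \<in> S \<Longrightarrow> norm (f' n y v - g' y v) \<le> e / (2 * (1 + norm v)) * norm v" by blast
      have "e / (2 * (1 + norm v)) * norm v < e"
      proof -
        have "norm v < 2 * (1 + norm v)" by (rule less_twice_one_plus) simp
        then show ?thesis using e by (simp add: divide_less_eq add_pos_nonneg)
      qed
      then have "dist (dcoeff c (s n) x v) (g' (crd c x) v) < e" if "n \<ge> N" "x \<in> V" for n x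
        using N[OF that(1) crdV[OF that(2)]] that(2) Vd c(1)
        by (auto simp: dist_norm f'_def subset_iff)
      then show "\<forall>\<^sub>F n in sequentially. \<forall>x\<in>V. dist (dcoeff c (s n) x v) (g' (crd c x) v) < e"
        by (auto simp: eventually_sequentially)
    qed
    show "\<forall>\<^sub>F n in sequentially. continuous_on V (\<lambda>x. dcoeff c (s n) x v)"
      using C1_inD(2)[OF C10_C1[OF s] c(1)] Vd continuous_on_subset by (intro always_eventually allI) blast
  qed simp
  have dtx: "((t \<circ> par c) has_derivative g' (crd c x)) (at (crd c x))" if "x \<in> V" for x
    by (rule dt[OF crdV[OF that]])
  have tC1: "C1_in V t"
    by (rule C1_in_chart[OF c(1) opV Vd dtx contV])
  have "(\<lambda>n. jet (s n) x i) \<longlonglongrightarrow> jet t x i" if "x \<in> V" "i \<in> jets" for x i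
  proof (cases i)
    case None
    then show ?thesis using lim by (simp add: jet_def)
  next
    case (Some b)
    have xd: "x \<in> dom c" using that Vd by blast
    have "dcoeff c t x = g' (crd c x)" by (rule dcoeff_eqI[OF dtx[OF that(1)]])
    moreover have "(\<lambda>n. f' n (crd c x) (cframe c x b)) \<longlonglongrightarrow> g' (crd c x) (cframe c x b)"
      by (rule lim'[OF crdV[OF that(1)]])
    ultimately show ?thesis
      using xd c(1) by (simp add: Some jet_chart[OF c(1) xd df] jet_chart[OF c(1) xd C1_in_diffble[OF tC1 that(1)]] f'_def)
  qed
  then show ?thesis using opV pV tC1 unfolding t_def by blast
qed

text \<open>Being of class C^1 is local. Vanishing at infinity is inherited from a single
  approximant \<open>s N\<close>, since all later ones differ from it by little in
  \<open>jnorm\<close>, uniformly in the point.\<close>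

lemma C10_complete:
  fixes s :: "nat \<Rightarrow> 'm \<Rightarrow> 'h::complex_hilbert"
  assumes s: "\<And>n. s n \<in> C10_maps M"
    and cauchy: "\<And>\<epsilon>. \<epsilon> > 0 \<Longrightarrow> \<exists>N. \<forall>m\<ge>N. \<forall>n\<ge>N. \<forall>x. jnorm (\<lambda>y. s m y - s n y) x \<le> \<epsilon>"
  shows "(\<lambda>x. lim (\<lambda>n. s n x)) \<in> C10_maps M" and "(\<lambda>n. s n x) \<longlonglongrightarrow> lim (\<lambda>n. s n x)"
proof -
  let ?t = "\<lambda>x. lim (\<lambda>n. s n x)"
  note loc = C10_local_limit[OF s cauchy]
  have t: "C1_in UNIV ?t"
    by (rule C1_in_local) (use loc in blast)
  have jl: "(\<lambda>n. jet (s n) x i) \<longlonglongrightarrow> jet ?t x i" if "i \<in> jets" for x i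
    using loc[of x] that by blast
  show "(\<lambda>n. s n x) \<longlonglongrightarrow> ?t x" using jl[of None x] by (simp add: jets_def jet_def)
  show "?t \<in> C10_maps M"
    unfolding C10_iff
  proof (intro conjI t allI impI)
    fix \<epsilon> :: real assume e: "\<epsilon> > 0"
    then obtain N where N: "\<And>m n x. m \<ge> N \<Longrightarrow> n \<ge> N \<Longrightarrow> jnorm (\<lambda>y. s m y - s n y) x \<le> \<epsilon> / 3"
      using cauchy[of "\<epsilon>/3"] by auto
    obtain K where K: "compact K" "\<And>x. x \<notin> K \<Longrightarrow> jnorm (s N) x < \<epsilon> / 3"
      using C10_vanish[OF s, of "\<epsilon> / 3" N] e by auto
    have "jnorm ?t x < \<epsilon>" if "x \<notin> K" for x
    proof -
      have "jnorm (s n) x \<le> 2 * \<epsilon> / 3" if "n \<ge> N" for n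
      proof -
        have "jnorm (\<lambda>y. s N y + (s n y - s N y)) x \<le> jnorm (s N) x + jnorm (\<lambda>y. s n y - s N y) x"
          by (intro jnorm_add diffble_diff C10_diffble s)
        then show ?thesis using N[OF that order_refl, of x] K(2)[OF \<open>x \<notin> K\<close>] by simp
      qed
      then have "jnorm ?t x \<le> 2 * \<epsilon> / 3"
        by (intro LIMSEQ_le_const2[OF jnorm_tendsto[of s x ?t]] jl) auto
      then show ?thesis using e by simp
    qed
    then show "\<exists>K. compact K \<and> (\<forall>x. x \<notin> K \<longrightarrow> jnorm ?t x < \<epsilon>)" using K(1) by blast
  qed
qed

context
  fixes e :: "nat \<Rightarrow> 'h::complex_hilbert"
  assumes onb: "orthonormal_basis e"
begin

section \<open>Partial sums and coefficients along an orthonormal basis\<close>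

definition cut :: "nat \<Rightarrow> (nat \<Rightarrow> 'm \<Rightarrow> complex) \<Rightarrow> 'm \<Rightarrow> 'h" where
  "cut K f x = (\<Sum>k<K. f k x *\<^sub>C e k)"

definition coef :: "('m \<Rightarrow> 'h) \<Rightarrow> nat \<Rightarrow> 'm \<Rightarrow> complex" where
  "coef s k x = cinner (e k) (s x)"

lemma coef_C10: "s \<in> C10_maps M \<Longrightarrow> coef s k \<in> C10_maps M"
  unfolding coef_def[abs_def] by (rule C10_linear[OF bounded_linear_cinner_right])

lemma cut_C10: "(\<And>k. f k \<in> C10_maps M) \<Longrightarrow> cut K f \<in> C10_maps M"
  unfolding cut_def[abs_def]
  by (intro C10_sum C10_linear[OF bounded_linear_scaleC_left]) auto

lemma jet_coef: "diffble s x \<Longrightarrow> jet (coef s k) x i = cinner (e k) (jet s x i)"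
  unfolding coef_def[abs_def] by (rule jet_linear[OF bounded_linear_cinner_right])

lemma jet_cut:
  assumes "\<And>k. diffble (f k) x"
  shows "diffble (cut K f) x" "jet (cut K f) x i = (\<Sum>k<K. jet (f k) x i *\<^sub>C e k)"
  unfolding cut_def[abs_def] using assms jet_sum[of "{..<K}" "\<lambda>k y. f k y *\<^sub>C e k" x]
  by (simp_all add: diffble_linear[OF bounded_linear_scaleC_left] jet_linear[OF bounded_linear_scaleC_left])

text \<open>Pythagoras in every component of the jet. It identifies the column norm of the entries
  \<open>K \<le> k < L\<close> with the jet norm of one \<open>'h\<close>-valued map.\<close>

lemma jnorm_cut_diff:
  assumes f: "\<And>k. diffble (f k) x" and KL: "K \<le> L"
  shows "(jnorm (\<lambda>y. cut L f y - cut K f y) x)\<^sup>2 = (\<Sum>k\<in>{K..<L}. (jnorm (f k) x)\<^sup>2)"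
proof -
  have "(jnorm (\<lambda>y. cut L f y - cut K f y) x)\<^sup>2 = (\<Sum>i\<in>jets. (norm (\<Sum>k\<in>{K..<L}. jet (f k) x i *\<^sub>C e k))\<^sup>2)"
    unfolding jnorm_sq_sum
  proof (intro sum.cong refl)
    fix i
    have "(\<Sum>k<L. jet (f k) x i *\<^sub>C e k) - (\<Sum>k<K. jet (f k) x i *\<^sub>C e k) = (\<Sum>k\<in>{K..<L}. jet (f k) x i *\<^sub>C e k)"
      using sum_diff_nat_ivl[of 0 K L "\<lambda>k. jet (f k) x i *\<^sub>C e k"] KL by (simp add: atLeast0LessThan)
    then show "(norm (jet (\<lambda>y. cut L f y - cut K f y) x i))\<^sup>2 = (norm (\<Sum>k\<in>{K..<L}. jet (f k) x i *\<^sub>C e k))\<^sup>2"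
      using f by (simp add: jet_diff jet_cut)
  qed
  also have "\<dots> = (\<Sum>i\<in>jets. \<Sum>k\<in>{K..<L}. (norm (jet (f k) x i))\<^sup>2)"
    by (intro sum.cong refl norm_sum_onb[OF onb]) simp
  also have "\<dots> = (\<Sum>k\<in>{K..<L}. (jnorm (f k) x)\<^sup>2)"
    unfolding jnorm_sq_sum by (rule sum.swap)
  finally show ?thesis .
qed

text \<open>Membership in the abstract completion turns into a Cauchy condition for
  \<open>'h\<close>-valued maps, to which \<open>C10_complete\<close> applies.\<close>

lemma std_columns_iff:
  "f \<in> std_columns M \<longleftrightarrow> (\<forall>k. f k \<in> C10_maps M) \<and>
    (\<forall>\<epsilon>>0. \<exists>N. \<forall>m\<ge>N. \<forall>n\<ge>N. \<forall>x. jnorm (\<lambda>y. cut m f y - cut n f y) x \<le> \<epsilon>)"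
proof -
  have "(\<forall>\<epsilon>>0. \<exists>K0. \<forall>K L. K0 \<le> K \<and> K \<le> L \<longrightarrow> norm1 M {K..<L} 1 (\<lambda>k _. f k) < \<epsilon>) \<longleftrightarrow>
      (\<forall>\<epsilon>>0. \<exists>N. \<forall>m\<ge>N. \<forall>n\<ge>N. \<forall>x. jnorm (\<lambda>y. cut m f y - cut n f y) x \<le> \<epsilon>)" (is "?A \<longleftrightarrow> ?B")
    if f: "\<forall>k. f k \<in> C10_maps M"
  proof -
    have df: "diffble (f k) x" for k x using f C10_diffble by blast
    have iff: "norm1 M {K..<L} 1 (\<lambda>k _. f k) \<le> C \<longleftrightarrow> (\<forall>x. jnorm (\<lambda>y. cut L f y - cut K f y) x \<le> C)"
      if "K \<le> L" "0 \<le> C" for K L C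
    proof -
      have "norm1 M {K..<L} 1 (\<lambda>k _. f k) \<le> C \<longleftrightarrow> (\<forall>x. (\<Sum>k\<in>{K..<L}. (jnorm (f k) x)\<^sup>2) \<le> C\<^sup>2)"
        using f by (intro norm1_column_le_iff[OF _ _ that(2)]) auto
      also have "\<dots> \<longleftrightarrow> (\<forall>x. (jnorm (\<lambda>y. cut L f y - cut K f y) x)\<^sup>2 \<le> C\<^sup>2)"
        by (simp only: jnorm_cut_diff[OF df that(1)])
      also have "\<dots> \<longleftrightarrow> (\<forall>x. jnorm (\<lambda>y. cut L f y - cut K f y) x \<le> C)"
        using that(2) by (simp add: power2_le_iff_abs_le jnorm_nonneg)
      finally show ?thesis .
    qed
    show ?thesis
    proof
      assume A: ?A
      show ?B
      proof (intro allI impI)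
        fix \<epsilon> :: real assume e: "\<epsilon> > 0"
        then obtain K0 where K0: "\<And>K L. K0 \<le> K \<Longrightarrow> K \<le> L \<Longrightarrow> norm1 M {K..<L} 1 (\<lambda>k _. f k) < \<epsilon>"
          using A by blast
        have 1: "jnorm (\<lambda>y. cut L f y - cut K f y) x \<le> \<epsilon>" if "K0 \<le> K" "K \<le> L" for K L x
          using iff[OF that(2), of \<epsilon>] K0[OF that] e by auto
        have "jnorm (\<lambda>y. cut m f y - cut n f y) x \<le> \<epsilon>" if "m \<ge> K0" "n \<ge> K0" for m n x
        proof (cases "n \<le> m")
          case True
          then show ?thesis using 1 that by blast
        next
          case False
          then have "jnorm (\<lambda>y. cut n f y - cut m f y) x \<le> \<epsilon>" using 1 that by simp
          then show ?thesis by (subst jnorm_minus_commute) (simp_all add: jet_cut df)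
        qed
        then show "\<exists>N. \<forall>m\<ge>N. \<forall>n\<ge>N. \<forall>x. jnorm (\<lambda>y. cut m f y - cut n f y) x \<le> \<epsilon>" by blast
      qed
    next
      assume B: ?B
      show ?A
      proof (intro allI impI)
        fix \<epsilon> :: real assume e: "\<epsilon> > 0"
        then obtain N where N: "\<And>m n x. m \<ge> N \<Longrightarrow> n \<ge> N \<Longrightarrow> jnorm (\<lambda>y. cut m f y - cut n f y) x \<le> \<epsilon>/2"
          using B[rule_format, of "\<epsilon>/2"] by auto
        have "norm1 M {K..<L} 1 (\<lambda>k _. f k) < \<epsilon>" if "N \<le> K" "K \<le> L" for K L
        proof -
          have "norm1 M {K..<L} 1 (\<lambda>k _. f k) \<le> \<epsilon>/2"
            using iff[OF that(2), of "\<epsilon>/2"] N that e by auto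
          then show ?thesis using e by linarith
        qed
        then show "\<exists>K0. \<forall>K L. K0 \<le> K \<and> K \<le> L \<longrightarrow> norm1 M {K..<L} 1 (\<lambda>k _. f k) < \<epsilon>" by blast
      qed
    qed
  qed
  then show ?thesis unfolding std_columns_def mem_Collect_eq by blast
qed

lemma column_sum_C10:
  assumes f: "f \<in> std_columns M"
  shows "column_sum e f \<in> C10_maps M" "(\<lambda>k. f k x *\<^sub>C e k) sums column_sum e f x"
    and "coef (column_sum e f) = f"
proof -
  have fC: "\<And>k. f k \<in> C10_maps M"
    and ca: "\<And>\<epsilon>. \<epsilon> > 0 \<Longrightarrow> \<exists>N. \<forall>m\<ge>N. \<forall>n\<ge>N. \<forall>x. jnorm (\<lambda>y. cut m f y - cut n f y) x \<le> \<epsilon>"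
    using f unfolding std_columns_iff by blast+
  note lim = C10_complete[of "\<lambda>n. cut n f", OF cut_C10[OF fC] ca]
  have *: "(\<lambda>k. f k x *\<^sub>C e k) sums lim (\<lambda>n. cut n f x)" for x
    using lim(2)[of x] by (simp add: sums_def cut_def)
  then have cs: "column_sum e f = (\<lambda>x. lim (\<lambda>n. cut n f x))"
    unfolding column_sum_def[abs_def] by (intro ext sums_unique[symmetric])
  show "column_sum e f \<in> C10_maps M" unfolding cs by (rule lim(1))
  show sm: "(\<lambda>k. f k x *\<^sub>C e k) sums column_sum e f x" for x unfolding cs by (rule *)
  show "coef (column_sum e f) = f"
    unfolding coef_def using cinner_onb_sums[OF onb sm] by (intro ext) simp
qed

lemma column_sum_coef: "column_sum e (coef s) = s"
  unfolding column_sum_def coef_def by (intro ext sums_unique[OF onb_sums[OF onb], symmetric])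

lemma jet_cut_coef: "diffble s x \<Longrightarrow> jet (cut K (coef s)) x i = proj e K (jet s x i)"
  unfolding proj_def
  by (subst jet_cut(2)) (simp_all add: jet_coef, simp add: coef_def[abs_def] diffble_linear[OF bounded_linear_cinner_right])

lemma diffble_coef: "diffble s x \<Longrightarrow> diffble (coef s k) x"
  unfolding coef_def[abs_def] by (rule diffble_linear[OF bounded_linear_cinner_right])

text \<open>The complementary projections are contractions, so the tail of a jet at \<open>x\<close>
  is at most the tail at \<open>p\<close> plus the distance of the two jets. By continuity one index
  \<open>N\<close> therefore serves a whole neighbourhood.\<close>

lemma cut_coef_local_tail:
  assumes s: "C1_in UNIV s" and e: "\<epsilon> > 0"
  shows "\<exists>V N. open V \<and> p \<in> V \<and> (\<forall>x\<in>V. \<forall>K\<ge>N. jnorm (\<lambda>y. s y - cut K (coef s) y) x \<le> \<epsilon>)"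
proof -
  obtain c where c: "c \<in> atlas M" "p \<in> dom c" using ex_chart by blast
  obtain W A where W: "open W" "p \<in> W" "W \<subseteq> dom c" "A \<ge> 1" and
    A: "\<And>s x. x \<in> W \<Longrightarrow> diffble s x \<Longrightarrow> jnorm (s :: 'm \<Rightarrow> 'h) x \<le> A * (norm (s x) + (\<Sum>b\<in>axes M. norm (dcoeff c s x b)))"
    by (rule jnorm_local_bound[OF c, where ?'h = 'h]) blast
  define u where "u x i = (case i of None \<Rightarrow> s x | Some b \<Rightarrow> dcoeff c s x b)" for x and i :: "'e option"
  have cont: "continuous_on (dom c) (\<lambda>x. u x i)" for i
    using C1_in_continuous_on[OF s] C1_inD(2)[OF s c(1)] unfolding u_def
    by (cases i) (auto intro: continuous_on_subset)
  \<comment> \<open>The divisor collects \<open>A\<close> from the comparison of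
    \<open>jnorm\<close> with coordinates, 2 from the two parts of each tail, and a bound for the
    number of jet components.\<close>
  define \<delta> where "\<delta> = \<epsilon> / (A * 2 * (1 + real (card jets)))"
  have d: "\<delta> > 0" unfolding \<delta>_def using e W(4) by (intro divide_pos_pos mult_pos_pos) auto
  have "\<forall>i. \<exists>N. \<forall>K\<ge>N. norm (u p i - proj e K (u p i)) < \<delta>"
    using tail_tendsto[OF onb] d by (auto simp: LIMSEQ_iff)
  then obtain Ni where Ni: "\<And>i K. K \<ge> Ni i \<Longrightarrow> norm (u p i - proj e K (u p i)) < \<delta>" by metis
  define N where "N = Max (Ni ` jets)"
  have N: "norm (u p i - proj e K (u p i)) < \<delta>" if "i \<in> jets" "K \<ge> N" for i K
  proof -
    have "Ni i \<le> N" using that(1) by (simp add: N_def)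
    then show ?thesis using Ni that(2) order_trans by blast
  qed
  define V where "V = W \<inter> (\<Inter>i\<in>jets. dom c \<inter> (\<lambda>x. u x i) -` ball (u p i) \<delta>)"
  have "open (dom c \<inter> (\<lambda>x. u x i) -` ball (u p i) \<delta>)" for i
    by (rule continuous_open_preimage[OF cont chart_open[OF c(1)] open_ball])
  then have opV: "open V" unfolding V_def using W by (intro open_Int open_INT) auto
  have pV: "p \<in> V" using W c d by (auto simp: V_def)
  have "jnorm (\<lambda>y. s y - cut K (coef s) y) x \<le> \<epsilon>" if x: "x \<in> V" and K: "K \<ge> N" for x K
  proof -
    have xW: "x \<in> W" and xd: "x \<in> dom c" using x W by (auto simp: V_def)
    have ds: "diffble s y" for y by (rule C1_in_diffble[OF s]) simp
    have dcut: "diffble (cut K (coef s)) y" for y by (intro jet_cut diffble_coef ds)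
    have dcs: "diff_at_chart c s x" using diffble_chart[OF c(1) xd] ds by blast
    have t: "norm (u x i - proj e K (u x i)) \<le> 2 * \<delta>" if i: "i \<in> jets" for i
    proof -
      have "u x i \<in> ball (u p i) \<delta>" using x i unfolding V_def by blast
      then have "norm (u x i - u p i) < \<delta>" by (simp add: dist_norm norm_minus_commute)
      \<comment> \<open>Tail at \<open>p\<close> plus tail of the increment. The first is small by
        the choice of \<open>N\<close>, the second because the increment itself is small.\<close>
      moreover have eq: "u x i - proj e K (u x i) = (u p i - proj e K (u p i)) + ((u x i - u p i) - proj e K (u x i - u p i))"
        by (simp add: proj_diff)
      moreover have "norm ((u x i - u p i) - proj e K (u x i - u p i)) \<le> norm (u x i - u p i)"
        by (rule norm_diff_proj_le[OF onb])
      ultimately show ?thesis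
        using N[OF i K] unfolding eq by (intro order_trans[OF norm_triangle_ineq]) linarith
    qed
    have dcc: "dcoeff c (\<lambda>y. s y - cut K (coef s) y) x b = dcoeff c s x b - proj e K (dcoeff c s x b)" for b
    proof -
      have bl: "bounded_linear (\<lambda>v. v - proj e K v)"
        unfolding proj_def
        by (intro bounded_linear_sub bounded_linear_ident bounded_linear_sum
            bounded_linear_compose[OF bounded_linear_scaleC_left] bounded_linear_cinner_right)
      show ?thesis using has_derivative_dcoeff_linear(2)[OF bl dcs, of b] by (simp add: cut_def coef_def proj_def)
    qed
    have "jnorm (\<lambda>y. s y - cut K (coef s) y) x \<le> A * (norm (s x - cut K (coef s) x) + (\<Sum>b\<in>axes M. norm (dcoeff c (\<lambda>y. s y - cut K (coef s) y) x b)))"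
      by (rule A[OF xW diffble_diff[OF ds dcut]])
    also have "\<dots> = A * (\<Sum>i\<in>jets. norm (u x i - proj e K (u x i)))"
      by (simp add: sum_jets u_def dcc) (simp add: cut_def coef_def proj_def)
    also have "\<dots> \<le> A * (\<Sum>i\<in>jets. 2 * \<delta>)"
      using W(4) by (intro mult_left_mono sum_mono t) auto
    also have "\<dots> = A * 2 * real (card jets) * \<delta>" by simp
    also have "\<dots> \<le> A * 2 * (1 + real (card jets)) * \<delta>"
      using W(4) d by (intro mult_right_mono mult_left_mono) auto
    also have "\<dots> = \<epsilon>" unfolding \<delta>_def using W(4) by (simp add: add_pos_nonneg less_imp_neq[symmetric])
    finally show ?thesis .
  qed
  then show ?thesis using opV pV by blast
qed

lemma jnorm_cut_coef_le:
  assumes "diffble s x"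
  shows "jnorm (\<lambda>y. s y - cut K (coef s) y) x \<le> jnorm s x" "jnorm (cut K (coef s)) x \<le> jnorm s x"
  using assms
  by (intro jnorm_mono, simp add: jet_diff jet_cut(1) diffble_coef jet_cut_coef norm_diff_proj_le[OF onb] norm_proj_le[OF onb])+

text \<open>Where the jet of \<open>s\<close> is already small, so are all tails, by contractivity.
  This leaves a compact set, on which finitely many of the local indices suffice.\<close>

lemma cut_coef_tail:
  assumes s: "s \<in> C10_maps M" and e: "\<epsilon> > 0"
  shows "\<exists>N. \<forall>K\<ge>N. \<forall>x. jnorm (\<lambda>y. s y - cut K (coef s) y) x \<le> \<epsilon>"
proof -
  obtain C where C: "compact C" "\<And>x. x \<notin> C \<Longrightarrow> jnorm s x < \<epsilon>" using C10_vanish[OF s e] by blast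
  let ?P = "\<lambda>N x. \<forall>K\<ge>N. jnorm (\<lambda>y. s y - cut K (coef s) y) x \<le> \<epsilon>"
  \<comment> \<open>The number of terms required at \<open>x\<close>. It has no continuity, but it
    is locally bounded, which suffices on the compact set \<open>C\<close>.\<close>
  let ?f = "\<lambda>x. real (LEAST N. ?P N x)"
  have "\<exists>B. \<forall>x\<in>C. ?f x \<le> B"
  proof (rule compact_locally_bounded[OF C(1)])
    fix p
    obtain V N where V: "open V" "p \<in> V" "\<forall>x\<in>V. ?P N x"
      using cut_coef_local_tail[OF C10_C1[OF s] e] by blast
    then have "\<forall>x\<in>V. ?f x \<le> real N" by (simp add: Least_le)
    then show "\<exists>W B. open W \<and> p \<in> W \<and> (\<forall>x\<in>W. ?f x \<le> B)" using V by blast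
  qed
  then obtain B where B: "\<And>x. x \<in> C \<Longrightarrow> ?f x \<le> B" by blast
  obtain N where N: "B \<le> real N" using real_arch_simple by blast
  have "jnorm (\<lambda>y. s y - cut K (coef s) y) x \<le> \<epsilon>" if "K \<ge> N" for K x
  proof (cases "x \<in> C")
    case True
    obtain V N' where V: "x \<in> V" "\<forall>x\<in>V. ?P N' x"
      using cut_coef_local_tail[OF C10_C1[OF s] e, of x] by blast
    then have "?P N' x" by blast
    then have "?P (LEAST N. ?P N x) x" by (rule LeastI)
    moreover have "(LEAST N. ?P N x) \<le> K" using B[OF True] N that by linarith
    ultimately show ?thesis by blast
  next
    case False
    then show ?thesis using C(2) jnorm_cut_coef_le(1)[OF C10_diffble[OF s]] by (meson less_imp_le order_trans)
  qed
  then show ?thesis by blast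
qed

lemma coef_std:
  assumes s: "s \<in> C10_maps M"
  shows "coef s \<in> std_columns M"
  unfolding std_columns_iff
proof (intro conjI allI impI coef_C10[OF s])
  fix \<epsilon> :: real assume e: "\<epsilon> > 0"
  then obtain N where N: "\<And>K x. K \<ge> N \<Longrightarrow> jnorm (\<lambda>y. s y - cut K (coef s) y) x \<le> \<epsilon>/2"
    using cut_coef_tail[OF s, of "\<epsilon>/2"] by auto
  have "jnorm (\<lambda>y. cut m (coef s) y - cut n (coef s) y) x \<le> \<epsilon>" if "m \<ge> N" "n \<ge> N" for m n x
  proof -
    have d: "diffble s x" "diffble (cut K (coef s)) x" for K
      using C10_diffble[OF s] by (auto intro!: jet_cut(1) diffble_coef)
    have "jnorm (\<lambda>y. (s y - cut n (coef s) y) + (cut m (coef s) y - s y)) x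
        \<le> jnorm (\<lambda>y. s y - cut n (coef s) y) x + jnorm (\<lambda>y. cut m (coef s) y - s y) x"
      by (intro jnorm_add diffble_diff d)
    also have "jnorm (\<lambda>y. cut m (coef s) y - s y) x = jnorm (\<lambda>y. s y - cut m (coef s) y) x"
      by (rule jnorm_minus_commute[OF d(2,1)])
    finally show ?thesis using N[OF that(1), of x] N[OF that(2), of x] by simp
  qed
  then show "\<exists>N. \<forall>m\<ge>N. \<forall>n\<ge>N. \<forall>x. jnorm (\<lambda>y. cut m (coef s) y - cut n (coef s) y) x \<le> \<epsilon>" by blast
qed

section \<open>The isomorphism of the column module with the module of maps\<close>

lemma bij_betw_column_sum: "bij_betw (column_sum e) (std_columns M) (C10_maps M)"
  by (rule bij_betw_byWitness[where f' = coef]) (auto simp: column_sum_C10 column_sum_coef coef_std)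

text \<open>Closure of \<open>std_columns M\<close> under the operations is read off on the other
  side: the resulting column is the coefficient sequence of a map in \<open>C10_maps M\<close>. The
  lemmas on scalars and on the action follow the same pattern.\<close>

lemma column_sum_add:
  assumes "f \<in> std_columns M" "g \<in> std_columns M"
  shows "column_sum e (\<lambda>k x. f k x + g k x) = (\<lambda>x. column_sum e f x + column_sum e g x)"
    "(\<lambda>k x. f k x + g k x) \<in> std_columns M"
proof -
  have *: "(\<lambda>k x. f k x + g k x) = coef (\<lambda>x. column_sum e f x + column_sum e g x)"
    using assms[THEN column_sum_C10(3)] by (simp add: coef_def cinner_add_right fun_eq_iff)
  show "column_sum e (\<lambda>k x. f k x + g k x) = (\<lambda>x. column_sum e f x + column_sum e g x)"
    unfolding * by (rule column_sum_coef)
  show "(\<lambda>k x. f k x + g k x) \<in> std_columns M"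
    unfolding * by (intro coef_std C10_add column_sum_C10 assms)
qed

lemma column_sum_scaleC:
  assumes "f \<in> std_columns M"
  shows "column_sum e (\<lambda>k x. c * f k x) = (\<lambda>x. c *\<^sub>C column_sum e f x)"
    "(\<lambda>k x. c * f k x) \<in> std_columns M"
proof -
  have *: "(\<lambda>k x. c * f k x) = coef (\<lambda>x. c *\<^sub>C column_sum e f x)"
    using assms[THEN column_sum_C10(3)] by (simp add: coef_def cinner_scaleC_right fun_eq_iff)
  show "column_sum e (\<lambda>k x. c * f k x) = (\<lambda>x. c *\<^sub>C column_sum e f x)"
    unfolding * by (rule column_sum_coef)
  show "(\<lambda>k x. c * f k x) \<in> std_columns M"
    unfolding * by (intro coef_std C10_scaleC column_sum_C10 assms)
qed

lemma column_sum_act: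
  assumes "f \<in> std_columns M" "a \<in> C10_maps M"
  shows "column_sum e (\<lambda>k x. f k x * a x) = (\<lambda>x. a x *\<^sub>C column_sum e f x)"
    "(\<lambda>k x. f k x * a x) \<in> std_columns M"
proof -
  have *: "(\<lambda>k x. f k x * a x) = coef (\<lambda>x. a x *\<^sub>C column_sum e f x)"
    using assms(1)[THEN column_sum_C10(3)] by (simp add: coef_def cinner_scaleC_right fun_eq_iff mult.commute)
  show "column_sum e (\<lambda>k x. f k x * a x) = (\<lambda>x. a x *\<^sub>C column_sum e f x)"
    unfolding * by (rule column_sum_coef)
  show "(\<lambda>k x. f k x * a x) \<in> std_columns M"
    unfolding * by (intro coef_std C10_act column_sum_C10 assms)
qed

lemma comb_sq_coef:
  assumes s: "\<And>i j. i < n \<Longrightarrow> j < n \<Longrightarrow> diffble (s i j) x"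
  shows "comb_sq ({..<n} \<times> {..<K}) n (\<lambda>(i, k) j. coef (s i j) k) v x =
    (\<Sum>i<n. (jnorm (cut K (coef (\<lambda>y. \<Sum>j<n. v j *\<^sub>C s i j y))) x)\<^sup>2)"
proof -
  have "comb_sq ({..<n} \<times> {..<K}) n (\<lambda>(i, k) j. coef (s i j) k) v x =
      (\<Sum>i<n. \<Sum>k<K. (jnorm (\<lambda>y. \<Sum>j<n. v j *\<^sub>C coef (s i j) k y) x)\<^sup>2)"
    unfolding comb_sq_def by (subst sum.cartesian_product') simp
  also have "\<dots> = (\<Sum>i<n. \<Sum>k<K. (jnorm (coef (\<lambda>y. \<Sum>j<n. v j *\<^sub>C s i j y) k) x)\<^sup>2)"
    by (simp add: coef_def[abs_def] cinner_sum_right cinner_scaleC_right scaleC_complex_def)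
  also have "\<dots> = (\<Sum>i<n. (jnorm (cut K (coef (\<lambda>y. \<Sum>j<n. v j *\<^sub>C s i j y))) x)\<^sup>2)"
  proof (intro sum.cong refl)
    fix i assume i: "i \<in> {..<n}"
    have d: "diffble (\<lambda>y. \<Sum>j<n. v j *\<^sub>C s i j y) x" using s i by (intro jet_comb) auto
    have "cut 0 (coef t) = (\<lambda>x. 0)" for t by (simp add: cut_def fun_eq_iff)
    then show "(\<Sum>k<K. (jnorm (coef (\<lambda>y. \<Sum>j<n. v j *\<^sub>C s i j y) k) x)\<^sup>2) =
        (jnorm (cut K (coef (\<lambda>y. \<Sum>j<n. v j *\<^sub>C s i j y))) x)\<^sup>2"
      using jnorm_cut_diff[of "coef (\<lambda>y. \<Sum>j<n. v j *\<^sub>C s i j y)" x 0 K] diffble_coef[OF d]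
      by (simp add: atLeast0LessThan)
  qed
  finally show ?thesis .
qed

text \<open>The truncated norms increase and are bounded by the full norm, so the limit in
  \<open>std_module\<close> exists and is their supremum. Equality with the full norm follows by
  letting \<open>K\<close> tend to infinity in the inequality that characterises the norm.\<close>

lemma mnorm_std_eq:
  assumes s: "\<And>i j. i < n \<Longrightarrow> j < n \<Longrightarrow> s i j \<in> C10_maps M"
  shows "(\<lambda>K. norm1 M ({..<n} \<times> {..<K}) n (\<lambda>(i, k) j. coef (s i j) k)) \<longlonglongrightarrow> norm1 M {..<n} n s"
proof -
  let ?N = "\<lambda>K. norm1 M ({..<n} \<times> {..<K}) n (\<lambda>(i, k) j. coef (s i j) k)"
  let ?t = "\<lambda>v i y. \<Sum>j<n. v j *\<^sub>C s i j y"
  have ds: "diffble (s i j) x" if "i < n" "j < n" for i j x using s[OF that] by (rule C10_diffble)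
  have dt: "diffble (?t v i) x" if "i < n" for v i x using ds that by (intro jet_comb) auto
  have C: "k \<in> {..<n} \<times> {..<K} \<Longrightarrow> j < n \<Longrightarrow> (case k of (i, k) \<Rightarrow> \<lambda>j. coef (s i j) k) j \<in> C10_maps M" for k K j
    using s coef_C10 by auto
  have le: "?N K \<le> C \<longleftrightarrow> (\<forall>x v. (\<Sum>i<n. (jnorm (cut K (coef (?t v i))) x)\<^sup>2) \<le> C\<^sup>2 * (\<Sum>j<n. (cmod (v j))\<^sup>2))"
    if "C \<ge> 0" for K C
    by (subst norm1_le_iff[OF _ C that]) (simp_all add: comb_sq_coef ds)
  have le': "norm1 M {..<n} n s \<le> C \<longleftrightarrow> (\<forall>x v. (\<Sum>i<n. (jnorm (?t v i) x)\<^sup>2) \<le> C\<^sup>2 * (\<Sum>j<n. (cmod (v j))\<^sup>2))"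
    if "C \<ge> 0" for C
    by (subst norm1_le_iff[OF _ _ that]) (simp_all add: s comb_sq_def)
  have nn: "0 \<le> ?N K" for K by (rule norm1_nonneg[OF _ C]) simp
  have nn': "0 \<le> norm1 M {..<n} n s" by (rule norm1_nonneg) (simp_all add: s)
  have up: "?N K \<le> norm1 M {..<n} n s" for K
    unfolding le[OF nn']
  proof (intro allI)
    fix x v
    have "(\<Sum>i<n. (jnorm (cut K (coef (?t v i))) x)\<^sup>2) \<le> (\<Sum>i<n. (jnorm (?t v i) x)\<^sup>2)"
      by (intro sum_mono power_mono jnorm_cut_coef_le dt jnorm_nonneg) auto
    also have "\<dots> \<le> (norm1 M {..<n} n s)\<^sup>2 * (\<Sum>j<n. (cmod (v j))\<^sup>2)" using le'[OF nn'] by blast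
    finally show "(\<Sum>i<n. (jnorm (cut K (coef (?t v i))) x)\<^sup>2) \<le> (norm1 M {..<n} n s)\<^sup>2 * (\<Sum>j<n. (cmod (v j))\<^sup>2)" .
  qed
  have bdd: "bdd_above (range ?N)" using up by (intro bdd_aboveI2)
  have inc: "incseq ?N"
  proof (rule incseq_SucI)
    fix K
    show "?N K \<le> ?N (Suc K)"
      unfolding le[OF nn]
    proof (intro allI)
      fix x v
      have "(\<Sum>i<n. (jnorm (cut K (coef (?t v i))) x)\<^sup>2) \<le> (\<Sum>i<n. (jnorm (cut (Suc K) (coef (?t v i))) x)\<^sup>2)"
      proof (intro sum_mono)
        fix i assume i: "i \<in> {..<n}"
        have d: "diffble (coef (?t v i) k) x" for k using i dt by (intro diffble_coef) auto
        have "cut 0 f = (\<lambda>x. 0)" for f by (simp add: cut_def fun_eq_iff)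
        then show "(jnorm (cut K (coef (?t v i))) x)\<^sup>2 \<le> (jnorm (cut (Suc K) (coef (?t v i))) x)\<^sup>2"
          using jnorm_cut_diff[OF d, of 0 K] jnorm_cut_diff[OF d, of 0 "Suc K"] by simp
      qed
      also have "\<dots> \<le> (?N (Suc K))\<^sup>2 * (\<Sum>j<n. (cmod (v j))\<^sup>2)" using le[OF nn, of "Suc K" "Suc K"] by blast
      finally show "(\<Sum>i<n. (jnorm (cut K (coef (?t v i))) x)\<^sup>2) \<le> (?N (Suc K))\<^sup>2 * (\<Sum>j<n. (cmod (v j))\<^sup>2)" .
    qed
  qed
  define S where "S = (SUP K. ?N K)"
  have "?N \<longlonglongrightarrow> S" unfolding S_def by (rule LIMSEQ_incseq_SUP[OF bdd inc])
  moreover have "S = norm1 M {..<n} n s"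
  proof (rule antisym)
    show "S \<le> norm1 M {..<n} n s" unfolding S_def using up by (intro cSUP_least) auto
    have NS: "?N K \<le> S" for K unfolding S_def using bdd by (rule cSUP_upper[OF UNIV_I])
    have S0: "0 \<le> S" using nn[of 0] NS[of 0] by linarith
    show "norm1 M {..<n} n s \<le> S"
      unfolding le'[OF S0]
    proof (intro allI)
      fix x v
      \<comment> \<open>With \<open>x\<close> and \<open>v\<close> fixed, pointwise convergence of
        the jets is enough. No uniformity is involved, because \<open>S\<close> bounds every
        truncation at every point.\<close>
      have "(\<lambda>K. \<Sum>i<n. (jnorm (cut K (coef (?t v i))) x)\<^sup>2) \<longlonglongrightarrow> (\<Sum>i<n. (jnorm (?t v i) x)\<^sup>2)"
        by (intro tendsto_sum tendsto_power jnorm_tendsto) (simp add: jet_cut_coef dt proj_tendsto[OF onb])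
      then show "(\<Sum>i<n. (jnorm (?t v i) x)\<^sup>2) \<le> S\<^sup>2 * (\<Sum>j<n. (cmod (v j))\<^sup>2)"
        by (rule LIMSEQ_le_const2) (use le[OF S0] NS in blast)
    qed
  qed
  ultimately show ?thesis by simp
qed

theorem module_iso_column_sum: "module_iso (std_module M) (maps_module M) (column_sum e)"
  unfolding module_iso_def module_map_def
proof (intro conjI ballI allI impI)
  fix f g assume f: "f \<in> elems (std_module M)" and g: "g \<in> elems (std_module M)"
  have f': "f \<in> std_columns M" and g': "g \<in> std_columns M" using f g by (simp_all add: std_module_def)
  show "column_sum e f \<in> elems (maps_module M)" using column_sum_C10(1)[OF f'] by (simp add: maps_module_def)
  show "column_sum e (add (std_module M) f g) = add (maps_module M) (column_sum e f) (column_sum e g)"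
    using column_sum_add(1)[OF f' g'] by (simp add: std_module_def maps_module_def)
  show "column_sum e (cscale (std_module M) c f) = cscale (maps_module M) c (column_sum e f)" for c
    using column_sum_scaleC(1)[OF f'] by (simp add: std_module_def maps_module_def)
  show "column_sum e (act (std_module M) f a) = act (maps_module M) (column_sum e f) a"
    if "a \<in> scalars (std_module M)" for a
    using column_sum_act(1)[OF f', of a] that by (simp add: std_module_def maps_module_def)
  show "form (maps_module M) (column_sum e f) (column_sum e g) = form (std_module M) f g"
    unfolding std_module_def maps_module_def op_module.simps
  proof
    fix x
    have "(\<lambda>k. cnj (f k x) * g k x) sums cinner (column_sum e f x) (column_sum e g x)"
      using cinner_sums[OF onb, of "column_sum e f x" "column_sum e g x"]
        fun_cong[OF fun_cong[OF column_sum_C10(3)[OF f']], of _ x] fun_cong[OF fun_cong[OF column_sum_C10(3)[OF g']], of _ x]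
      by (simp add: coef_def)
    then show "cinner (column_sum e f x) (column_sum e g x) = (\<Sum>k. cnj (f k x) * g k x)" by (rule sums_unique)
  qed
next
  show "scalars (std_module M) = scalars (maps_module M)" by (simp add: std_module_def maps_module_def)
  show "bij_betw (column_sum e) (elems (std_module M)) (elems (maps_module M))"
    using bij_betw_column_sum by (simp add: std_module_def maps_module_def)
next
  fix n and F :: "nat \<Rightarrow> nat \<Rightarrow> nat \<Rightarrow> 'm \<Rightarrow> complex"
  assume "\<forall>i<n. \<forall>j<n. F i j \<in> elems (std_module M)"
  then have F: "\<And>i j. i < n \<Longrightarrow> j < n \<Longrightarrow> F i j \<in> std_columns M" by (simp add: std_module_def)
  let ?s = "\<lambda>i j. column_sum e (F i j)"
  have eq: "norm1 M ({..<n} \<times> {..<K}) n (\<lambda>(i, k) j. F i j k) = norm1 M ({..<n} \<times> {..<K}) n (\<lambda>(i, k) j. coef (?s i j) k)" for K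
  proof -
    have "cmatrix_norm n (\<lambda>i j. \<Sum>k\<in>{..<n} \<times> {..<K}. jet_inner M ((case k of (i, k) \<Rightarrow> \<lambda>j. F i j k) i) ((case k of (i, k) \<Rightarrow> \<lambda>j. F i j k) j) x)
       = cmatrix_norm n (\<lambda>i j. \<Sum>k\<in>{..<n} \<times> {..<K}. jet_inner M ((case k of (i, k) \<Rightarrow> \<lambda>j. coef (?s i j) k) i) ((case k of (i, k) \<Rightarrow> \<lambda>j. coef (?s i j) k) j) x)" for x
      unfolding cmatrix_norm_def
      by (intro SUP_cong refl arg_cong[of _ _ sqrt] sum.cong arg_cong[of _ _ "\<lambda>z. (cmod z)\<^sup>2"] arg_cong2[of _ _ _ _ "(*)"])
        (auto simp: column_sum_C10(3)[OF F])
    then show ?thesis unfolding norm1_def by simp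
  qed
  have "(\<lambda>K. norm1 M ({..<n} \<times> {..<K}) n (\<lambda>(i, k) j. F i j k)) \<longlonglongrightarrow> norm1 M {..<n} n ?s"
    unfolding eq by (rule mnorm_std_eq) (rule column_sum_C10(1)[OF F])
  then show "mnorm (maps_module M) n (\<lambda>i j. column_sum e (F i j)) = mnorm (std_module M) n F"
    by (simp add: std_module_def maps_module_def limI)
qed

lemma std_module_closed:
  "f \<in> elems (std_module M) \<Longrightarrow> g \<in> elems (std_module M) \<Longrightarrow> add (std_module M) f g \<in> elems (std_module M)"
  "f \<in> elems (std_module M) \<Longrightarrow> cscale (std_module M) c f \<in> elems (std_module M)"
  "f \<in> elems (std_module M) \<Longrightarrow> a \<in> scalars (std_module M) \<Longrightarrow> act (std_module M) f a \<in> elems (std_module M)"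
  using column_sum_add(2) column_sum_scaleC(2) column_sum_act(2) by (simp_all add: std_module_def)

end

end

section \<open>Transport of endomorphisms\<close>

text \<open>In the record a matrix is a function on all pairs of indices. Composing an isomorphism
  with its inverse gives back only the entries that lie in the module, so the norm must not look
  beyond the \<open>n\<close> by \<open>n\<close> block.\<close>

definition mnorm_local :: "('m, 'x) op_module \<Rightarrow> bool" where
  "mnorm_local X \<longleftrightarrow> (\<forall>n s t. (\<forall>i<n. \<forall>j<n. s i j = t i j) \<longrightarrow> mnorm X n s = mnorm X n t)"

text \<open>The record imposes no closure. It is required for showing that the inverse of a module
  map respects the operations: both sides must lie where the map is injective.\<close>

definition closed_module :: "('m, 'x) op_module \<Rightarrow> bool" where
  "closed_module X \<longleftrightarrow> (\<forall>s\<in>elems X. \<forall>t\<in>elems X. add X s t \<in> elems X) \<and>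
    (\<forall>c. \<forall>s\<in>elems X. cscale X c s \<in> elems X) \<and> (\<forall>s\<in>elems X. \<forall>f\<in>scalars X. act X s f \<in> elems X)"

lemma module_map_elems: "module_map X Y u \<Longrightarrow> s \<in> elems X \<Longrightarrow> u s \<in> elems Y"
  by (simp add: module_map_def)

lemma module_iso_inverse:
  assumes iso: "module_iso X Y u" and X: "closed_module X" and Y: "mnorm_local Y"
  shows "module_iso Y X (inv_into (elems X) u)"
proof -
  let ?v = "inv_into (elems X) u"
  have bij: "bij_betw u (elems X) (elems Y)" and sc: "scalars X = scalars Y" and mm: "module_map X Y u"
    and frm: "\<And>s t. s \<in> elems X \<Longrightarrow> t \<in> elems X \<Longrightarrow> form Y (u s) (u t) = form X s t"
    and nrm: "\<And>n s. \<forall>i<n. \<forall>j<n. s i j \<in> elems X \<Longrightarrow> mnorm Y n (\<lambda>i j. u (s i j)) = mnorm X n s"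
    using iso unfolding module_iso_def by blast+
  have v: "?v s \<in> elems X" "u (?v s) = s" if "s \<in> elems Y" for s
    using bij that by (auto simp: bij_betw_def inv_into_into f_inv_into_f)
  have vu: "?v (u f) = f" if "f \<in> elems X" for f
    using bij that by (simp add: bij_betw_def)
  have "module_map Y X ?v"
    unfolding module_map_def
  proof (intro conjI ballI allI)
    fix s assume s: "s \<in> elems Y"
    show "?v s \<in> elems X" by (rule v[OF s])
    show "?v (add Y s t) = add X (?v s) (?v t)" if t: "t \<in> elems Y" for t
    proof -
      have "u (add X (?v s) (?v t)) = add Y s t"
        using mm v[OF s] v[OF t] by (simp add: module_map_def)
      moreover have "add X (?v s) (?v t) \<in> elems X" using X v[OF s] v[OF t] by (simp add: closed_module_def)
      ultimately show ?thesis using vu by metis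
    qed
    show "?v (cscale Y c s) = cscale X c (?v s)" for c
    proof -
      have "u (cscale X c (?v s)) = cscale Y c s" using mm v[OF s] by (simp add: module_map_def)
      moreover have "cscale X c (?v s) \<in> elems X" using X v[OF s] by (simp add: closed_module_def)
      ultimately show ?thesis using vu by metis
    qed
    show "?v (act Y s f) = act X (?v s) f" if f: "f \<in> scalars Y" for f
    proof -
      have "u (act X (?v s) f) = act Y s f" using mm v[OF s] f sc by (simp add: module_map_def)
      moreover have "act X (?v s) f \<in> elems X" using X v[OF s] f sc by (simp add: closed_module_def)
      ultimately show ?thesis using vu by metis
    qed
  qed
  moreover have "form X (?v s) (?v t) = form Y s t" if "s \<in> elems Y" "t \<in> elems Y" for s t
    using frm[OF v(1)[OF that(1)] v(1)[OF that(2)]] that by (simp add: v)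
  moreover have "mnorm X n (\<lambda>i j. ?v (s i j)) = mnorm Y n s" if "\<forall>i<n. \<forall>j<n. s i j \<in> elems Y" for n s
  proof -
    have "mnorm X n (\<lambda>i j. ?v (s i j)) = mnorm Y n (\<lambda>i j. u (?v (s i j)))"
      using nrm[of n "\<lambda>i j. ?v (s i j)"] that v(1) by simp
    also have "\<dots> = mnorm Y n s"
      using Y[unfolded mnorm_local_def, rule_format, of n "\<lambda>i j. u (?v (s i j))" s] that v(2) by simp
    finally show ?thesis .
  qed
  ultimately show ?thesis
    using sc bij_betw_inv_into[OF bij] unfolding module_iso_def by simp
qed

lemma transport_map:
  assumes iso: "module_iso X Y u" and X: "closed_module X" and Y: "mnorm_local Y" "closed_module Y"
    and \<beta>: "module_map X X \<beta>" "completely_bounded X \<beta>"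
  shows "module_map Y Y (transport X Y u \<beta>)" and "completely_bounded Y (transport X Y u \<beta>)"
proof -
  let ?v = "inv_into (elems X) u"
  note iso' = module_iso_inverse[OF iso X Y(1)]
  have sc: "scalars X = scalars Y" and mm: "module_map X Y u"
    and nrm: "\<And>n s. \<forall>i<n. \<forall>j<n. s i j \<in> elems X \<Longrightarrow> mnorm Y n (\<lambda>i j. u (s i j)) = mnorm X n s"
    using iso unfolding module_iso_def by blast+
  have mm': "module_map Y X ?v"
    and nrm': "\<And>n s. \<forall>i<n. \<forall>j<n. s i j \<in> elems Y \<Longrightarrow> mnorm X n (\<lambda>i j. ?v (s i j)) = mnorm Y n s"
    using iso' unfolding module_iso_def by blast+
  have v: "?v s \<in> elems X" "\<beta> (?v s) \<in> elems X" "u (\<beta> (?v s)) \<in> elems Y" if "s \<in> elems Y" for s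
    by (intro module_map_elems[OF mm] module_map_elems[OF \<beta>(1)] module_map_elems[OF mm'] that)+
  show "module_map Y Y (transport X Y u \<beta>)"
    unfolding module_map_def
  proof (intro conjI ballI allI)
    fix s assume s: "s \<in> elems Y"
    show "transport X Y u \<beta> s \<in> elems Y" using v(3) s by (simp add: transport_def)
    show "transport X Y u \<beta> (add Y s t) = add Y (transport X Y u \<beta> s) (transport X Y u \<beta> t)"
      if t: "t \<in> elems Y" for t
    proof -
      have "add Y s t \<in> elems Y" using Y(2) s t by (simp add: closed_module_def)
      then show ?thesis
        using mm mm' \<beta>(1) s t v[OF s] v[OF t] by (simp add: transport_def module_map_def)
    qed
    show "transport X Y u \<beta> (cscale Y c s) = cscale Y c (transport X Y u \<beta> s)" for c
    proof -
      have "cscale Y c s \<in> elems Y" using Y(2) s by (simp add: closed_module_def)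
      then show ?thesis using mm mm' \<beta>(1) s v[OF s] by (simp add: transport_def module_map_def)
    qed
    show "transport X Y u \<beta> (act Y s f) = act Y (transport X Y u \<beta> s) f" if f: "f \<in> scalars Y" for f
    proof -
      have "act Y s f \<in> elems Y" using Y(2) s f by (simp add: closed_module_def)
      then show ?thesis using mm mm' \<beta>(1) s v[OF s] f sc by (simp add: transport_def module_map_def)
    qed
  qed
  obtain C where C: "\<And>n s. \<forall>i<n. \<forall>j<n. s i j \<in> elems X \<Longrightarrow> mnorm X n (\<lambda>i j. \<beta> (s i j)) \<le> C * mnorm X n s"
    using \<beta>(2) unfolding completely_bounded_def by blast
  have "mnorm Y n (\<lambda>i j. transport X Y u \<beta> (s i j)) \<le> C * mnorm Y n s"
    if s: "\<forall>i<n. \<forall>j<n. s i j \<in> elems Y" for n s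
  proof -
    have "mnorm Y n (\<lambda>i j. transport X Y u \<beta> (s i j)) = mnorm Y n (\<lambda>i j. u (\<beta> (?v (s i j))))"
      by (rule Y(1)[unfolded mnorm_local_def, rule_format]) (use s in \<open>simp add: transport_def\<close>)
    also have "\<dots> = mnorm X n (\<lambda>i j. \<beta> (?v (s i j)))"
      using s v by (intro nrm) simp
    also have "\<dots> \<le> C * mnorm X n (\<lambda>i j. ?v (s i j))"
      using s v by (intro C) simp
    also have "mnorm X n (\<lambda>i j. ?v (s i j)) = mnorm Y n s" by (rule nrm'[OF s])
    finally show ?thesis .
  qed
  then show "completely_bounded Y (transport X Y u \<beta>)" unfolding completely_bounded_def by blast
qed

lemma transport_endomorphism:
  assumes iso: "module_iso X Y u" and X: "closed_module X" and Y: "mnorm_local Y" "closed_module Y"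
    and \<beta>: "\<beta> \<in> endomorphisms X"
  shows "transport X Y u \<beta> \<in> endomorphisms Y"
proof -
  let ?v = "inv_into (elems X) u"
  have \<beta>1: "module_map X X \<beta>" "completely_bounded X \<beta>" using \<beta> by (simp_all add: endomorphisms_def)
  obtain \<beta>' where \<beta>': "module_map X X \<beta>'" "completely_bounded X \<beta>'"
    "\<And>s t. s \<in> elems X \<Longrightarrow> t \<in> elems X \<Longrightarrow> form X (\<beta> s) t = form X s (\<beta>' t)"
    using \<beta> unfolding endomorphisms_def by blast
  have bij: "bij_betw u (elems X) (elems Y)"
    and frm: "\<And>s t. s \<in> elems X \<Longrightarrow> t \<in> elems X \<Longrightarrow> form Y (u s) (u t) = form X s t"
    using iso unfolding module_iso_def by blast+
  have v: "?v s \<in> elems X" "u (?v s) = s" if "s \<in> elems Y" for s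
    using bij that by (auto simp: bij_betw_def inv_into_into f_inv_into_f)
  have "form Y (transport X Y u \<beta> s) t = form Y s (transport X Y u \<beta>' t)"
    if s: "s \<in> elems Y" and t: "t \<in> elems Y" for s t
  proof -
    have "\<beta> (?v s) \<in> elems X" "\<beta>' (?v t) \<in> elems X"
      by (intro module_map_elems[OF \<beta>1(1)] module_map_elems[OF \<beta>'(1)] v s t)+
    then have "form Y (u (\<beta> (?v s))) (u (?v t)) = form Y (u (?v s)) (u (\<beta>' (?v t)))"
      using frm \<beta>'(3) v(1) s t by simp
    then show ?thesis using s t by (simp add: transport_def v(2))
  qed
  moreover have "transport X Y u \<beta> \<in> extensional (elems Y)" by (simp add: transport_def)
  ultimately show ?thesis
    using transport_map[OF iso X Y \<beta>1] transport_map[OF iso X Y \<beta>'(1,2)]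
    unfolding endomorphisms_def mem_Collect_eq by blast
qed

text \<open>Transport along the inverse isomorphism is the inverse. Endomorphisms are extensional,
  so they are compared on module elements only.\<close>

lemma bij_betw_transport:
  assumes iso: "module_iso X Y u" and X: "mnorm_local X" "closed_module X" and Y: "mnorm_local Y" "closed_module Y"
  shows "bij_betw (transport X Y u) (endomorphisms X) (endomorphisms Y)"
proof -
  let ?v = "inv_into (elems X) u"
  note iso' = module_iso_inverse[OF iso X(2) Y(1)]
  have bij: "bij_betw u (elems X) (elems Y)" using iso unfolding module_iso_def by blast
  have v: "?v s \<in> elems X" "u (?v s) = s" if "s \<in> elems Y" for s
    using bij that by (auto simp: bij_betw_def inv_into_into f_inv_into_f)
  have u: "u f \<in> elems Y" "?v (u f) = f" if "f \<in> elems X" for f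
    using bij that by (auto simp: bij_betw_def)
  have vi: "inv_into (elems Y) ?v f = u f" if "f \<in> elems X" for f
    by (rule inv_into_f_eq[OF bij_betw_imp_inj_on[OF bij_betw_inv_into[OF bij]] u[OF that]])
  have 1: "transport Y X ?v (transport X Y u \<beta>) = \<beta>" if "\<beta> \<in> endomorphisms X" for \<beta>
  proof (rule extensionalityI[of _ "elems X"])
    show "\<beta> \<in> extensional (elems X)" using that by (simp add: endomorphisms_def)
    fix f assume f: "f \<in> elems X"
    then have "\<beta> f \<in> elems X" using that module_map_elems by (auto simp: endomorphisms_def)
    then show "transport Y X ?v (transport X Y u \<beta>) f = \<beta> f"
      using f u vi by (simp add: transport_def)
  qed (simp add: transport_def)
  have 2: "transport X Y u (transport Y X ?v \<gamma>) = \<gamma>" if "\<gamma> \<in> endomorphisms Y" for \<gamma>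
  proof (rule extensionalityI[of _ "elems Y"])
    show "\<gamma> \<in> extensional (elems Y)" using that by (simp add: endomorphisms_def)
    fix f assume f: "f \<in> elems Y"
    then have "\<gamma> f \<in> elems Y" using that module_map_elems by (auto simp: endomorphisms_def)
    then show "transport X Y u (transport Y X ?v \<gamma>) f = \<gamma> f"
      using f v vi by (simp add: transport_def)
  qed (simp add: transport_def)
  show ?thesis
    by (rule bij_betw_byWitness[where f' = "transport Y X ?v"])
      (use 1 2 transport_endomorphism[OF iso X(2) Y] transport_endomorphism[OF iso' Y(2) X] in auto)
qed

section \<open>Multiplication operators\<close>

text \<open>A sequence of steps is used instead of a real parameter, so that a directional
  derivative of \<open>\<alpha>\<close> appears as the pointwise limit of a sequence of bounded
  operators, ready for Banach-Steinhaus.\<close>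

lemma directional_difference_quotient:
  assumes "(f has_derivative f') (at z)"
  shows "(\<lambda>n. real (Suc n) *\<^sub>R (f (z + w /\<^sub>R real (Suc n)) - f z)) \<longlonglongrightarrow> f' w"
proof (cases "w = 0")
  case True
  then show ?thesis using has_derivative_bounded_linear[OF assms] by (simp add: linear_simps)
next
  case False
  define h where "h n = w /\<^sub>R real (Suc n)" for n
  have bl: "bounded_linear f'" using assms by (rule has_derivative_bounded_linear)
  have lim: "((\<lambda>h. norm (f (z + h) - f z - f' h) / norm h) \<longlongrightarrow> 0) (at 0)"
    using assms by (simp add: has_derivative_at)
  have "h \<longlonglongrightarrow> 0"
  proof -
    have "(\<lambda>n. inverse (real (Suc n)) *\<^sub>R w) \<longlonglongrightarrow> 0 *\<^sub>R w"
      by (intro tendsto_scaleR LIMSEQ_inverse_real_of_nat tendsto_const)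
    then show ?thesis unfolding h_def by simp
  qed
  moreover have "h n \<noteq> 0" for n using False by (simp add: h_def)
  ultimately have "filterlim h (at 0) sequentially" by (simp add: filterlim_at)
  from filterlim_compose[OF lim this]
  have "(\<lambda>n. norm (f (z + h n) - f z - f' (h n)) / norm (h n) * norm w) \<longlonglongrightarrow> 0 * norm w"
    by (intro tendsto_mult tendsto_const)
  moreover have "norm (f (z + h n) - f z - f' (h n)) / norm (h n) * norm w
      = norm (real (Suc n) *\<^sub>R (f (z + h n) - f z) - f' w)" for n
  proof -
    have "real (Suc n) *\<^sub>R f' (h n) = f' w"
      unfolding h_def linear_cmul[OF bounded_linear.linear[OF bl], symmetric] by simp
    then have "real (Suc n) *\<^sub>R (f (z + h n) - f z) - f' w = real (Suc n) *\<^sub>R (f (z + h n) - f z - f' (h n))"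
      by (simp only: scaleR_diff_right)
    moreover have "norm (h n) = norm w / real (Suc n)"
      by (simp add: h_def divide_inverse mult.commute)
    then have "norm w / norm (h n) = real (Suc n)" using False by simp
    then have "real (Suc n) = norm w / norm (h n)" ..
    ultimately show ?thesis by (simp only: norm_scaleR abs_of_nat) simp
  qed
  ultimately have "(\<lambda>n. norm (real (Suc n) *\<^sub>R (f (z + h n) - f z) - f' w)) \<longlonglongrightarrow> 0" by simp
  then show ?thesis unfolding h_def using LIM_zero_iff tendsto_norm_zero_iff by blast
qed

text \<open>Made for the remainder in the product rule: applying a uniformly bounded family of
  operators, differentiable or not, to a term of order o(h) leaves it of order o(h).\<close>

lemma has_derivative_zero_comparison:
  assumes r: "(r has_derivative (\<lambda>h. 0)) (at z)" "r z = 0" and q: "\<And>y. norm (q y) \<le> A * norm (r y)"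
  shows "(q has_derivative (\<lambda>h. 0)) (at z)"
  unfolding has_derivative_at
proof
  have "q z = 0" using q[of z] r(2) by simp
  have "((\<lambda>h. norm (r (z + h)) / norm h) \<longlongrightarrow> 0) (at 0)"
    using r by (simp add: has_derivative_at)
  then have "((\<lambda>h. A * (norm (r (z + h)) / norm h)) \<longlongrightarrow> A * 0) (at 0)" by (intro tendsto_mult tendsto_const)
  then have l: "((\<lambda>h. A * (norm (r (z + h)) / norm h)) \<longlongrightarrow> 0) (at 0)" by simp
  have "((\<lambda>h. norm (q (z + h)) / norm h) \<longlongrightarrow> 0) (at 0)"
  proof (rule Lim_null_comparison[OF always_eventually[OF allI] l])
    fix h
    show "norm (norm (q (z + h)) / norm h) \<le> A * (norm (r (z + h)) / norm h)"
      using divide_right_mono[OF q[of "z + h"], of "norm h"] by simp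
  qed
  then show "((\<lambda>h. norm (q (z + h) - q z - 0) / norm h) \<longlongrightarrow> 0) (at 0)" using \<open>q z = 0\<close> by simp
qed simp

text \<open>Writing \<open>T y (g y) = T y (g y - g x) + T y (g x)\<close>, strong continuity
  handles the second term, and the first is at most \<open>B y * norm (g y - g x)\<close>.\<close>

lemma continuous_on_strong_apply:
  fixes T :: "'a::topological_space \<Rightarrow> 'b::real_normed_vector \<Rightarrow> 'c::real_normed_vector"
  assumes lin: "\<And>x. x \<in> S \<Longrightarrow> linear (T x)" and cont: "\<And>v. continuous_on S (\<lambda>x. T x v)"
    and bd: "\<And>x v. x \<in> S \<Longrightarrow> norm (T x v) \<le> B x * norm v" and B: "continuous_on S B" and g: "continuous_on S g"
  shows "continuous_on S (\<lambda>x. T x (g x))"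
  unfolding continuous_on_def
proof
  fix x assume x: "x \<in> S"
  have l: "((\<lambda>y. B y * norm (g y - g x)) \<longlongrightarrow> 0) (at x within S)"
  proof -
    have "((\<lambda>y. B y * norm (g y - g x)) \<longlongrightarrow> B x * norm (g x - g x)) (at x within S)"
      using B g x by (intro tendsto_intros) (auto simp: continuous_on_def)
    then show ?thesis by simp
  qed
  have "((\<lambda>y. T y (g y - g x)) \<longlongrightarrow> 0) (at x within S)"
    by (rule Lim_null_comparison[OF _ l]) (use bd in \<open>auto simp: eventually_at_filter\<close>)
  moreover have "((\<lambda>y. T y (g x)) \<longlongrightarrow> T x (g x)) (at x within S)"
    using cont x by (auto simp: continuous_on_def)
  ultimately have "((\<lambda>y. T y (g y - g x) + T y (g x)) \<longlongrightarrow> 0 + T x (g x)) (at x within S)"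
    by (rule tendsto_add)
  moreover have "\<forall>\<^sub>F y in at x within S. T y (g y - g x) + T y (g x) = T y (g y)"
    using lin by (auto simp: eventually_at_filter linear_diff)
  ultimately show "((\<lambda>y. T y (g y)) \<longlongrightarrow> T x (g x)) (at x within S)"
    using tendsto_cong by fastforce
qed

context riemannian
begin

section \<open>The two modules satisfy the hypotheses of the transport\<close>

lemma norm1_cong:
  assumes "\<And>k j. k \<in> R \<Longrightarrow> j < n \<Longrightarrow> s k j = t k j"
  shows "norm1 M R n s = norm1 M R n t"
proof -
  have "cmatrix_norm n (\<lambda>i j. \<Sum>k\<in>R. jet_inner M (s k i) (s k j) x) = cmatrix_norm n (\<lambda>i j. \<Sum>k\<in>R. jet_inner M (t k i) (t k j) x)" for x
    unfolding cmatrix_norm_def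
    by (intro SUP_cong refl arg_cong[of _ _ sqrt] sum.cong arg_cong[of _ _ "\<lambda>z. (cmod z)\<^sup>2"] arg_cong2[of _ _ _ _ "(*)"])
      (auto simp: assms)
  then show ?thesis by (simp add: norm1_def)
qed

lemma maps_module_closed_local:
  "closed_module (maps_module M :: ('m, 'm \<Rightarrow> 'h::complex_hilbert) op_module)"
  "mnorm_local (maps_module M :: ('m, 'm \<Rightarrow> 'h) op_module)"
proof -
  show "closed_module (maps_module M :: ('m, 'm \<Rightarrow> 'h) op_module)"
    by (auto simp: closed_module_def maps_module_def intro: C10_add C10_scaleC C10_act)
  show "mnorm_local (maps_module M :: ('m, 'm \<Rightarrow> 'h) op_module)"
    by (auto simp: mnorm_local_def maps_module_def intro: norm1_cong)
qed

lemma std_module_closed_local: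
  assumes "orthonormal_basis (e :: nat \<Rightarrow> 'h::complex_hilbert)"
  shows "closed_module (std_module M)" "mnorm_local (std_module M)"
proof -
  show "closed_module (std_module M)"
    using std_module_closed[OF assms] by (simp add: closed_module_def)
  show "mnorm_local (std_module M)"
    unfolding mnorm_local_def
  proof (intro allI impI)
    fix n and s t :: "nat \<Rightarrow> nat \<Rightarrow> nat \<Rightarrow> 'm \<Rightarrow> complex"
    assume "\<forall>i<n. \<forall>j<n. s i j = t i j"
    then have "norm1 M ({..<n} \<times> {..<K}) n (\<lambda>(i, k) j. s i j k) = norm1 M ({..<n} \<times> {..<K}) n (\<lambda>(i, k) j. t i j k)" for K
      by (intro norm1_cong) auto
    then show "mnorm (std_module M) n s = mnorm (std_module M) n t" by (simp add: std_module_def)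
  qed
qed

text \<open>Explicit inequalities in place of suprema. The adjoint is left out, since the product
  rule concerns \<open>\<alpha>\<close> alone and the adjoint family is treated as a second
  instance.\<close>

definition strongly_bounded :: "('m \<Rightarrow> 'h::complex_hilbert \<Rightarrow>\<^sub>L 'h) \<Rightarrow> real \<Rightarrow> real \<Rightarrow> bool" where
  "strongly_bounded \<alpha> A D \<longleftrightarrow> (\<forall>x. \<alpha> x \<in> bounded_operators) \<and> (\<forall>\<xi>. C1_in UNIV (\<lambda>x. \<alpha> x \<xi>)) \<and>
    (\<forall>x \<xi>. norm (\<alpha> x \<xi>) \<le> A * norm \<xi>) \<and> (\<forall>x \<xi>. dnorm (\<lambda>y. \<alpha> y \<xi>) x \<le> D * norm \<xi>) \<and> 0 \<le> A \<and> 0 \<le> D"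

lemma strongly_boundedD:
  assumes "strongly_bounded \<alpha> A D"
  shows "\<alpha> x \<in> bounded_operators" "C1_in UNIV (\<lambda>x. \<alpha> x \<xi>)" "norm (\<alpha> x \<xi>) \<le> A * norm \<xi>"
    "dnorm (\<lambda>y. \<alpha> y \<xi>) x \<le> D * norm \<xi>" "0 \<le> A" "0 \<le> D"
  using assms unfolding strongly_bounded_def by auto

text \<open>By the uniform boundedness principle. Without it the supremum in \<^const>\<open>strong_deriv_norm\<close>
  might be that of an unbounded set, whose value is arbitrary.\<close>

lemma strong_derivative_bounded:
  fixes \<alpha> :: "'m \<Rightarrow> 'h::complex_hilbert \<Rightarrow>\<^sub>L 'h"
  assumes C1: "\<And>\<xi>. C1_in UNIV (\<lambda>x. \<alpha> x \<xi>)"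
  shows "\<exists>C. \<forall>\<xi>. dnorm (\<lambda>y. \<alpha> y \<xi>) x \<le> C * norm \<xi>"
proof -
  let ?c = "chart_at M x"
  let ?J = "\<lambda>b \<xi>. jet (\<lambda>y. \<alpha> y \<xi>) x (Some b)"
  have "\<exists>C. \<forall>\<xi>. norm (?J b \<xi>) \<le> C * norm \<xi>" for b
  proof (rule limit_of_blinfuns_bounded)
    \<comment> \<open>For small \<open>n\<close> the displaced coordinates may leave the image of
      the chart, where \<open>par\<close> is unspecified. Each \<open>?T n\<close> is nevertheless a
      bounded operator, and only the limit matters.\<close>
    let ?T = "\<lambda>n. real (Suc n) *\<^sub>R (\<alpha> (par ?c (crd ?c x + frame x b /\<^sub>R real (Suc n))) - \<alpha> x)"
    fix \<xi>
    have d: "((\<lambda>y. \<alpha> y \<xi>) \<circ> par ?c has_derivative dcoeff ?c (\<lambda>y. \<alpha> y \<xi>) x) (at (crd ?c x))"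
      by (rule diff_at_chartD[OF C1_inD(1)[OF C1 chart_at UNIV_I]])
    show "(\<lambda>n. ?T n \<xi>) \<longlonglongrightarrow> ?J b \<xi>"
      using directional_difference_quotient[OF d, of "frame x b"] chart_at[of x]
      by (simp add: jet_def deriv_at_def blinfun.scaleR_left blinfun.diff_left)
  qed
  then have "\<exists>C. \<forall>b \<xi>. norm (?J b \<xi>) \<le> C b * norm \<xi>" by (rule choice[OF allI])
  then obtain C where "\<forall>b \<xi>. norm (?J b \<xi>) \<le> C b * norm \<xi>" ..
  then have C: "norm (?J b \<xi>) \<le> C b * norm \<xi>" for b \<xi> by simp
  have "dnorm (\<lambda>y. \<alpha> y \<xi>) x \<le> (\<Sum>b\<in>axes M. C b) * norm \<xi>" for \<xi>
  proof -
    have "dnorm (\<lambda>y. \<alpha> y \<xi>) x \<le> (\<Sum>b\<in>axes M. norm (?J b \<xi>))"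
      unfolding dnorm_def by (rule L2_set_le_sum) simp
    also have "\<dots> \<le> (\<Sum>b\<in>axes M. C b * norm \<xi>)" by (intro sum_mono C)
    finally show ?thesis by (simp add: sum_distrib_right)
  qed
  then show ?thesis by blast
qed

lemma dnorm_scaleR: "diffble s x \<Longrightarrow> dnorm (\<lambda>y. r *\<^sub>R s y) x = \<bar>r\<bar> * dnorm s x"
  unfolding dnorm_def L2_set_right_distrib[OF abs_ge_zero]
  by (intro L2_set_cong refl) (simp add: jet_linear[OF bounded_linear_scaleR_right])

lemma strong_deriv_norm_eq:
  fixes \<alpha> :: "'m \<Rightarrow> 'h::complex_hilbert \<Rightarrow>\<^sub>L 'h"
  assumes "\<And>\<xi>. C1_in UNIV (\<lambda>x. \<alpha> x \<xi>)"
  shows "strong_deriv_norm M \<alpha> x = (SUP \<xi>\<in>{\<xi>. norm \<xi> \<le> 1}. dnorm (\<lambda>y. \<alpha> y \<xi>) x)"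
  unfolding strong_deriv_norm_def
  by (intro SUP_cong refl cotangent_norm_eq C1_in_diffble[OF assms]) simp

text \<open>A bound on a sum bounds both summands only if they are nonnegative. For
  \<open>strong_deriv_norm\<close> this rests on its supremum being taken over a bounded set, which
  \<open>strong_derivative_bounded\<close> ensures.\<close>

lemma bounded_star_strongD:
  fixes \<alpha> :: "'m \<Rightarrow> 'h::complex_hilbert \<Rightarrow>\<^sub>L 'h"
  assumes "\<alpha> \<in> bounded_star_strong M"
  shows "\<exists>A D. strongly_bounded \<alpha> A D" and "C1_in UNIV (\<lambda>x. adjoint_op (\<alpha> x) \<xi>)"
proof -
  have lin: "\<And>x. \<alpha> x \<in> bounded_operators" and C1: "\<And>\<xi>. C1_in UNIV (\<lambda>x. \<alpha> x \<xi>)"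
    and C1': "\<And>\<xi>. C1_in UNIV (\<lambda>x. adjoint_op (\<alpha> x) \<xi>)"
    and bdd: "bdd_above (range (\<lambda>x. strong_deriv_norm M \<alpha> x + norm (\<alpha> x)))"
    using assms unfolding bounded_star_strong_def star_strongly_differentiable_def
      strongly_differentiable_def C1_map_iff by auto
  show "C1_in UNIV (\<lambda>x. adjoint_op (\<alpha> x) \<xi>)" by (rule C1')
  obtain B where B: "\<And>x. strong_deriv_norm M \<alpha> x + norm (\<alpha> x) \<le> B"
    using bdd unfolding bdd_above_def by blast
  have bdd': "bdd_above ((\<lambda>\<xi>. dnorm (\<lambda>y. \<alpha> y \<xi>) x) ` {\<xi>. norm \<xi> \<le> 1})" for x
  proof -
    obtain C where C: "\<And>\<xi>. dnorm (\<lambda>y. \<alpha> y \<xi>) x \<le> C * norm \<xi>"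
      using strong_derivative_bounded[OF C1] by blast
    have "dnorm (\<lambda>y. \<alpha> y \<xi>) x \<le> \<bar>C\<bar>" if "norm \<xi> \<le> 1" for \<xi>
    proof -
      have "C * norm \<xi> \<le> \<bar>C\<bar> * norm \<xi>" by (intro mult_right_mono) auto
      also have "\<dots> \<le> \<bar>C\<bar> * 1" using that by (intro mult_left_mono) auto
      finally show ?thesis using C[of \<xi>] by simp
    qed
    then show ?thesis by (intro bdd_aboveI2[of _ _ "\<bar>C\<bar>"]) auto
  qed
  have up: "dnorm (\<lambda>y. \<alpha> y \<xi>) x \<le> strong_deriv_norm M \<alpha> x" if "norm \<xi> \<le> 1" for \<xi> x
    unfolding strong_deriv_norm_eq[OF C1] by (rule cSUP_upper[OF _ bdd']) (use that in simp)
  have sdn0: "0 \<le> strong_deriv_norm M \<alpha> x" for x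
    using up[of 0 x] dnorm_nonneg order_trans by (metis norm_zero zero_le_one)
  have "norm (\<alpha> x \<xi>) \<le> B * norm \<xi>" for x \<xi>
  proof -
    have "norm (\<alpha> x) \<le> B" using B[of x] sdn0[of x] by linarith
    then show ?thesis using norm_blinfun[of "\<alpha> x" \<xi>] by (meson mult_right_mono norm_ge_zero order_trans)
  qed
  moreover have "dnorm (\<lambda>y. \<alpha> y \<xi>) x \<le> B * norm \<xi>" for x \<xi>
  proof (cases "\<xi> = 0")
    case True
    obtain C where C: "\<And>\<xi>. dnorm (\<lambda>y. \<alpha> y \<xi>) x \<le> C * norm \<xi>"
      using strong_derivative_bounded[OF C1] by blast
    then show ?thesis using True C[of 0] by simp
  next
    case False
    let ?u = "\<xi> /\<^sub>R norm \<xi>"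
    have "dnorm (\<lambda>y. \<alpha> y ?u) x \<le> strong_deriv_norm M \<alpha> x" by (rule up) (use False in simp)
    also have "\<dots> \<le> B" using B[of x] norm_ge_zero[of "\<alpha> x"] by linarith
    finally have u: "dnorm (\<lambda>y. \<alpha> y ?u) x \<le> B" .
    have "dnorm (\<lambda>y. \<alpha> y \<xi>) x = dnorm (\<lambda>y. norm \<xi> *\<^sub>R \<alpha> y ?u) x"
      using False by (simp add: blinfun.scaleR_right)
    also have "\<dots> = norm \<xi> * dnorm (\<lambda>y. \<alpha> y ?u) x"
      by (subst dnorm_scaleR) (auto intro: C1_in_diffble[OF C1])
    also have "\<dots> \<le> norm \<xi> * B" using u by (intro mult_left_mono) auto
    finally show ?thesis by (simp add: mult.commute)
  qed
  moreover have "0 \<le> B" using B[of undefined] sdn0[of undefined] norm_ge_zero[of "\<alpha> undefined"] by linarith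
  ultimately have "strongly_bounded \<alpha> B B" using lin C1 by (simp add: strongly_bounded_def)
  then show "\<exists>A D. strongly_bounded \<alpha> A D" by blast
qed

lemma bounded_star_strongI:
  fixes \<alpha> :: "'m \<Rightarrow> 'h::complex_hilbert \<Rightarrow>\<^sub>L 'h"
  assumes b: "strongly_bounded \<alpha> A D" and C1': "\<And>\<xi>. C1_in UNIV (\<lambda>x. adjoint_op (\<alpha> x) \<xi>)"
  shows "\<alpha> \<in> bounded_star_strong M"
proof -
  note b' = strongly_boundedD[OF b]
  have "strong_deriv_norm M \<alpha> x + norm (\<alpha> x) \<le> D + A" for x
  proof (rule add_mono)
    show "strong_deriv_norm M \<alpha> x \<le> D"
      unfolding strong_deriv_norm_eq[OF b'(2)]
    proof (rule cSUP_least)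
      show "{\<xi>::'h. norm \<xi> \<le> 1} \<noteq> {}" by (auto intro: exI[of _ 0])
      fix \<xi> :: 'h assume "\<xi> \<in> {\<xi>. norm \<xi> \<le> 1}"
      then have "D * norm \<xi> \<le> D * 1" using b'(6) by (intro mult_left_mono) auto
      then show "dnorm (\<lambda>y. \<alpha> y \<xi>) x \<le> D" using b'(4)[of \<xi> x] by linarith
    qed
    show "norm (\<alpha> x) \<le> A" using b'(3,5) by (subst norm_blinfun_le_iff) auto
  qed
  then have "bdd_above (range (\<lambda>x. strong_deriv_norm M \<alpha> x + norm (\<alpha> x)))" by (intro bdd_aboveI2)
  then show ?thesis
    using b' C1' unfolding bounded_star_strong_def star_strongly_differentiable_def
      strongly_differentiable_def C1_map_iff by blast
qed

context
  fixes \<alpha> :: "'m \<Rightarrow> 'h::complex_hilbert \<Rightarrow>\<^sub>L 'h" and A D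
  assumes strongly_bounded: "strongly_bounded \<alpha> A D"
begin

lemma mult_derivative:
  assumes c: "c \<in> atlas M" "x \<in> dom c" and s: "diff_at_chart c s x"
  shows "((\<lambda>y. \<alpha> y (s y)) \<circ> par c has_derivative
    (\<lambda>v. \<alpha> x (dcoeff c s x v) + dcoeff c (\<lambda>y. \<alpha> y (s x)) x v)) (at (crd c x))"
proof -
  let ?z = "crd c x" and ?f' = "dcoeff c s x"
  define f where "f z = s (par c z)" for z
  define a where "a z = \<alpha> (par c z)" for z
  have fz: "f ?z = s x" "a ?z = \<alpha> x" using c by (simp_all add: f_def a_def)
  have df: "(f has_derivative ?f') (at ?z)" using diff_at_chartD[OF s] by (simp add: f_def[abs_def] comp_def)
  have blf: "bounded_linear ?f'" using df by (rule has_derivative_bounded_linear)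
  then have lf: "linear ?f'" by (rule bounded_linear.linear)
  have da: "((\<lambda>z. a z \<xi>) has_derivative dcoeff c (\<lambda>y. \<alpha> y \<xi>) x) (at ?z)" for \<xi>
    using diff_at_chartD[OF C1_inD(1)[OF strongly_boundedD(2)[OF strongly_bounded] c]] by (simp add: a_def[abs_def] comp_def)
  \<comment> \<open>The Taylor remainder, of order o(z - z0) and zero at the centre.\<close>
  define r where "r z = f z - f ?z - ?f' (z - ?z)" for z
  have dlin: "((\<lambda>z. ?f' (z - ?z)) has_derivative ?f') (at ?z)"
    using bounded_linear.has_derivative[OF blf has_derivative_diff[OF has_derivative_ident has_derivative_const]]
    by simp
  have "(r has_derivative (\<lambda>h. ?f' h - 0 - ?f' h)) (at ?z)"
    unfolding r_def by (intro has_derivative_diff df has_derivative_const dlin)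
  then have dr: "(r has_derivative (\<lambda>h. 0)) (at ?z)" by simp
  have 1: "((\<lambda>z. a z (r z)) has_derivative (\<lambda>h. 0)) (at ?z)"
  proof (rule has_derivative_zero_comparison[OF dr])
    show "r ?z = 0" by (simp add: r_def linear_0[OF lf])
    show "norm (a y (r y)) \<le> A * norm (r y)" for y unfolding a_def by (rule strongly_boundedD(3)[OF strongly_bounded])
  qed
  have dz: "((\<lambda>z. (z - ?z) \<bullet> b) has_derivative (\<lambda>h. h \<bullet> b)) (at ?z)" for b
    by (auto intro!: derivative_eq_intros)
  \<comment> \<open>Along the axes the linear part is a finite sum of scalar functions times
    strongly differentiable vectors. The scalars vanish at the centre, so the derivatives of
    \<open>a\<close> drop out there.\<close>
  have "((\<lambda>z. \<Sum>b\<in>axes M. ((z - ?z) \<bullet> b) *\<^sub>R a z (?f' b)) has_derivative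
      (\<lambda>h. \<Sum>b\<in>axes M. ((?z - ?z) \<bullet> b) *\<^sub>R dcoeff c (\<lambda>y. \<alpha> y (?f' b)) x h + (h \<bullet> b) *\<^sub>R a ?z (?f' b))) (at ?z)"
    by (intro has_derivative_sum has_derivative_scaleR dz da)
  moreover have aeq: "(\<Sum>b\<in>axes M. (h \<bullet> b) *\<^sub>R a z (?f' b)) = a z (?f' h)" for h z
    by (subst (2) linear_expansion[OF lf]) (simp add: blinfun.sum_right blinfun.scaleR_right)
  ultimately have 2: "((\<lambda>z. a z (?f' (z - ?z))) has_derivative (\<lambda>h. \<alpha> x (?f' h))) (at ?z)"
    by (simp add: aeq fz(2)[symmetric])
  have "((\<lambda>z. a z (r z) + a z (?f' (z - ?z)) + a z (s x)) has_derivative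
      (\<lambda>h. 0 + \<alpha> x (?f' h) + dcoeff c (\<lambda>y. \<alpha> y (s x)) x h)) (at ?z)"
    by (intro has_derivative_add 1 2 da)
  moreover have "a z (r z) + a z (?f' (z - ?z)) + a z (s x) = ((\<lambda>y. \<alpha> y (s y)) \<circ> par c) z" for z
    unfolding blinfun.add_right[symmetric] using c by (simp add: r_def fz a_def f_def)
  ultimately show ?thesis by (simp add: comp_def)
qed

lemma linear_dcoeff_strong:
  assumes c: "c \<in> atlas M" "x \<in> dom c"
  shows "linear (\<lambda>\<xi>. dcoeff c (\<lambda>y. \<alpha> y \<xi>) x v)"
proof (rule linearI)
  note d = C1_inD(1)[OF strongly_boundedD(2)[OF strongly_bounded] c UNIV_I]
  show "dcoeff c (\<lambda>y. \<alpha> y (\<xi> + \<eta>)) x v = dcoeff c (\<lambda>y. \<alpha> y \<xi>) x v + dcoeff c (\<lambda>y. \<alpha> y \<eta>) x v" for \<xi> \<eta>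
    using has_derivative_dcoeff_add(2)[OF d d] by (simp add: blinfun.add_right)
  show "dcoeff c (\<lambda>y. \<alpha> y (r *\<^sub>R \<xi>)) x v = r *\<^sub>R dcoeff c (\<lambda>y. \<alpha> y \<xi>) x v" for r \<xi>
    using has_derivative_dcoeff_linear(2)[OF bounded_linear_scaleR_right d, of r] by (simp add: blinfun.scaleR_right)
qed

lemma mult_C1:
  assumes s: "C1_in UNIV s"
  shows "C1_in UNIV (\<lambda>y. \<alpha> y (s y))"
proof (rule C1_in_local)
  fix p :: 'm
  obtain c where c: "c \<in> atlas M" "p \<in> dom c" using ex_chart by blast
  have sd: "diff_at_chart c s x" if "x \<in> dom c" for x using C1_inD(1)[OF s c(1) that] by simp
  have \<alpha>C: "C1_in UNIV (\<lambda>x. \<alpha> x \<xi>)" for \<xi> by (rule strongly_boundedD(2)[OF strongly_bounded])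
  have "C1_in (dom c) (\<lambda>y. \<alpha> y (s y))"
  proof (rule C1_in_chart[OF c(1) chart_open[OF c(1)] order_refl])
    show "((\<lambda>y. \<alpha> y (s y)) \<circ> par c has_derivative
        (\<lambda>v. \<alpha> x (dcoeff c s x v) + dcoeff c (\<lambda>y. \<alpha> y (s x)) x v)) (at (crd c x))" if "x \<in> dom c" for x
      by (rule mult_derivative[OF c(1) that sd[OF that]])
    fix v
    have 1: "continuous_on (dom c) (\<lambda>x. \<alpha> x (dcoeff c s x v))"
    proof (rule continuous_on_strong_apply[where T = "\<lambda>x \<xi>. \<alpha> x \<xi>" and g = "\<lambda>x. dcoeff c s x v" and B = "\<lambda>_. A"])
      show "linear (blinfun_apply (\<alpha> x))" for x by (rule bounded_linear.linear[OF blinfun.bounded_linear_right])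
      show "continuous_on (dom c) (\<lambda>x. \<alpha> x v)" for v
        using C1_in_continuous_on[OF \<alpha>C open_UNIV] continuous_on_subset by blast
      show "norm (\<alpha> x v) \<le> A * norm v" for x v by (rule strongly_boundedD(3)[OF strongly_bounded])
      show "continuous_on (dom c) (\<lambda>x. dcoeff c s x v)" using C1_inD(2)[OF s c(1), of v] by simp
    qed simp
    have 2: "continuous_on (dom c) (\<lambda>x. dcoeff c (\<lambda>y. \<alpha> y (s x)) x v)"
    \<comment> \<open>The bound \<open>D\<close> refers to the Riemannian norm. In the chart it
      acquires the factor \<open>gnorm c x v\<close>, which is continuous in
      \<open>x\<close>.\<close>
    proof (rule continuous_on_strong_apply[where T = "\<lambda>x \<xi>. dcoeff c (\<lambda>y. \<alpha> y \<xi>) x v" and g = s and B = "\<lambda>x. gnorm c x v * D"])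
      show "linear (\<lambda>\<xi>. dcoeff c (\<lambda>y. \<alpha> y \<xi>) x v)" if "x \<in> dom c" for x
        by (rule linear_dcoeff_strong[OF c(1) that])
      show "continuous_on (dom c) (\<lambda>x. dcoeff c (\<lambda>y. \<alpha> y \<xi>) x v)" for \<xi>
        using C1_inD(2)[OF \<alpha>C c(1), of \<xi> v] by simp
      show "norm (dcoeff c (\<lambda>y. \<alpha> y \<xi>) x v) \<le> gnorm c x v * D * norm \<xi>" if x: "x \<in> dom c" for x \<xi>
      proof -
        have "norm (dcoeff c (\<lambda>y. \<alpha> y \<xi>) x v) \<le> gnorm c x v * dnorm (\<lambda>y. \<alpha> y \<xi>) x"
          by (rule dcoeff_le_dnorm[OF c(1) x C1_in_diffble[OF \<alpha>C UNIV_I]])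
        also have "\<dots> \<le> gnorm c x v * (D * norm \<xi>)"
          by (intro mult_left_mono strongly_boundedD(4)[OF strongly_bounded] gnorm_nonneg c(1) x)
        finally show ?thesis by (simp add: mult.assoc)
      qed
      show "continuous_on (dom c) (\<lambda>x. gnorm c x v * D)"
        unfolding gnorm_def by (intro continuous_intros met_cont c)
      show "continuous_on (dom c) s"
        using C1_in_continuous_on[OF s open_UNIV] continuous_on_subset by blast
    qed
    show "continuous_on (dom c) (\<lambda>x. \<alpha> x (dcoeff c s x v) + dcoeff c (\<lambda>y. \<alpha> y (s x)) x v)"
      by (intro continuous_on_add 1 2)
  qed
  then show "\<exists>V. open V \<and> p \<in> V \<and> C1_in V (\<lambda>y. \<alpha> y (s y))" using c chart_open by blast
qed

lemma jet_mult:
  assumes s: "diffble s x"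
  shows "jet (\<lambda>y. \<alpha> y (s y)) x (Some b) = \<alpha> x (jet s x (Some b)) + jet (\<lambda>y. \<alpha> y (s x)) x (Some b)"
  using dcoeff_eqI[OF mult_derivative[OF chart_at s[unfolded diffble_def]]]
  by (simp add: jet_def deriv_at_def)

text \<open>The value contributes \<open>A\<close>, and the two terms of the product rule contribute
  \<open>A\<close> and \<open>D\<close>.\<close>

lemma jnorm_mult:
  assumes s: "diffble s x"
  shows "jnorm (\<lambda>y. \<alpha> y (s y)) x \<le> (2 * A + D) * jnorm s x"
proof -
  have "dnorm (\<lambda>y. \<alpha> y (s y)) x
      \<le> L2_set (\<lambda>b. A * norm (jet s x (Some b)) + norm (jet (\<lambda>y. \<alpha> y (s x)) x (Some b))) (axes M)"
    unfolding dnorm_def jet_mult[OF s]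
    using strongly_boundedD(3)[OF strongly_bounded] by (intro L2_set_mono) (auto intro: order_trans[OF norm_triangle_ineq])
  also have "\<dots> \<le> A * dnorm s x + dnorm (\<lambda>y. \<alpha> y (s x)) x"
    unfolding dnorm_def L2_set_right_distrib[OF strongly_boundedD(5)[OF strongly_bounded]] by (rule L2_set_triangle_ineq)
  also have "\<dots> \<le> A * jnorm s x + D * jnorm s x"
    using strongly_boundedD(4)[OF strongly_bounded, of "s x" x] strongly_boundedD(5,6)[OF strongly_bounded]
    by (intro add_mono mult_left_mono dnorm_le_jnorm order_trans[OF strongly_boundedD(4)[OF strongly_bounded]] norm_le_jnorm)
  finally have "dnorm (\<lambda>y. \<alpha> y (s y)) x \<le> A * jnorm s x + D * jnorm s x" .
  moreover have "norm (\<alpha> x (s x)) \<le> A * jnorm s x"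
    by (rule order_trans[OF strongly_boundedD(3)[OF strongly_bounded] mult_left_mono[OF norm_le_jnorm strongly_boundedD(5)[OF strongly_bounded]]])
  ultimately show ?thesis using jnorm_le[of "\<lambda>y. \<alpha> y (s y)" x] by (simp add: algebra_simps)
qed

lemma mult_C10:
  assumes s: "s \<in> C10_maps M"
  shows "(\<lambda>y. \<alpha> y (s y)) \<in> C10_maps M"
  by (rule C10_dominated1[OF mult_C1[OF C10_C1[OF s]] s jnorm_mult[OF C10_diffble[OF s]]])

lemma mult_op_map:
  "module_map (maps_module M) (maps_module M) (mult_op M \<alpha>)"
  "completely_bounded (maps_module M) (mult_op M \<alpha>)"
proof -
  have sc: "\<alpha> x (c *\<^sub>C \<xi>) = c *\<^sub>C \<alpha> x \<xi>" for x c \<xi>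
    using strongly_boundedD(1)[OF strongly_bounded] by (simp add: bounded_operators_def)
  show "module_map (maps_module M) (maps_module M) (mult_op M \<alpha>)"
    unfolding module_map_def maps_module_def mult_op_def
    by (auto simp: mult_C10 C10_add C10_scaleC C10_act blinfun.add_right sc)
  let ?C = "2 * A + D"
  have C0: "0 \<le> ?C" using strongly_boundedD(5,6)[OF strongly_bounded] by simp
  have "norm1 M {..<n} n (\<lambda>i j. mult_op M \<alpha> (s i j)) \<le> ?C * norm1 M {..<n} n s"
    if s: "\<forall>i<n. \<forall>j<n. s i j \<in> C10_maps M" for n s
  proof -
    have s': "\<And>k j. k \<in> {..<n} \<Longrightarrow> j < n \<Longrightarrow> s k j \<in> C10_maps M" using s by simp
    have ms: "\<And>k j. k \<in> {..<n} \<Longrightarrow> j < n \<Longrightarrow> mult_op M \<alpha> (s k j) \<in> C10_maps M"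
      using s by (simp add: mult_op_def mult_C10)
    have n0: "0 \<le> norm1 M {..<n} n s" by (rule norm1_nonneg[OF _ s']) simp_all
    have "comb_sq {..<n} n (\<lambda>i j. mult_op M \<alpha> (s i j)) v x \<le> (?C * norm1 M {..<n} n s)\<^sup>2 * (\<Sum>j<n. (cmod (v j))\<^sup>2)" for v x
    proof -
      have "comb_sq {..<n} n (\<lambda>i j. mult_op M \<alpha> (s i j)) v x \<le> ?C\<^sup>2 * comb_sq {..<n} n s v x"
        unfolding comb_sq_def sum_distrib_left
      proof (rule sum_mono)
        fix k assume k: "k \<in> {..<n}"
        let ?t = "\<lambda>y. \<Sum>j<n. v j *\<^sub>C s k j y"
        \<comment> \<open>Complex linearity moves the combination inside \<open>\<alpha>\<close>, so
          the bound for a single map applies with the same constant for every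
          \<open>n\<close>.\<close>
        have "(\<lambda>y. \<Sum>j<n. v j *\<^sub>C mult_op M \<alpha> (s k j) y) = (\<lambda>y. \<alpha> y (?t y))"
          using k s' by (simp add: mult_op_def blinfun.sum_right sc)
        moreover have "diffble ?t x" using k s' by (intro jet_comb C10_diffble) auto
        ultimately have "jnorm (\<lambda>y. \<Sum>j<n. v j *\<^sub>C mult_op M \<alpha> (s k j) y) x \<le> ?C * jnorm ?t x"
          using jnorm_mult by simp
        then have "(jnorm (\<lambda>y. \<Sum>j<n. v j *\<^sub>C mult_op M \<alpha> (s k j) y) x)\<^sup>2 \<le> (?C * jnorm ?t x)\<^sup>2"
          by (intro power_mono jnorm_nonneg)
        then show "(jnorm (\<lambda>y. \<Sum>j<n. v j *\<^sub>C mult_op M \<alpha> (s k j) y) x)\<^sup>2 \<le> ?C\<^sup>2 * (jnorm ?t x)\<^sup>2"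
          by (simp only: power_mult_distrib)
      qed
      also have "\<dots> \<le> ?C\<^sup>2 * ((norm1 M {..<n} n s)\<^sup>2 * (\<Sum>j<n. (cmod (v j))\<^sup>2))"
        using norm1_le_iff[of "{..<n}" n s, OF finite_lessThan s' n0] by (intro mult_left_mono) auto
      finally show ?thesis by (simp only: power_mult_distrib mult.assoc)
    qed
    then show ?thesis
      using norm1_le_iff[of "{..<n}" n "\<lambda>i j. mult_op M \<alpha> (s i j)", OF finite_lessThan ms mult_nonneg_nonneg[OF C0 n0]]
      by simp
  qed
  then show "completely_bounded (maps_module M) (mult_op M \<alpha>)"
    unfolding completely_bounded_def by (intro exI[of _ ?C]) (simp add: maps_module_def)
qed

end

text \<open>The definition of \<open>bounded_star_strong\<close> bounds no derivative of the
  adjoint. Differentiating \<open>cinner (\<alpha>' y \<xi>) \<eta>\<close> shows that each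
  directional derivative of \<open>\<alpha>'\<close> is adjoint to that of \<open>\<alpha>\<close>,
  hence bounded by \<open>D\<close>. Summing over the frame costs the factor
  \<open>card (axes M)\<close>.\<close>

lemma adjoint_strongly_bounded:
  fixes \<alpha> \<alpha>' :: "'m \<Rightarrow> 'h::complex_hilbert \<Rightarrow>\<^sub>L 'h"
  assumes b: "strongly_bounded \<alpha> A D" and adj: "\<And>x \<xi> \<eta>. cinner (\<alpha>' x \<xi>) \<eta> = cinner \<xi> (\<alpha> x \<eta>)"
    and C1': "\<And>\<xi>. C1_in UNIV (\<lambda>x. \<alpha>' x \<xi>)"
  shows "strongly_bounded \<alpha>' A (real (card (axes M)) * D)"
  unfolding strongly_bounded_def
proof (intro conjI allI C1')
  note b' = strongly_boundedD[OF b]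
  fix x \<xi>
  show "\<alpha>' x \<in> bounded_operators" by (rule adjoint_in_bounded_operators[OF adj])
  show "norm (\<alpha>' x \<xi>) \<le> A * norm \<xi>" by (rule norm_adjoint_le[OF adj b'(3)])
  have "norm (jet (\<lambda>y. \<alpha>' y \<xi>) x (Some b)) \<le> D * norm \<xi>" if bb: "b \<in> axes M" for b
  proof (rule norm_adjoint_le[where S = "\<lambda>\<xi>. jet (\<lambda>y. \<alpha>' y \<xi>) x (Some b)" and T = "\<lambda>\<eta>. jet (\<lambda>y. \<alpha> y \<eta>) x (Some b)"])
    fix \<xi> \<eta>
    have "cinner (jet (\<lambda>y. \<alpha>' y \<xi>) x (Some b)) \<eta> = jet (\<lambda>y. cinner (\<alpha>' y \<xi>) \<eta>) x (Some b)"
      by (rule jet_linear[OF bounded_linear_cinner_left C1_in_diffble[OF C1' UNIV_I], symmetric])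
    also have "\<dots> = jet (\<lambda>y. cinner \<xi> (\<alpha> y \<eta>)) x (Some b)" by (simp only: adj)
    also have "\<dots> = cinner \<xi> (jet (\<lambda>y. \<alpha> y \<eta>) x (Some b))"
      by (rule jet_linear[OF bounded_linear_cinner_right C1_in_diffble[OF b'(2) UNIV_I]])
    finally show "cinner (jet (\<lambda>y. \<alpha>' y \<xi>) x (Some b)) \<eta> = cinner \<xi> (jet (\<lambda>y. \<alpha> y \<eta>) x (Some b))" .
    have "norm (jet (\<lambda>y. \<alpha> y \<eta>) x (Some b)) \<le> dnorm (\<lambda>y. \<alpha> y \<eta>) x"
      unfolding dnorm_def by (rule member_le_L2_set) (use bb in auto)
    then show "norm (jet (\<lambda>y. \<alpha> y \<eta>) x (Some b)) \<le> D * norm \<eta>" using b'(4) order_trans by blast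
  qed
  then have "(\<Sum>b\<in>axes M. norm (jet (\<lambda>y. \<alpha>' y \<xi>) x (Some b))) \<le> (\<Sum>b\<in>axes M. D * norm \<xi>)"
    by (rule sum_mono)
  moreover have "dnorm (\<lambda>y. \<alpha>' y \<xi>) x \<le> (\<Sum>b\<in>axes M. norm (jet (\<lambda>y. \<alpha>' y \<xi>) x (Some b)))"
    unfolding dnorm_def by (rule L2_set_le_sum) simp
  ultimately show "dnorm (\<lambda>y. \<alpha>' y \<xi>) x \<le> real (card (axes M)) * D * norm \<xi>" by simp
  show "0 \<le> A" "0 \<le> real (card (axes M)) * D" using b'(5,6) by auto
qed

lemma mult_op_endomorphism:
  fixes \<alpha> :: "'m \<Rightarrow> 'h::complex_hilbert \<Rightarrow>\<^sub>L 'h"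
  assumes onb: "orthonormal_basis (e :: nat \<Rightarrow> 'h)" and \<alpha>: "\<alpha> \<in> bounded_star_strong M"
  shows "mult_op M \<alpha> \<in> endomorphisms (maps_module M)"
proof -
  obtain A D where b: "strongly_bounded \<alpha> A D" using bounded_star_strongD(1)[OF \<alpha>] by blast
  define \<alpha>' where "\<alpha>' x = adjoint_op (\<alpha> x)" for x
  have adj: "cinner (\<alpha>' x \<xi>) \<eta> = cinner \<xi> (\<alpha> x \<eta>)" for x \<xi> \<eta>
  proof -
    obtain S where S: "\<And>\<xi> \<eta>. cinner (blinfun_apply S \<xi>) \<eta> = cinner \<xi> (\<alpha> x \<eta>)"
      using adjoint_exists[OF onb strongly_boundedD(1)[OF b]] by blast
    then show ?thesis using adjoint_op_eqI[of S "\<alpha> x"] by (simp add: \<alpha>'_def)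
  qed
  have b': "strongly_bounded \<alpha>' A (real (card (axes M)) * D)"
    by (rule adjoint_strongly_bounded[OF b adj]) (use bounded_star_strongD(2)[OF \<alpha>] in \<open>simp add: \<alpha>'_def\<close>)
  have "form (maps_module M) (mult_op M \<alpha> s) t = form (maps_module M) s (mult_op M \<alpha>' t)"
    if "s \<in> elems (maps_module M)" "t \<in> elems (maps_module M)" for s t
  proof -
    have "cinner (\<alpha> x (s x)) (t x) = cinner (s x) (\<alpha>' x (t x))" for x
      using adj[of x "t x" "s x"] by (metis cinner_commute)
    then show ?thesis using that by (simp add: maps_module_def mult_op_def)
  qed
  moreover have "mult_op M \<alpha> \<in> extensional (elems (maps_module M))"
    by (simp add: maps_module_def mult_op_def)
  ultimately show ?thesis
    using mult_op_map[OF b] mult_op_map[OF b'] unfolding endomorphisms_def by blast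
qed

section \<open>Maps with compact support; injectivity of the correspondence\<close>

lemma compact_support_C10:
  fixes s :: "'m \<Rightarrow> 'h::complex_hilbert"
  assumes s: "C1_in UNIV s" and K: "compact K" "\<And>x. x \<notin> K \<Longrightarrow> s x = 0"
  shows "s \<in> C10_maps M"
proof -
  have "jnorm s x = 0" if "x \<notin> K" for x
  proof -
    let ?c = "chart_at M x"
    have op: "open (- K)" using K(1) by (simp add: compact_imp_closed open_Compl)
    have "dcoeff ?c s x = dcoeff ?c (\<lambda>x. 0) x"
      by (rule diff_at_chart_cong(2)[OF chart_at(1) op _ chart_at(2) _ has_derivative_dcoeff_const(1)])
        (use that K(2) in simp_all)
    then have "jet s x i = jet (\<lambda>x. 0) x i" for i
      using K(2)[OF that] by (simp add: jet_def deriv_at_def split: option.split)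
    then have "jnorm s x = jnorm (\<lambda>x. 0 :: 'h) x" by (intro jnorm_cong) simp
    then show ?thesis by (simp add: jnorm_const_zero)
  qed
  then show ?thesis using s K(1) unfolding C10_iff by (metis)
qed

lemma bump_C10:
  obtains f :: "'m \<Rightarrow> complex" and V where "f \<in> C10_maps M" "open V" "x \<in> V" "\<And>y. y \<in> V \<Longrightarrow> f y = 1"
proof -
  obtain f :: "'m \<Rightarrow> real" and V K where f: "C1_in UNIV f" "open V" "x \<in> V" "\<And>y. y \<in> V \<Longrightarrow> f y = 1"
    "compact K" "\<And>y. y \<notin> K \<Longrightarrow> f y = 0" by (rule bump[OF open_UNIV UNIV_I, of x]) blast
  have "(\<lambda>y. complex_of_real (f y)) \<in> C10_maps M"
    by (rule compact_support_C10[OF C1_in_linear[OF bounded_linear_of_real f(1)] f(5)]) (simp add: f(6))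
  then show ?thesis using that[of "\<lambda>y. complex_of_real (f y)" V] f by simp
qed

lemma C10_times_vector: "f \<in> C10_maps M \<Longrightarrow> (\<lambda>x. f x *\<^sub>C (\<xi>::'h::complex_hilbert)) \<in> C10_maps M"
  by (rule C10_linear[OF bounded_linear_scaleC_left])

lemma mult_op_inj: "inj_on (mult_op M) (bounded_star_strong M :: ('m \<Rightarrow> 'h::complex_hilbert \<Rightarrow>\<^sub>L 'h) set)"
proof (rule inj_onI)
  fix \<alpha> \<beta> :: "'m \<Rightarrow> 'h \<Rightarrow>\<^sub>L 'h" assume eq: "mult_op M \<alpha> = mult_op M \<beta>"
  show "\<alpha> = \<beta>"
  proof (intro ext blinfun_eqI)
    fix x and \<xi> :: 'h
    obtain f :: "'m \<Rightarrow> complex" and V where f: "f \<in> C10_maps M" "open V" "x \<in> V" "\<And>y. y \<in> V \<Longrightarrow> f y = 1"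
      by (rule bump_C10[of x], blast)
    let ?s = "\<lambda>x. f x *\<^sub>C \<xi>"
    have "mult_op M \<alpha> ?s x = mult_op M \<beta> ?s x" by (simp add: eq)
    then show "\<alpha> x \<xi> = \<beta> x \<xi>"
      using C10_times_vector[OF f(1), of \<xi>] f(3,4) by (simp add: mult_op_def)
  qed
qed

end

section \<open>Endomorphisms are multiplication operators\<close>

context riemannian
begin

text \<open>Cut-offs at a single point always exist; the content is that \<open>C\<close> is chosen
  before \<open>x\<close>. Completeness reaches the theory of endomorphisms only through this
  property.\<close>

definition uniform_cutoffs :: bool where
  "uniform_cutoffs \<longleftrightarrow> (\<exists>C. \<forall>x. \<exists>f :: 'm \<Rightarrow> complex. f \<in> C10_maps M \<and> f x = 1 \<and> (\<forall>y. jnorm f y \<le> C))"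

lemma norm1_single_le_iff:
  fixes f :: "'m \<Rightarrow> 'h::complex_hilbert"
  assumes f: "f \<in> C10_maps M" and K: "0 \<le> K"
  shows "norm1 M {..<1::nat} 1 (\<lambda>i j. f) \<le> K \<longleftrightarrow> (\<forall>x. jnorm f x \<le> K)"
  using norm1_column_le_iff[of "{..<1::nat}" "\<lambda>_. f" K] f K
  by (simp add: power2_le_iff_abs_le jnorm_nonneg)

text \<open>The conditions on the second map are limited to the adjoint relation, so the definition
  can be applied once to the pair and once with the roles exchanged.\<close>

definition endo_pair :: "(('m \<Rightarrow> 'h::complex_hilbert) \<Rightarrow> 'm \<Rightarrow> 'h) \<Rightarrow> (('m \<Rightarrow> 'h) \<Rightarrow> 'm \<Rightarrow> 'h) \<Rightarrow> bool" where
  "endo_pair \<beta> \<beta>' \<longleftrightarrow> module_map (maps_module M) (maps_module M) \<beta> \<and> completely_bounded (maps_module M) \<beta> \<and>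
    (\<forall>s\<in>C10_maps M. \<forall>t\<in>C10_maps M. \<forall>x. cinner (\<beta> s x) (t x) = cinner (s x) (\<beta>' t x))"

lemma endo_pairD:
  fixes \<beta> :: "('m \<Rightarrow> 'h::complex_hilbert) \<Rightarrow> 'm \<Rightarrow> 'h"
  assumes "endo_pair \<beta> \<beta>'"
  shows "s \<in> C10_maps M \<Longrightarrow> \<beta> s \<in> C10_maps M"
    and "s \<in> C10_maps M \<Longrightarrow> t \<in> C10_maps M \<Longrightarrow> \<beta> (\<lambda>x. s x + t x) = (\<lambda>x. \<beta> s x + \<beta> t x)"
    and "s \<in> C10_maps M \<Longrightarrow> \<beta> (\<lambda>x. c *\<^sub>C s x) = (\<lambda>x. c *\<^sub>C \<beta> s x)"
    and "s \<in> C10_maps M \<Longrightarrow> f \<in> C10_maps M \<Longrightarrow> \<beta> (\<lambda>x. f x *\<^sub>C s x) = (\<lambda>x. f x *\<^sub>C \<beta> s x)"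
    and "s \<in> C10_maps M \<Longrightarrow> t \<in> C10_maps M \<Longrightarrow> cinner (\<beta> s x) (t x) = cinner (s x) (\<beta>' t x)"
    and "\<exists>C\<ge>0. \<forall>s\<in>C10_maps M. \<forall>K. (\<forall>x. jnorm s x \<le> K) \<longrightarrow> (\<forall>x. jnorm (\<beta> s) x \<le> C * K)"
proof -
  have mm: "module_map (maps_module M) (maps_module M) \<beta>" and cb: "completely_bounded (maps_module M) \<beta>"
    using assms by (simp_all add: endo_pair_def)
  show C: "s \<in> C10_maps M \<Longrightarrow> \<beta> s \<in> C10_maps M" for s
    using mm by (simp add: module_map_def maps_module_def)
  show "s \<in> C10_maps M \<Longrightarrow> t \<in> C10_maps M \<Longrightarrow> \<beta> (\<lambda>x. s x + t x) = (\<lambda>x. \<beta> s x + \<beta> t x)"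
    and "s \<in> C10_maps M \<Longrightarrow> \<beta> (\<lambda>x. c *\<^sub>C s x) = (\<lambda>x. c *\<^sub>C \<beta> s x)"
    and "s \<in> C10_maps M \<Longrightarrow> f \<in> C10_maps M \<Longrightarrow> \<beta> (\<lambda>x. f x *\<^sub>C s x) = (\<lambda>x. f x *\<^sub>C \<beta> s x)"
    using mm by (simp_all add: module_map_def maps_module_def)
  show "s \<in> C10_maps M \<Longrightarrow> t \<in> C10_maps M \<Longrightarrow> cinner (\<beta> s x) (t x) = cinner (s x) (\<beta>' t x)"
    using assms by (simp add: endo_pair_def)
  obtain C where c: "\<And>n s. (\<forall>i<n. \<forall>j<n. s i j \<in> C10_maps M) \<Longrightarrow>
      norm1 M {..<n} n (\<lambda>i j. \<beta> (s i j)) \<le> C * norm1 M {..<n} n s"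
    using cb by (auto simp: completely_bounded_def maps_module_def)
  show "\<exists>C\<ge>0. \<forall>s\<in>C10_maps M. \<forall>K. (\<forall>x. jnorm s x \<le> K) \<longrightarrow> (\<forall>x. jnorm (\<beta> s) x \<le> C * K)"
  \<comment> \<open>The constant in \<open>completely_bounded\<close> carries no sign.\<close>
  proof (intro exI[of _ "\<bar>C\<bar>"] conjI ballI allI impI)
    fix s :: "'m \<Rightarrow> 'h" and K x assume s: "s \<in> C10_maps M" and K: "\<forall>x. jnorm s x \<le> K"
    have K0: "0 \<le> K" using K jnorm_nonneg order_trans by blast
    have n0: "0 \<le> norm1 M {..<1::nat} 1 (\<lambda>i j. s)" using s by (intro norm1_nonneg) auto
    have "norm1 M {..<1::nat} 1 (\<lambda>i j. \<beta> s) \<le> C * norm1 M {..<1::nat} 1 (\<lambda>i j. s)"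
      using c[of 1 "\<lambda>i j. s"] s by simp
    also have "\<dots> \<le> \<bar>C\<bar> * norm1 M {..<1::nat} 1 (\<lambda>i j. s)" using n0 by (intro mult_right_mono) auto
    also have "\<dots> \<le> \<bar>C\<bar> * K"
      using norm1_single_le_iff[OF s K0] K by (intro mult_left_mono) auto
    finally show "jnorm (\<beta> s) x \<le> \<bar>C\<bar> * K"
      using norm1_single_le_iff[OF C[OF s], of "\<bar>C\<bar> * K"] K0 by simp
  qed simp
qed

text \<open>The vector \<open>\<beta> s x\<close> is determined by its inner products with test
  sections \<open>f \<eta>\<close>. The adjoint moves \<open>\<beta>\<close> onto the test section,
  after which only the value \<open>s x\<close> occurs.\<close>

lemma endo_pair_pointwise:
  fixes \<beta> :: "('m \<Rightarrow> 'h::complex_hilbert) \<Rightarrow> 'm \<Rightarrow> 'h"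
  assumes p: "endo_pair \<beta> \<beta>'" and s: "s \<in> C10_maps M" "t \<in> C10_maps M" and eq: "s x = t x"
  shows "\<beta> s x = \<beta> t x"
proof (rule cinner_ext)
  fix \<eta> :: 'h
  obtain f :: "'m \<Rightarrow> complex" and V where f: "f \<in> C10_maps M" "open V" "x \<in> V" "\<And>y. y \<in> V \<Longrightarrow> f y = 1"
    by (rule bump_C10[of x], blast)
  let ?u = "\<lambda>y. f y *\<^sub>C \<eta>"
  have u: "?u \<in> C10_maps M" "?u x = \<eta>" using C10_times_vector[OF f(1)] f(3,4) by auto
  have "cinner (\<beta> s x) (?u x) = cinner (\<beta> t x) (?u x)"
    by (simp only: endo_pairD(5)[OF p s(1) u(1)] endo_pairD(5)[OF p s(2) u(1)] eq)
  then show "cinner \<eta> (\<beta> s x) = cinner \<eta> (\<beta> t x)"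
    unfolding u(2) by (metis cinner_commute)
qed

lemma jnorm_times_vector:
  "diffble f x \<Longrightarrow> jnorm (\<lambda>y. f y *\<^sub>C (\<xi>::'h::complex_hilbert)) x \<le> norm \<xi> * jnorm f x"
  by (rule jnorm_linear[OF bounded_linear_scaleC_left]) (simp_all add: norm_scaleC)

lemma endo_pair_multiplier:
  fixes \<beta> :: "('m \<Rightarrow> 'h::complex_hilbert) \<Rightarrow> 'm \<Rightarrow> 'h"
  assumes cut: uniform_cutoffs and p: "endo_pair \<beta> \<beta>'"
  shows "\<exists>\<alpha> A D. strongly_bounded \<alpha> A D \<and> (\<forall>s\<in>C10_maps M. \<forall>x. \<beta> s x = \<alpha> x (s x))"
proof -
  obtain C0 where "\<forall>x. \<exists>f :: 'm \<Rightarrow> complex. f \<in> C10_maps M \<and> f x = 1 \<and> (\<forall>y. jnorm f y \<le> C0)"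
    using cut unfolding uniform_cutoffs_def by blast
  from choice[OF this] obtain F :: "'m \<Rightarrow> 'm \<Rightarrow> complex" where
    "\<forall>x. F x \<in> C10_maps M \<and> F x x = 1 \<and> (\<forall>y. jnorm (F x) y \<le> C0)" ..
  then have F: "F x \<in> C10_maps M" "F x x = 1" "jnorm (F x) y \<le> C0" for x y by auto
  have C00: "0 \<le> C0" using F(3)[of undefined undefined] jnorm_nonneg order_trans by blast
  obtain C where C: "C \<ge> 0"
    "\<And>s K x. s \<in> C10_maps M \<Longrightarrow> \<forall>x. jnorm s x \<le> K \<Longrightarrow> jnorm (\<beta> s) x \<le> C * K"
    using endo_pairD(6)[OF p] by blast
  define a where "a x \<xi> = \<beta> (\<lambda>y. F x y *\<^sub>C \<xi>) x" for x \<xi>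
  have Fx: "(\<lambda>y. F x y *\<^sub>C \<xi>) \<in> C10_maps M" for x \<xi> by (rule C10_times_vector[OF F(1)])
  have bF: "jnorm (\<beta> (\<lambda>y. F x y *\<^sub>C \<xi>)) z \<le> C * (norm \<xi> * C0)" for x z \<xi>
  proof (rule C(2)[OF Fx], intro allI)
    fix y
    have "jnorm (\<lambda>y. F x y *\<^sub>C \<xi>) y \<le> norm \<xi> * jnorm (F x) y"
      by (rule jnorm_times_vector[OF C10_diffble[OF F(1)]])
    also have "\<dots> \<le> norm \<xi> * C0" by (intro mult_left_mono F) simp
    finally show "jnorm (\<lambda>y. F x y *\<^sub>C \<xi>) y \<le> norm \<xi> * C0" .
  qed
  have abound: "norm (a x \<xi>) \<le> (C * C0) * norm \<xi>" for x \<xi>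
    using order_trans[OF norm_le_jnorm bF, of x \<xi> x] by (simp add: a_def mult_ac)
  \<comment> \<open>At \<open>x\<close> the maps \<open>s\<close> and \<open>F x\<close> times the
    constant vector \<open>s x\<close> agree, because \<open>F x x = 1\<close>.\<close>
  have key: "\<beta> s x = a x (s x)" if "s \<in> C10_maps M" for s x
    unfolding a_def by (rule endo_pair_pointwise[OF p that Fx]) (simp add: F)
  have aadd: "a x (\<xi> + \<eta>) = a x \<xi> + a x \<eta>" for x \<xi> \<eta>
    unfolding a_def scaleC_add_right endo_pairD(2)[OF p Fx Fx] ..
  have asc: "a x (c *\<^sub>C \<xi>) = c *\<^sub>C a x \<xi>" for x c \<xi>
  proof -
    have "(\<lambda>y. F x y *\<^sub>C c *\<^sub>C \<xi>) = (\<lambda>y. c *\<^sub>C F x y *\<^sub>C \<xi>)"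
      by (simp only: scaleC_scaleC mult.commute)
    then show ?thesis unfolding a_def using endo_pairD(3)[OF p Fx, of c x \<xi>] by simp
  qed
  have bl: "bounded_linear (a x)" for x
    by (rule bounded_linear_intro[where K = "C * C0", OF aadd])
      (simp_all only: scaleR_scaleC asc abound mult.commute[of "norm _"])
  define \<alpha> where "\<alpha> x = Blinfun (a x)" for x
  have \<alpha>: "blinfun_apply (\<alpha> x) = a x" for x
    unfolding \<alpha>_def by (rule bounded_linear_Blinfun_apply[OF bl])
  \<comment> \<open>The definition of \<open>a\<close> uses a different cut-off at every point, from
    which no regularity can be read off. Near \<open>q\<close> one fixed bump \<open>f\<close>,
    equal to 1 there, represents \<open>a\<close> as the single map \<open>\<beta>\<close> applied
    to \<open>f\<close> times \<open>\<xi>\<close>.\<close>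
  have C1: "C1_in UNIV (\<lambda>x. a x \<xi>)" for \<xi>
  proof (rule C1_in_local)
    fix q
    obtain f :: "'m \<Rightarrow> complex" and V where f: "f \<in> C10_maps M" "open V" "q \<in> V" "\<And>y. y \<in> V \<Longrightarrow> f y = 1"
      by (rule bump_C10[of q], blast)
    have fC: "(\<lambda>y. f y *\<^sub>C \<xi>) \<in> C10_maps M" by (rule C10_times_vector[OF f(1)])
    have "C1_in V (\<lambda>x. a x \<xi>)"
    proof (rule C1_in_cong[OF f(2)])
      show "C1_in V (\<beta> (\<lambda>y. f y *\<^sub>C \<xi>))"
        by (rule C1_in_subset[OF C10_C1[OF endo_pairD(1)[OF p fC]]]) simp
      show "\<beta> (\<lambda>y. f y *\<^sub>C \<xi>) y = a y \<xi>" if "y \<in> V" for y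
        using key[OF fC, of y] f(4)[OF that] by simp
    qed
    then show "\<exists>V. open V \<and> q \<in> V \<and> C1_in V (\<lambda>x. a x \<xi>)" using f by blast
  qed
  have dbound: "dnorm (\<lambda>y. a y \<xi>) x \<le> (C * C0 + C0 * (C * C0)) * norm \<xi>" for x \<xi>
  proof -
    let ?G = "\<beta> (\<lambda>y. F x y *\<^sub>C \<xi>)"
    have G: "?G = (\<lambda>y. F x y *\<^sub>C a y \<xi>)" using key[OF Fx] asc by auto
    have dF: "diffble (F x) x" by (rule C10_diffble[OF F(1)])
    have da: "diffble (\<lambda>y. a y \<xi>) x" by (rule C1_in_diffble[OF C1 UNIV_I])
    \<comment> \<open>The product rule at the point where \<open>F x\<close> equals 1: the
      derivative of \<open>a\<close> occurs with coefficient 1 and can be isolated, the price being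
      the differential of the cut-off.\<close>
    have jG: "jet ?G x (Some b) = jet (\<lambda>y. a y \<xi>) x (Some b) + jet (F x) x (Some b) *\<^sub>C a x \<xi>" for b
      unfolding G jet_def deriv_at_def option.case
      using has_derivative_dcoeff_bilinear(2)[OF bounded_bilinear_scaleC chart_at dF[unfolded diffble_def] da[unfolded diffble_def]]
      by (simp add: F(2))
    have "norm (jet (\<lambda>y. a y \<xi>) x (Some b)) \<le> norm (jet ?G x (Some b)) + norm (a x \<xi>) * norm (jet (F x) x (Some b))" for b
    proof -
      have "jet (\<lambda>y. a y \<xi>) x (Some b) = jet ?G x (Some b) - jet (F x) x (Some b) *\<^sub>C a x \<xi>" by (simp add: jG)
      then show ?thesis using norm_triangle_ineq4 by (metis norm_scaleC mult.commute)
    qed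
    then have "dnorm (\<lambda>y. a y \<xi>) x \<le> L2_set (\<lambda>b. norm (jet ?G x (Some b)) + norm (a x \<xi>) * norm (jet (F x) x (Some b))) (axes M)"
      unfolding dnorm_def by (intro L2_set_mono) auto
    also have "\<dots> \<le> dnorm ?G x + norm (a x \<xi>) * dnorm (F x) x"
      unfolding dnorm_def L2_set_right_distrib[OF norm_ge_zero] by (rule L2_set_triangle_ineq)
    also have "\<dots> \<le> C * (norm \<xi> * C0) + (C * C0 * norm \<xi>) * C0"
      by (intro add_mono mult_mono order_trans[OF dnorm_le_jnorm bF] abound order_trans[OF dnorm_le_jnorm F(3)])
        (auto simp: C C00 dnorm_nonneg)
    finally show ?thesis by (simp add: algebra_simps)
  qed
  have "strongly_bounded \<alpha> (C * C0) (C * C0 + C0 * (C * C0))"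
    unfolding strongly_bounded_def \<alpha> using C(1) C00 abound dbound C1 asc by (auto simp: bounded_operators_def \<alpha>)
  then show ?thesis using key \<alpha> by metis
qed

theorem endomorphism_is_mult_op:
  fixes \<beta> :: "('m \<Rightarrow> 'h::complex_hilbert) \<Rightarrow> 'm \<Rightarrow> 'h"
  assumes cut: uniform_cutoffs and \<beta>: "\<beta> \<in> endomorphisms (maps_module M)"
  shows "\<exists>\<alpha>\<in>bounded_star_strong M. mult_op M \<alpha> = \<beta>"
proof -
  obtain \<beta>' where \<beta>': "module_map (maps_module M) (maps_module M) \<beta>'" "completely_bounded (maps_module M) \<beta>'"
    "\<forall>s\<in>elems (maps_module M). \<forall>t\<in>elems (maps_module M). form (maps_module M) (\<beta> s) t = form (maps_module M) s (\<beta>' t)"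
    using \<beta> unfolding endomorphisms_def by blast
  have adj: "cinner (\<beta> s x) (t x) = cinner (s x) (\<beta>' t x)" if "s \<in> C10_maps M" "t \<in> C10_maps M" for s t x
    using \<beta>'(3) that by (simp add: maps_module_def fun_eq_iff)
  have p: "endo_pair \<beta> \<beta>'" using \<beta> adj by (simp add: endo_pair_def endomorphisms_def)
  have "cinner (\<beta>' s x) (t x) = cinner (s x) (\<beta> t x)" if "s \<in> C10_maps M" "t \<in> C10_maps M" for s t x
    using adj[OF that(2,1), of x] by (metis cinner_commute)
  \<comment> \<open>Conjugate symmetry exchanges the roles. Hence \<open>\<beta>'\<close> is a
    multiplier as well, and since its symbol turns out to be the adjoint of \<open>\<alpha>\<close>,
    the strong differentiability of the adjoint family follows.\<close>
  then have p': "endo_pair \<beta>' \<beta>" using \<beta>'(1,2) by (simp add: endo_pair_def)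
  obtain \<alpha> A D where \<alpha>: "strongly_bounded \<alpha> A D" "\<And>s x. s \<in> C10_maps M \<Longrightarrow> \<beta> s x = \<alpha> x (s x)"
    using endo_pair_multiplier[OF cut p] by blast
  obtain \<alpha>' A' D' where \<alpha>': "strongly_bounded \<alpha>' A' D'" "\<And>s x. s \<in> C10_maps M \<Longrightarrow> \<beta>' s x = \<alpha>' x (s x)"
    using endo_pair_multiplier[OF cut p'] by blast
  have "adjoint_op (\<alpha> x) = \<alpha>' x" for x
  proof (rule adjoint_op_eqI)
    fix \<xi> \<eta>
    obtain f :: "'m \<Rightarrow> complex" and V where f: "f \<in> C10_maps M" "open V" "x \<in> V" "\<And>y. y \<in> V \<Longrightarrow> f y = 1"
      by (rule bump_C10[of x], blast)
    have fC: "(\<lambda>y. f y *\<^sub>C \<zeta>) \<in> C10_maps M" for \<zeta> :: 'h by (rule C10_times_vector[OF f(1)])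
    have "cinner (\<beta>' (\<lambda>y. f y *\<^sub>C \<xi>) x) (f x *\<^sub>C \<eta>) = cinner (f x *\<^sub>C \<xi>) (\<beta> (\<lambda>y. f y *\<^sub>C \<eta>) x)"
      by (rule endo_pairD(5)[OF p' fC fC])
    then show "cinner (\<alpha>' x \<xi>) \<eta> = cinner \<xi> (\<alpha> x \<eta>)"
      using f(3,4) by (simp add: \<alpha>(2)[OF fC] \<alpha>'(2)[OF fC])
  qed
  then have "\<alpha> \<in> bounded_star_strong M"
    using bounded_star_strongI[OF \<alpha>(1)] strongly_boundedD(2)[OF \<alpha>'(1)] by simp
  moreover have "mult_op M \<alpha> = \<beta>"
  proof (rule extensionalityI[of _ "C10_maps M"])
    show "mult_op M \<alpha> \<in> extensional (C10_maps M)" by (simp add: mult_op_def)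
    show "\<beta> \<in> extensional (C10_maps M)" using \<beta> by (simp add: endomorphisms_def maps_module_def)
    show "mult_op M \<alpha> s = \<beta> s" if "s \<in> C10_maps M" for s
      using \<alpha>(2)[OF that] that by (simp add: mult_op_def fun_eq_iff)
  qed
  ultimately show ?thesis by blast
qed

lemma bij_betw_mult_op:
  assumes "orthonormal_basis (e :: nat \<Rightarrow> 'h::complex_hilbert)" and uniform_cutoffs
  shows "bij_betw (mult_op M) (bounded_star_strong M)
    (endomorphisms (maps_module M :: ('m, 'm \<Rightarrow> 'h) op_module))"
  unfolding bij_betw_def
proof
  show "inj_on (mult_op M) (bounded_star_strong M :: ('m \<Rightarrow> 'h \<Rightarrow>\<^sub>L 'h) set)" by (rule mult_op_inj)
  show "mult_op M ` bounded_star_strong M = endomorphisms (maps_module M :: ('m, 'm \<Rightarrow> 'h) op_module)"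
    using mult_op_endomorphism[OF assms(1)] endomorphism_is_mult_op[OF assms(2)] by (auto simp: image_iff)
qed

end

section \<open>The Riemannian distance\<close>

context riemannian
begin

section \<open>Curves, velocities and arc length\<close>

definition vel :: "('m, 'e) chart \<Rightarrow> (real \<Rightarrow> 'm) \<Rightarrow> real \<Rightarrow> 'e" where
  "vel c \<gamma> t = vector_derivative (crd c \<circ> \<gamma>) (at t within {0..1})"

lemma C1_curve_iff:
  "C1_curve M \<gamma> \<longleftrightarrow> continuous_on {0..1} \<gamma> \<and> (\<forall>c\<in>atlas M.
    (\<forall>t\<in>{0..1}. \<gamma> t \<in> dom c \<longrightarrow> (crd c \<circ> \<gamma> has_vector_derivative vel c \<gamma> t) (at t within {0..1})) \<and>
    continuous_on {t\<in>{0..1}. \<gamma> t \<in> dom c} (vel c \<gamma>))"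
  unfolding C1_curve_def case_prod_beta vector_derivative_works vel_def[abs_def] by auto

lemma C1_curveD:
  assumes "C1_curve M \<gamma>"
  shows "continuous_on {0..1} \<gamma>"
    and "c \<in> atlas M \<Longrightarrow> t \<in> {0..1} \<Longrightarrow> \<gamma> t \<in> dom c \<Longrightarrow>
      (crd c \<circ> \<gamma> has_vector_derivative vel c \<gamma> t) (at t within {0..1})"
    and "c \<in> atlas M \<Longrightarrow> continuous_on {t\<in>{0..1}. \<gamma> t \<in> dom c} (vel c \<gamma>)"
  using assms unfolding C1_curve_iff by auto

lemma vel_eqI:
  "t \<in> {0..1} \<Longrightarrow> (crd c \<circ> \<gamma> has_vector_derivative v) (at t within {0..1}) \<Longrightarrow> vel c \<gamma> t = v"
  unfolding vel_def using vector_derivative_within_cbox[of 0 1 t "crd c \<circ> \<gamma>" v] by simp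

lemma curve_nbhd:
  assumes \<gamma>: "continuous_on {0..1} \<gamma>" and t: "t \<in> {0..1}" "\<gamma> t \<in> U" and U: "open U"
  obtains d :: real where "d > 0" "\<And>u. u \<in> {0..1} \<Longrightarrow> dist u t < d \<Longrightarrow> \<gamma> u \<in> U"
proof -
  have "\<exists>A. open A \<and> A \<inter> {0..1} = \<gamma> -` U \<inter> {0..1}"
    by (rule \<gamma>[unfolded continuous_on_open_invariant, THEN spec, THEN mp, OF U])
  then obtain A where A: "open A" "A \<inter> {0..1} = \<gamma> -` U \<inter> {0..1}" by metis
  have "t \<in> A \<inter> {0..1}" unfolding A(2) using t by simp
  then have "t \<in> A" by simp
  then obtain d where d: "d > 0" "ball t d \<subseteq> A" using A(1) open_contains_ball by blast
  have "\<gamma> u \<in> U" if u: "u \<in> {0..1}" "dist u t < d" for u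
  proof -
    have "u \<in> A \<inter> {0..1}" using u d(2) by (simp add: dist_commute subset_iff)
    then show ?thesis unfolding A(2) by simp
  qed
  with d(1) show ?thesis by (rule that)
qed

lemma curve_chain:
  assumes \<gamma>: "C1_curve M \<gamma>" and c: "c \<in> atlas M" and t: "t \<in> {0..1}" "\<gamma> t \<in> dom c"
    and s: "diff_at_chart c s (\<gamma> t)"
  shows "(s \<circ> \<gamma> has_vector_derivative dcoeff c s (\<gamma> t) (vel c \<gamma> t)) (at t within {0..1})"
proof -
  have "(s \<circ> par c has_derivative dcoeff c s (\<gamma> t)) (at ((crd c \<circ> \<gamma>) t))"
    using diff_at_chartD[OF s] by simp
  then have 1: "(s \<circ> par c has_derivative dcoeff c s (\<gamma> t)) (at ((crd c \<circ> \<gamma>) t) within (crd c \<circ> \<gamma>) ` {0..1})"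
    by (rule has_derivative_at_withinI)
  have 2: "(crd c \<circ> \<gamma> has_derivative (\<lambda>x. x *\<^sub>R vel c \<gamma> t)) (at t within {0..1})"
    using C1_curveD(2)[OF \<gamma> c t] by (simp add: has_vector_derivative_def)
  have lin: "linear (dcoeff c s (\<gamma> t))" by (rule linear_dcoeff[OF s])
  have 3: "((s \<circ> par c) \<circ> (crd c \<circ> \<gamma>) has_vector_derivative dcoeff c s (\<gamma> t) (vel c \<gamma> t)) (at t within {0..1})"
    using diff_chain_within[OF 2 1] by (simp add: has_vector_derivative_def comp_def linear_cmul[OF lin])
  obtain d :: real where d: "d > 0" "\<And>u. u \<in> {0..1} \<Longrightarrow> dist u t < d \<Longrightarrow> \<gamma> u \<in> dom c"
    by (rule curve_nbhd[OF C1_curveD(1)[OF \<gamma>] t chart_open[OF c]]) blast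
  show ?thesis
    by (rule has_vector_derivative_transform_within[OF 3 d(1) t(1)]) (use d(2) c in simp)
qed

lemma vel_transit:
  assumes \<gamma>: "C1_curve M \<gamma>" and c: "c \<in> atlas M" "c' \<in> atlas M" and t: "t \<in> {0..1}" "\<gamma> t \<in> dom c" "\<gamma> t \<in> dom c'"
  shows "vel c' \<gamma> t = transit c c' (\<gamma> t) (vel c \<gamma> t)"
proof (rule vel_eqI[OF t(1)])
  have "diff_at_chart c (crd c') (\<gamma> t)"
    using transit_deriv[OF c t(2,3)] by (rule diff_at_chartI)
  from curve_chain[OF \<gamma> c(1) t(1,2) this]
  show "(crd c' \<circ> \<gamma> has_vector_derivative transit c c' (\<gamma> t) (vel c \<gamma> t)) (at t within {0..1})"
    by (simp add: transit_def)
qed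

lemma speed_chart:
  assumes \<gamma>: "C1_curve M \<gamma>" and c: "c \<in> atlas M" and t: "t \<in> {0..1}" "\<gamma> t \<in> dom c"
  shows "speed M \<gamma> t = gnorm c (\<gamma> t) (vel c \<gamma> t)"
proof -
  have "speed M \<gamma> t = gnorm (chart_at M (\<gamma> t)) (\<gamma> t) (vel (chart_at M (\<gamma> t)) \<gamma> t)"
    by (simp add: speed_def gnorm_def vel_def Let_def)
  then show ?thesis
    unfolding vel_transit[OF \<gamma> c chart_at(1) t chart_at(2)] gnorm_transit[OF c chart_at(1) t(2) chart_at(2)] .
qed

lemma speed_nonneg: "C1_curve M \<gamma> \<Longrightarrow> t \<in> {0..1} \<Longrightarrow> 0 \<le> speed M \<gamma> t"
  by (subst speed_chart[OF _ chart_at(1) _ chart_at(2)]) (simp_all add: gnorm_nonneg chart_at)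

lemma met_expansion:
  assumes "c \<in> atlas M" "x \<in> dom c"
  shows "met c x v w = (\<Sum>b\<in>axes M. \<Sum>d\<in>axes M. (v \<bullet> b) * (w \<bullet> d) * met c x b d)"
proof -
  have bl: "bilinear (met c x)" by (rule met_bilinear[OF assms])
  have "linear (\<lambda>v. met c x v w)" using bl by (simp add: bilinear_def)
  from linear_expansion[OF this, of v]
  have "met c x v w = (\<Sum>b\<in>axes M. (v \<bullet> b) * met c x b w)" by simp
  moreover have "met c x b w = (\<Sum>d\<in>axes M. (w \<bullet> d) * met c x b d)" for b
  proof -
    have "linear (\<lambda>w. met c x b w)" using bl by (simp add: bilinear_def)
    from linear_expansion[OF this, of w] show ?thesis by simp
  qed
  ultimately show ?thesis by (simp add: sum_distrib_left mult.assoc)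
qed

lemma speed_cont:
  assumes \<gamma>: "C1_curve M \<gamma>"
  shows "continuous_on {0..1} (speed M \<gamma>)"
  unfolding continuous_on_eq_continuous_within
proof
  fix t :: real assume t: "t \<in> {0..1}"
  obtain c where c: "c \<in> atlas M" "\<gamma> t \<in> dom c" using ex_chart by blast
  let ?N = "{t\<in>{0..1}. \<gamma> t \<in> dom c}"
  obtain d :: real where d: "d > 0" "\<And>u. u \<in> {0..1} \<Longrightarrow> dist u t < d \<Longrightarrow> \<gamma> u \<in> dom c"
    by (rule curve_nbhd[OF C1_curveD(1)[OF \<gamma>] t c(2) chart_open[OF c(1)]]) blast
  have cg: "continuous_on ?N \<gamma>"
    by (rule continuous_on_subset[OF C1_curveD(1)[OF \<gamma>]]) auto
  have cm: "continuous_on ?N (\<lambda>t. met c (\<gamma> t) b d)" for b d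
    by (rule continuous_on_compose2[OF met_cont[OF c(1)] cg]) auto
  have "continuous_on ?N (\<lambda>t. sqrt (\<Sum>b\<in>axes M. \<Sum>d\<in>axes M. (vel c \<gamma> t \<bullet> b) * (vel c \<gamma> t \<bullet> d) * met c (\<gamma> t) b d))"
    by (intro continuous_intros cm C1_curveD(3)[OF \<gamma> c(1)])
  then have "continuous_on ?N (speed M \<gamma>)"
    by (rule continuous_on_eq) (simp add: speed_chart[OF \<gamma> c(1)] gnorm_def met_expansion[OF c(1), symmetric])
  then have "continuous (at t within ?N) (speed M \<gamma>)"
    using t c(2) by (simp add: continuous_on_eq_continuous_within)
  moreover have "at t within ?N = at t within {0..1}"
  proof (rule at_within_nhd)
    show "t \<in> ball t d" "open (ball t d)" using d by auto
    show "?N \<inter> ball t d - {t} = {0..1} \<inter> ball t d - {t}"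
      using d(2) by (auto simp: dist_commute)
  qed
  ultimately show "continuous (at t within {0..1}) (speed M \<gamma>)" by simp
qed

definition arc :: "(real \<Rightarrow> 'm) \<Rightarrow> real \<Rightarrow> real" where
  "arc \<gamma> t = integral {0..t} (speed M \<gamma>)"

lemma arc_deriv:
  assumes \<gamma>: "C1_curve M \<gamma>" and t: "t \<in> {0..1}"
  shows "(arc \<gamma> has_vector_derivative speed M \<gamma> t) (at t within {0..1})"
  unfolding arc_def[abs_def] by (rule integral_has_vector_derivative[OF speed_cont[OF \<gamma>] t])

lemma arc_0 [simp]: "arc \<gamma> 0 = 0" by (simp add: arc_def)

lemma arc_mono:
  assumes \<gamma>: "C1_curve M \<gamma>" and t: "0 \<le> a" "a \<le> b" "b \<le> 1"
  shows "arc \<gamma> a \<le> arc \<gamma> b"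
  unfolding arc_def
  using t speed_nonneg[OF \<gamma>] speed_cont[OF \<gamma>]
  by (intro integral_subset_le integrable_continuous_interval) (auto intro: continuous_on_subset)

lemma arc_cont: "C1_curve M \<gamma> \<Longrightarrow> continuous_on {0..1} (arc \<gamma>)"
  unfolding continuous_on_eq_continuous_within
  by (intro ballI has_vector_derivative_continuous[OF arc_deriv])

text \<open>The case \<open>b < a\<close> is included, so that the same computation restricts curves
  and reverses them; hence the absolute value.\<close>

lemma reparam:
  assumes \<gamma>: "C1_curve M \<gamma>" and ab: "a \<in> {0..1}" "b \<in> {0..1}"
  defines "\<delta> \<equiv> \<lambda>t. \<gamma> (a + t * (b - a))"
  shows "C1_curve M \<delta>" and "integral {0..1} (speed M \<delta>) = \<bar>arc \<gamma> b - arc \<gamma> a\<bar>"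
proof -
  let ?h = "\<lambda>t. a + t * (b - a)"
  have h: "?h t \<in> {0..1}" if "t \<in> {0..1}" for t
  proof -
    have "?h t = (1 - t) * a + t * b" by (simp add: algebra_simps)
    moreover have "0 \<le> (1 - t) * a + t * b" using that ab by auto
    moreover have "(1 - t) * a + t * b \<le> (1 - t) * 1 + t * 1"
      using that ab by (intro add_mono mult_left_mono) auto
    ultimately show ?thesis by simp
  qed
  then have hI: "?h ` {0..1} \<subseteq> {0..1}" by blast
  have hc: "continuous_on S ?h" for S by (intro continuous_intros)
  have hd: "(?h has_vector_derivative (b - a)) (at t within S)" for t S
    by (auto intro!: derivative_eq_intros simp: has_vector_derivative_def)
  have vd: "(crd c \<circ> \<delta> has_vector_derivative (b - a) *\<^sub>R vel c \<gamma> (?h t)) (at t within {0..1})"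
    if c: "c \<in> atlas M" and t: "t \<in> {0..1}" "\<delta> t \<in> dom c" for c t
  proof -
    have "(crd c \<circ> \<gamma> has_vector_derivative vel c \<gamma> (?h t)) (at (?h t) within {0..1})"
      using t h by (intro C1_curveD(2)[OF \<gamma> c]) (auto simp: \<delta>_def)
    then have "(crd c \<circ> \<gamma> has_vector_derivative vel c \<gamma> (?h t)) (at (?h t) within ?h ` {0..1})"
      using hI by (rule has_vector_derivative_within_subset)
    from vector_diff_chain_within[OF hd this] show ?thesis by (simp add: \<delta>_def comp_def)
  qed
  then have ve: "vel c \<delta> t = (b - a) *\<^sub>R vel c \<gamma> (?h t)" if "c \<in> atlas M" "t \<in> {0..1}" "\<delta> t \<in> dom c" for c t
    using that vel_eqI by blast
  show C: "C1_curve M \<delta>"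
    unfolding C1_curve_iff
  proof (intro conjI ballI impI)
    show "continuous_on {0..1} \<delta>"
      unfolding \<delta>_def by (rule continuous_on_compose2[OF C1_curveD(1)[OF \<gamma>] hc hI])
    fix c assume c: "c \<in> atlas M"
    show "(crd c \<circ> \<delta> has_vector_derivative vel c \<delta> t) (at t within {0..1})" if "t \<in> {0..1}" "\<delta> t \<in> dom c" for t
      using vd[OF c that] ve[OF c that] by simp
    have "continuous_on {t\<in>{0..1}. \<delta> t \<in> dom c} (\<lambda>t. (b - a) *\<^sub>R vel c \<gamma> (?h t))"
      by (intro continuous_intros continuous_on_compose2[OF C1_curveD(3)[OF \<gamma> c] hc])
        (use h in \<open>auto simp: \<delta>_def\<close>)
    then show "continuous_on {t\<in>{0..1}. \<delta> t \<in> dom c} (vel c \<delta>)"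
      by (rule continuous_on_eq) (simp add: ve[OF c])
  qed
  have sp: "speed M \<delta> t = \<bar>b - a\<bar> * speed M \<gamma> (?h t)" if t: "t \<in> {0..1}" for t
  proof -
    let ?c = "chart_at M (\<delta> t)"
    note ca = chart_at[of "\<delta> t"]
    have ca2: "\<gamma> (?h t) \<in> dom ?c" using ca(2) by (simp add: \<delta>_def)
    have lin: "bilinear (met ?c (\<gamma> (?h t)))" by (rule met_bilinear[OF ca(1) ca2])
    have "speed M \<delta> t = sqrt (met ?c (\<gamma> (?h t)) ((b - a) *\<^sub>R vel ?c \<gamma> (?h t)) ((b - a) *\<^sub>R vel ?c \<gamma> (?h t)))"
      unfolding speed_chart[OF C ca(1) t ca(2)] ve[OF ca(1) t ca(2)] gnorm_def by (simp add: \<delta>_def)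
    also have "\<dots> = \<bar>b - a\<bar> * gnorm ?c (\<gamma> (?h t)) (vel ?c \<gamma> (?h t))"
      by (simp add: bilinear_lmul[OF lin] bilinear_rmul[OF lin] gnorm_def real_sqrt_mult mult.assoc[symmetric])
    also have "\<dots> = \<bar>b - a\<bar> * speed M \<gamma> (?h t)"
      using speed_chart[OF \<gamma> ca(1) h[OF t] ca2] by simp
    finally show ?thesis .
  qed
  have "((\<lambda>t. (b - a) *\<^sub>R speed M \<gamma> (?h t)) has_integral (arc \<gamma> (?h 1) - arc \<gamma> (?h 0))) {0..1}"
  proof (rule fundamental_theorem_of_calculus)
    fix t :: real assume t: "t \<in> {0..1}"
    have "(arc \<gamma> has_vector_derivative speed M \<gamma> (?h t)) (at (?h t) within ?h ` {0..1})"
      using arc_deriv[OF \<gamma> h[OF t]] hI by (rule has_vector_derivative_within_subset)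
    from vector_diff_chain_within[OF hd this]
    show "((\<lambda>t. arc \<gamma> (?h t)) has_vector_derivative (b - a) *\<^sub>R speed M \<gamma> (?h t)) (at t within {0..1})"
      by (simp add: comp_def)
  qed simp
  then have I: "((\<lambda>t. (b - a) * speed M \<gamma> (?h t)) has_integral (arc \<gamma> b - arc \<gamma> a)) {0..1}" by simp
  show "integral {0..1} (speed M \<delta>) = \<bar>arc \<gamma> b - arc \<gamma> a\<bar>"
  proof (cases "a \<le> b")
    case True
    have "(speed M \<delta> has_integral (arc \<gamma> b - arc \<gamma> a)) {0..1}"
      by (rule has_integral_eq[OF _ I]) (use sp True in simp)
    then show ?thesis using arc_mono[OF \<gamma> _ True] ab by (simp add: integral_unique)
  next
    case False
    have "(speed M \<delta> has_integral - (arc \<gamma> b - arc \<gamma> a)) {0..1}"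
      by (rule has_integral_eq[OF _ has_integral_neg[OF I]]) (use sp False in \<open>simp add: minus_mult_left\<close>)
    then show ?thesis using arc_mono[OF \<gamma>, of b a] False ab by (simp add: integral_unique)
  qed
qed

section \<open>Concatenated paths\<close>

lemma pw_C1_path_trans: "pw_C1_path M y z m \<Longrightarrow> pw_C1_path M x y l \<Longrightarrow> pw_C1_path M x z (l + m)"
proof (induction rule: pw_C1_path.induct)
  case (2 y \<gamma> m)
  then show ?case using pw_C1_path.intros(2)[of M x \<gamma> "l + m"] by (simp add: add.assoc)
qed simp

lemma pw_C1_path_piece:
  assumes \<gamma>: "C1_curve M \<gamma>" and ab: "a \<in> {0..1}" "b \<in> {0..1}"
  shows "pw_C1_path M (\<gamma> a) (\<gamma> b) \<bar>arc \<gamma> b - arc \<gamma> a\<bar>"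
  using pw_C1_path.intros(2)[of M "\<gamma> a" "\<lambda>t. \<gamma> (a + t * (b - a))" 0]
    pw_C1_path.intros(1)[of M "\<gamma> a"] reparam[OF assms] by simp

lemma pw_C1_path_sym: "pw_C1_path M x y l \<Longrightarrow> pw_C1_path M y x l"
proof (induction rule: pw_C1_path.induct)
  case (2 x \<gamma> l)
  have "pw_C1_path M (\<gamma> 1) (\<gamma> 0) \<bar>arc \<gamma> 0 - arc \<gamma> 1\<bar>" by (rule pw_C1_path_piece[OF 2(2)]) auto
  then have "pw_C1_path M (\<gamma> 1) (\<gamma> 0) (integral {0..1} (speed M \<gamma>))"
    using arc_mono[OF 2(2), of 0 1] by (simp add: arc_def)
  from pw_C1_path_trans[OF 2(3) this] show ?case by (simp add: add.commute)
qed (rule pw_C1_path.intros(1))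

lemma pw_C1_path_nonneg: "pw_C1_path M x y l \<Longrightarrow> 0 \<le> l"
proof (induction rule: pw_C1_path.induct)
  case (2 x \<gamma> l)
  then show ?case using arc_mono[OF 2(2), of 0 1] by (simp add: arc_def)
qed simp

text \<open>Fundamental theorem of calculus on every piece, with the integrand bounded by
  \<open>L\<close> times the speed. Functions with bounded differential thereby give lower bounds
  for the distance.\<close>

lemma pw_C1_path_Lipschitz:
  assumes f: "C1_in UNIV (f :: 'm \<Rightarrow> real)" and L: "\<And>x. dnorm f x \<le> L" and p: "pw_C1_path M x y l"
  shows "\<bar>f y - f x\<bar> \<le> L * l"
  using p
proof (induction rule: pw_C1_path.induct)
  case (2 x \<gamma> l)
  note \<gamma> = 2(2)
  have "(f \<circ> \<gamma> has_vector_derivative deriv_at M f (\<gamma> t) (vel (chart_at M (\<gamma> t)) \<gamma> t)) (at t within {0..1})"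
    if "t \<in> {0..1}" for t
    unfolding deriv_at_def
    by (rule curve_chain[OF \<gamma> chart_at(1) that chart_at(2) C1_inD(1)[OF f chart_at UNIV_I]])
  then have I: "((\<lambda>t. deriv_at M f (\<gamma> t) (vel (chart_at M (\<gamma> t)) \<gamma> t)) has_integral ((f \<circ> \<gamma>) 1 - (f \<circ> \<gamma>) 0)) {0..1}"
    by (rule fundamental_theorem_of_calculus[OF zero_le_one])
  have sI: "speed M \<gamma> integrable_on {0..1}" by (rule integrable_continuous_interval[OF speed_cont[OF \<gamma>]])
  have "norm (integral {0..1} (\<lambda>t. deriv_at M f (\<gamma> t) (vel (chart_at M (\<gamma> t)) \<gamma> t))) \<le> integral {0..1} (\<lambda>t. L * speed M \<gamma> t)"
  proof (rule integral_norm_bound_integral)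
    show "(\<lambda>t. deriv_at M f (\<gamma> t) (vel (chart_at M (\<gamma> t)) \<gamma> t)) integrable_on {0..1}" using I by blast
    show "(\<lambda>t. L * speed M \<gamma> t) integrable_on {0..1}" using integrable_on_mult_right[OF sI] by simp
    fix t :: real assume t: "t \<in> {0..1}"
    have "norm (deriv_at M f (\<gamma> t) (vel (chart_at M (\<gamma> t)) \<gamma> t)) \<le>
        gnorm (chart_at M (\<gamma> t)) (\<gamma> t) (vel (chart_at M (\<gamma> t)) \<gamma> t) * dnorm f (\<gamma> t)"
      unfolding deriv_at_def by (rule dcoeff_le_dnorm[OF chart_at C1_in_diffble[OF f UNIV_I]])
    also have "\<dots> = dnorm f (\<gamma> t) * speed M \<gamma> t"
      by (simp add: speed_chart[OF \<gamma> chart_at(1) t chart_at(2)])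
    also have "\<dots> \<le> L * speed M \<gamma> t" by (intro mult_right_mono L speed_nonneg \<gamma> t)
    finally show "norm (deriv_at M f (\<gamma> t) (vel (chart_at M (\<gamma> t)) \<gamma> t)) \<le> L * speed M \<gamma> t" .
  qed
  then have "\<bar>f (\<gamma> 1) - f (\<gamma> 0)\<bar> \<le> L * integral {0..1} (speed M \<gamma>)"
    using integral_unique[OF I] by simp
  then show ?case using 2(3) by (simp add: distrib_left)
qed simp

text \<open>A straight segment in coordinates is an admissible curve, so local bounds on the metric
  become upper bounds for the distance.\<close>

lemma segment_path:
  assumes c: "c \<in> atlas M" and seg: "\<And>t. t \<in> {0..1} \<Longrightarrow> z + t *\<^sub>R v \<in> crd c ` dom c"
    and L: "\<And>t. t \<in> {0..1} \<Longrightarrow> gnorm c (par c (z + t *\<^sub>R v)) v \<le> L"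
  shows "\<exists>l\<le>L. pw_C1_path M (par c z) (par c (z + v)) l"
proof -
  let ?h = "\<lambda>t. z + t *\<^sub>R v"
  define \<gamma> where "\<gamma> t = par c (?h t)" for t
  have d: "\<gamma> t \<in> dom c" "crd c (\<gamma> t) = ?h t" if "t \<in> {0..1}" for t
    using seg[OF that] by (auto simp: \<gamma>_def inv_into_into f_inv_into_f)
  have hc: "continuous_on {0..1} ?h" by (intro continuous_intros)
  have cg: "continuous_on {0..1} \<gamma>"
    unfolding \<gamma>_def by (rule continuous_on_compose2[OF par_cont[OF c] hc]) (use seg in auto)
  have vd: "(crd c' \<circ> \<gamma> has_vector_derivative transit c c' (\<gamma> t) v) (at t within {0..1})"
    if c': "c' \<in> atlas M" and t: "t \<in> {0..1}" "\<gamma> t \<in> dom c'" for c' t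
  proof -
    have "(crd c' \<circ> par c has_derivative transit c c' (\<gamma> t)) (at (?h t))"
      using transit_deriv[OF c c' d(1)[OF t(1)] t(2)] d(2)[OF t(1)] by simp
    then have 1: "(crd c' \<circ> par c has_derivative transit c c' (\<gamma> t)) (at (?h t) within ?h ` {0..1})"
      by (rule has_derivative_at_withinI)
    have 2: "(?h has_derivative (\<lambda>x. x *\<^sub>R v)) (at t within {0..1})"
      by (auto intro!: derivative_eq_intros)
    have lin: "linear (transit c c' (\<gamma> t))" using 1 by (rule has_derivative_linear)
    show ?thesis using diff_chain_within[OF 2 1]
      by (simp add: has_vector_derivative_def comp_def linear_cmul[OF lin[unfolded \<gamma>_def]] \<gamma>_def)
  qed
  then have ve: "vel c' \<gamma> t = transit c c' (\<gamma> t) v" if "c' \<in> atlas M" "t \<in> {0..1}" "\<gamma> t \<in> dom c'" for c' t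
    using that vel_eqI by blast
  have C: "C1_curve M \<gamma>"
    unfolding C1_curve_iff
  proof (intro conjI ballI impI cg)
    fix c' assume c': "c' \<in> atlas M"
    show "(crd c' \<circ> \<gamma> has_vector_derivative vel c' \<gamma> t) (at t within {0..1})" if "t \<in> {0..1}" "\<gamma> t \<in> dom c'" for t
      using vd[OF c' that] ve[OF c' that] by simp
    have "continuous_on {t\<in>{0..1}. \<gamma> t \<in> dom c'} (\<lambda>t. transit c c' (\<gamma> t) v)"
      by (rule continuous_on_compose2[OF transit_cont[OF c c'] continuous_on_subset[OF cg]]) (use d in auto)
    then show "continuous_on {t\<in>{0..1}. \<gamma> t \<in> dom c'} (vel c' \<gamma>)"
      by (rule continuous_on_eq) (simp add: ve[OF c'])
  qed
  have sp: "speed M \<gamma> t \<le> L" if t: "t \<in> {0..1}" for t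
  proof -
    have "vel c \<gamma> t = v"
      unfolding ve[OF c t d(1)[OF t]] transit_def by (rule crd_dcoeff[OF c d(1)[OF t]])
    then have "speed M \<gamma> t = gnorm c (par c (?h t)) v"
      using speed_chart[OF C c t d(1)[OF t]] \<gamma>_def[of t] by simp
    then show ?thesis using L[OF t] by simp
  qed
  have "integral {0..1} (speed M \<gamma>) \<le> integral {0..1} (\<lambda>t::real. L)"
    by (intro integral_le integrable_continuous_interval speed_cont C continuous_on_const sp)
  then have "integral {0..1} (speed M \<gamma>) \<le> L" by simp
  moreover have "pw_C1_path M (\<gamma> 0) (\<gamma> 1) (0 + integral {0..1} (speed M \<gamma>))"
    by (intro pw_C1_path.intros C)
  ultimately show ?thesis by (intro exI[of _ "integral {0..1} (speed M \<gamma>)"]) (simp add: \<gamma>_def)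
qed

lemma path_nearby:
  assumes e: "\<epsilon> > 0"
  obtains V where "open V" "p \<in> V" "\<And>y. y \<in> V \<Longrightarrow> \<exists>l<\<epsilon>. pw_C1_path M p y l"
proof -
  obtain c where c: "c \<in> atlas M" "p \<in> dom c" using ex_chart by blast
  obtain W A where W: "open W" "p \<in> W" "W \<subseteq> dom c" "A > 0"
    and A: "\<And>x v. x \<in> W \<Longrightarrow> gnorm c x v \<le> A * norm v"
    using gnorm_euclid_nearby[OF c] by metis
  obtain r where r: "r > 0" "cball (crd c p) r \<subseteq> crd c ` dom c" "par c ` cball (crd c p) r \<subseteq> W"
    using chart_nbhd[OF c W(1,2)] by blast
  define \<rho> where "\<rho> = min r (\<epsilon> / (2 * A))"
  have \<rho>: "\<rho> > 0" "\<rho> \<le> r" "A * \<rho> < \<epsilon>"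
  proof -
    show "\<rho> > 0" "\<rho> \<le> r" using r e W by (auto simp: \<rho>_def)
    have "A * \<rho> \<le> A * (\<epsilon> / (2 * A))" using W(4) by (intro mult_left_mono) (auto simp: \<rho>_def)
    also have "\<dots> = \<epsilon> / 2" using W(4) by simp
    finally show "A * \<rho> < \<epsilon>" using e by simp
  qed
  define V where "V = par c ` ball (crd c p) \<rho>"
  have "open V" unfolding V_def by (rule par_open_image[OF c(1) open_ball]) (use r \<rho> in auto)
  moreover have "p \<in> V" unfolding V_def using c \<rho> by (intro image_eqI[of _ _ "crd c p"]) auto
  moreover have "\<exists>l<\<epsilon>. pw_C1_path M p y l" if y: "y \<in> V" for y
  proof -
    obtain w where w: "w \<in> ball (crd c p) \<rho>" "y = par c w" using y V_def by blast
    let ?v = "w - crd c p"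
    have nv: "norm ?v < \<rho>" using w by (simp add: dist_norm norm_minus_commute)
    have seg: "crd c p + t *\<^sub>R ?v \<in> cball (crd c p) r" if "t \<in> {0..1}" for t
    proof -
      have "norm (t *\<^sub>R ?v) \<le> 1 * norm ?v" using that by (simp add: mult_left_le_one_le)
      then show ?thesis using nv \<rho> by (simp add: dist_norm)
    qed
    have "\<exists>l\<le>A * norm ?v. pw_C1_path M (par c (crd c p)) (par c (crd c p + ?v)) l"
      by (rule segment_path[OF c(1)]) (use seg r in \<open>blast intro!: A\<close>)+
    then obtain l where l: "l \<le> A * norm ?v" "pw_C1_path M p y l" using c w by auto
    have "A * norm ?v < \<epsilon>" using mult_strict_left_mono[OF nv W(4)] \<rho>(3) by linarith
    then show ?thesis using l by (intro exI[of _ l]) auto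
  qed
  ultimately show ?thesis using that by blast
qed

text \<open>Being joined by a path is an equivalence relation with open classes, so connectedness
  applies. It guarantees that the infimum in \<open>riemannian_dist\<close> is never that of an
  empty set.\<close>

lemma ex_path: "\<exists>l. pw_C1_path M x y l"
proof (rule connected_equivalence_relation[OF connected_M])
  show "\<exists>l. pw_C1_path M y x l" if "\<exists>l. pw_C1_path M x y l" for x y using that pw_C1_path_sym by blast
  show "\<exists>l. pw_C1_path M x z l" if "\<exists>l. pw_C1_path M x y l" "\<exists>l. pw_C1_path M y z l" for x y z
    using that pw_C1_path_trans by blast
  show "\<exists>T. openin (top_of_set UNIV) T \<and> a \<in> T \<and> (\<forall>x\<in>T. \<exists>l. pw_C1_path M a x l)" for a
  proof -
    obtain V where "open V" "a \<in> V" "\<And>y. y \<in> V \<Longrightarrow> \<exists>l<1. pw_C1_path M a y l"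
      by (rule path_nearby[of 1 a]) auto
    then show ?thesis by (intro exI[of _ V]) auto
  qed
qed auto

section \<open>The distance function and its topology\<close>

abbreviation d :: "'m \<Rightarrow> 'm \<Rightarrow> real" where "d \<equiv> riemannian_dist M"

lemma path_bdd_below: "bdd_below {l. pw_C1_path M x y l}"
  using pw_C1_path_nonneg by (intro bdd_belowI[of _ 0]) auto

lemma d_le: "pw_C1_path M x y l \<Longrightarrow> d x y \<le> l"
  unfolding riemannian_dist_def by (rule cInf_lower[OF _ path_bdd_below]) simp

lemma d_less: "d x y < r \<Longrightarrow> \<exists>l<r. pw_C1_path M x y l"
  unfolding riemannian_dist_def using cInf_lessD[of "{l. pw_C1_path M x y l}" r] ex_path[of x y] by auto

lemma d_nonneg: "0 \<le> d x y"
  unfolding riemannian_dist_def by (rule cInf_greatest) (use ex_path pw_C1_path_nonneg in auto)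

lemma d_sym: "d x y = d y x"
proof -
  have "{l. pw_C1_path M x y l} = {l. pw_C1_path M y x l}" using pw_C1_path_sym by blast
  then show ?thesis by (simp add: riemannian_dist_def)
qed

lemma d_triangle: "d x z \<le> d x y + d y z"
proof (rule field_le_epsilon)
  fix e :: real assume e: "0 < e"
  obtain l where l: "l < d x y + e/2" "pw_C1_path M x y l" using d_less[of x y "d x y + e/2"] e by auto
  obtain m where m: "m < d y z + e/2" "pw_C1_path M y z m" using d_less[of y z "d y z + e/2"] e by auto
  show "d x z \<le> d x y + d y z + e" using d_le[OF pw_C1_path_trans[OF m(2) l(2)]] l m by linarith
qed

lemma d_refl: "d x x = 0"
  by (intro antisym d_le pw_C1_path.intros(1) d_nonneg)

lemma d_Lipschitz:
  assumes f: "C1_in UNIV (f :: 'm \<Rightarrow> real)" and L: "\<And>x. dnorm f x \<le> L"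
  shows "\<bar>f y - f x\<bar> \<le> L * d x y"
proof (rule field_le_epsilon)
  fix e :: real assume e: "0 < e"
  have L0: "0 \<le> L" using L dnorm_nonneg order_trans by blast
  \<comment> \<open>The divisor is \<open>L + 1\<close> because \<open>L\<close> may be 0.\<close>
  have "d x y < d x y + e / (L + 1)" using e L0 by simp
  then obtain l where l: "l < d x y + e / (L + 1)" "pw_C1_path M x y l" using d_less by blast
  have "\<bar>f y - f x\<bar> \<le> L * l" by (rule pw_C1_path_Lipschitz[OF f L l(2)])
  also have "\<dots> \<le> L * (d x y + e / (L + 1))" using l L0 by (intro mult_left_mono) auto
  also have "\<dots> \<le> L * d x y + e"
  proof -
    have "L * (e / (L + 1)) \<le> e" using e L0 by (simp add: field_simps)
    then show ?thesis by (simp only: distrib_left)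
  qed
  finally show "\<bar>f y - f x\<bar> \<le> L * d x y + e" .
qed

text \<open>A bump supported in \<open>U\<close> is Lipschitz for \<open>d\<close> and falls from 1
  at \<open>x\<close> to 0 outside \<open>U\<close>, so leaving \<open>U\<close> costs a definite
  length. This gives both the separation axiom for \<open>d\<close> and one half of the comparison
  of topologies.\<close>

lemma d_ball_subset:
  assumes "open U" "x \<in> U"
  shows "\<exists>r>0. \<forall>y. d x y < r \<longrightarrow> y \<in> U"
proof -
  obtain f :: "'m \<Rightarrow> real" and V K where f: "C1_in UNIV f" "open V" "x \<in> V" "\<And>y. y \<in> V \<Longrightarrow> f y = 1"
    "compact K" "K \<subseteq> U" "\<And>y. y \<notin> K \<Longrightarrow> f y = 0" by (rule bump[OF assms]) blast
  let ?g = "\<lambda>y. complex_of_real (f y)"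
  have "?g \<in> C10_maps M"
    by (rule compact_support_C10[OF C1_in_linear[OF bounded_linear_of_real f(1)] f(5)]) (simp add: f(7))
  then obtain B where B: "B > 0" "\<And>y. jnorm ?g y \<le> B" using C10_bounded by blast
  have L: "dnorm f y \<le> B" for y
    using order_trans[OF dnorm_le_jnorm B(2), of y] dnorm_of_real(2)[OF C1_in_diffble[OF f(1) UNIV_I]] by simp
  have "y \<in> U" if "d x y < 1 / B" for y
  proof (rule ccontr)
    assume "y \<notin> U"
    then have "f y = 0" "f x = 1" using f by auto
    then have "1 \<le> B * d x y" using d_Lipschitz[OF f(1) L, of y x] by simp
    then show False using that B(1) by (simp add: field_simps)
  qed
  then show ?thesis using B(1) by (intro exI[of _ "1/B"]) auto
qed

lemma d_nearby:
  assumes "r > 0"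
  shows "\<exists>V. open V \<and> x \<in> V \<and> (\<forall>y\<in>V. d x y < r)"
  by (rule path_nearby[OF assms, of x]) (meson d_le le_less_trans)

sublocale dist: Metric_space UNIV d
proof
  show "0 \<le> d x y" for x y by (rule d_nonneg)
  show "d x y = d y x" for x y by (rule d_sym)
  show "d x y = 0 \<longleftrightarrow> x = y" for x y
  proof
    assume "d x y = 0"
    show "x = y"
    proof (rule ccontr)
      assume "x \<noteq> y"
      then obtain r where "r > 0" "\<forall>z. d x z < r \<longrightarrow> z \<in> - {y}" using d_ball_subset[of "- {y}" x] by auto
      moreover have "d x y < r" using \<open>d x y = 0\<close> \<open>r > 0\<close> by simp
      ultimately show False by blast
    qed
  qed (simp add: d_refl)
  show "d x z \<le> d x y + d y z" for x y z by (rule d_triangle)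
qed

lemma mtopology_eq: "dist.mtopology = euclidean"
proof -
  have "openin dist.mtopology U \<longleftrightarrow> open U" for U
  proof
    assume "openin dist.mtopology U"
    then have *: "\<And>x. x \<in> U \<Longrightarrow> \<exists>r>0. dist.mball x r \<subseteq> U" by (simp add: dist.openin_mtopology)
    show "open U"
    proof (subst open_subopen, intro ballI)
      fix x assume "x \<in> U"
      then obtain r where "r > 0" "dist.mball x r \<subseteq> U" using * by blast
      moreover obtain V where "open V" "x \<in> V" "\<forall>y\<in>V. d x y < r"
        using d_nearby[OF \<open>r > 0\<close>, of x] by (elim exE conjE)
      ultimately show "\<exists>T. open T \<and> x \<in> T \<and> T \<subseteq> U"
        by (intro exI[of _ V]) (auto simp: dist.mball_def subset_iff)
    qed
  next
    assume U: "open U"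
    show "openin dist.mtopology U"
      unfolding dist.openin_mtopology
    proof (intro conjI subset_UNIV allI impI)
      fix x assume "x \<in> U"
      then obtain r where "r > 0" "\<forall>y. d x y < r \<longrightarrow> y \<in> U" using d_ball_subset[OF U] by blast
      then show "\<exists>r>0. dist.mball x r \<subseteq> U" by (intro exI[of _ r]) (auto simp: dist.mball_def)
    qed
  qed
  then show ?thesis by (simp add: topology_eq)
qed

text \<open>Arc length takes every intermediate value along a piece. This length-space property is
  what the compactness argument below uses in place of geodesics.\<close>

lemma path_intermediate:
  assumes "pw_C1_path M x y l" "0 \<le> r" "r \<le> l"
  shows "\<exists>z. d x z \<le> r \<and> d z y \<le> l - r"
  using assms
proof (induction arbitrary: r rule: pw_C1_path.induct)
  case (1 x)
  then show ?case by (intro exI[of _ x]) (simp add: d_refl)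
next
  case (2 x \<gamma> l)
  note \<gamma> = 2(2)
  have a1: "arc \<gamma> 1 = integral {0..1} (speed M \<gamma>)" by (simp add: arc_def)
  show ?case
  proof (cases "r \<le> l")
    case True
    then obtain z where z: "d x z \<le> r" "d z (\<gamma> 0) \<le> l - r" using 2 by blast
    have "d (\<gamma> 0) (\<gamma> 1) \<le> \<bar>arc \<gamma> 1 - arc \<gamma> 0\<bar>" by (intro d_le pw_C1_path_piece[OF \<gamma>]) auto
    also have "\<dots> = integral {0..1} (speed M \<gamma>)" using arc_mono[OF \<gamma>, of 0 1] a1 by simp
    finally show ?thesis using z d_triangle[of z "\<gamma> 1" "\<gamma> 0"] by (intro exI[of _ z]) auto
  next
    case False
    have "\<exists>t. 0 \<le> t \<and> t \<le> 1 \<and> arc \<gamma> t = r - l"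
      by (rule IVT') (use False 2(5) a1 arc_cont[OF \<gamma>] in auto)
    then obtain t where t: "t \<in> {0..1}" "arc \<gamma> t = r - l" by auto
    have "d (\<gamma> 0) (\<gamma> t) \<le> \<bar>arc \<gamma> t - arc \<gamma> 0\<bar>" by (intro d_le pw_C1_path_piece[OF \<gamma>]) (use t in auto)
    then have 1: "d (\<gamma> 0) (\<gamma> t) \<le> r - l" using t False by simp
    have "d (\<gamma> t) (\<gamma> 1) \<le> \<bar>arc \<gamma> 1 - arc \<gamma> t\<bar>" by (intro d_le pw_C1_path_piece[OF \<gamma>]) (use t in auto)
    then have 2: "d (\<gamma> t) (\<gamma> 1) \<le> integral {0..1} (speed M \<gamma>) - (r - l)"
      using arc_mono[OF \<gamma>, of t 1] t a1 by auto
    have "d x (\<gamma> 0) \<le> l" by (rule d_le[OF \<open>pw_C1_path M x (\<gamma> 0) l\<close>])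
    then show ?thesis using 1 2 d_triangle[of x "\<gamma> t" "\<gamma> 0"] by (intro exI[of _ "\<gamma> t"]) auto
  qed
qed

text \<open>The point lies on a nearly shortest path. As the infimum defining \<open>d\<close> need
  not be attained, one of the distances is bounded strictly, under a strict hypothesis.\<close>

lemma d_intermediate:
  assumes "d x y < r + s" "0 \<le> r" "0 < s"
  shows "\<exists>z. d x z \<le> r \<and> d z y < s"
proof -
  obtain l where l: "l < r + s" "pw_C1_path M x y l" using d_less[OF assms(1)] by blast
  have "0 \<le> l" by (rule pw_C1_path_nonneg[OF l(2)])
  then obtain z where z: "d x z \<le> min r l" "d z y \<le> l - min r l"
    using path_intermediate[OF l(2), of "min r l"] assms by auto
  then show ?thesis using l(1) assms(3) by (intro exI[of _ z]) (auto simp: min_def split: if_splits)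
qed

end

section \<open>Compactness of closed balls\<close>

context riemannian
begin

lemma compact_subcover:
  fixes V :: "'m \<Rightarrow> 'm set"
  assumes "compact B" "\<And>p. p \<in> B \<Longrightarrow> open (V p)" "\<And>p. p \<in> B \<Longrightarrow> p \<in> V p"
  shows "\<exists>D\<subseteq>B. finite D \<and> B \<subseteq> (\<Union>p\<in>D. V p)"
proof -
  have *: "B \<subseteq> (\<Union>p\<in>B. V p)" using assms(3) by blast
  obtain D where "D \<subseteq> B" "finite D" "B \<subseteq> (\<Union>p\<in>D. V p)"
    by (rule compactE_image[OF assms(1,2) *])
  then show ?thesis by blast
qed

lemma mcball_eq: "dist.mcball x r = {y. d x y \<le> r}"
  by (auto simp: dist.mcball_def)

lemma mcball_0: "dist.mcball x 0 = {x}"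
proof -
  have "d x y \<le> 0 \<longleftrightarrow> y = x" for y
  proof
    assume "d x y \<le> 0"
    then have "d x y = 0" using d_nonneg[of x y] by (rule antisym)
    then show "y = x" using dist.zero[of x y] by simp
  qed (simp add: d_refl)
  then show ?thesis by (simp add: mcball_eq)
qed

lemma closed_mcball: "closed (dist.mcball x r)"
  using dist.closedin_mcball[of x r] by (simp add: mtopology_eq)

lemma compact_subset_mcball: "compact (dist.mcball x r) \<Longrightarrow> s \<le> r \<Longrightarrow> compact (dist.mcball x s)"
proof -
  assume c: "compact (dist.mcball x r)" and "s \<le> r"
  then have "dist.mcball x s \<subseteq> dist.mcball x r" by (auto simp: mcball_eq)
  then show ?thesis using compact_Int_closed[OF c closed_mcball[of x s]] by (simp add: Int_absorb1)
qed

lemma locally_compact_d: "\<exists>r>0. compact (dist.mcball y r)"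
proof -
  obtain c where c: "c \<in> atlas M" "y \<in> dom c" using ex_chart by blast
  obtain r where r: "r > 0" "cball (crd c y) r \<subseteq> crd c ` dom c"
    by (rule chart_nbhd[OF c open_UNIV UNIV_I]) blast
  let ?K = "par c ` cball (crd c y) r" and ?V = "par c ` ball (crd c y) r"
  have K: "compact ?K"
    by (rule compact_continuous_image[OF continuous_on_subset[OF par_cont[OF c(1)] r(2)] compact_cball_model])
  have "open ?V" using r by (intro par_open_image[OF c(1)]) auto
  moreover have "y \<in> ?V" using c r by (intro image_eqI[of _ _ "crd c y"]) auto
  ultimately obtain \<delta> where \<delta>: "\<delta> > 0" "\<forall>z. d y z < \<delta> \<longrightarrow> z \<in> ?V" using d_ball_subset by blast
  have "dist.mcball y (\<delta>/2) \<subseteq> ?K"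
  proof
    fix z assume "z \<in> dist.mcball y (\<delta>/2)"
    then have "z \<in> ?V" using \<delta> by (simp add: mcball_eq)
    then show "z \<in> ?K" using ball_subset_cball by blast
  qed
  then have "compact (dist.mcball y (\<delta>/2))"
    using compact_Int_closed[OF K closed_mcball[of y "\<delta>/2"]] by (simp add: Int_absorb1)
  then show ?thesis using \<delta>(1) by (intro exI[of _ "\<delta>/2"]) auto
qed

text \<open>A compact ball is covered by finitely many small compact balls, and these still cover a
  slightly larger concentric ball, because its points are close to points of the original
  one.\<close>

lemma compact_mcball_extend:
  assumes "compact (dist.mcball x r)" "0 \<le> r"
  shows "\<exists>s>r. compact (dist.mcball x s)"
proof -
  let ?B = "dist.mcball x r"
  obtain \<delta> where \<delta>: "\<And>y. \<delta> y > 0" "\<And>y. compact (dist.mcball y (\<delta> y))"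
    using locally_compact_d by metis
  have "\<exists>V. open V \<and> y \<in> V \<and> (\<forall>z\<in>V. d y z < \<delta> y / 2)" for y using d_nearby[of "\<delta> y / 2" y] \<delta>(1) by simp
  then obtain V where V: "\<And>y. open (V y)" "\<And>y. y \<in> V y" "\<And>y z. z \<in> V y \<Longrightarrow> d y z < \<delta> y / 2" by metis
  obtain D where D: "D \<subseteq> ?B" "finite D" "?B \<subseteq> (\<Union>y\<in>D. V y)"
    using compact_subcover[OF assms(1) V(1,2)] by blast
  have xB: "x \<in> ?B" using assms(2) by (simp add: mcball_eq d_refl)
  then have "D \<noteq> {}" using D(3) by auto
  \<comment> \<open>The centre \<open>y\<close> is within \<open>\<delta> y / 2\<close> of an
    intermediate point, and that point within \<open>2 * \<epsilon> \<le> \<delta> y / 2\<close> of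
    the target.\<close>
  define \<epsilon> where "\<epsilon> = Min (\<delta> ` D) / 4"
  have \<epsilon>: "\<epsilon> > 0" "\<And>y. y \<in> D \<Longrightarrow> 4 * \<epsilon> \<le> \<delta> y"
    using D(2) \<open>D \<noteq> {}\<close> \<delta>(1) by (auto simp: \<epsilon>_def)
  have "dist.mcball x (r + \<epsilon>) \<subseteq> (\<Union>y\<in>D. dist.mcball y (\<delta> y))"
  proof
    fix z assume "z \<in> dist.mcball x (r + \<epsilon>)"
    then have "d x z < r + 2 * \<epsilon>" using \<epsilon>(1) by (simp add: mcball_eq)
    then obtain w where w: "d x w \<le> r" "d w z < 2 * \<epsilon>" using d_intermediate[of x z r "2*\<epsilon>"] assms(2) \<epsilon>(1) by auto
    then obtain y where y: "y \<in> D" "w \<in> V y" using D(3) by (auto simp: mcball_eq)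
    have "d y z \<le> \<delta> y" using d_triangle[of y z w] V(3)[OF y(2)] w(2) \<epsilon>(2)[OF y(1)] by linarith
    then show "z \<in> (\<Union>y\<in>D. dist.mcball y (\<delta> y))" using y(1) by (auto simp: mcball_eq)
  qed
  moreover have "compact (\<Union>y\<in>D. dist.mcball y (\<delta> y))" using D(2) \<delta>(2) by (intro compact_UN) auto
  ultimately have "compact (dist.mcball x (r + \<epsilon>))"
    using compact_Int_closed[OF _ closed_mcball[of x "r + \<epsilon>"]] by (metis Int_absorb1)
  then show ?thesis using \<epsilon>(1) by (intro exI[of _ "r + \<epsilon>"]) auto
qed

text \<open>A finite net of a slightly smaller ball, which is compact, is also a coarser net of the
  ball of radius \<open>R\<close>. Total boundedness becomes compactness by completeness.\<close>

lemma compact_mcball_limit: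
  assumes complete: "complete_manifold M" and R: "0 \<le> R" and less: "\<And>r. 0 \<le> r \<Longrightarrow> r < R \<Longrightarrow> compact (dist.mcball x r)"
  shows "compact (dist.mcball x R)"
proof -
  have mc: "dist.mcomplete" using complete by (simp add: complete_manifold_def)
  have "dist.mtotally_bounded (dist.mcball x R)"
    unfolding dist.mtotally_bounded_def
  proof (intro allI impI)
    fix \<epsilon> :: real assume e: "\<epsilon> > 0"
    \<comment> \<open>If \<open>r < R\<close> fails then \<open>R = 0\<close>, and the ball is a
      single point. Otherwise a point of the large ball is within \<open>\<epsilon> / 2\<close> of
      the small one, which leaves room for a net of mesh \<open>\<epsilon> / 4\<close>.\<close>
    define r where "r = max 0 (R - \<epsilon> / 4)"
    have r: "0 \<le> r" "r \<le> R" "R - r \<le> \<epsilon> / 4" using R e by (auto simp: r_def max_def)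
    have "compact (dist.mcball x r)"
    proof (cases "r < R")
      case True
      then show ?thesis using less r by blast
    next
      case False
      then have "R = 0" using R e by (auto simp: r_def max_def split: if_splits)
      then have "r = 0" using r by simp
      then show ?thesis by (simp add: mcball_0)
    qed
    then have "dist.mtotally_bounded (dist.mcball x r)"
      by (intro dist.compactin_imp_mtotally_bounded) (simp add: mtopology_eq compactin_euclidean_iff)
    then obtain D where D: "finite D" "D \<subseteq> dist.mcball x r" "dist.mcball x r \<subseteq> (\<Union>y\<in>D. dist.mball y (\<epsilon>/4))"
      unfolding dist.mtotally_bounded_def using e by (metis divide_pos_pos zero_less_numeral)
    have "dist.mcball x R \<subseteq> (\<Union>y\<in>D. dist.mball y \<epsilon>)"
    proof
      fix z assume "z \<in> dist.mcball x R"
      then have "d x z < r + \<epsilon> / 2" using r(3) e by (simp add: mcball_eq)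
      then obtain w where w: "d x w \<le> r" "d w z < \<epsilon> / 2" using d_intermediate[of x z r "\<epsilon>/2"] r(1) e by auto
      then obtain y where y: "y \<in> D" "d y w < \<epsilon> / 4" using D(3) by (auto simp: mcball_eq)
      have "d y z < \<epsilon>" using d_triangle[of y z w] w(2) y(2) e by linarith
      then show "z \<in> (\<Union>y\<in>D. dist.mball y \<epsilon>)" using y(1) by auto
    qed
    moreover have "D \<subseteq> dist.mcball x R" using D(2) r(2) by (auto simp: mcball_eq subset_iff intro: order_trans)
    ultimately show "\<exists>K. finite K \<and> K \<subseteq> dist.mcball x R \<and> dist.mcball x R \<subseteq> (\<Union>y\<in>K. dist.mball y \<epsilon>)"
      using D(1) by blast
  qed
  then have "compactin dist.mtopology (dist.mtopology closure_of (dist.mcball x R))"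
    using dist.mtotally_bounded_eq_compact_closure_of[OF mc] by blast
  then show ?thesis
    using closure_of_closedin[OF dist.closedin_mcball] by (simp add: mtopology_eq compactin_euclidean_iff)
qed

text \<open>If some ball were not compact, the radii with compact ball would be bounded. Their
  supremum would belong to them by completeness, and could then be exceeded by local
  compactness.\<close>

theorem hopf_rinow:
  assumes complete: "complete_manifold M"
  shows "compact (dist.mcball x R)"
proof (rule ccontr)
  assume R: "\<not> compact (dist.mcball x R)"
  define S where "S = {r. 0 \<le> r \<and> compact (dist.mcball x r)}"
  have up: "r \<le> R" if "r \<in> S" for r
  proof (rule ccontr)
    assume "\<not> r \<le> R"
    then show False using compact_subset_mcball[of x r R] that R by (simp add: S_def)
  qed
  have 0: "0 \<in> S" by (simp add: S_def mcball_0)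
  have bdd: "bdd_above S" using up by (intro bdd_aboveI[of _ R])
  define T where "T = Sup S"
  have T0: "0 \<le> T" unfolding T_def by (rule cSup_upper[OF 0 bdd])
  have "compact (dist.mcball x r)" if r: "0 \<le> r" "r < T" for r
  proof -
    have "\<exists>s\<in>S. r < s" using r(2) less_cSup_iff[OF _ bdd] 0 unfolding T_def by blast
    then obtain s where s: "s \<in> S" "r < s" by blast
    then show ?thesis using compact_subset_mcball[of x s r] by (simp add: S_def)
  qed
  then have "compact (dist.mcball x T)" by (rule compact_mcball_limit[OF complete T0])
  then obtain s where s: "s > T" "compact (dist.mcball x s)" using compact_mcball_extend T0 by blast
  then have "s \<in> S" using T0 by (simp add: S_def)
  then have "s \<le> T" unfolding T_def using bdd by (rule cSup_upper)
  then show False using s(1) by simp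
qed

section \<open>Cut-off functions with uniformly bounded differentials\<close>

lemma met_cauchy_schwarz:
  assumes c: "c \<in> atlas M" "x \<in> dom c"
  shows "\<bar>met c x v w\<bar> \<le> gnorm c x v * gnorm c x w"
proof -
  let ?F = "cframe c x"
  have F: "orthonormal_frame (met c x) ?F" by (rule cframe_orthonormal[OF c])
  have bl: "bilinear (met c x)" by (rule met_bilinear[OF c])
  have lin: "linear (\<lambda>w. met c x v w)" using bl by (simp add: bilinear_def)
  have "met c x v w = met c x v (\<Sum>b\<in>axes M. met c x w (?F b) *\<^sub>R ?F b)"
    using F by (simp add: orthonormal_frame_def)
  also have "\<dots> = (\<Sum>b\<in>axes M. met c x w (?F b) * met c x v (?F b))"
    by (simp add: linear_sum[OF lin] linear_cmul[OF lin])
  finally have "\<bar>met c x v w\<bar> \<le> (\<Sum>b\<in>axes M. \<bar>met c x v (?F b)\<bar> * \<bar>met c x w (?F b)\<bar>)"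
    using sum_abs[of "\<lambda>b. met c x w (?F b) * met c x v (?F b)" "axes M"] by (simp add: abs_mult mult.commute)
  also have "\<dots> \<le> L2_set (\<lambda>b. met c x v (?F b)) (axes M) * L2_set (\<lambda>b. met c x w (?F b)) (axes M)"
    by (rule L2_set_mult_ineq)
  also have "\<dots> = gnorm c x v * gnorm c x w"
    by (simp add: L2_set_def gnorm_def frame_parseval[OF F bl, of v] frame_parseval[OF F bl, of w])
  finally show ?thesis .
qed

lemma gnorm_triangle:
  assumes c: "c \<in> atlas M" "x \<in> dom c"
  shows "gnorm c x (v + w) \<le> gnorm c x v + gnorm c x w"
proof (rule power2_le_imp_le)
  have bl: "bilinear (met c x)" by (rule met_bilinear[OF c])
  have "(gnorm c x (v + w))\<^sup>2 = met c x v v + 2 * met c x v w + met c x w w"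
    by (simp add: gnorm_sq[OF c] bilinear_ladd[OF bl] bilinear_radd[OF bl] met_sym[OF c, of w v])
  also have "\<dots> \<le> (gnorm c x v)\<^sup>2 + 2 * (gnorm c x v * gnorm c x w) + (gnorm c x w)\<^sup>2"
    using met_cauchy_schwarz[OF c, of v w] by (simp add: gnorm_sq[OF c])
  also have "\<dots> = (gnorm c x v + gnorm c x w)\<^sup>2" by (simp add: power2_sum)
  finally show "(gnorm c x (v + w))\<^sup>2 \<le> (gnorm c x v + gnorm c x w)\<^sup>2" .
  show "0 \<le> gnorm c x v + gnorm c x w" by (simp add: gnorm_nonneg c)
qed

lemma gnorm_scaleR:
  assumes c: "c \<in> atlas M" "x \<in> dom c"
  shows "gnorm c x (t *\<^sub>R v) = \<bar>t\<bar> * gnorm c x v"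
  unfolding gnorm_def
  by (simp add: bilinear_lmul[OF met_bilinear[OF c]] bilinear_rmul[OF met_bilinear[OF c]]
      real_sqrt_mult mult.assoc[symmetric])

lemma met_bounded_bilinear:
  assumes c: "c \<in> atlas M" "x \<in> dom c"
  shows "bounded_bilinear (met c x)"
proof -
  have bl: "bilinear (met c x)" by (rule met_bilinear[OF c])
  obtain A where A: "A > 0" "\<And>v. gnorm c x v \<le> A * norm v" by (rule gnorm_euclid[OF c]) blast
  show ?thesis
  proof (rule bounded_bilinear.intro)
    show "\<exists>K. \<forall>v w. norm (met c x v w) \<le> norm v * norm w * K"
    proof (intro exI[of _ "A * A"] allI)
      fix v w
      have "\<bar>met c x v w\<bar> \<le> gnorm c x v * gnorm c x w" by (rule met_cauchy_schwarz[OF c])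
      also have "\<dots> \<le> (A * norm v) * (A * norm w)"
        using A by (intro mult_mono gnorm_nonneg c) auto
      finally show "norm (met c x v w) \<le> norm v * norm w * (A * A)" by (simp add: mult_ac)
    qed
  qed (simp_all add: bilinear_ladd[OF bl] bilinear_radd[OF bl] bilinear_lmul[OF bl] bilinear_rmul[OF bl])
qed

lemma gnorm_cont:
  assumes c: "c \<in> atlas M" "x \<in> dom c"
  shows "continuous_on S (gnorm c x)"
  unfolding gnorm_def[abs_def]
  by (intro continuous_intros bounded_bilinear.continuous_on[OF met_bounded_bilinear[OF c]])

text \<open>The base point \<open>q\<close> of the constant comparison metric differs from the centre \<open>p\<close>, since finitely
  many constant metrics have to serve all points of a compact set with one radius.\<close>

definition almost_flat :: "('m, 'e) chart \<Rightarrow> 'm \<Rightarrow> 'm \<Rightarrow> real \<Rightarrow> bool" where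
  "almost_flat c q p r \<longleftrightarrow> c \<in> atlas M \<and> q \<in> dom c \<and> p \<in> dom c \<and> (\<forall>z. gnorm c q (z - crd c p) < r \<longrightarrow>
    z \<in> crd c ` dom c \<and> (\<forall>v. gnorm c (par c z) v \<le> 2 * gnorm c q v \<and> gnorm c q v \<le> 2 * gnorm c (par c z) v))"

lemma almost_flat_exists: "\<exists>c r. r > 0 \<and> almost_flat c q q r"
proof -
  obtain c where c: "c \<in> atlas M" "q \<in> dom c" using ex_chart by blast
  obtain W where W: "open W" "q \<in> W" "W \<subseteq> dom c"
    "\<And>x v. x \<in> W \<Longrightarrow> gnorm c x v \<le> 2 * gnorm c q v" "\<And>x v. x \<in> W \<Longrightarrow> gnorm c q v \<le> 2 * gnorm c x v"
    by (rule gnorm_nearby[OF c]) blast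
  obtain r where r: "r > 0" "cball (crd c q) r \<subseteq> crd c ` dom c" "par c ` cball (crd c q) r \<subseteq> W"
    using chart_nbhd[OF c W(1,2)] by blast
  obtain A where A: "A > 0" "\<And>v. norm v \<le> A * gnorm c q v" by (rule gnorm_euclid[OF c]) blast
  have "almost_flat c q q (r / A)"
    unfolding almost_flat_def
  proof (intro conjI c allI impI)
    fix z assume "gnorm c q (z - crd c q) < r / A"
    then have "norm (z - crd c q) \<le> r" using A(1) A(2)[of "z - crd c q"] by (simp add: field_simps)
    then have z: "z \<in> cball (crd c q) r" by (simp add: dist_norm norm_minus_commute)
    then show "z \<in> crd c ` dom c" using r by blast
    have "par c z \<in> W" using z r by blast
    then show "gnorm c (par c z) v \<le> 2 * gnorm c q v" "gnorm c q v \<le> 2 * gnorm c (par c z) v" for v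
      using W by auto
  qed
  then show ?thesis using r(1) A(1) by (intro exI[of _ c] exI[of _ "r/A"]) auto
qed

lemma open_gball:
  assumes "almost_flat c q p r" "s \<le> r" "0 < s"
  shows "open (par c ` {z. gnorm c q (z - crd c p) < s})" "p \<in> par c ` {z. gnorm c q (z - crd c p) < s}"
proof -
  have c: "c \<in> atlas M" "q \<in> dom c" "p \<in> dom c" using assms by (auto simp: almost_flat_def)
  have "open {z. gnorm c q (z - crd c p) < s}"
    by (intro open_Collect_less continuous_on_compose2[OF gnorm_cont[OF c(1,2)]] continuous_intros) auto
  then show "open (par c ` {z. gnorm c q (z - crd c p) < s})"
    using assms by (intro par_open_image[OF c(1)]) (auto simp: almost_flat_def)
  show "p \<in> par c ` {z. gnorm c q (z - crd c p) < s}"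
    using c assms(3) by (intro image_eqI[of _ _ "crd c p"]) (auto simp: gnorm_def bilinear_lzero[OF met_bilinear])
qed

text \<open>A Lebesgue-number argument: a point close to one of finitely many base points
  \<open>q\<close> inherits the chart and the constant metric of \<open>q\<close>, with half the
  radius.\<close>

lemma almost_flat_uniform:
  assumes B: "compact B"
  shows "\<exists>r>0. r \<le> 1 \<and> (\<forall>p\<in>B. \<exists>c q. almost_flat c q p r)"
proof -
  have "\<forall>q. \<exists>c r. r > 0 \<and> almost_flat c q q r" using almost_flat_exists by blast
  then obtain c r where cr: "\<And>q. r q > 0" "\<And>q. almost_flat (c q) q q (r q)" by metis
  \<comment> \<open>Half of \<open>r q\<close> is reserved for the position of \<open>p\<close>
    relative to \<open>q\<close>, the other half for the ball around \<open>p\<close>.\<close>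
  define U where "U q = par (c q) ` {z. gnorm (c q) q (z - crd (c q) q) < r q / 2}" for q
  have r2: "r q / 2 \<le> r q" "0 < r q / 2" for q using cr(1)[of q] by auto
  have U: "open (U q)" "q \<in> U q" for q
    unfolding U_def by (rule open_gball[OF cr(2) r2])+
  obtain D where D: "D \<subseteq> B" "finite D" "B \<subseteq> (\<Union>q\<in>D. U q)"
    using compact_subcover[OF B U] by blast
  define s where "s = Min (insert 1 ((\<lambda>q. r q / 2) ` D))"
  have s: "s > 0" "s \<le> 1" "\<And>q. q \<in> D \<Longrightarrow> s \<le> r q / 2"
  proof -
    show "s > 0" "s \<le> 1" using D(2) cr(1) by (auto simp: s_def)
    show "s \<le> r q / 2" if "q \<in> D" for q unfolding s_def using D(2) that by (intro Min_le) auto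
  qed
  have "\<exists>c q. almost_flat c q p s" if "p \<in> B" for p
  proof -
    obtain q where q: "q \<in> D" "p \<in> U q" using D(3) \<open>p \<in> B\<close> by blast
    let ?c = "c q"
    note af = cr(2)[of q, unfolded almost_flat_def]
    have c: "?c \<in> atlas M" "q \<in> dom ?c" using af by auto
    obtain y where y: "p = par ?c y" "gnorm ?c q (y - crd ?c q) < r q / 2" using q(2) by (auto simp: U_def)
    then have "gnorm ?c q (y - crd ?c q) < r q" using cr(1)[of q] by simp
    then have yi: "y \<in> crd ?c ` dom ?c" using af by blast
    then have p: "p \<in> dom ?c" "crd ?c p = y" using y(1) by (auto simp: inv_into_into f_inv_into_f)
    have "gnorm ?c q (z - crd ?c q) < r q" if "gnorm ?c q (z - crd ?c p) < s" for z
    proof -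
      have "gnorm ?c q ((z - crd ?c p) + (y - crd ?c q)) \<le> gnorm ?c q (z - crd ?c p) + gnorm ?c q (y - crd ?c q)"
        by (rule gnorm_triangle[OF c])
      then show ?thesis using that y(2) s(3)[OF q(1)] p(2) by simp
    qed
    then have "almost_flat ?c q p s" using af p(1) unfolding almost_flat_def by blast
    then show ?thesis by blast
  qed
  then show ?thesis using s(1,2) by blast
qed

lemma almost_flat_d_le:
  assumes af: "almost_flat c q p r" and x: "x \<in> dom c" "gnorm c q (crd c x - crd c p) < r"
  shows "d p x \<le> 2 * gnorm c q (crd c x - crd c p)"
proof -
  have c: "c \<in> atlas M" "q \<in> dom c" "p \<in> dom c" using af by (auto simp: almost_flat_def)
  let ?v = "crd c x - crd c p"
  have in_ball: "gnorm c q ((crd c p + t *\<^sub>R ?v) - crd c p) < r" if t: "t \<in> {0..1}" for t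
  proof -
    have "\<bar>t\<bar> * gnorm c q ?v \<le> 1 * gnorm c q ?v" using t by (intro mult_right_mono gnorm_nonneg c) auto
    then show ?thesis using x(2) by (simp add: gnorm_scaleR[OF c(1,2)])
  qed
  have "\<exists>l\<le>2 * gnorm c q ?v. pw_C1_path M (par c (crd c p)) (par c (crd c p + ?v)) l"
  proof (rule segment_path[OF c(1)])
    fix t :: real assume t: "t \<in> {0..1}"
    show "crd c p + t *\<^sub>R ?v \<in> crd c ` dom c" "gnorm c (par c (crd c p + t *\<^sub>R ?v)) ?v \<le> 2 * gnorm c q ?v"
      using in_ball[OF t] af unfolding almost_flat_def by blast+
  qed
  then obtain l where "l \<le> 2 * gnorm c q ?v" "pw_C1_path M p x l" using c x(1) by auto
  then show ?thesis using d_le by fastforce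
qed

section \<open>A single summand of the soft maximum\<close>

lemma dnorm_eq_0:
  fixes s :: "'m \<Rightarrow> 'h::real_normed_vector"
  assumes W: "open W" "x \<in> W" "\<And>y. y \<in> W \<Longrightarrow> s y = 0"
  shows "dnorm s x = 0"
proof -
  have "dcoeff (chart_at M x) s x = dcoeff (chart_at M x) (\<lambda>x. 0) x"
    by (rule diff_at_chart_cong(2)[OF chart_at(1) W(1,2) chart_at(2) _ has_derivative_dcoeff_const(1)])
      (simp add: W(3))
  then have "jet s x (Some b) = 0" for b
    by (simp add: jet_def deriv_at_def has_derivative_dcoeff_const)
  then show ?thesis by (simp add: dnorm_def L2_set_def)
qed

lemma plateau'_bound: "0 \<le> t \<Longrightarrow> \<bar>plateau' t\<bar> \<le> 8"
proof -
  assume "0 \<le> t"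
  then have a: "0 \<le> max 0 (1 - t)" "max 0 (1 - t) \<le> 1" by auto
  have b: "0 \<le> max 0 (1 - 2 * (max 0 (1 - t))\<^sup>2)" "max 0 (1 - 2 * (max 0 (1 - t))\<^sup>2) \<le> 1" by auto
  have "max 0 (1 - 2 * (max 0 (1 - t))\<^sup>2) * max 0 (1 - t) \<le> 1 * 1" using a b by (intro mult_mono) auto
  moreover have "\<bar>plateau' t\<bar> = 8 * (max 0 (1 - 2 * (max 0 (1 - t))\<^sup>2) * max 0 (1 - t))"
    unfolding plateau'_def using a b by (simp add: abs_mult)
  ultimately show ?thesis by simp
qed

text \<open>In the bound for the differential the first term stems from the exponent, the second
  from the cut-off. The latter is expressed through \<open>a - d p x - s\<close> because for
  \<open>a = 1 - d x0 p\<close> the triangle inequality makes this at most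
  \<open>1 - d x0 x - s\<close>, whatever \<open>p\<close> is, and so comparable with the whole sum
  at \<open>x\<close>. On \<open>U\<close> the function is close to its peak on the exponential
  scale; \<open>U\<close> serves all \<open>a\<close> and \<open>\<mu>\<close>, since the net is
  fixed before \<open>\<mu>\<close>.\<close>

definition soft_bump :: "'m \<Rightarrow> real \<Rightarrow> 'm set \<Rightarrow> real \<Rightarrow> real \<Rightarrow> ('m \<Rightarrow> real) \<Rightarrow> 'm set \<Rightarrow> bool" where
  "soft_bump p s U a \<mu> T K \<longleftrightarrow> C1_in UNIV T \<and> compact K \<and> (\<forall>x. x \<notin> K \<longrightarrow> T x = 0) \<and>
    (\<forall>x. 0 \<le> T x) \<and> (\<forall>x. T x \<le> exp (\<mu> * a)) \<and>
    (\<forall>x. dnorm T x \<le> 32 * \<mu> * T x + 32 / s * exp (\<mu> * (a - d p x - s))) \<and>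
    (\<forall>x\<in>U. d p x \<le> s / 4) \<and> (\<forall>x\<in>U. exp (\<mu> * (a - s / 8)) \<le> T x)"

lemma soft_bumpD:
  assumes "soft_bump p s U a \<mu> T K"
  shows "C1_in UNIV T" "compact K" "x \<notin> K \<Longrightarrow> T x = 0" "0 \<le> T x" "T x \<le> exp (\<mu> * a)"
    "dnorm T x \<le> 32 * \<mu> * T x + 32 / s * exp (\<mu> * (a - d p x - s))"
    "x \<in> U \<Longrightarrow> d p x \<le> s / 4" "x \<in> U \<Longrightarrow> exp (\<mu> * (a - s / 8)) \<le> T x"
  using assms unfolding soft_bump_def by auto

text \<open>In the chart \<open>c\<close> the function is \<open>\<chi> exp (\<mu> (a - 8 n\<^sup>2 / s))\<close>, where \<open>n\<close> is the distance to
  \<open>p\<close> in the constant metric and \<open>\<chi>\<close> is a cut-off at \<open>n = s\<close>. Where \<open>\<chi>\<close> is not constant,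
  \<open>n \<ge> s / 2\<close> and hence \<open>8 n\<^sup>2 / s \<ge> 4 n \<ge> d p x + s\<close>.\<close>

lemma soft_bump_exists:
  assumes af: "almost_flat c q p r" and s: "0 < s" "s < r"
  shows "\<exists>U. open U \<and> p \<in> U \<and> (\<forall>a \<mu>. \<mu> > 0 \<longrightarrow> (\<exists>T K. soft_bump p s U a \<mu> T K))"
proof -
  have c: "c \<in> atlas M" "q \<in> dom c" "p \<in> dom c" using af by (auto simp: almost_flat_def)
  define n where "n x = gnorm c q (crd c x - crd c p)" for x
  define Q where "Q x = met c q (crd c x - crd c p) (crd c x - crd c p)" for x
  have Qn: "Q x = (n x)\<^sup>2" for x by (simp add: Q_def n_def gnorm_sq[OF c(1,2)])
  have n0: "0 \<le> n x" for x by (simp add: n_def gnorm_nonneg c)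
  \<comment> \<open>For \<open>n < s / 8\<close> the distance to \<open>p\<close> is at most
    \<open>2 * n\<close>, below \<open>s / 4\<close>, and the loss in the exponent
    \<open>8 * n\<^sup>2 / s\<close> is at most \<open>s / 8\<close>.\<close>
  define U where "U = par c ` {z. gnorm c q (z - crd c p) < s / 8}"
  have s8: "s / 8 \<le> r" "0 < s / 8" using s by auto
  have U: "open U" "p \<in> U" unfolding U_def by (rule open_gball[OF af s8])+
  have Un: "x \<in> dom c \<and> n x < s / 8" if xU: "x \<in> U" for x
  proof -
    obtain z where z: "x = par c z" "gnorm c q (z - crd c p) < s / 8" using xU U_def by blast
    then have "z \<in> crd c ` dom c" using af s unfolding almost_flat_def by force
    then show ?thesis using z by (simp add: n_def inv_into_into f_inv_into_f)
  qed
  define K where "K = par c ` {z. gnorm c q (z - crd c p) \<le> s}"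
  have sub: "{z. gnorm c q (z - crd c p) \<le> s} \<subseteq> crd c ` dom c"
    using af s unfolding almost_flat_def by force
  have K: "compact K"
    unfolding K_def
  proof (rule compact_continuous_image[OF continuous_on_subset[OF par_cont[OF c(1)] sub]])
    obtain A where A: "A > 0" "\<And>v. norm v \<le> A * gnorm c q v" by (rule gnorm_euclid[OF c(1,2)]) blast
    show "compact {z. gnorm c q (z - crd c p) \<le> s}"
    proof (rule compact_closed_bounded)
      show "closed {z. gnorm c q (z - crd c p) \<le> s}"
        by (intro closed_Collect_le continuous_on_compose2[OF gnorm_cont[OF c(1,2)]] continuous_intros) auto
      show "{z. gnorm c q (z - crd c p) \<le> s} \<subseteq> cball (crd c p) (A * s)"
      proof
        fix z assume "z \<in> {z. gnorm c q (z - crd c p) \<le> s}"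
        then have "norm (z - crd c p) \<le> A * s"
          using A(1) by (intro order_trans[OF A(2) mult_left_mono]) auto
        then show "z \<in> cball (crd c p) (A * s)" by (simp add: dist_norm norm_minus_commute)
      qed
    qed
  qed
  have Kd: "K \<subseteq> dom c" unfolding K_def using sub by (auto simp: inv_into_into)
  have Kn: "x \<in> K \<longleftrightarrow> x \<in> dom c \<and> n x \<le> s" for x
  proof
    assume "x \<in> K"
    then obtain z where z: "x = par c z" "gnorm c q (z - crd c p) \<le> s" using K_def by blast
    then have "z \<in> crd c ` dom c" using sub by blast
    then show "x \<in> dom c \<and> n x \<le> s" using z by (simp add: n_def inv_into_into f_inv_into_f)
  next
    assume "x \<in> dom c \<and> n x \<le> s"
    then show "x \<in> K" unfolding K_def n_def using c by (intro image_eqI[of _ _ "crd c x"]) auto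
  qed
  have wC1: "C1_in (dom c) (\<lambda>x. crd c x - crd c p)"
    using C1_in_diff[OF crd_C1[OF c(1)] C1_in_const] by simp
  have QC1: "C1_in (dom c) Q"
    unfolding Q_def by (rule C1_in_bilinear[OF met_bounded_bilinear[OF c(1,2)] wC1 wC1 chart_open[OF c(1)]])
  have Qd: "dcoeff c Q x h = 2 * met c q (crd c x - crd c p) h" if x: "x \<in> dom c" for x h
  proof -
    have wd: "diff_at_chart c (\<lambda>x. crd c x - crd c p) x" by (rule C1_inD(1)[OF wC1 c(1) x x])
    have "((\<lambda>x. crd c x - crd c p) \<circ> par c has_derivative (\<lambda>h. dcoeff c (crd c) x h - 0)) (at (crd c x))"
      using has_derivative_diff[OF diff_at_chartD[OF C1_inD(1)[OF crd_C1[OF c(1)] c(1) x x]] has_derivative_const]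
      by (simp add: comp_def)
    from dcoeff_eqI[OF this] have "dcoeff c (\<lambda>x. crd c x - crd c p) x h = h" for h
      using crd_dcoeff[OF c(1) x] by simp
    then show ?thesis
      unfolding Q_def using has_derivative_dcoeff_bilinear(2)[OF met_bounded_bilinear[OF c(1,2)] c(1) x wd wd, of h]
        met_sym[OF c(1,2), of h] by simp
  qed
  have "\<exists>T K. soft_bump p s U a \<mu> T K" if l: "\<mu> > 0" for a \<mu>
  proof -
    define E where "E t = exp (\<mu> * (a - 8 / s * t))" for t
    define H where "H t = plateau (t * (1 / s\<^sup>2)) * E t" for t
    define H' where "H' t = plateau' (t * (1 / s\<^sup>2)) * (1 / s\<^sup>2) * E t - plateau (t * (1 / s\<^sup>2)) * (E t * (\<mu> * (8 / s)))" for t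
    define T where "T x = (if x \<in> dom c then H (Q x) else 0)" for x
    have Ed: "(E has_real_derivative - (E t * (\<mu> * (8 / s)))) (at t)" for t
      unfolding E_def[abs_def] using s(1) by (auto intro!: derivative_eq_intros)
    have scale: "((\<lambda>t. t * k) has_real_derivative k) (at t)" for k t :: real
      by (auto intro!: derivative_eq_intros)
    have pd: "((\<lambda>t. plateau (t * (1 / s\<^sup>2))) has_real_derivative plateau' (t * (1 / s\<^sup>2)) * (1 / s\<^sup>2)) (at t)" for t
      by (rule DERIV_chain2[OF plateau_deriv scale])
    have Hd: "(H has_real_derivative H' t) (at t)" for t
      unfolding H_def[abs_def] H'_def using DERIV_mult[OF pd[of t] Ed[of t]] by (simp add: algebra_simps)
    have H'c: "continuous_on S H'" for S
      unfolding H'_def[abs_def] E_def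
      by (intro continuous_intros continuous_on_compose2[OF plateau'_cont[of UNIV]]
          continuous_on_compose2[OF DERIV_continuous_on[OF DERIV_subset[OF plateau_deriv subset_UNIV], of UNIV]]) auto
    have HQ: "C1_in (dom c) (\<lambda>x. H (Q x))" by (rule C1_in_compose[OF QC1 chart_open[OF c(1)] Hd H'c])
    have far: "1 \<le> Q x * (1 / s\<^sup>2)" if "x \<in> dom c" "x \<notin> K" for x
    proof -
      have "s < n x" using that Kn by auto
      then have "s\<^sup>2 \<le> (n x)\<^sup>2" using s by (intro power_mono) auto
      then show ?thesis using s by (simp add: Qn)
    qed
    have T0: "T x = 0" if "x \<notin> K" for x using far[of x] that by (simp add: T_def H_def plateau_eq_0)
    have TC1: "C1_in UNIV T"
      unfolding T_def by (rule C1_in_extend[OF c(1) HQ K Kd]) (use far in \<open>simp add: H_def plateau_eq_0\<close>)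
    have Tnn: "0 \<le> T x" for x by (simp add: T_def H_def E_def plateau_nonneg)
    have Tle: "T x \<le> exp (\<mu> * a)" for x
    proof -
      have "E (Q x) \<le> exp (\<mu> * a)" using l s by (simp add: E_def Qn)
      then have "plateau (Q x * (1 / s\<^sup>2)) * E (Q x) \<le> 1 * exp (\<mu> * a)"
        by (intro mult_mono plateau_le_1) (auto simp: E_def)
      then show ?thesis by (simp add: T_def H_def)
    qed
    have grad: "dnorm T x \<le> 32 * \<mu> * T x + 32 / s * exp (\<mu> * (a - d p x - s))" for x
    proof (cases "x \<in> K")
      case False
      have "open (- K)" using K by (simp add: compact_imp_closed open_Compl)
      then have "dnorm T x = 0" using False T0 by (intro dnorm_eq_0[of "- K"]) auto
      moreover have "0 \<le> 32 * \<mu> * T x + 32 / s * exp (\<mu> * (a - d p x - s))"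
        using Tnn[of x] l s by (intro add_nonneg_nonneg mult_nonneg_nonneg) auto
      ultimately show ?thesis by simp
    next
      case True
      then have x: "x \<in> dom c" "n x \<le> s" using Kn by auto
      have nr: "n x < r" using x s by simp
      have Td: "dcoeff c T x h = H' (Q x) * (2 * met c q (crd c x - crd c p) h)" for h
      proof -
        have "dcoeff c T x = dcoeff c (\<lambda>x. H (Q x)) x"
          by (rule diff_at_chart_cong(2)[OF c(1) chart_open[OF c(1)] x(1) x(1) _ C1_inD(1)[OF HQ c(1) x(1) x(1)]])
            (simp add: T_def)
        then show ?thesis
          using has_derivative_dcoeff_compose(2)[OF c(1) x(1) C1_inD(1)[OF QC1 c(1) x(1) x(1)] Hd] Qd[OF x(1)] by simp
      qed
      have E0: "0 \<le> E t" for t by (simp add: E_def)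
      have cs: "\<bar>met c q (crd c x - crd c p) h\<bar> \<le> s * (2 * gnorm c x h)" for h
      proof -
        have "gnorm c q h \<le> 2 * gnorm c (par c (crd c x)) h"
          using af nr unfolding almost_flat_def n_def by blast
        then have "gnorm c q h \<le> 2 * gnorm c x h" using c(1) x(1) by simp
        moreover have "\<bar>met c q (crd c x - crd c p) h\<bar> \<le> n x * gnorm c q h"
          unfolding n_def by (rule met_cauchy_schwarz[OF c(1,2)])
        moreover have "n x * gnorm c q h \<le> s * (2 * gnorm c x h)"
          using x n0 calculation(1) s by (intro mult_mono gnorm_nonneg c) auto
        ultimately show ?thesis by linarith
      qed
      have pl: "\<bar>plateau' (Q x * (1 / s\<^sup>2))\<bar> * E (Q x) \<le> 8 * exp (\<mu> * (a - d p x - s))"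
      proof (cases "Q x * (1 / s\<^sup>2) \<le> 1 / 4")
        case True
        then show ?thesis by (simp add: plateau'_eq_0)
      next
        case False
        then have "(s / 2)\<^sup>2 \<le> (n x)\<^sup>2" using s by (simp add: Qn power_divide field_simps)
        then have n2: "s / 2 \<le> n x" by (rule power2_le_imp_le[OF _ n0])
        have "d p x \<le> 2 * n x" unfolding n_def by (rule almost_flat_d_le[OF af x(1)]) (use nr n_def in simp)
        moreover have "4 * n x \<le> 8 / s * Q x"
        proof -
          have "4 * n x * s \<le> 8 * n x * n x" using n2 n0[of x] mult_left_mono[of "s/2" "n x" "8 * n x"] by simp
          then show ?thesis using s by (simp add: Qn power2_eq_square field_simps)
        qed
        ultimately have "a - 8 / s * Q x \<le> a - d p x - s" using n2 by linarith
        then have "E (Q x) \<le> exp (\<mu> * (a - d p x - s))" using l by (simp add: E_def)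
        moreover have "\<bar>plateau' (Q x * (1 / s\<^sup>2))\<bar> \<le> 8" by (rule plateau'_bound) (simp add: Qn)
        ultimately show ?thesis by (intro mult_mono) (auto simp: E_def)
      qed
      have H'b: "\<bar>H' (Q x)\<bar> \<le> 1 / s\<^sup>2 * (8 * exp (\<mu> * (a - d p x - s))) + \<mu> * (8 / s) * T x"
      proof -
        have "\<bar>H' (Q x)\<bar> \<le> \<bar>plateau' (Q x * (1 / s\<^sup>2)) * (1 / s\<^sup>2) * E (Q x)\<bar> + \<bar>plateau (Q x * (1 / s\<^sup>2)) * (E (Q x) * (\<mu> * (8 / s)))\<bar>"
          unfolding H'_def by (rule abs_triangle_ineq4)
        also have "\<bar>plateau (Q x * (1 / s\<^sup>2)) * (E (Q x) * (\<mu> * (8 / s)))\<bar> = \<mu> * (8 / s) * T x"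
          using x(1) l s E0 plateau_nonneg by (simp add: T_def H_def abs_mult)
        also have "\<bar>plateau' (Q x * (1 / s\<^sup>2)) * (1 / s\<^sup>2) * E (Q x)\<bar> = 1 / s\<^sup>2 * (\<bar>plateau' (Q x * (1 / s\<^sup>2))\<bar> * E (Q x))"
          using E0 by (simp add: abs_mult)
        also have "\<dots> \<le> 1 / s\<^sup>2 * (8 * exp (\<mu> * (a - d p x - s)))" by (intro mult_left_mono pl) simp
        finally show ?thesis by simp
      qed
      show ?thesis
      proof (rule dnorm_le_of_dcoeff[OF c(1) x(1) C1_in_diffble[OF TC1 UNIV_I]])
        show "0 \<le> 32 * \<mu> * T x + 32 / s * exp (\<mu> * (a - d p x - s))"
          using Tnn[of x] l s by (intro add_nonneg_nonneg mult_nonneg_nonneg) auto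
        fix h
        have "\<bar>dcoeff c T x h\<bar> = \<bar>H' (Q x)\<bar> * (2 * \<bar>met c q (crd c x - crd c p) h\<bar>)"
          by (simp add: Td abs_mult)
        \<comment> \<open>Origin of 32: the rate \<open>8 / s\<close> of the exponent, a factor 2
          from differentiating the square \<open>Q\<close>, and \<open>s * 2\<close> from
          Cauchy-Schwarz with \<open>n x \<le> s\<close> and the comparison of metrics. The radius
          cancels in the main term; the cut-off term keeps \<open>32 / s\<close>, to be beaten by
          its exponential factor.\<close>
        also have "\<dots> \<le> (1 / s\<^sup>2 * (8 * exp (\<mu> * (a - d p x - s))) + \<mu> * (8 / s) * T x) * (2 * (s * (2 * gnorm c x h)))"
          by (intro mult_mono H'b mult_left_mono cs) (use Tnn[of x] l s in auto)
        also have "\<dots> = (32 * \<mu> * T x + 32 / s * exp (\<mu> * (a - d p x - s))) * gnorm c x h"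
          using s by (simp add: field_simps power2_eq_square)
        finally show "\<bar>dcoeff c T x h\<bar> \<le> (32 * \<mu> * T x + 32 / s * exp (\<mu> * (a - d p x - s))) * gnorm c x h" .
      qed
    qed
    have near: "d p x \<le> s / 4 \<and> exp (\<mu> * (a - s / 8)) \<le> T x" if xU: "x \<in> U" for x
    proof
      have x: "x \<in> dom c" "n x < s / 8" using Un[OF xU] by auto
      have "d p x \<le> 2 * n x" unfolding n_def by (rule almost_flat_d_le[OF af x(1)]) (use x(2) s n_def in simp)
      then show "d p x \<le> s / 4" using x(2) by simp
      have Q: "Q x \<le> (s / 8)\<^sup>2" unfolding Qn using x(2) n0 by (intro power_mono) auto
      also have "(s / 8)\<^sup>2 = s * s / 64" by (simp add: power2_eq_square)
      finally have Q': "Q x \<le> s * s / 64" .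
      have "Q x * (1 / s\<^sup>2) \<le> s * s / 64 * (1 / s\<^sup>2)" using Q' by (intro mult_right_mono) auto
      also have "\<dots> = 1 / 64" using s by (simp add: power2_eq_square)
      finally have "plateau (Q x * (1 / s\<^sup>2)) = 1" by (intro plateau_eq_1) linarith
      moreover have "8 / s * Q x \<le> s / 8"
        using Q' s by (simp add: field_simps)
      then have "exp (\<mu> * (a - s / 8)) \<le> E (Q x)" using l by (simp add: E_def)
      ultimately show "exp (\<mu> * (a - s / 8)) \<le> T x" using x(1) by (simp add: T_def H_def)
    qed
    show ?thesis
      by (rule exI[of _ T], rule exI[of _ K], unfold soft_bump_def)
        (intro conjI allI impI ballI TC1 K T0 Tnn Tle grad near[THEN conjunct1] near[THEN conjunct2])
  qed
  then show ?thesis using U by blast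
qed

section \<open>The soft maximum over a finite net\<close>

lemma exp_minus_le_inverse: "0 < y \<Longrightarrow> exp (- y) \<le> 1 / (y::real)"
proof -
  assume y: "0 < y"
  have "y \<le> exp y" using exp_ge_add_one_self[of y] by linarith
  then show ?thesis using y by (simp add: exp_minus field_simps)
qed

theorem complete_imp_uniform_cutoffs:
  assumes complete: "complete_manifold M"
  shows uniform_cutoffs
proof -
  \<comment> \<open>The soft maximum \<open>V\<close> lies between 0 and 2, has differential at most
    33, and is at least 1/2 at \<open>x0\<close>. Normalising its value at \<open>x0\<close> to 1 at
    most doubles both, and 70 = 4 + 66.\<close>
  have "\<exists>f :: 'm \<Rightarrow> complex. f \<in> C10_maps M \<and> f x0 = 1 \<and> (\<forall>y. jnorm f y \<le> 70)" for x0
  proof -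
    let ?B = "dist.mcball x0 1" and ?\<rho> = "d x0"
    have B: "compact ?B" by (rule hopf_rinow[OF complete])
    obtain r where r: "r > 0" "r \<le> 1" "\<And>p. p \<in> ?B \<Longrightarrow> \<exists>c q. almost_flat c q p r"
      using almost_flat_uniform[OF B] by blast
    define s where "s = r / 2"
    have s: "0 < s" "s < r" "s \<le> 1" using r by (auto simp: s_def)
    have "\<forall>p\<in>?B. \<exists>U. open U \<and> p \<in> U \<and> (\<forall>a \<mu>. \<mu> > 0 \<longrightarrow> (\<exists>T K. soft_bump p s U a \<mu> T K))"
    proof
      fix p assume "p \<in> ?B"
      then obtain c q where "almost_flat c q p r" using r(3) by blast
      from soft_bump_exists[OF this s(1,2)]
      show "\<exists>U. open U \<and> p \<in> U \<and> (\<forall>a \<mu>. \<mu> > 0 \<longrightarrow> (\<exists>T K. soft_bump p s U a \<mu> T K))" .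
    qed
    from bchoice[OF this] obtain U where
      UU: "\<forall>p\<in>?B. open (U p) \<and> p \<in> U p \<and> (\<forall>a \<mu>. \<mu> > 0 \<longrightarrow> (\<exists>T K. soft_bump p s (U p) a \<mu> T K))" ..
    then have U: "open (U p)" "p \<in> U p" and
      cell: "\<mu> > 0 \<Longrightarrow> \<exists>T K. soft_bump p s (U p) a \<mu> T K" if "p \<in> ?B" for p a \<mu>
      using that by blast+
    obtain D where D: "D \<subseteq> ?B" "finite D" "?B \<subseteq> (\<Union>p\<in>D. U p)"
      using compact_subcover[OF B U] by blast
    define n where "n = real (card D)"
    have n0: "0 \<le> n" by (simp add: n_def)
    \<comment> \<open>One summand for each requirement: 1 gives
      \<open>E x \<le> \<mu> * E x\<close>, the second makes the cut-off errors of all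
      \<open>n\<close> net points add up to at most \<open>E x\<close>, and the logarithm keeps the
      excess of a soft maximum of \<open>n + 1\<close> terms below 1.\<close>
    define \<mu> where "\<mu> = 1 + 64 * n / s\<^sup>2 + ln (n + 1)"
    have ln0: "0 \<le> ln (n + 1)" using n0 by simp
    have nd: "0 \<le> 64 * n / s\<^sup>2" using n0 by simp
    have mu: "\<mu> > 0" "1 \<le> \<mu>" "ln (n + 1) \<le> \<mu>" "64 * n / s\<^sup>2 \<le> \<mu>"
      unfolding \<mu>_def using ln0 nd by linarith+
    have "\<forall>p\<in>D. \<exists>T. \<exists>K. soft_bump p s (U p) (1 - ?\<rho> p) \<mu> T K"
      using cell[OF _ mu(1)] D(1) by blast
    from bchoice[OF this] obtain T where "\<forall>p\<in>D. \<exists>K. soft_bump p s (U p) (1 - ?\<rho> p) \<mu> (T p) K" ..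
    from bchoice[OF this] obtain K where TK: "\<forall>p\<in>D. soft_bump p s (U p) (1 - ?\<rho> p) \<mu> (T p) (K p)" ..
    note T = soft_bumpD[OF TK[THEN bspec]]
    \<comment> \<open>The summand 1 is a competitor of height 0 in the soft maximum: it keeps
      \<open>V\<close> nonnegative and makes it vanish exactly where all \<open>T p\<close> do, so
      compact support survives the logarithm.\<close>
    define E where "E x = 1 + (\<Sum>p\<in>D. T p x)" for x
    define V where "V x = ln (E x) * (1 / \<mu>)" for x
    have E1: "1 \<le> E x" for x unfolding E_def using T(4) by (simp add: sum_nonneg)
    \<comment> \<open>Inside the ball some net point is within \<open>s / 4\<close> of
      \<open>x\<close> and loses a further \<open>s / 8\<close> by being off centre, together
      \<open>3 * s / 8\<close>. Outside the ball the exponent is negative and the summand 1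
      suffices.\<close>
    have Elow: "exp (\<mu> * (1 - ?\<rho> x - 3 * s / 8)) \<le> E x" for x
    proof (cases "x \<in> ?B")
      case True
      then obtain p where p: "p \<in> D" "x \<in> U p" using D(3) by blast
      have "?\<rho> p \<le> ?\<rho> x + s / 4" using d_triangle[of x0 p x] T(7)[OF p] d_sym[of p x] by linarith
      then have "1 - ?\<rho> x - 3 * s / 8 \<le> (1 - ?\<rho> p) - s / 8" by linarith
      then have "exp (\<mu> * (1 - ?\<rho> x - 3 * s / 8)) \<le> exp (\<mu> * ((1 - ?\<rho> p) - s / 8))"
        using mu(1) by simp
      also have "\<dots> \<le> T p x" by (rule T(8)[OF p])
      also have "\<dots> \<le> (\<Sum>p\<in>D. T p x)" using p(1) D(2) T(4) by (intro member_le_sum) auto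
      also have "\<dots> \<le> E x" by (simp add: E_def)
      finally show ?thesis .
    next
      case False
      then have "1 - ?\<rho> x - 3 * s / 8 \<le> 0" using s(1) by (simp add: mcball_eq)
      then have "\<mu> * (1 - ?\<rho> x - 3 * s / 8) \<le> 0" using mu(1) by (simp add: mult_le_0_iff)
      then have "exp (\<mu> * (1 - ?\<rho> x - 3 * s / 8)) \<le> 1" by simp
      then show ?thesis using E1[of x] by linarith
    qed
    \<comment> \<open>With \<open>y = \<mu> * s / 2\<close> the estimate
      \<open>exp (- y) \<le> 1 / y\<close> leaves \<open>64 * n / s\<^sup>2\<close> divided by
      \<open>\<mu>\<close>.\<close>
    have small: "n * (32 / s * exp (- (\<mu> * s / 2))) \<le> 1"
    proof -
      have y: "0 < \<mu> * s / 2" using mu(1) s(1) by simp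
      have "n * (32 / s * exp (- (\<mu> * s / 2))) \<le> n * (32 / s * (1 / (\<mu> * s / 2)))"
        using n0 s(1) by (intro mult_left_mono exp_minus_le_inverse y) auto
      also have "\<dots> = (64 * n / s\<^sup>2) / \<mu>" using s(1) mu(1) by (simp add: power2_eq_square mult_ac)
      also have "\<dots> \<le> 1" using mu(1,4) by (simp only: divide_le_eq_1_pos)
      finally show ?thesis .
    qed
    \<comment> \<open>The cut-off term has exponent at most \<open>1 - d x0 x - s\<close>, while
      \<open>E x\<close> is at least the exponential with \<open>3 * s / 8\<close> in place of
      \<open>s\<close>. The gap exceeds \<open>s / 2\<close>, so the error is a small multiple of
      \<open>E x\<close> uniformly in \<open>p\<close>.\<close>
    have gradT: "dnorm (T p) x \<le> 32 * \<mu> * T p x + 32 / s * exp (- (\<mu> * s / 2)) * E x" if p: "p \<in> D" for p x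
    proof -
      have "?\<rho> x \<le> ?\<rho> p + d p x" by (rule d_triangle)
      then have "(1 - ?\<rho> p) - d p x - s \<le> (1 - ?\<rho> x - 3 * s / 8) - s / 2" using s(1) by linarith
      then have "\<mu> * ((1 - ?\<rho> p) - d p x - s) \<le> \<mu> * ((1 - ?\<rho> x - 3 * s / 8) - s / 2)" using mu(1) by simp
      also have "\<dots> = - (\<mu> * s / 2) + \<mu> * (1 - ?\<rho> x - 3 * s / 8)" by (simp add: algebra_simps)
      finally have "exp (\<mu> * ((1 - ?\<rho> p) - d p x - s)) \<le> exp (- (\<mu> * s / 2)) * exp (\<mu> * (1 - ?\<rho> x - 3 * s / 8))"
        by (simp add: exp_add[symmetric])
      also have "\<dots> \<le> exp (- (\<mu> * s / 2)) * E x" by (intro mult_left_mono Elow) simp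
      finally have "32 / s * exp (\<mu> * ((1 - ?\<rho> p) - d p x - s)) \<le> 32 / s * (exp (- (\<mu> * s / 2)) * E x)"
        using s(1) by (intro mult_left_mono) auto
      then show ?thesis using T(6)[OF p, of x] by (simp add: mult.assoc)
    qed
    have EC1: "C1_in UNIV E" unfolding E_def by (intro C1_in_add C1_in_const C1_in_sum T(1))
    have hd: "((\<lambda>t. ln t * (1 / \<mu>)) has_real_derivative (1 / t * (1 / \<mu>))) (at t)" if "t > 0" for t
      using that mu(1) by (auto intro!: derivative_eq_intros)
    have Epos: "E x > 0" for x using E1[of x] by linarith
    have VC1: "C1_in UNIV V"
      unfolding V_def
    proof (rule C1_in_compose[OF EC1 open_UNIV hd[OF Epos]])
      show "continuous_on (range E) (\<lambda>t. 1 / t * (1 / \<mu>))"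
        using Epos by (intro continuous_intros) (auto simp: less_imp_neq[symmetric])
    qed
    \<comment> \<open>The derivative of \<open>ln E / \<mu>\<close> is that of \<open>E\<close>
      divided by \<open>\<mu> * E\<close>. The exponents contribute 32, being a weighted mean, and
      the cut-offs together at most 1.\<close>
    have gradV: "dnorm V x \<le> 33" for x
    proof -
      let ?c = "chart_at M x"
      note ca = chart_at[of x]
      show ?thesis
      proof (rule dnorm_le_of_dcoeff[OF ca C1_in_diffble[OF VC1 UNIV_I]])
        fix h
        have dE: "dcoeff ?c E x h = (\<Sum>p\<in>D. dcoeff ?c (T p) x h)"
        proof -
          have dT: "diff_at_chart ?c (T p) x" if "p \<in> D" for p by (rule C1_inD(1)[OF T(1)[OF that] ca UNIV_I])
          have "dcoeff ?c E x h = dcoeff ?c (\<lambda>x. 1) x h + dcoeff ?c (\<lambda>x. \<Sum>p\<in>D. T p x) x h"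
            unfolding E_def by (rule has_derivative_dcoeff_add(2)[OF has_derivative_dcoeff_const(1) has_derivative_dcoeff_sum(1)[OF dT]])
          then show ?thesis by (simp add: has_derivative_dcoeff_const has_derivative_dcoeff_sum(2)[OF dT])
        qed
        have "dcoeff ?c V x h = 1 / E x * (1 / \<mu>) * dcoeff ?c E x h"
          unfolding V_def by (rule has_derivative_dcoeff_compose(2)[OF ca C1_inD(1)[OF EC1 ca UNIV_I] hd[OF Epos]])
        then have "\<bar>dcoeff ?c V x h\<bar> = 1 / (E x * \<mu>) * \<bar>dcoeff ?c E x h\<bar>"
          using Epos[of x] mu(1) by (simp add: abs_mult)
        also have "\<dots> \<le> 1 / (E x * \<mu>) * (33 * \<mu> * E x * gnorm ?c x h)"
        proof (rule mult_left_mono)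
          have g0: "0 \<le> gnorm ?c x h" by (rule gnorm_nonneg[OF ca])
          have "\<bar>dcoeff ?c E x h\<bar> \<le> (\<Sum>p\<in>D. \<bar>dcoeff ?c (T p) x h\<bar>)" unfolding dE by (rule sum_abs)
          also have "\<dots> \<le> (\<Sum>p\<in>D. (32 * \<mu> * T p x + 32 / s * exp (- (\<mu> * s / 2)) * E x) * gnorm ?c x h)"
          proof (rule sum_mono)
            fix p assume p: "p \<in> D"
            have "\<bar>dcoeff ?c (T p) x h\<bar> \<le> gnorm ?c x h * dnorm (T p) x"
              using dcoeff_le_dnorm[OF ca C1_in_diffble[OF T(1)[OF p] UNIV_I]] by simp
            also have "\<dots> \<le> gnorm ?c x h * (32 * \<mu> * T p x + 32 / s * exp (- (\<mu> * s / 2)) * E x)"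
              by (intro mult_left_mono gradT p g0)
            finally show "\<bar>dcoeff ?c (T p) x h\<bar> \<le> (32 * \<mu> * T p x + 32 / s * exp (- (\<mu> * s / 2)) * E x) * gnorm ?c x h"
              by (simp only: mult.commute)
          qed
          also have "\<dots> = (32 * \<mu> * (E x - 1) + n * (32 / s * exp (- (\<mu> * s / 2))) * E x) * gnorm ?c x h"
            by (simp add: E_def n_def sum_distrib_right[symmetric] sum.distrib sum_distrib_left[symmetric] mult.assoc)
          also have "\<dots> \<le> (32 * \<mu> * E x + 1 * E x) * gnorm ?c x h"
            using mu(1) small Epos[of x] by (intro mult_right_mono add_mono g0 mult_left_mono) auto
          also have "\<dots> \<le> (33 * \<mu> * E x) * gnorm ?c x h"
          proof (rule mult_right_mono[OF _ g0])
            have "1 * E x \<le> \<mu> * E x" using mu(2) Epos[of x] by (intro mult_right_mono) auto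
            then show "32 * \<mu> * E x + 1 * E x \<le> 33 * \<mu> * E x" by simp
          qed
          finally show "\<bar>dcoeff ?c E x h\<bar> \<le> 33 * \<mu> * E x * gnorm ?c x h" .
          show "0 \<le> 1 / (E x * \<mu>)" using Epos[of x] mu(1) by simp
        qed
        also have "\<dots> = 33 * gnorm ?c x h" using Epos[of x] mu(1) by simp
        finally show "\<bar>dcoeff ?c V x h\<bar> \<le> 33 * gnorm ?c x h" .
      qed simp
    qed
    have V0: "0 \<le> V x" for x using E1[of x] mu(1) by (simp add: V_def)
    have V2: "V x \<le> 2" for x
    proof -
      have "(\<Sum>p\<in>D. T p x) \<le> (\<Sum>p\<in>D. exp \<mu>)"
      proof (rule sum_mono)
        fix p assume p: "p \<in> D"
        have "\<mu> * (1 - ?\<rho> p) \<le> \<mu> * 1" using mu(1) d_nonneg[of x0 p] by (intro mult_left_mono) auto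
        then have "exp (\<mu> * (1 - ?\<rho> p)) \<le> exp \<mu>" by simp
        then show "T p x \<le> exp \<mu>" using T(5)[OF p, of x] by linarith
      qed
      also have "\<dots> = n * exp \<mu>" by (simp add: n_def)
      finally have "E x \<le> 1 + n * exp \<mu>" by (simp add: E_def)
      also have "\<dots> \<le> exp \<mu> + n * exp \<mu>" using mu(1) by simp
      also have "\<dots> = (n + 1) * exp \<mu>" by (simp add: algebra_simps)
      finally have "ln (E x) \<le> ln ((n + 1) * exp \<mu>)" using Epos[of x] n0 by (subst ln_le_cancel_iff) auto
      also have "\<dots> = ln (n + 1) + \<mu>" using n0 by (subst ln_mult) auto
      also have "\<dots> \<le> 2 * \<mu>" using mu(3) by simp
      finally show ?thesis unfolding V_def using mu(1) by (simp add: field_simps)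
    qed
    have Vx0: "1/2 \<le> V x0"
    proof -
      have "1/2 * \<mu> \<le> \<mu> * (1 - ?\<rho> x0 - 3 * s / 8)" using s(3) mu(1) by (simp add: d_refl)
      also have "\<dots> = ln (exp (\<mu> * (1 - ?\<rho> x0 - 3 * s / 8)))" by simp
      also have "\<dots> \<le> ln (E x0)" using Elow[of x0] Epos[of x0] by (subst ln_le_cancel_iff) auto
      finally show ?thesis unfolding V_def using mu(1) by (simp add: field_simps)
    qed
    \<comment> \<open>Division by \<open>V x0\<close> secures the exact value 1 at the centre; since
      \<open>V x0\<close> is at least 1/2, it costs at most a factor 2.\<close>
    define f where "f x = V x * (1 / V x0)" for x
    have fC1: "C1_in UNIV f" unfolding f_def by (rule C1_in_linear[OF bounded_linear_mult_left VC1])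
    let ?g = "\<lambda>x. complex_of_real (f x)"
    have gC: "?g \<in> C10_maps M"
    proof (rule compact_support_C10[OF C1_in_linear[OF bounded_linear_of_real fC1]])
      show "compact (\<Union>p\<in>D. K p)" using D(2) T(2) by (intro compact_UN) auto
      show "?g x = 0" if "x \<notin> (\<Union>p\<in>D. K p)" for x
      proof -
        have "E x = 1" using that T(3) by (simp add: E_def sum.neutral)
        then show ?thesis by (simp add: f_def V_def)
      qed
    qed
    have "jnorm ?g y \<le> 70" for y
    proof -
      have inv: "0 \<le> 1 / V x0" "1 / V x0 \<le> 2" using Vx0 by (auto simp: divide_le_eq)
      have "norm (?g y) \<le> 2 * 2" unfolding f_def using V0[of y] V2[of y] inv by (simp only: norm_of_real abs_mult) (intro mult_mono, auto)
      moreover have "dnorm ?g y \<le> 33 * 2"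
      proof -
        have "dnorm ?g y = dnorm f y" by (rule dnorm_of_real(2)[OF C1_in_diffble[OF fC1 UNIV_I]])
        also have "\<dots> = dnorm (\<lambda>y. (1 / V x0) *\<^sub>R V y) y" by (simp add: f_def[abs_def] mult.commute)
        also have "\<dots> = \<bar>1 / V x0\<bar> * dnorm V y" by (rule dnorm_scaleR[OF C1_in_diffble[OF VC1 UNIV_I]])
        also have "\<dots> \<le> 2 * 33" using inv gradV[of y] dnorm_nonneg by (intro mult_mono) auto
        finally show ?thesis by simp
      qed
      ultimately show ?thesis using jnorm_le[of ?g y] by linarith
    qed
    moreover have "?g x0 = 1" using Vx0 by (simp add: f_def)
    ultimately show ?thesis using gC by blast
  qed
  then show ?thesis unfolding uniform_cutoffs_def by blast
qed

end

theorem proposition1p1: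
  fixes M :: "('m::{second_countable_topology, t2_space}, 'e::real_inner) manifold"
    and e :: "nat \<Rightarrow> 'h::complex_hilbert"
  assumes "riemannian_manifold M" and "complete_manifold M"
    and "separable_space (euclidean :: 'h topology)"
    and "infinite_dimensional TYPE('h)"
    and "orthonormal_basis e"
  shows "module_iso (std_module M) (maps_module M) (column_sum e) \<and>
    bij_betw (transport (std_module M) (maps_module M) (column_sum e))
      (endomorphisms (std_module M))
      (endomorphisms (maps_module M :: ('m, 'm \<Rightarrow> 'h) op_module)) \<and>
    bij_betw (mult_op M) (bounded_star_strong M)
      (endomorphisms (maps_module M :: ('m, 'm \<Rightarrow> 'h) op_module))"
proof -
  interpret riemannian M by standard (rule assms(1))
  note iso = module_iso_column_sum[OF assms(5)]
  show ?thesis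
    using iso
      bij_betw_transport[OF iso std_module_closed_local(2,1)[OF assms(5)] maps_module_closed_local(2,1)]
      bij_betw_mult_op[OF assms(5) complete_imp_uniform_cutoffs[OF assms(2)]]
    by blast
qed

end
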